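(* Let $p$ be a regular prime, $N$ a prime with $N\equiv1\pmod p$ and $L=\mathbb{Q}(\zeta_p,N^{1/p})$. Then for every $j$, $L$ has no unramified $A^{p-1,j}$-extensions.
   Context: $p$ regular means $p$ odd and $p\nmid|\operatorname{Cl}(\mathbb{Q}(\zeta_p))|$. $\chi$ is the mod $p$ cyclotomic character, $b:G_\mathbb{Q}\to\mathbb{F}_p$ with $\sigma(N^{1/p})/N^{1/p}=\zeta_p^{b(\sigma)}$, $V\cong\mathbb{F}_p^2$ with action $\sigma\mapsto\begin{pmatrix}\chi(\sigma)&b(\sigma)\\0&1\end{pmatrix}$, $A^{i,j}=\operatorname{Sym}^i(V)\otimes\mathbb{F}_p(j)$ with $\mathbb{F}_p(j)$ the twist by $\chi^j$. An $A^{i,j}$-extension of $L$ is a Galois extension $M/L$ with $M/\mathbb{Q}$ Galois and $\operatorname{Gal}(M/L)\cong A^{i,j}$ as $\operatorname{Gal}(L/\mathbb{Q})$-modules. *)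

theory Defs
  imports
    "HOL-Algebra.Bij"
    "HOL-Algebra.Generated_Fields"
    "HOL-Algebra.Algebraic_Closure_Type"
    "HOL-Algebra.Ideal_Product"
    "HOL-Number_Theory.Number_Theory"
begin

text \<open>
  Algebraic number fields are realised as subfields of the complex numbers. This is no restriction:
  an algebraic extension of a subfield of the complex numbers embeds into the complex numbers over it.
\<close>

abbreviation complex_ring :: "complex ring"
  where "complex_ring \<equiv> ring_of_type_algebra"

abbreviation subfield_ring :: "complex set \<Rightarrow> complex ring"
  where "subfield_ring K \<equiv> complex_ring\<lparr>carrier := K\<rparr>"


subsection \<open>Ideals, class groups and ramification\<close>

definition int_ring :: "complex set \<Rightarrow> complex ring"
  where "int_ring K = complex_ring\<lparr>carrier := {x \<in> K. algebraic_int x}\<rparr>"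

definition fractional_ideals :: "complex set \<Rightarrow> complex set set"
  where "fractional_ideals K =
    {I. I \<subseteq> K \<and> I \<noteq> {0} \<and> additive_subgroup I complex_ring \<and>
        (\<forall>a\<in>carrier (int_ring K). \<forall>x\<in>I. a * x \<in> I) \<and>
        (\<exists>d\<in>carrier (int_ring K). d \<noteq> 0 \<and> (\<forall>x\<in>I. d * x \<in> carrier (int_ring K)))}"

definition fractional_ideal_group :: "complex set \<Rightarrow> complex set monoid"
  where "fractional_ideal_group K =
    \<lparr>carrier = fractional_ideals K, monoid.mult = ideal_prod complex_ring, one = carrier (int_ring K)\<rparr>"

definition principal_fractional_ideals :: "complex set \<Rightarrow> complex set set"
  where "principal_fractional_ideals K =
    {(\<lambda>a. x * a) ` carrier (int_ring K) |x. x \<in> K \<and> x \<noteq> 0}"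

definition class_group :: "complex set \<Rightarrow> complex set set monoid"
  where "class_group K = fractional_ideal_group K Mod principal_fractional_ideals K"

definition ideal_pow :: "('a, 'b) ring_scheme \<Rightarrow> 'a set \<Rightarrow> nat \<Rightarrow> 'a set"
  where "ideal_pow R I n = (ideal_prod R I ^^ n) (carrier R)"

definition ramification_index :: "complex set \<Rightarrow> complex set \<Rightarrow> complex set \<Rightarrow> nat"
  where "ramification_index K M Q =
    (GREATEST n. Idl\<^bsub>int_ring M\<^esub> (Q \<inter> K) \<subseteq> ideal_pow (int_ring M) Q n)"

text \<open>
  Residue fields of number fields are finite, so separability of the residue extensions is automatic.
  No condition at the infinite places is imposed; it would be empty over a totally complex base field,
  such as a field containing a primitive \<open>p\<close>-th root of unity for an odd prime \<open>p\<close>.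
\<close>

definition unramified :: "complex set \<Rightarrow> complex set \<Rightarrow> bool"
  where "unramified K M \<longleftrightarrow>
    (\<forall>Q. primeideal Q (int_ring M) \<and> Q \<noteq> {0} \<longrightarrow> ramification_index K M Q = 1)"


subsection \<open>Galois extensions\<close>

definition gal_group :: "complex set \<Rightarrow> complex set \<Rightarrow> (complex \<Rightarrow> complex) monoid"
  where "gal_group K M = BijGroup M
    \<lparr>carrier := {\<sigma> \<in> Bij M. \<sigma> \<in> ring_hom (subfield_ring M) (subfield_ring M) \<and> (\<forall>x\<in>K. \<sigma> x = x)}\<rparr>"

definition galois_extension :: "complex set \<Rightarrow> complex set \<Rightarrow> bool"
  where "galois_extension K M \<longleftrightarrow>
    subfield K complex_ring \<and> subfield M complex_ring \<and> K \<subseteq> M \<and>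
    (\<forall>x\<in>M. (ring.algebraic complex_ring over K) x) \<and>
    {x \<in> M. \<forall>\<sigma>\<in>carrier (gal_group K M). \<sigma> x = x} = K"


subsection \<open>Symmetric powers of modules\<close>

text \<open>
  The record type of modules extends that of rings; its multiplicative fields play no role for modules
  and are left unspecified.
\<close>

definition free_module :: "('a, 'm) ring_scheme \<Rightarrow> 's set \<Rightarrow> ('a, 's \<Rightarrow> 'a) module"
  where "free_module R S =
    \<lparr>carrier = {c \<in> S \<rightarrow>\<^sub>E carrier R. finite {s \<in> S. c s \<noteq> \<zero>\<^bsub>R\<^esub>}},
     monoid.mult = undefined, one = undefined,
     ring.zero = (\<lambda>s\<in>S. \<zero>\<^bsub>R\<^esub>),
     ring.add = (\<lambda>c d. \<lambda>s\<in>S. c s \<oplus>\<^bsub>R\<^esub> d s),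
     module.smult = (\<lambda>a c. \<lambda>s\<in>S. a \<otimes>\<^bsub>R\<^esub> c s)\<rparr>"

definition free_basis :: "('a, 'm) ring_scheme \<Rightarrow> 's set \<Rightarrow> 's \<Rightarrow> 's \<Rightarrow> 'a"
  where "free_basis R S s = (\<lambda>t\<in>S. if t = s then \<one>\<^bsub>R\<^esub> else \<zero>\<^bsub>R\<^esub>)"

definition free_module_map ::
    "('a, 'm) ring_scheme \<Rightarrow> 's set \<Rightarrow> ('s \<Rightarrow> 's) \<Rightarrow> ('s \<Rightarrow> 'a) \<Rightarrow> 's \<Rightarrow> 'a"
  where "free_module_map R S f c =
    (\<lambda>t\<in>S. \<Oplus>\<^bsub>R\<^esub>s\<in>{s \<in> S. f s = t \<and> c s \<noteq> \<zero>\<^bsub>R\<^esub>}. c s)"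

definition quot_module :: "('a, 'b, 'm) module_scheme \<Rightarrow> 'b set \<Rightarrow> ('a, 'b set) module"
  where "quot_module M H =
    \<lparr>carrier = a_rcosets\<^bsub>M\<^esub> H,
     monoid.mult = undefined, one = undefined,
     ring.zero = H,
     ring.add = set_add M,
     module.smult = (\<lambda>a C. set_add M H ((\<lambda>x. a \<odot>\<^bsub>M\<^esub> x) ` C))\<rparr>"

abbreviation tuples :: "('a, 'b, 'm) module_scheme \<Rightarrow> nat \<Rightarrow> 'b list set"
  where "tuples M i \<equiv> {xs. set xs \<subseteq> carrier M \<and> length xs = i}"

abbreviation free_on_tuples ::
    "('a, 'k) ring_scheme \<Rightarrow> ('a, 'b, 'm) module_scheme \<Rightarrow> nat \<Rightarrow> ('a, 'b list \<Rightarrow> 'a) module"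
  where "free_on_tuples R M i \<equiv> free_module R (tuples M i)"

text \<open>
  The \<open>i\<close>-th symmetric power of \<open>M\<close> is the free module on the \<open>i\<close>-tuples of elements of \<open>M\<close> modulo
  the relations that make the product of \<open>i\<close> elements additive and homogeneous in each factor, and
  symmetric.
\<close>

definition sym_relations ::
    "('a, 'k) ring_scheme \<Rightarrow> ('a, 'b, 'm) module_scheme \<Rightarrow> nat \<Rightarrow> ('b list \<Rightarrow> 'a) set"
  where "sym_relations R M i =
    (let F = free_on_tuples R M i; e = free_basis R (tuples M i) in
      {e (xs @ [x \<oplus>\<^bsub>M\<^esub> y] @ ys) \<ominus>\<^bsub>F\<^esub> (e (xs @ [x] @ ys) \<oplus>\<^bsub>F\<^esub> e (xs @ [y] @ ys)) |xs ys x y.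
         xs @ [x] @ ys \<in> tuples M i \<and> y \<in> carrier M} \<union>
      {e (xs @ [a \<odot>\<^bsub>M\<^esub> x] @ ys) \<ominus>\<^bsub>F\<^esub> (a \<odot>\<^bsub>F\<^esub> e (xs @ [x] @ ys)) |xs ys a x.
         xs @ [x] @ ys \<in> tuples M i \<and> a \<in> carrier R} \<union>
      {e xs \<ominus>\<^bsub>F\<^esub> e ys |xs ys. xs \<in> tuples M i \<and> ys \<in> tuples M i \<and> mset xs = mset ys})"

definition sym_kernel ::
    "('a, 'k) ring_scheme \<Rightarrow> ('a, 'b, 'm) module_scheme \<Rightarrow> nat \<Rightarrow> ('b list \<Rightarrow> 'a) set"
  where "sym_kernel R M i = (\<lambda>H. submodule H R (free_on_tuples R M i)) hull sym_relations R M i"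

definition sym_power ::
    "('a, 'k) ring_scheme \<Rightarrow> ('a, 'b, 'm) module_scheme \<Rightarrow> nat \<Rightarrow> ('a, ('b list \<Rightarrow> 'a) set) module"
  where "sym_power R M i = quot_module (free_on_tuples R M i) (sym_kernel R M i)"

text \<open>
  The endomorphism of the symmetric power induced by an endomorphism \<open>f\<close> of \<open>M\<close>; adding the kernel
  turns the image of a coset into a full coset.
\<close>

definition sym_power_map ::
    "('a, 'k) ring_scheme \<Rightarrow> ('a, 'b, 'm) module_scheme \<Rightarrow> nat \<Rightarrow> ('b \<Rightarrow> 'b) \<Rightarrow>
     ('b list \<Rightarrow> 'a) set \<Rightarrow> ('b list \<Rightarrow> 'a) set"
  where "sym_power_map R M i f C =
    set_add (free_on_tuples R M i) (sym_kernel R M i) (free_module_map R (tuples M i) (map f) ` C)"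


subsection \<open>The fields and the representations\<close>

definition zeta :: "nat \<Rightarrow> complex"
  where "zeta p = cis (2 * pi / real p)"

definition nth_root :: "nat \<Rightarrow> nat \<Rightarrow> complex"
  where "nth_root p N = complex_of_real (root p (real N))"

definition cyclotomic_field :: "nat \<Rightarrow> complex set"
  where "cyclotomic_field p = generate_field complex_ring {zeta p}"

definition kummer_field :: "nat \<Rightarrow> nat \<Rightarrow> complex set"
  where "kummer_field p N = generate_field complex_ring {zeta p, nth_root p N}"

definition regular_prime :: "nat \<Rightarrow> bool"
  where "regular_prime p \<longleftrightarrow>
    Factorial_Ring.prime p \<and> odd p \<and> \<not> p dvd Coset.order (class_group (cyclotomic_field p))"

abbreviation prime_field :: "nat \<Rightarrow> int ring"
  where "prime_field p \<equiv> residue_ring (int p)"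

text \<open>
  Both functions on the absolute Galois group factor through the Galois group of
  \<^term>\<open>kummer_field p N\<close> over the rationals, whose elements are the arguments \<open>\<sigma>\<close> below.
\<close>

definition cyclo_char :: "nat \<Rightarrow> (complex \<Rightarrow> complex) \<Rightarrow> int"
  where "cyclo_char p \<sigma> =
    (THE a. a \<in> carrier (prime_field p) \<and> \<sigma> (zeta p) = zeta p powi a)"

definition kummer_cocycle :: "nat \<Rightarrow> nat \<Rightarrow> (complex \<Rightarrow> complex) \<Rightarrow> int"
  where "kummer_cocycle p N \<sigma> =
    (THE a. a \<in> carrier (prime_field p) \<and> \<sigma> (nth_root p N) / nth_root p N = zeta p powi a)"

definition V_module :: "nat \<Rightarrow> (int, int \<times> int) module"
  where "V_module p = (let F = prime_field p in
    \<lparr>carrier = carrier F \<times> carrier F,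
     monoid.mult = undefined, one = undefined,
     ring.zero = (\<zero>\<^bsub>F\<^esub>, \<zero>\<^bsub>F\<^esub>),
     ring.add = (\<lambda>(x, y) (x', y'). (x \<oplus>\<^bsub>F\<^esub> x', y \<oplus>\<^bsub>F\<^esub> y')),
     module.smult = (\<lambda>a (x, y). (a \<otimes>\<^bsub>F\<^esub> x, a \<otimes>\<^bsub>F\<^esub> y))\<rparr>)"

definition V_act :: "nat \<Rightarrow> nat \<Rightarrow> (complex \<Rightarrow> complex) \<Rightarrow> int \<times> int \<Rightarrow> int \<times> int"
  where "V_act p N \<sigma> = (\<lambda>(x, y).
    ((cyclo_char p \<sigma> \<otimes>\<^bsub>prime_field p\<^esub> x) \<oplus>\<^bsub>prime_field p\<^esub> (kummer_cocycle p N \<sigma> \<otimes>\<^bsub>prime_field p\<^esub> y), y))"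

definition A_module :: "nat \<Rightarrow> nat \<Rightarrow> (int, ((int \<times> int) list \<Rightarrow> int) set) module"
  where "A_module p i = sym_power (prime_field p) (V_module p) i"

definition A_act ::
    "nat \<Rightarrow> nat \<Rightarrow> nat \<Rightarrow> int \<Rightarrow> (complex \<Rightarrow> complex) \<Rightarrow>
     ((int \<times> int) list \<Rightarrow> int) set \<Rightarrow> ((int \<times> int) list \<Rightarrow> int) set"
  where "A_act p N i j \<sigma> C =
    (cyclo_char p \<sigma> [^]\<^bsub>prime_field p\<^esub> j) \<odot>\<^bsub>A_module p i\<^esub>
      sym_power_map (prime_field p) (V_module p) i (V_act p N \<sigma>) C"

text \<open>
  An element \<open>\<sigma>\<close> of the Galois group of \<open>L\<close> over the rationals acts on the abelian group
  \<open>Gal(M/L)\<close> by conjugation with any lift \<open>\<tau>\<close> of \<open>\<sigma>\<close> to \<open>M\<close>.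
\<close>

definition A_extension :: "nat \<Rightarrow> nat \<Rightarrow> nat \<Rightarrow> int \<Rightarrow> complex set \<Rightarrow> bool"
  where "A_extension p N i j M \<longleftrightarrow>
    (let L = kummer_field p N; G = gal_group \<rat> M in
      galois_extension L M \<and> galois_extension \<rat> M \<and>
      (\<exists>\<phi>\<in>iso (gal_group L M) (add_monoid (A_module p i)).
        \<forall>\<sigma>\<in>carrier (gal_group \<rat> L). \<forall>\<tau>\<in>carrier G. restrict \<tau> L = \<sigma> \<longrightarrow>
          (\<forall>g\<in>carrier (gal_group L M).
            \<phi> (\<tau> \<otimes>\<^bsub>G\<^esub> g \<otimes>\<^bsub>G\<^esub> inv\<^bsub>G\<^esub> \<tau>) = A_act p N i j \<sigma> (\<phi> g))))"

end

theory Submission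
  imports Defs
begin

text \<open>
  Let \<open>K = \<rat>(\<zeta>\<^sub>p)\<close> and let \<open>M/L\<close> be an unramified \<open>A\<^sup>p\<^sup>-\<^sup>1\<^sup>,\<^sup>j\<close>-extension. Elements of \<open>Sym\<^sup>p\<^sup>-\<^sup>1(V)\<close>
  can be evaluated at linear forms \<open>v\<close> on \<open>V\<close>; the evaluation at \<open>(0, 1)\<close> is a character of \<open>Gal(M/L)\<close>
  invariant under \<open>Gal(M/K)\<close>, and up to sign it is the sum of the evaluations at all \<open>(1, k)\<close>. Since
  inertia groups meet \<open>Gal(M/L)\<close> trivially, this suffices to produce a nonzero character
  \<open>\<psi> : Gal(M/K) \<rightarrow> \<int>/p\<close> that kills all inertia groups; its kernel has a fixed field \<open>H\<close> that is cyclic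
  of degree \<open>p\<close> and unramified over \<open>K\<close>, with group generated by \<open>s\<close>.

  If \<open>p\<close> did not divide the class number of \<open>K\<close>, every unit of \<open>H\<close> of relative norm one, and in
  particular \<open>\<zeta>\<^sub>p\<close>, would be of the form \<open>\<eta> / s \<eta>\<close> with a unit \<open>\<eta>\<close>. Filtering the units \<open>E\<close> of \<open>H\<close> by the
  powers of \<open>s - 1\<close> then gives \<open>(E : E\<^sup>p) \<le> p\<^sup>n\<^sup>p\<^sup>-\<^sup>1\<close>, where \<open>n\<close> is the number of complex places of \<open>K\<close>.
  This contradicts the growth of the number of units of bounded height, as \<open>E\<close> has rank \<open>n p - 1\<close> and
  contains \<open>\<zeta>\<^sub>p\<close>.
\<close>


section \<open>Algebraic preliminaries\<close>

subsection \<open>Homomorphisms defined on a subring\<close>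

text \<open>\<open>L/K\<close> may ramify, so inertia of \<open>M/K\<close> can lie outside
  \<open>Gal(M/L)\<close>; extending an invariant character of \<open>Gal(M/L)\<close> so that it
  kills this inertia is the difficulty. Inertia elements outside \<open>Gal(M/L)\<close> have order
  \<open>p\<close>, since their \<open>p\<close>-th powers are inertial and lie in
  \<open>Gal(M/L)\<close>. Two of them give a relation in \<open>Gal(M/L)\<close> whose value is the
  sum of the evaluations at all \<open>(1, k)\<close>. Along this line an element of the symmetric
  power is a polynomial in \<open>k\<close> of degree at most \<open>p - 1\<close>, and
  \<open>p - 1\<close> is the first exponent whose power sum over the residues is nonzero modulo
  \<open>p\<close>. The twist by \<open>j\<close> is invisible on \<open>Gal(M/K)\<close>.

  The exponent is \<open>n p - 1 = n (p - 1) + (n - 1)\<close>: each of \<open>p - 1\<close> steps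
  by \<open>s - 1\<close> costs at most \<open>p^n\<close> classes of units of \<open>K\<close>
  modulo \<open>p\<close>-th powers, and the remainder consists, up to \<open>p\<close>-th powers,
  of units of \<open>K\<close>, where one factor \<open>p\<close> is saved by a unit that becomes a
  \<open>p\<close>-th power only in \<open>H\<close>. Ranks enter as growth exponents of the number
  of units in boxes of logarithmic height, bounded above for \<open>K\<close> and below for
  \<open>H\<close>.\<close>

locale subring_hom =
  fixes A :: "'a::comm_ring_1 set" and h :: "'a \<Rightarrow> 'b::comm_ring_1"
  assumes zero_mem [simp, intro]: "0 \<in> A"
    and one_mem [simp, intro]: "1 \<in> A"
    and add_mem [intro]: "x \<in> A \<Longrightarrow> y \<in> A \<Longrightarrow> x + y \<in> A"
    and mult_mem [intro]: "x \<in> A \<Longrightarrow> y \<in> A \<Longrightarrow> x * y \<in> A"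
    and uminus_mem [intro]: "x \<in> A \<Longrightarrow> - x \<in> A"
    and hom_add: "x \<in> A \<Longrightarrow> y \<in> A \<Longrightarrow> h (x + y) = h x + h y"
    and hom_mult: "x \<in> A \<Longrightarrow> y \<in> A \<Longrightarrow> h (x * y) = h x * h y"
    and hom_one: "h 1 = 1"
begin

lemma hom_zero: "h 0 = 0"
  using hom_add[of 0 0] by simp

lemma hom_uminus: "x \<in> A \<Longrightarrow> h (- x) = - h x"
  using hom_add[of x "- x"] hom_zero uminus_mem by (simp add: eq_neg_iff_add_eq_0 add.commute)

lemma diff_mem: "x \<in> A \<Longrightarrow> y \<in> A \<Longrightarrow> x - y \<in> A"
  using add_mem[of x "- y"] uminus_mem by simp

lemma hom_diff: "x \<in> A \<Longrightarrow> y \<in> A \<Longrightarrow> h (x - y) = h x - h y"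
  using hom_add[of x "- y"] hom_uminus uminus_mem by simp

lemma sum_mem: "(\<And>i. i \<in> I \<Longrightarrow> f i \<in> A) \<Longrightarrow> sum f I \<in> A"
  by (induction I rule: infinite_finite_induct) auto

lemma prod_mem: "(\<And>i. i \<in> I \<Longrightarrow> f i \<in> A) \<Longrightarrow> prod f I \<in> A"
  by (induction I rule: infinite_finite_induct) auto

lemma power_mem: "x \<in> A \<Longrightarrow> x ^ n \<in> A"
  by (induction n) auto

lemma hom_sum: "(\<And>i. i \<in> I \<Longrightarrow> f i \<in> A) \<Longrightarrow> h (sum f I) = (\<Sum>i\<in>I. h (f i))"
  by (induction I rule: infinite_finite_induct) (auto simp: hom_zero hom_add sum_mem)

lemma hom_prod: "(\<And>i. i \<in> I \<Longrightarrow> f i \<in> A) \<Longrightarrow> h (prod f I) = (\<Prod>i\<in>I. h (f i))"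
  by (induction I rule: infinite_finite_induct) (auto simp: hom_one hom_mult prod_mem)

lemma hom_power: "x \<in> A \<Longrightarrow> h (x ^ n) = h x ^ n"
  by (induction n) (auto simp: hom_one hom_mult power_mem)

lemma coeff_map_poly_hom: "coeff (map_poly h f) i = h (coeff f i)"
  by (simp add: coeff_map_poly hom_zero)

lemma coeff_mult_mem:
  "(\<And>i. coeff f i \<in> A) \<Longrightarrow> (\<And>i. coeff g i \<in> A) \<Longrightarrow> coeff (f * g) i \<in> A"
  unfolding coeff_mult by (intro sum_mem mult_mem)

text \<open>The conclusion is again an instance of the locale, so coefficientwise maps can be
  iterated to polynomials over polynomials. The explicit set \<open>A\<close> is carried along
  because field automorphisms are extensional functions, \<open>undefined\<close> outside
  \<open>M\<close>.\<close>

lemma subring_hom_map_poly: "subring_hom {f. \<forall>i. coeff f i \<in> A} (map_poly h)"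
proof
  fix f g assume f: "f \<in> {f. \<forall>i. coeff f i \<in> A}" and g: "g \<in> {f. \<forall>i. coeff f i \<in> A}"
  show "map_poly h (f + g) = map_poly h f + map_poly h g"
    using f g by (intro poly_eqI) (simp add: coeff_map_poly_hom hom_add)
  show "map_poly h (f * g) = map_poly h f * map_poly h g"
    using f g by (intro poly_eqI) (simp add: coeff_map_poly_hom coeff_mult hom_sum hom_mult mult_mem)
  show "f * g \<in> {f. \<forall>i. coeff f i \<in> A}"
    using f g coeff_mult_mem by blast
qed (auto simp: hom_one coeff_1 map_poly_1' split: if_splits)

lemma hom_poly:
  assumes "\<And>i. coeff f i \<in> A" "a \<in> A"
  shows "h (poly f a) = poly (map_poly h f) (h a)"
proof -
  \<comment> \<open>\<open>h\<close> may kill leading coefficients, so only an inequality holds and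
    the sums run up to the degree of \<open>f\<close>.\<close>
  have d: "degree (map_poly h f) \<le> degree f"
    by (intro degree_le) (simp add: coeff_map_poly_hom coeff_eq_0 hom_zero)
  have "h (poly f a) = (\<Sum>i\<le>degree f. h (coeff f i) * h a ^ i)"
    unfolding poly_altdef using assms
    by (subst hom_sum) (auto simp: hom_mult hom_power power_mem)
  also have "\<dots> = (\<Sum>i\<le>degree f. coeff (map_poly h f) i * h a ^ i)"
    by (simp add: coeff_map_poly_hom)
  also have "\<dots> = poly (map_poly h f) (h a)"
    unfolding poly_altdef using d
    by (intro sum.mono_neutral_right) (auto simp: coeff_eq_0)
  finally show ?thesis .
qed

end


subsection \<open>Algebraic integers form a ring\<close>

interpretation int_hom: subring_hom UNIV "of_int :: int \<Rightarrow> complex"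
  by unfold_locales auto

interpretation int_poly_hom: subring_hom "{f :: int poly. \<forall>i. coeff f i \<in> UNIV}" "map_poly (of_int :: int \<Rightarrow> complex)"
  by (rule int_hom.subring_hom_map_poly)

abbreviation ieval :: "int poly \<Rightarrow> complex \<Rightarrow> complex"
  where "ieval q y \<equiv> poly (map_poly of_int q) y"

text \<open>
  Gaussian elimination: eliminating one unknown squares the degree pattern, so the diagonal stays
  monic and dominant until a single equation \<open>P(y) v = 0\<close> remains.
\<close>

lemma algebraic_int_of_system:
  fixes v :: "'i \<Rightarrow> complex" and m :: "'i \<Rightarrow> 'i \<Rightarrow> int poly"
  assumes "finite I" "k \<notin> I" "v k \<noteq> 0" "D > 0"
    and "\<And>i. i \<in> insert k I \<Longrightarrow> degree (m i i) = D \<and> lead_coeff (m i i) = 1"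
    and "\<And>i j. i \<in> insert k I \<Longrightarrow> j \<in> insert k I \<Longrightarrow> i \<noteq> j \<Longrightarrow> degree (m i j) < D"
    and "\<And>i. i \<in> insert k I \<Longrightarrow> (\<Sum>j\<in>insert k I. ieval (m i j) y * v j) = 0"
  shows "algebraic_int y"
  using assms
proof (induction I arbitrary: m D rule: finite_induct)
  case empty
  then have "ieval (m k k) y = 0" "lead_coeff (m k k) = 1" by auto
  then show ?case using algebraic_int_altdef_ipoly by blast
next
  case (insert a I)
  let ?J = "insert k I"
  \<comment> \<open>Rows are cross-multiplied with the pivot \<open>m a a\<close> instead of divided
    by it, so entries stay integer polynomials.\<close>
  define m' where "m' i j = m a a * m i j - m i a * m a j" for i j
  have aJ: "a \<notin> ?J" and ka: "k \<noteq> a" using insert by auto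
  have eq: "ieval (m i a) y * v a + (\<Sum>j\<in>?J. ieval (m i j) y * v j) = 0" if "i \<in> insert a ?J" for i
    using insert.prems(6)[of i] that aJ insert.hyps(1) by (simp add: insert_commute[of k a])
  have dg: "degree (m i i) = D" "lead_coeff (m i i) = 1" "m i i \<noteq> 0" if "i \<in> insert a ?J" for i
    using insert.prems(4)[of i] that insert.prems(3) by auto
  have off: "degree (m i j) < D" if "i \<in> insert a ?J" "j \<in> insert a ?J" "i \<noteq> j" for i j
    using insert.prems(5) that by auto
  have small: "degree (m i a * m a j) < 2 * D" if "i \<in> ?J" "j \<in> ?J" for i j
  proof -
    have "degree (m i a) < D" "degree (m a j) < D" using off[of i a] off[of a j] that aJ by auto
    then show ?thesis using degree_mult_le[of "m i a" "m a j"] by linarith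
  qed
  show ?case
  proof (rule insert.IH[of "2 * D" m'])
    show "k \<notin> I" "v k \<noteq> 0" "2 * D > 0" using insert.prems by auto
  next
    fix i assume i: "i \<in> ?J"
    have d2: "degree (m a a * m i i) = 2 * D"
      using dg[of a] dg[of i] i by (auto simp: degree_mult_eq)
    moreover have "lead_coeff (m a a * m i i) = 1"
      using dg(2)[of a] dg(2)[of i] i unfolding lead_coeff_mult by simp
    moreover from d2 small[OF i i] have "degree (m' i i) = 2 * D"
      unfolding m'_def using degree_add_eq_left[of "- (m i a * m a i)" "m a a * m i i"] by simp
    ultimately show "degree (m' i i) = 2 * D \<and> lead_coeff (m' i i) = 1"
      using small[OF i i] by (simp add: m'_def coeff_eq_0)
  next
    fix i j assume ij: "i \<in> ?J" "j \<in> ?J" "i \<noteq> j"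
    have "degree (m a a * m i j) < 2 * D"
      using degree_mult_le[of "m a a" "m i j"] dg(1)[of a] off[of i j] ij by auto
    then show "degree (m' i j) < 2 * D"
      unfolding m'_def using small[OF ij(1,2)] by (rule degree_diff_less)
  next
    fix i assume i: "i \<in> ?J"
    have "(\<Sum>j\<in>?J. ieval (m' i j) y * v j)
        = ieval (m a a) y * (\<Sum>j\<in>?J. ieval (m i j) y * v j)
          - ieval (m i a) y * (\<Sum>j\<in>?J. ieval (m a j) y * v j)"
      unfolding m'_def sum_distrib_left sum_subtractf[symmetric]
      by (intro sum.cong) (auto simp: int_poly_hom.hom_diff int_poly_hom.hom_mult algebra_simps)
    also have "(\<Sum>j\<in>?J. ieval (m i j) y * v j) = - (ieval (m i a) y * v a)"
      using eq[of i] i by (simp add: eq_neg_iff_add_eq_0 add.commute)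
    also have "(\<Sum>j\<in>?J. ieval (m a j) y * v j) = - (ieval (m a a) y * v a)"
      using eq[of a] by (simp add: eq_neg_iff_add_eq_0 add.commute)
    finally show "(\<Sum>j\<in>?J. ieval (m' i j) y * v j) = 0" by (simp add: algebra_simps)
  qed
qed

text \<open>The determinant trick for a finitely generated module stable under \<open>y\<close>: the
  system has diagonal entries \<open>X - c i i\<close> and constants elsewhere, so elimination
  starts with degree 1. The nonzero unknown \<open>v k\<close> is the one left at the end.\<close>

lemma algebraic_int_of_span:
  fixes v :: "'i \<Rightarrow> complex" and c :: "'i \<Rightarrow> 'i \<Rightarrow> int"
  assumes "finite J" "k \<in> J" "v k \<noteq> 0"
    and "\<And>i. i \<in> J \<Longrightarrow> y * v i = (\<Sum>j\<in>J. of_int (c i j) * v j)"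
  shows "algebraic_int y"
proof (rule algebraic_int_of_system[of "J - {k}" k v 1 "\<lambda>i j. (if i = j then [:0, 1:] else 0) - [:c i j:]"])
  fix i assume "i \<in> insert k (J - {k})"
  then have i: "i \<in> J" using assms by auto
  have "(\<Sum>j\<in>J. ieval ((if i = j then [:0, 1:] else 0) - [:c i j:]) y * v j)
      = (\<Sum>j\<in>J. (if i = j then y * v j else 0) - of_int (c i j) * v j)"
    by (intro sum.cong)
       (auto simp: int_poly_hom.hom_diff int_hom.hom_zero map_poly_pCons algebra_simps)
  also have "\<dots> = 0" using assms i by (simp add: sum_subtractf sum.delta)
  finally show "(\<Sum>j\<in>insert k (J - {k}). ieval ((if i = j then [:0, 1:] else 0) - [:c i j:]) y * v j) = 0"
    using assms by (simp add: insert_absorb)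
qed (use assms in \<open>auto\<close>)

text \<open>Both \<open>x + y\<close> and \<open>x y\<close> preserve the lattice spanned by the monomials in \<open>x\<close> and \<open>y\<close>.\<close>

definition lattice :: "('i \<Rightarrow> complex) \<Rightarrow> 'i set \<Rightarrow> complex set"
  where "lattice v J = {\<Sum>j\<in>J. of_int (c j) * v j |c. True}"

lemma lattice_add: "a \<in> lattice v J \<Longrightarrow> b \<in> lattice v J \<Longrightarrow> a + b \<in> lattice v J"
proof -
  assume "a \<in> lattice v J" "b \<in> lattice v J"
  then obtain c d where "a = (\<Sum>j\<in>J. of_int (c j) * v j)" "b = (\<Sum>j\<in>J. of_int (d j) * v j)"
    unfolding lattice_def by blast
  then have "a + b = (\<Sum>j\<in>J. of_int (c j + d j) * v j)"
    by (simp add: sum.distrib algebra_simps)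
  then show ?thesis unfolding lattice_def by (blast intro: exI[of _ "\<lambda>j. c j + d j"])
qed

lemma lattice_scale: "a \<in> lattice v J \<Longrightarrow> of_int n * a \<in> lattice v J"
proof -
  assume "a \<in> lattice v J"
  then obtain c where "a = (\<Sum>j\<in>J. of_int (c j) * v j)"
    unfolding lattice_def by blast
  then have "of_int n * a = (\<Sum>j\<in>J. of_int (n * c j) * v j)"
    by (simp add: sum_distrib_left algebra_simps)
  then show ?thesis unfolding lattice_def by (blast intro: exI[of _ "\<lambda>j. n * c j"])
qed

lemma lattice_zero: "0 \<in> lattice v J"
  unfolding lattice_def by (auto intro!: exI[of _ "\<lambda>_. 0"])

lemma lattice_sum: "(\<And>i. i \<in> I \<Longrightarrow> f i \<in> lattice v J) \<Longrightarrow> sum f I \<in> lattice v J"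
  by (induction I rule: infinite_finite_induct) (auto simp: lattice_add lattice_zero)

lemma lattice_basis: "finite J \<Longrightarrow> j \<in> J \<Longrightarrow> v j \<in> lattice v J"
  unfolding lattice_def
  by (auto intro!: exI[of _ "\<lambda>i. if i = j then 1 else 0"] simp: if_distrib[of "\<lambda>n. n * _"] if_distrib[of of_int] sum.delta cong: if_cong)

lemma algebraic_int_of_lattice:
  assumes "finite J" "k \<in> J" "v k \<noteq> 0" "\<And>i. i \<in> J \<Longrightarrow> y * v i \<in> lattice v J"
  shows "algebraic_int y"
proof -
  have "\<exists>c. y * v i = (\<Sum>j\<in>J. of_int (c j) * v j)" if "i \<in> J" for i
    using assms(4)[OF that] unfolding lattice_def by blast
  then obtain c where "\<And>i. i \<in> J \<Longrightarrow> y * v i = (\<Sum>j\<in>J. of_int (c i j) * v j)"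
    by metis
  then show ?thesis using algebraic_int_of_span[of J k v y c] assms by blast
qed

lemma algebraic_int_powerE:
  assumes "algebraic_int (x :: complex)"
  obtains n c where "n > 0" "x ^ n = (\<Sum>i<n. of_int (c i) * x ^ i)"
proof -
  obtain f :: "int poly" where f: "ieval f x = 0" "lead_coeff f = 1"
    using assms algebraic_int_altdef_ipoly by blast
  have d: "degree f > 0"
  proof (rule ccontr)
    assume "\<not> ?thesis"
    then obtain a where "f = [:a:]" by (meson degree_eq_zeroE gr0I)
    with f show False by (auto simp: map_poly_pCons split: if_splits)
  qed
  have "0 = (\<Sum>i\<le>degree f. of_int (coeff f i) * x ^ i)"
    using f by (simp add: poly_altdef coeff_map_poly degree_map_poly)
  also have "\<dots> = (\<Sum>i<degree f. of_int (coeff f i) * x ^ i) + x ^ degree f"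
    using f(2) by (simp flip: lessThan_Suc_atMost)
  finally have "x ^ degree f = (\<Sum>i<degree f. of_int (- coeff f i) * x ^ i)"
    by (simp add: sum_negf eq_neg_iff_add_eq_0 add.commute)
  with d that[of "degree f" "\<lambda>i. - coeff f i"] show ?thesis by blast
qed

lemma algebraic_int_add_mult:
  assumes "algebraic_int (x :: complex)" "algebraic_int y"
  shows "algebraic_int (x + y)" "algebraic_int (x * y)"
proof -
  obtain n c where n: "n > 0" "x ^ n = (\<Sum>i<n. of_int (c i) * x ^ i)"
    using assms(1) by (rule algebraic_int_powerE)
  obtain m d where m: "m > 0" "y ^ m = (\<Sum>i<m. of_int (d i) * y ^ i)"
    using assms(2) by (rule algebraic_int_powerE)
  define J where "J = {..<n} \<times> {..<m}"
  define v where "v = (\<lambda>(i, j). x ^ i * y ^ j)"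
  have J: "finite J" "(0, 0) \<in> J" "v (0, 0) \<noteq> 0" using n m by (auto simp: J_def v_def)
  have vJ: "x ^ i * y ^ j \<in> lattice v J" if "i < n" "j < m" for i j
    using lattice_basis[of J "(i, j)" v] that J by (simp add: J_def v_def)
  have xv: "x * (x ^ i * y ^ j) \<in> lattice v J" if ij: "i < n" "j < m" for i j
  proof (cases "Suc i < n")
    case True
    then show ?thesis using vJ[of "Suc i" j] ij by (simp add: mult.assoc)
  next
    case False
    then have "x * (x ^ i * y ^ j) = (\<Sum>i<n. of_int (c i) * (x ^ i * y ^ j))"
    proof -
      have "Suc i = n" using False ij by simp
      moreover have "x * (x ^ i * y ^ j) = x ^ Suc i * y ^ j" by simp
      ultimately have "x * (x ^ i * y ^ j) = x ^ n * y ^ j" by (simp only:)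
      then show ?thesis unfolding n(2) by (simp only: sum_distrib_right mult.assoc)
    qed
    then show ?thesis using vJ ij by (auto intro!: lattice_sum lattice_scale)
  qed
  have yv: "y * (x ^ i * y ^ j) \<in> lattice v J" if ij: "i < n" "j < m" for i j
  proof (cases "Suc j < m")
    case True
    then show ?thesis using vJ[of i "Suc j"] ij by (simp add: algebra_simps)
  next
    case False
    then have "Suc j = m" using ij by simp
    then have "y * (x ^ i * y ^ j) = x ^ i * y ^ m" by (auto simp: algebra_simps)
    also have "\<dots> = (\<Sum>j<m. of_int (d j) * (x ^ i * y ^ j))"
      unfolding m(2) by (simp add: sum_distrib_left algebra_simps)
    finally show ?thesis using vJ ij by (auto intro!: lattice_sum lattice_scale)
  qed
  have xl: "x * a \<in> lattice v J" if "a \<in> lattice v J" for a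
  proof -
    from that obtain e where "a = (\<Sum>j\<in>J. of_int (e j) * v j)"
      unfolding lattice_def by blast
    then have "x * a = (\<Sum>j\<in>J. of_int (e j) * (x * v j))"
      by (simp add: sum_distrib_left algebra_simps)
    then show ?thesis using xv by (auto simp: J_def v_def intro!: lattice_sum lattice_scale)
  qed
  have "(x + y) * v i \<in> lattice v J" "x * y * v i \<in> lattice v J" if "i \<in> J" for i
  proof -
    obtain a b where i: "i = (a, b)" "a < n" "b < m" using \<open>i \<in> J\<close> by (auto simp: J_def)
    have "x * v i \<in> lattice v J" "y * v i \<in> lattice v J" using xv yv i by (auto simp: v_def)
    then show "(x + y) * v i \<in> lattice v J" "x * y * v i \<in> lattice v J"
      using lattice_add xl by (auto simp: distrib_right mult.assoc)
  qed
  then show "algebraic_int (x + y)" "algebraic_int (x * y)"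
    by (auto intro!: algebraic_int_of_lattice[of J "(0, 0)" v, OF J])
qed

lemma algebraic_int_diff: "algebraic_int (x :: complex) \<Longrightarrow> algebraic_int y \<Longrightarrow> algebraic_int (x - y)"
  using algebraic_int_add_mult(1)[of x "- y"] by simp

lemma algebraic_int_of_int_complex [simp]: "algebraic_int (of_int n :: complex)" "algebraic_int (of_nat m :: complex)"
  "algebraic_int (1 :: complex)" "algebraic_int (numeral k :: complex)"
  by (auto intro: int_imp_algebraic_int)

lemma algebraic_int_root_of_unity:
  assumes "(x :: complex) ^ n = 1" "n > 0"
  shows "algebraic_int x"
  by (rule algebraic_int_root[of 1 "monom 1 n"]) (use assms in \<open>auto simp: poly_monom degree_monom_eq\<close>)

lemma algebraic_int_multiple:
  assumes "algebraic (x :: complex)"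
  obtains n :: nat where "n > 0" "algebraic_int (of_nat n * x)"
proof -
  obtain f :: "int poly" where f: "ieval f x = 0" "f \<noteq> 0"
    using assms by (auto elim: algebraicE')
  define a where "a = lead_coeff f"
  define d where "d = degree f"
  have a: "a \<noteq> 0" using f by (simp add: a_def)
  have d: "d > 0"
  proof (rule ccontr)
    assume "\<not> ?thesis"
    then obtain c where "f = [:c:]" unfolding d_def by (meson degree_eq_zeroE gr0I)
    with f show False by (auto simp: map_poly_pCons split: if_splits)
  qed
  \<comment> \<open>This is \<open>a^(d-1) f(X/a)\<close>: monic, with integer coefficients and root
    \<open>a x\<close>.\<close>
  define g where "g = monom 1 d + (\<Sum>i<d. monom (coeff f i * a ^ (d - 1 - i)) i)"
  have cg: "coeff g i = (if i = d then 1 else if i < d then coeff f i * a ^ (d - 1 - i) else 0)" for i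
    by (auto simp: g_def coeff_sum)
  have dg: "degree g = d"
    by (intro order.antisym degree_le le_degree) (auto simp: cg)
  have e0: "(\<Sum>i<d. of_int (coeff f i) * x ^ i) + of_int a * x ^ d = 0"
    using f by (simp add: poly_altdef coeff_map_poly degree_map_poly d_def a_def flip: lessThan_Suc_atMost)
  have "ieval g (of_int a * x) = (\<Sum>i<d. of_int (coeff f i * a ^ (d - 1 - i)) * (of_int a * x) ^ i) + (of_int a * x) ^ d"
    by (simp add: poly_altdef coeff_map_poly degree_map_poly dg cg flip: lessThan_Suc_atMost)
  also have "(\<Sum>i<d. of_int (coeff f i * a ^ (d - 1 - i)) * (of_int a * x) ^ i)
      = of_int a ^ (d - 1) * (\<Sum>i<d. of_int (coeff f i) * x ^ i)"
    unfolding sum_distrib_left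
    by (intro sum.cong refl)
       (auto simp: power_mult_distrib algebra_simps simp flip: power_add)
  also have "(of_int a * x) ^ d = of_int a ^ (d - 1) * (of_int a * x ^ d)"
    using d by (cases d) (auto simp: power_mult_distrib algebra_simps)
  finally have "ieval g (of_int a * x) = of_int a ^ (d - 1) * ((\<Sum>i<d. of_int (coeff f i) * x ^ i) + of_int a * x ^ d)"
    by (simp add: algebra_simps)
  then have "ieval g (of_int a * x) = 0" using e0 by simp
  then have ai: "algebraic_int (of_int a * x)"
    using cg dg algebraic_int_altdef_ipoly[of "of_int a * x"] by auto
  show ?thesis
  proof (rule that)
    show "nat \<bar>a\<bar> > 0" using a by simp
    have "of_nat (nat \<bar>a\<bar>) * x = of_int a * x \<or> of_nat (nat \<bar>a\<bar>) * x = - (of_int a * x)"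
      by (cases "a \<ge> 0") auto
    then show "algebraic_int (of_nat (nat \<bar>a\<bar>) * x)" using ai by auto
  qed
qed

text \<open>\<open>y\<close> is a root of the monic polynomial \<open>X^n - X^m - c\<close> with
  \<open>c\<close> an algebraic integer. The pigeonhole principle on powers of \<open>y\<close> will
  provide such a \<open>c\<close>.\<close>

lemma algebraic_int_of_power_diff:
  assumes "algebraic_int (y ^ n - y ^ m :: complex)" "m < n"
  shows "algebraic_int y"
proof (rule algebraic_int_root[OF assms(1)])
  let ?f = "monom 1 n - monom 1 m :: complex poly"
  show "poly ?f y = y ^ n - y ^ m" by (simp add: poly_monom)
  have "degree ?f = n"
    using assms(2) by (intro order.antisym degree_le le_degree) auto
  then show "lead_coeff ?f = 1" "degree ?f > 0" using assms(2) by auto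
qed auto


subsection \<open>Dual bases for a set of homomorphisms\<close>

text \<open>
  If every map \<open>g \<in> S\<close> moves elements of the ring \<open>R\<close> generating the unit ideal, then \<open>R\<close> has a dual
  basis for \<open>S\<close>: the products of the relations for the single maps kill all of \<open>S\<close> at once.
\<close>

lemma dual_basis_exists:
  fixes R :: "'a::comm_ring_1 set" and S :: "('a \<Rightarrow> 'a) set"
  assumes R: "1 \<in> R" "\<And>x y. x \<in> R \<Longrightarrow> y \<in> R \<Longrightarrow> x * y \<in> R" "\<And>x y. x \<in> R \<Longrightarrow> y \<in> R \<Longrightarrow> x - y \<in> R"
    and S: "finite S"
      "\<And>g x y. g \<in> S \<Longrightarrow> x \<in> R \<Longrightarrow> y \<in> R \<Longrightarrow> g (x * y) = g x * g y" "\<And>g. g \<in> S \<Longrightarrow> g 1 = 1"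
    and unit: "\<And>g. g \<in> S \<Longrightarrow> \<exists>l. set l \<subseteq> R \<times> R \<and> (\<Sum>(a, b)\<leftarrow>l. a * (b - g b)) = 1"
    and gR: "\<And>g x. g \<in> S \<Longrightarrow> x \<in> R \<Longrightarrow> g x \<in> R"
  shows "\<exists>l. set l \<subseteq> R \<times> R \<and> (\<Sum>(x, y)\<leftarrow>l. x * y) = 1 \<and> (\<forall>g\<in>S. (\<Sum>(x, y)\<leftarrow>l. x * g y) = 0)"
  using S unit gR
proof (induction S rule: finite_induct)
  case empty
  show ?case using R by (intro exI[of _ "[(1, 1)]"]) auto
next
  case (insert g S)
  from insert obtain l where l: "set l \<subseteq> R \<times> R" "(\<Sum>(x, y)\<leftarrow>l. x * y) = 1"
    "\<forall>g\<in>S. (\<Sum>(x, y)\<leftarrow>l. x * g y) = 0" by auto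
  from insert.prems(3) obtain k where k: "set k \<subseteq> R \<times> R" "(\<Sum>(a, b)\<leftarrow>k. a * (b - g b)) = 1"
    by blast
  have gk: "\<And>x. x \<in> R \<Longrightarrow> g x \<in> R" using insert.prems(4) by auto
  have R0: "0 \<in> R" "\<And>x. x \<in> R \<Longrightarrow> - x \<in> R" "\<And>x y. x \<in> R \<Longrightarrow> y \<in> R \<Longrightarrow> x + y \<in> R"
  proof -
    show z: "0 \<in> R" using R(3)[OF R(1) R(1)] by simp
    show m: "- x \<in> R" if "x \<in> R" for x using R(3)[OF z that] by simp
    show "x + y \<in> R" if "x \<in> R" "y \<in> R" for x y using R(3)[OF that(1) m[OF that(2)]] by simp
  qed
  define t where "t = (\<Sum>(a, b)\<leftarrow>k. a * g b)"
  have tR: "t \<in> R"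
    unfolding t_def using k(1)
    by (induction k) (auto intro!: R0 R(2) gk)
  \<comment> \<open>The extra pair corrects the relation for \<open>g\<close>: the sum of the
    \<open>a * b\<close> becomes 1 and the sum of the \<open>a * g b\<close> becomes 0, since
    \<open>g 1 = 1\<close>.\<close>
  define k' where "k' = (- t, 1) # k"
  have k': "set k' \<subseteq> R \<times> R" using k(1) tR R0 R by (auto simp: k'_def)
  have "(\<Sum>(a, b)\<leftarrow>k. a * (b - g b)) = (\<Sum>(a, b)\<leftarrow>k. a * b) - t"
    unfolding t_def by (induction k) (auto simp: algebra_simps)
  then have s1: "(\<Sum>(a, b)\<leftarrow>k'. a * b) = 1" using k(2) by (simp add: k'_def)
  have s2: "(\<Sum>(a, b)\<leftarrow>k'. a * g b) = 0" using insert.prems(2)[of g] by (simp add: k'_def t_def)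
  \<comment> \<open>The product of both lists in the tensor square of \<open>R\<close>: pairing it
    with a multiplicative \<open>f\<close> multiplies the two pairings, so old zeros are kept and a
    zero at \<open>g\<close> is added.\<close>
  define r where "r = concat (map (\<lambda>(a, b). map (\<lambda>(x, y). (x * a, y * b)) l) k')"
  have prod: "(\<Sum>(x, y)\<leftarrow>concat (map (\<lambda>(a, b). map (\<lambda>(x, y). (x * a, y * b)) l) k'). x * f y)
      = (\<Sum>(x, y)\<leftarrow>l. x * f y) * (\<Sum>(a, b)\<leftarrow>k'. a * f b)"
    if f: "\<And>x y. x \<in> R \<Longrightarrow> y \<in> R \<Longrightarrow> f (x * y) = f x * f y" for f
    using k'
  proof (induction k')
    case (Cons c k')
    obtain a b where c: "c = (a, b)" by force
    have "b \<in> R" using Cons.prems c by auto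
    then have "(\<Sum>(x, y)\<leftarrow>map (\<lambda>(x, y). (x * a, y * b)) l. x * f y) = (\<Sum>(x, y)\<leftarrow>l. x * f y) * (a * f b)"
      using l(1) by (induction l) (auto simp: f algebra_simps)
    then show ?case using Cons c by (simp add: algebra_simps)
  qed simp
  have "set r \<subseteq> R \<times> R" using k' l(1) R(2) by (fastforce simp: r_def)
  moreover have "(\<Sum>(x, y)\<leftarrow>r. x * y) = 1"
    unfolding r_def using prod[of "\<lambda>x. x"] l(2) s1 by simp
  moreover have "(\<Sum>(x, y)\<leftarrow>r. x * f y) = 0" if "f \<in> insert g S" for f
    unfolding r_def using prod[of f] l(3) s2 insert.prems(1) that by auto
  ultimately show ?case by blast
qed


section \<open>Galois number fields inside the complex numbers\<close>

subsection \<open>Subfields of the complex numbers\<close>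

definition fld :: "complex set \<Rightarrow> bool"
  where "fld F \<longleftrightarrow> 1 \<in> F \<and> (\<forall>x\<in>F. \<forall>y\<in>F. x - y \<in> F \<and> x * y \<in> F) \<and> (\<forall>x\<in>F. inverse x \<in> F)"

lemma complex_ring_simps [simp]:
  "carrier complex_ring = UNIV" "x \<otimes>\<^bsub>complex_ring\<^esub> y = x * y" "x \<oplus>\<^bsub>complex_ring\<^esub> y = x + y"
  "\<one>\<^bsub>complex_ring\<^esub> = 1" "\<zero>\<^bsub>complex_ring\<^esub> = 0"
  by (simp_all add: ring_of_type_algebra_def)

lemma cring_complex_ring: "cring complex_ring" and field_complex_ring: "field complex_ring"
  by (rule cring_from_type_algebra field_from_type_algebra)+

lemma complex_ring_a_inv [simp]: "\<ominus>\<^bsub>complex_ring\<^esub> x = - x"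
  using abelian_group.minus_equality[OF ring.is_abelian_group[OF cring.axioms(1)[OF cring_complex_ring]], of "- x" x] by simp

lemma complex_ring_m_inv: "x \<noteq> 0 \<Longrightarrow> inv\<^bsub>complex_ring\<^esub> x = inverse x"
  using comm_monoid.comm_inv_char[OF cring.axioms(2)[OF cring_complex_ring], of x "inverse x"] by simp

locale subfield_of_complex =
  fixes F :: "complex set"
  assumes fld: "fld F"
begin

lemma one_F [simp]: "1 \<in> F" and diff_F [intro]: "x \<in> F \<Longrightarrow> y \<in> F \<Longrightarrow> x - y \<in> F"
  and mult_F [intro]: "x \<in> F \<Longrightarrow> y \<in> F \<Longrightarrow> x * y \<in> F" and inverse_F [intro]: "x \<in> F \<Longrightarrow> inverse x \<in> F"
  using fld by (auto simp: fld_def)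

lemma zero_F [simp]: "0 \<in> F"
  using diff_F[of 1 1] by simp

lemma uminus_F [intro]: "x \<in> F \<Longrightarrow> - x \<in> F"
  using diff_F[of 0 x] by simp

lemma add_F [intro]: "x \<in> F \<Longrightarrow> y \<in> F \<Longrightarrow> x + y \<in> F"
  using diff_F[of x "- y"] by auto

lemma divide_F [intro]: "x \<in> F \<Longrightarrow> y \<in> F \<Longrightarrow> x / y \<in> F"
  by (auto simp: divide_inverse)

lemma power_F [intro]: "x \<in> F \<Longrightarrow> x ^ n \<in> F"
  by (induction n) auto

lemma sum_F: "(\<And>i. i \<in> I \<Longrightarrow> f i \<in> F) \<Longrightarrow> sum f I \<in> F"
  by (induction I rule: infinite_finite_induct) auto

lemma prod_F: "(\<And>i. i \<in> I \<Longrightarrow> f i \<in> F) \<Longrightarrow> prod f I \<in> F"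
  by (induction I rule: infinite_finite_induct) auto

lemma of_nat_F [simp]: "of_nat n \<in> F"
  by (induction n) auto

lemma of_int_F [simp]: "of_int n \<in> F"
  by (cases n rule: int_cases2) auto

lemma Rats_F: "\<rat> \<subseteq> F"
  by (auto elim!: Rats_cases')

end

lemma fldI_subfield:
  assumes "subfield F complex_ring"
  shows "fld F"
proof -
  note subringE = subringE[OF subfieldE(1)[OF assms]]
  have "x - y \<in> F" if "x \<in> F" "y \<in> F" for x y
    using subringE(7)[OF that(1) subringE(5)[OF that(2)]] by simp
  moreover have "inverse x \<in> F" if "x \<in> F" for x
  proof (cases "x = 0")
    case False
    then show ?thesis
      using ring.subfield_m_inv(1)[OF cring.axioms(1)[OF cring_complex_ring] assms, of x] that by (simp add: complex_ring_m_inv)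
  qed (use that in simp)
  ultimately show ?thesis using subringE(3,6) by (auto simp: fld_def)
qed

definition ints :: "complex set \<Rightarrow> complex set"
  where "ints F = {x \<in> F. algebraic_int x}"

lemma carrier_int_ring [simp]: "carrier (int_ring F) = ints F"
  by (simp add: int_ring_def ints_def)

lemma int_ring_simps [simp]:
  "x \<otimes>\<^bsub>int_ring F\<^esub> y = x * y" "x \<oplus>\<^bsub>int_ring F\<^esub> y = x + y"
  "\<one>\<^bsub>int_ring F\<^esub> = 1" "\<zero>\<^bsub>int_ring F\<^esub> = 0"
  by (simp_all add: int_ring_def)

context subfield_of_complex
begin

lemma ints_F: "x \<in> ints F \<Longrightarrow> x \<in> F" "x \<in> ints F \<Longrightarrow> algebraic_int x"
  by (auto simp: ints_def)

lemma ints_0 [simp]: "0 \<in> ints F" and ints_1 [simp]: "1 \<in> ints F"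
  by (auto simp: ints_def)

lemma ints_of_nat [simp]: "of_nat n \<in> ints F" and ints_of_int [simp]: "of_int i \<in> ints F"
  by (auto simp: ints_def)

lemma ints_add [intro]: "x \<in> ints F \<Longrightarrow> y \<in> ints F \<Longrightarrow> x + y \<in> ints F"
  and ints_diff [intro]: "x \<in> ints F \<Longrightarrow> y \<in> ints F \<Longrightarrow> x - y \<in> ints F"
  and ints_mult [intro]: "x \<in> ints F \<Longrightarrow> y \<in> ints F \<Longrightarrow> x * y \<in> ints F"
  and ints_uminus [intro]: "x \<in> ints F \<Longrightarrow> - x \<in> ints F"
  by (auto simp: ints_def algebraic_int_add_mult algebraic_int_diff)

lemma ints_power [intro]: "x \<in> ints F \<Longrightarrow> x ^ n \<in> ints F"
  by (induction n) auto

lemma ints_sum: "(\<And>i. i \<in> I \<Longrightarrow> f i \<in> ints F) \<Longrightarrow> sum f I \<in> ints F"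
  by (induction I rule: infinite_finite_induct) auto

lemma ints_prod: "(\<And>i. i \<in> I \<Longrightarrow> f i \<in> ints F) \<Longrightarrow> prod f I \<in> ints F"
  by (induction I rule: infinite_finite_induct) auto

end

lemma ints_mono: "F \<subseteq> F' \<Longrightarrow> ints F \<subseteq> ints F'"
  by (auto simp: ints_def)


subsection \<open>The Galois group and its action\<close>

locale galois_over_rats =
  fixes M :: "complex set"
  assumes galois: "galois_extension \<rat> M"
begin

abbreviation G where "G \<equiv> gal_group \<rat> M"

sublocale M: subfield_of_complex M
  using galois by unfold_locales (auto simp: galois_extension_def intro: fldI_subfield)

lemma gal_carrier:
  "carrier (gal_group K M) = {g \<in> Bij M. (\<forall>x\<in>M. \<forall>y\<in>M. g (x + y) = g x + g y \<and> g (x * y) = g x * g y) \<and> g 1 = 1 \<and> (\<forall>x\<in>K. g x = x)}"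
  unfolding gal_group_def ring_hom_def using Bij_imp_funcset by fastforce

lemma gal_bij: "g \<in> carrier G \<Longrightarrow> bij_betw g M M"
  by (auto simp: gal_carrier Bij_def)

lemma gal_mem [simp, intro]: "g \<in> carrier G \<Longrightarrow> x \<in> M \<Longrightarrow> g x \<in> M"
  using gal_bij bij_betwE by blast

lemma gal_hom: "g \<in> carrier G \<Longrightarrow> subring_hom M g"
  by unfold_locales (auto simp: gal_carrier)

lemma gal_eqI:
  assumes "g \<in> carrier G" "h \<in> carrier G" "\<And>x. x \<in> M \<Longrightarrow> g x = h x"
  shows "g = h"
  by (rule extensionalityI[of _ M]) (use assms in \<open>auto simp: gal_carrier Bij_def\<close>)

lemma mult_G: "g \<in> carrier G \<Longrightarrow> h \<in> carrier G \<Longrightarrow> g \<otimes>\<^bsub>G\<^esub> h = compose M g h"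
  by (simp add: gal_group_def BijGroup_def)

lemma one_G: "\<one>\<^bsub>G\<^esub> = (\<lambda>x\<in>M. x)"
  by (simp add: gal_group_def BijGroup_def)

lemma group_gal: "group (gal_group K M)" if K: "K \<subseteq> M" for K
proof -
  have "subgroup (carrier (gal_group K M)) (BijGroup M)"
  proof (rule group.subgroupI[OF group_BijGroup])
    show "carrier (gal_group K M) \<subseteq> carrier (BijGroup M)"
      by (auto simp: gal_carrier BijGroup_def)
    have "(\<lambda>x\<in>M. x) \<in> carrier (gal_group K M)"
      using id_Bij K by (auto simp: gal_carrier)
    then show "carrier (gal_group K M) \<noteq> {}" by blast
  next
    fix g assume g: "g \<in> carrier (gal_group K M)"
    then have gB: "g \<in> Bij M" by (simp add: gal_carrier)
    have inv: "inv\<^bsub>BijGroup M\<^esub> g = (\<lambda>x\<in>M. inv_into M g x)"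
      by (rule inv_BijGroup[OF gB])
    have bij: "bij_betw g M M" using gB by (simp add: Bij_def)
    have im: "inv_into M g (g x) = x" if "x \<in> M" for x
      using that bij by (simp add: bij_betw_def)
    have *: "inv_into M g (x + y) = inv_into M g x + inv_into M g y"
      "inv_into M g (x * y) = inv_into M g x * inv_into M g y" if "x \<in> M" "y \<in> M" for x y
      by (rule Bij_inv_into_lemma[where S = M], use that g gB in \<open>auto simp: gal_carrier\<close>)+
    show "inv\<^bsub>BijGroup M\<^esub> g \<in> carrier (gal_group K M)"
      unfolding inv gal_carrier
    proof (intro CollectI conjI ballI)
      show "(\<lambda>x\<in>M. inv_into M g x) \<in> Bij M" by (rule restrict_inv_into_Bij[OF gB])
      show "(\<lambda>x\<in>M. inv_into M g x) 1 = 1" using im[of 1] g by (simp add: gal_carrier)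
      show "(\<lambda>x\<in>M. inv_into M g x) x = x" if "x \<in> K" for x
      proof -
        have "x \<in> M" "g x = x" using that g K by (auto simp: gal_carrier)
        then show ?thesis using im[of x] by simp
      qed
    qed (use * in auto)
  next
    fix g h assume "g \<in> carrier (gal_group K M)" "h \<in> carrier (gal_group K M)"
    then show "g \<otimes>\<^bsub>BijGroup M\<^esub> h \<in> carrier (gal_group K M)"
      using compose_Bij[of g M h] K bij_betwE[of h M M]
      by (auto simp: gal_carrier BijGroup_def compose_def Bij_def subset_iff)
  qed
  moreover have "gal_group K M = BijGroup M\<lparr>carrier := carrier (gal_group K M)\<rparr>"
    by (simp add: gal_group_def)
  ultimately show ?thesis
    using subgroup.subgroup_is_group[OF _ group_BijGroup] by metis
qed

sublocale G: group G
  using group_gal[OF M.Rats_F] .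

lemma act_mult: "g \<in> carrier G \<Longrightarrow> h \<in> carrier G \<Longrightarrow> x \<in> M \<Longrightarrow> (g \<otimes>\<^bsub>G\<^esub> h) x = g (h x)"
  by (simp add: mult_G compose_eq)

lemma act_one: "x \<in> M \<Longrightarrow> \<one>\<^bsub>G\<^esub> x = x"
  by (simp add: one_G)

lemma act_inv: "g \<in> carrier G \<Longrightarrow> x \<in> M \<Longrightarrow> (inv\<^bsub>G\<^esub> g) (g x) = x"
  "g \<in> carrier G \<Longrightarrow> x \<in> M \<Longrightarrow> g ((inv\<^bsub>G\<^esub> g) x) = x"
  using act_mult[of "inv\<^bsub>G\<^esub> g" g x] act_mult[of g "inv\<^bsub>G\<^esub> g" x] by (auto simp: act_one)

lemma gal_add: "g \<in> carrier G \<Longrightarrow> x \<in> M \<Longrightarrow> y \<in> M \<Longrightarrow> g (x + y) = g x + g y"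
  and gal_diff: "g \<in> carrier G \<Longrightarrow> x \<in> M \<Longrightarrow> y \<in> M \<Longrightarrow> g (x - y) = g x - g y"
  and gal_mult: "g \<in> carrier G \<Longrightarrow> x \<in> M \<Longrightarrow> y \<in> M \<Longrightarrow> g (x * y) = g x * g y"
  and gal_one: "g \<in> carrier G \<Longrightarrow> g 1 = 1"
  and gal_zero: "g \<in> carrier G \<Longrightarrow> g 0 = 0"
  and gal_power: "g \<in> carrier G \<Longrightarrow> x \<in> M \<Longrightarrow> g (x ^ n) = g x ^ n"
  using subring_hom.hom_add[OF gal_hom] subring_hom.hom_diff[OF gal_hom] subring_hom.hom_mult[OF gal_hom]
    subring_hom.hom_one[OF gal_hom] subring_hom.hom_zero[OF gal_hom]
    subring_hom.hom_power[OF gal_hom] by auto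

lemma gal_sum: "g \<in> carrier G \<Longrightarrow> (\<And>i. i \<in> I \<Longrightarrow> f i \<in> M) \<Longrightarrow> g (sum f I) = (\<Sum>i\<in>I. g (f i))"
  using subring_hom.hom_sum[OF gal_hom] by blast

lemma gal_prod: "g \<in> carrier G \<Longrightarrow> (\<And>i. i \<in> I \<Longrightarrow> f i \<in> M) \<Longrightarrow> g (prod f I) = (\<Prod>i\<in>I. g (f i))"
  using subring_hom.hom_prod[OF gal_hom] by blast

lemma gal_inverse: "g \<in> carrier G \<Longrightarrow> x \<in> M \<Longrightarrow> g (inverse x) = inverse (g x)"
proof (cases "x = 0")
  case False
  assume g: "g \<in> carrier G" "x \<in> M"
  then have "g x * g (inverse x) = 1"
    using gal_mult[of g x "inverse x"] False M.inverse_F by (simp add: gal_one)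
  then show ?thesis by (metis inverse_unique)
qed (simp add: gal_zero)

lemma gal_divide: "g \<in> carrier G \<Longrightarrow> x \<in> M \<Longrightarrow> y \<in> M \<Longrightarrow> g (x / y) = g x / g y"
  by (simp add: divide_inverse gal_mult gal_inverse M.inverse_F)

lemma gal_eq_0_iff: "g \<in> carrier G \<Longrightarrow> x \<in> M \<Longrightarrow> g x = 0 \<longleftrightarrow> x = 0"
  using act_inv(1)[of g x] gal_zero[of g] gal_zero[of "inv\<^bsub>G\<^esub> g"] by auto

lemma gal_Rats: "g \<in> carrier G \<Longrightarrow> x \<in> \<rat> \<Longrightarrow> g x = x"
  by (simp add: gal_carrier)

lemma gal_of_int: "g \<in> carrier G \<Longrightarrow> g (of_int n) = of_int n" "g \<in> carrier G \<Longrightarrow> g (of_nat m) = of_nat m"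
  by (simp_all add: gal_Rats)

lemma gal_fixed: "x \<in> M \<Longrightarrow> (\<And>g. g \<in> carrier G \<Longrightarrow> g x = x) \<Longrightarrow> x \<in> \<rat>"
  using galois unfolding galois_extension_def by blast

lemma gal_algebraic_int:
  assumes "g \<in> carrier G" "x \<in> M" "algebraic_int x"
  shows "algebraic_int (g x)"
proof -
  obtain f :: "int poly" where f: "ieval f x = 0" "lead_coeff f = 1"
    using assms(3) algebraic_int_altdef_ipoly by blast
  have "map_poly g (map_poly of_int f) = map_poly of_int f"
    using assms(1) by (intro poly_eqI) (simp add: coeff_map_poly gal_zero gal_of_int)
  then have "ieval f (g x) = g (ieval f x)"
    using subring_hom.hom_poly[OF gal_hom[OF assms(1)], of "map_poly of_int f" x] assms(2)
    by (simp add: coeff_map_poly)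
  then have "ieval f (g x) = 0" using f assms(1) by (simp add: gal_zero)
  then show ?thesis using f algebraic_int_altdef_ipoly by blast
qed

lemma gal_ints [simp, intro]: "g \<in> carrier G \<Longrightarrow> x \<in> ints M \<Longrightarrow> g x \<in> ints M"
  using gal_algebraic_int by (auto simp: ints_def)

end

text \<open>\<open>galois_extension\<close> admits infinite algebraic extensions, so finiteness is a
  separate assumption; for the field of the theorem it is derived from the finiteness of the
  symmetric power.\<close>

locale galois_field = galois_over_rats +
  assumes finite_gal: "finite (carrier (gal_group \<rat> M))"
begin

lemma sum_gal_reindex:
  assumes "h \<in> carrier G"
  shows "(\<Sum>g\<in>carrier G. f (h \<otimes>\<^bsub>G\<^esub> g)) = (\<Sum>g\<in>carrier G. f g)"
    and "(\<Prod>g\<in>carrier G. f' (h \<otimes>\<^bsub>G\<^esub> g)) = (\<Prod>g\<in>carrier G. f' g)"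
proof -
  have "bij_betw (\<lambda>g. h \<otimes>\<^bsub>G\<^esub> g) (carrier G) (carrier G)"
    by (rule bij_betwI[of _ _ _ "\<lambda>g. inv\<^bsub>G\<^esub> h \<otimes>\<^bsub>G\<^esub> g"]) (use assms in \<open>auto simp: G.m_assoc[symmetric]\<close>)
  then show "(\<Sum>g\<in>carrier G. f (h \<otimes>\<^bsub>G\<^esub> g)) = (\<Sum>g\<in>carrier G. f g)"
    "(\<Prod>g\<in>carrier G. f' (h \<otimes>\<^bsub>G\<^esub> g)) = (\<Prod>g\<in>carrier G. f' g)"
    by (rule sum.reindex_bij_betw prod.reindex_bij_betw)+
qed

definition trace :: "complex \<Rightarrow> complex" where "trace x = (\<Sum>g\<in>carrier G. g x)"

definition norm_Q :: "complex \<Rightarrow> complex" where "norm_Q x = (\<Prod>g\<in>carrier G. g x)"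

lemma trace_Rats: "x \<in> M \<Longrightarrow> trace x \<in> \<rat>"
proof (rule gal_fixed)
  assume x: "x \<in> M"
  then show "trace x \<in> M" by (auto simp: trace_def intro: M.sum_F)
  fix h assume h: "h \<in> carrier G"
  have "h (trace x) = (\<Sum>g\<in>carrier G. (h \<otimes>\<^bsub>G\<^esub> g) x)"
    using x h by (simp add: trace_def gal_sum act_mult)
  then show "h (trace x) = trace x"
    using sum_gal_reindex(1)[OF h, of "\<lambda>g. g x"] by (simp add: trace_def)
qed

lemma norm_Rats: "x \<in> M \<Longrightarrow> norm_Q x \<in> \<rat>"
proof (rule gal_fixed)
  assume x: "x \<in> M"
  then show "norm_Q x \<in> M" by (auto simp: norm_Q_def intro: M.prod_F)
  fix h assume h: "h \<in> carrier G"
  have "h (norm_Q x) = (\<Prod>g\<in>carrier G. (h \<otimes>\<^bsub>G\<^esub> g) x)"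
    using x h by (simp add: norm_Q_def gal_prod act_mult)
  then show "h (norm_Q x) = norm_Q x"
    using sum_gal_reindex(2)[OF h, of "\<lambda>g. g x"] by (simp add: norm_Q_def)
qed

lemma trace_Ints: "x \<in> ints M \<Longrightarrow> trace x \<in> \<int>"
proof (rule rational_algebraic_int_is_int)
  assume x: "x \<in> ints M"
  then have "trace x \<in> ints M" unfolding trace_def by (intro M.ints_sum) auto
  then show "algebraic_int (trace x)" by (rule M.ints_F)
  show "trace x \<in> \<rat>" using x by (intro trace_Rats M.ints_F)
qed

lemma norm_Ints: "x \<in> ints M \<Longrightarrow> norm_Q x \<in> \<int>"
proof (rule rational_algebraic_int_is_int)
  assume x: "x \<in> ints M"
  then have "norm_Q x \<in> ints M" unfolding norm_Q_def by (intro M.ints_prod) auto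
  then show "algebraic_int (norm_Q x)" by (rule M.ints_F)
  show "norm_Q x \<in> \<rat>" using x by (intro norm_Rats M.ints_F)
qed

lemma norm_eq_0_iff: "x \<in> M \<Longrightarrow> norm_Q x = 0 \<longleftrightarrow> x = 0"
  using finite_gal G.one_closed by (auto simp: norm_Q_def gal_eq_0_iff)

lemma norm_multiple:
  assumes "x \<in> ints M"
  obtains y where "y \<in> ints M" "norm_Q x = x * y"
proof
  have "norm_Q x = \<one>\<^bsub>G\<^esub> x * (\<Prod>g\<in>carrier G - {\<one>\<^bsub>G\<^esub>}. g x)"
    unfolding norm_Q_def using finite_gal by (intro prod.remove) auto
  then show "norm_Q x = x * (\<Prod>g\<in>carrier G - {\<one>\<^bsub>G\<^esub>}. g x)"
    using assms by (simp add: act_one M.ints_F)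
  show "(\<Prod>g\<in>carrier G - {\<one>\<^bsub>G\<^esub>}. g x) \<in> ints M"
    using assms by (auto intro!: M.ints_prod)
qed

lemma norm_Q_mult: "x \<in> M \<Longrightarrow> y \<in> M \<Longrightarrow> norm_Q (x * y) = norm_Q x * norm_Q y"
  by (simp add: norm_Q_def gal_mult prod.distrib)

lemma orbit_poly_Rats:
  assumes "x \<in> M" shows "coeff (\<Prod>g\<in>carrier G. [:- g x, 1:]) i \<in> \<rat>"
proof -
  interpret P: subring_hom M "\<one>\<^bsub>G\<^esub>" by (rule gal_hom) simp
  define f where "f = (\<Prod>g\<in>carrier G. [:- g x, 1:])"
  have cM: "coeff [:- g x, 1:] i \<in> M" if "g \<in> carrier G" for g i
    using assms that by (auto simp: coeff_pCons split: nat.split)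
  have fM: "coeff f i \<in> M" for i
    unfolding f_def using subring_hom.prod_mem[OF P.subring_hom_map_poly, of "carrier G" "\<lambda>g. [:- g x, 1:]"] cM
    by blast
  have "coeff f i \<in> \<rat>"
  proof (rule gal_fixed[OF fM])
    fix h assume h: "h \<in> carrier G"
    interpret h: subring_hom M h by (rule gal_hom[OF h])
    interpret H: subring_hom "{f. \<forall>i. coeff f i \<in> M}" "map_poly h" by (rule h.subring_hom_map_poly)
    have "map_poly h f = (\<Prod>g\<in>carrier G. map_poly h [:- g x, 1:])"
      unfolding f_def by (rule H.hom_prod) (use cM in blast)
    also have "\<dots> = (\<Prod>g\<in>carrier G. [:- (h \<otimes>\<^bsub>G\<^esub> g) x, 1:])"
      using assms h by (intro prod.cong) (auto simp: map_poly_pCons h.hom_zero h.hom_one h.hom_uminus act_mult)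
    also have "\<dots> = f"
      unfolding f_def using sum_gal_reindex(2)[OF h, of "\<lambda>g. [:- g x, 1:]"] .
    finally show "h (coeff f i) = coeff f i" by (metis h.coeff_map_poly_hom)
  qed
  then show ?thesis by (simp add: f_def)
qed

lemma orbit_poly_root:
  assumes "x \<in> M" shows "poly (\<Prod>g\<in>carrier G. [:- g x, 1:]) x = 0"
  unfolding poly_prod using finite_gal assms G.one_closed
  by (auto simp: prod_zero_iff act_one intro!: bexI[of _ "\<one>\<^bsub>G\<^esub>"])

lemma algebraic_M: "x \<in> M \<Longrightarrow> algebraic x"
  using algebraicI'[of "\<Prod>g\<in>carrier G. [:- g x, 1:]" x] orbit_poly_Rats orbit_poly_root finite_gal by simp

text \<open>Normality: the orbit polynomial of \<open>x\<close> has rational coefficients, so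
  \<open>cnj x\<close> is another of its roots, hence a conjugate of \<open>x\<close> in
  \<open>M\<close>.\<close>

lemma cnj_gal:
  obtains c where "c \<in> carrier G" "\<And>x. x \<in> M \<Longrightarrow> c x = cnj x"
proof -
  have cM: "cnj x \<in> M" if x: "x \<in> M" for x
  proof -
    let ?f = "\<Prod>g\<in>carrier G. [:- g x, 1:]"
    have "map_poly cnj ?f = ?f"
    proof (intro poly_eqI)
      fix i
      obtain a b :: int where "coeff ?f i = of_int a / of_int b"
        using orbit_poly_Rats[OF x, of i] by (auto elim!: Rats_cases')
      then show "coeff (map_poly cnj ?f) i = coeff ?f i" by (simp add: coeff_map_poly)
    qed
    then have "poly ?f (cnj x) = cnj (poly ?f x)" by (metis poly_cnj complex_cnj_cnj)
    then have "poly ?f (cnj x) = 0" using orbit_poly_root[OF x] by simp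
    then obtain g where "g \<in> carrier G" "cnj x = g x"
      using finite_gal by (auto simp: poly_prod prod_zero_iff)
    then show ?thesis using x by simp
  qed
  let ?c = "\<lambda>x\<in>M. cnj x"
  have "bij_betw ?c M M"
    by (rule bij_betwI[of _ _ _ ?c]) (use cM in auto)
  then have "?c \<in> carrier G"
    by (auto simp: gal_carrier Bij_def M.add_F M.mult_F M.Rats_F[THEN subsetD] elim!: Rats_cases')
  then show ?thesis using that[of ?c] by auto
qed

end


subsection \<open>Finiteness of residue rings\<close>

lemma sum_list_mem_closed:
  assumes "0 \<in> A" "\<And>x y. x \<in> A \<Longrightarrow> y \<in> A \<Longrightarrow> x + y \<in> A" "\<And>i. i \<in> set l \<Longrightarrow> f i \<in> A"
  shows "(\<Sum>i\<leftarrow>l. f i) \<in> (A :: 'a :: monoid_add set)"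
  using assms(3) by (induction l) (auto simp: assms)

lemma sum_list_sum_swap:
  "(\<Sum>i\<leftarrow>l. \<Sum>j\<in>J. f i j) = (\<Sum>j\<in>J. \<Sum>i\<leftarrow>l. (f i j :: 'a :: comm_monoid_add))"
  by (induction l) (auto simp: sum.distrib)

context galois_field
begin

lemma moved_imp_unit_relation:
  assumes "g \<in> carrier G" "x \<in> R" "g x \<noteq> x" and R: "fld R" "R \<subseteq> M" "g x \<in> R"
  shows "\<exists>l. set l \<subseteq> R \<times> R \<and> (\<Sum>(a, b)\<leftarrow>l. a * (b - g b)) = 1"
proof -
  interpret R: subfield_of_complex R by unfold_locales (fact R)
  show ?thesis
    using assms by (intro exI[of _ "[(inverse (x - g x), x)]"]) (auto intro!: R.inverse_F R.diff_F)
qed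

text \<open>A list dual to the nontrivial automorphisms gives 1 at the identity and 0 elsewhere,
  which turns the sum of the \<open>a * trace (b * x)\<close> into \<open>x\<close>. It serves as an
  integral basis: denominators are shifted from \<open>b\<close> to \<open>a\<close>, so that the
  coordinates of an integer are rational integers.\<close>

lemma trace_dual_basis:
  obtains l where "set l \<subseteq> M \<times> ints M" "\<And>x. x \<in> M \<Longrightarrow> x = (\<Sum>(a, b)\<leftarrow>l. a * trace (b * x))"
proof -
  have "\<exists>l. set l \<subseteq> M \<times> M \<and> (\<Sum>(x, y)\<leftarrow>l. x * y) = 1 \<and>
      (\<forall>g\<in>carrier G - {\<one>\<^bsub>G\<^esub>}. (\<Sum>(x, y)\<leftarrow>l. x * g y) = 0)"
  proof (rule dual_basis_exists)
    fix g assume g: "g \<in> carrier G - {\<one>\<^bsub>G\<^esub>}"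
    then obtain x where "x \<in> M" "g x \<noteq> x"
      using gal_eqI[of g "\<one>\<^bsub>G\<^esub>"] act_one by force
    then show "\<exists>l. set l \<subseteq> M \<times> M \<and> (\<Sum>(a, b)\<leftarrow>l. a * (b - g b)) = 1"
      using g moved_imp_unit_relation[of g x M] M.fld by auto
  qed (use finite_gal in \<open>auto simp: gal_mult gal_one\<close>)
  then obtain l where l: "set l \<subseteq> M \<times> M" "(\<Sum>(x, y)\<leftarrow>l. x * y) = 1"
    "\<And>g. g \<in> carrier G \<Longrightarrow> g \<noteq> \<one>\<^bsub>G\<^esub> \<Longrightarrow> (\<Sum>(x, y)\<leftarrow>l. x * g y) = 0" by blast
  have "\<forall>y\<in>snd ` set l. \<exists>n>0. algebraic_int (of_nat n * y)"
  proof
    fix y assume "y \<in> snd ` set l"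
    then have "y \<in> M" using l(1) by auto
    then show "\<exists>n>0. algebraic_int (of_nat n * y)" by (meson algebraic_M algebraic_int_multiple)
  qed
  then obtain n where n: "\<And>y. y \<in> snd ` set l \<Longrightarrow> n y > 0 \<and> algebraic_int (of_nat (n y) * y)"
    by metis
  define l' where "l' = map (\<lambda>(x, y). (x / of_nat (n y), of_nat (n y) * y)) l"
  show ?thesis
  proof (rule that[of l'])
    show "set l' \<subseteq> M \<times> ints M"
      using l(1) n by (force simp: l'_def ints_def)
    fix z assume z: "z \<in> M"
    have tr: "x / of_nat (n y) * trace (of_nat (n y) * y * z) = (\<Sum>g\<in>carrier G. x * g y * g z)"
      if "(x, y) \<in> set l" for x y
    proof -
      have y: "y \<in> M" "n y > 0" using that l(1) n by force+
      have "trace (of_nat (n y) * y * z) = of_nat (n y) * (\<Sum>g\<in>carrier G. g y * g z)"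
        unfolding trace_def sum_distrib_left
        using y z by (intro sum.cong) (auto simp: gal_mult gal_of_int mult.assoc M.mult_F)
      then show ?thesis using y by (simp add: sum_distrib_left mult.assoc)
    qed
    have "(\<Sum>(a, b)\<leftarrow>l'. a * trace (b * z)) = (\<Sum>c\<leftarrow>l. \<Sum>g\<in>carrier G. fst c * g (snd c) * g z)"
      unfolding l'_def map_map
      by (rule arg_cong[of _ _ sum_list], rule map_cong) (auto simp: tr simp del: times_divide_eq_left)
    also have "\<dots> = (\<Sum>g\<in>carrier G. (\<Sum>c\<leftarrow>l. fst c * g (snd c)) * g z)"
      by (simp add: sum_list_sum_swap sum_list_mult_const)
    also have "\<dots> = (\<Sum>g\<in>carrier G. if g = \<one>\<^bsub>G\<^esub> then z else 0)"
    proof (intro sum.cong refl)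
      fix g assume g: "g \<in> carrier G"
      have "(\<Sum>c\<leftarrow>l. fst c * g (snd c)) = (if g = \<one>\<^bsub>G\<^esub> then 1 else 0)"
      proof (cases "g = \<one>\<^bsub>G\<^esub>")
        case True
        have "(\<Sum>c\<leftarrow>l. fst c * g (snd c)) = (\<Sum>(x, y)\<leftarrow>l. x * y)"
          by (rule arg_cong[of _ _ sum_list], rule map_cong) (use l(1) True in \<open>auto simp: act_one\<close>)
        then show ?thesis using l(2) True by simp
      qed (use l(3)[OF g] in \<open>simp add: case_prod_unfold\<close>)
      then show "(\<Sum>c\<leftarrow>l. fst c * g (snd c)) * g z = (if g = \<one>\<^bsub>G\<^esub> then z else 0)"
        using z by (simp add: act_one)
    qed
    also have "\<dots> = z" using finite_gal by simp
    finally show "z = (\<Sum>(a, b)\<leftarrow>l'. a * trace (b * z))" ..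
  qed
qed

lemma trace_diff: "x \<in> M \<Longrightarrow> y \<in> M \<Longrightarrow> trace (x - y) = trace x - trace y"
  by (simp add: trace_def gal_diff sum_subtractf)

text \<open>The coordinates \<open>trace (b * x)\<close>, reduced modulo \<open>m\<close> times a
  denominator of \<open>a\<close>, determine \<open>x\<close> modulo \<open>m\<close>. The set
  \<open>Y\<close> is arbitrary so that representatives can be taken inside the integers of a
  subfield.\<close>

lemma finite_residues:
  assumes "m > 0" "Y \<subseteq> ints M"
  obtains S where "finite S" "S \<subseteq> Y" "\<And>x. x \<in> Y \<Longrightarrow> \<exists>s\<in>S. algebraic_int ((x - s) / of_nat m)"
proof -
  obtain l where l: "set l \<subseteq> M \<times> ints M" "\<And>x. x \<in> M \<Longrightarrow> x = (\<Sum>(a, b)\<leftarrow>l. a * trace (b * x))"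
    using trace_dual_basis by blast
  have "\<forall>c\<in>set l. \<exists>n>0. algebraic_int (of_nat n * fst c)"
  proof
    fix c assume "c \<in> set l"
    then have "fst c \<in> M" using l(1) by auto
    then show "\<exists>n>0. algebraic_int (of_nat n * fst c)" by (meson algebraic_M algebraic_int_multiple)
  qed
  then obtain n where n: "\<And>c. c \<in> set l \<Longrightarrow> n c > 0 \<and> algebraic_int (of_nat (n c) * fst c)"
    by metis
  define t :: "complex \<times> complex \<Rightarrow> complex \<Rightarrow> int" where "t c x = (THE k. trace (snd c * x) = of_int k)" for c x
  have t: "trace (snd c * x) = of_int (t c x)" if "c \<in> set l" "x \<in> ints M" for c x
  proof -
    have "trace (snd c * x) \<in> \<int>" using that l(1) by (intro trace_Ints M.ints_mult) auto
    then obtain k :: int where "trace (snd c * x) = of_int k" by (auto elim: Ints_cases)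
    then show ?thesis unfolding t_def by (auto intro!: theI2[of _ k])
  qed
  define f where "f x = map (\<lambda>c. t c x mod int (m * n c)) l" for x
  define B where "B = (\<Union>c\<in>set l. {0..<int (m * n c)})"
  have "f ` Y \<subseteq> {xs. set xs \<subseteq> B \<and> length xs = length l}"
    using assms(1) n by (force simp: f_def B_def)
  then have "finite (f ` Y)"
    by (rule finite_subset) (auto intro!: finite_lists_length_eq simp: B_def)
  then obtain S where S: "finite S" "S \<subseteq> Y" "f ` Y = f ` S"
    by (meson finite_subset_image order_refl)
  show ?thesis
  proof (rule that[OF S(1,2)])
    fix x assume x: "x \<in> Y"
    then obtain s where s: "s \<in> S" "f x = f s" using S(3) by blast
    have xs: "x \<in> ints M" "s \<in> ints M" using x s S assms by auto
    have "algebraic_int (fst c * trace (snd c * (x - s)) / of_nat m)" if c: "c \<in> set l" for c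
    proof -
      have "t c x mod int (m * n c) = t c s mod int (m * n c)"
        using s(2) c by (simp add: f_def)
      then obtain k where k: "t c x - t c s = int (m * n c) * k"
        by (metis mod_eq_dvd_iff dvdE)
      have "snd c \<in> M" using c l(1) by (auto simp: ints_def)
      then have "trace (snd c * (x - s)) = of_int (t c x) - of_int (t c s)"
        using t[OF c xs(1)] t[OF c xs(2)] xs by (simp add: right_diff_distrib trace_diff M.mult_F M.ints_F)
      also have "\<dots> = of_nat m * of_nat (n c) * of_int k"
        using k by (metis of_int_diff of_int_mult of_int_of_nat_eq of_nat_mult)
      finally have "fst c * trace (snd c * (x - s)) / of_nat m = (of_nat (n c) * fst c) * of_int k"
        using assms(1) by simp
      then show ?thesis using n[OF c] algebraic_int_add_mult(2) by simp
    qed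
    then have *: "algebraic_int (\<Sum>c\<leftarrow>l. fst c * trace (snd c * (x - s)) / of_nat m)"
      using sum_list_mem_closed[of "Collect algebraic_int" l "\<lambda>c. fst c * trace (snd c * (x - s)) / of_nat m"]
      by (auto simp: algebraic_int_add_mult)
    have "x - s = (\<Sum>c\<leftarrow>l. fst c * trace (snd c * (x - s)))"
      using l(2)[of "x - s"] xs by (simp add: case_prod_unfold M.diff_F M.ints_F)
    then have "(x - s) / of_nat m = (\<Sum>c\<leftarrow>l. fst c * trace (snd c * (x - s)) / of_nat m)"
      by (simp add: divide_inverse sum_list_mult_const)
    then show "\<exists>s\<in>S. algebraic_int ((x - s) / of_nat m)" using * s(1) by metis
  qed
qed

lemma residue_pigeonhole:
  fixes f :: "nat \<Rightarrow> complex"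
  assumes "m > 0" "\<And>i. f i \<in> ints M"
  obtains i j where "i < j" "algebraic_int ((f j - f i) / of_nat m)"
proof -
  obtain S where S: "finite S" "\<And>x. x \<in> ints M \<Longrightarrow> \<exists>s\<in>S. algebraic_int ((x - s) / of_nat m)"
    using finite_residues[OF assms(1) order_refl] by metis
  define r where "r i = (SOME s. s \<in> S \<and> algebraic_int ((f i - s) / of_nat m))" for i
  have r: "r i \<in> S" "algebraic_int ((f i - r i) / of_nat m)" for i
    using someI_ex[of "\<lambda>s. s \<in> S \<and> algebraic_int ((f i - s) / of_nat m)"] S(2)[OF assms(2)] unfolding r_def by blast+
  have "\<not> inj r"
    using S(1) r(1) by (metis finite_imageD finite_subset image_subsetI infinite_UNIV_nat)
  then obtain i j where "i < j" "r i = r j"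
    by (metis injI linorder_neqE_nat)
  then have "algebraic_int ((f j - r j) / of_nat m - (f i - r i) / of_nat m)"
    using r(2) algebraic_int_diff by blast
  then show ?thesis
    using that[OF \<open>i < j\<close>] \<open>r i = r j\<close> by (simp add: diff_divide_distrib)
qed

lemma norm_nat_multiple:
  assumes "x \<in> ints M" "x \<noteq> 0"
  obtains m y where "m > 0" "y \<in> ints M" "of_nat m = x * y"
proof -
  obtain y where y: "y \<in> ints M" "norm_Q x = x * y" using norm_multiple assms(1) by blast
  obtain k :: int where k: "norm_Q x = of_int k" using norm_Ints[OF assms(1)] by (auto elim: Ints_cases)
  have "k \<noteq> 0" using assms norm_eq_0_iff[of x] k by (auto simp: M.ints_F)
  then consider "k > 0" | "k < 0" by linarith
  then show ?thesis
  proof cases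
    case 1
    then show ?thesis using that[of "nat k" y] y k by simp
  next
    case 2
    then have "(of_nat (nat (- k)) :: complex) = - norm_Q x" using k by simp
    then show ?thesis using that[of "nat (- k)" "- y"] y 2 by (auto simp: M.ints_uminus)
  qed
qed

text \<open>For a positive integer \<open>m\<close> divisible by \<open>d\<close> all
  \<open>m y^n\<close> are integral; two of them agree modulo \<open>m\<close>, so some
  \<open>y^j - y^i\<close> is integral. This is the way in which integrality of an element is
  established below.\<close>

lemma almost_integral_imp_integral:
  assumes "y \<in> M" "d \<in> ints M" "d \<noteq> 0" "\<And>n. algebraic_int (d * y ^ n)"
  shows "algebraic_int y"
proof -
  obtain m d' where m: "m > 0" "d' \<in> ints M" "of_nat m = d * d'"
    using norm_nat_multiple[OF assms(2,3)] by metis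
  have "of_nat m * y ^ n \<in> ints M" for n
  proof -
    have "of_nat m * y ^ n = d' * (d * y ^ n)" using m by simp
    moreover have "d * y ^ n \<in> ints M"
      using assms(1,2,4) by (auto simp: ints_def)
    ultimately show ?thesis using m(2) M.ints_mult by metis
  qed
  then obtain i j where "i < j" "algebraic_int ((of_nat m * y ^ j - of_nat m * y ^ i) / of_nat m)"
    using residue_pigeonhole[OF m(1), of "\<lambda>n. of_nat m * y ^ n"] by blast
  then have "algebraic_int (y ^ j - y ^ i)" using m(1) by (simp add: diff_divide_distrib)
  then show ?thesis using algebraic_int_of_power_diff \<open>i < j\<close> by blast
qed

end


subsection \<open>Ideals of rings of integers\<close>

text \<open>\<open>F\<close> need not be Galois over the rationals, so norms and traces are those of
  the ambient \<open>M\<close>. The ideal theory below is applied to \<open>M\<close> itself and to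
  the fields \<open>H\<close> and \<open>K\<close>.\<close>

locale galois_subfield = galois_field + F: subfield_of_complex F for F +
  assumes F_sub: "F \<subseteq> M"
begin

lemma ints_FM: "x \<in> ints F \<Longrightarrow> x \<in> ints M"
  using ints_mono[OF F_sub] by blast

definition idl :: "complex set \<Rightarrow> bool"
  where "idl I \<longleftrightarrow> I \<subseteq> ints F \<and> 0 \<in> I \<and> (\<forall>x\<in>I. \<forall>y\<in>I. x + y \<in> I) \<and> (\<forall>a\<in>ints F. \<forall>x\<in>I. a * x \<in> I)"

definition prime_idl :: "complex set \<Rightarrow> bool"
  where "prime_idl Q \<longleftrightarrow> idl Q \<and> Q \<noteq> {0} \<and> 1 \<notin> Q \<and> (\<forall>a\<in>ints F. \<forall>b\<in>ints F. a * b \<in> Q \<longrightarrow> a \<in> Q \<or> b \<in> Q)"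

lemma idlD:
  assumes "idl I"
  shows "I \<subseteq> ints F" "0 \<in> I" "x \<in> I \<Longrightarrow> y \<in> I \<Longrightarrow> x + y \<in> I" "a \<in> ints F \<Longrightarrow> x \<in> I \<Longrightarrow> a * x \<in> I"
    "a \<in> ints F \<Longrightarrow> x \<in> I \<Longrightarrow> x * a \<in> I" "x \<in> I \<Longrightarrow> y \<in> I \<Longrightarrow> x - y \<in> I" "x \<in> I \<Longrightarrow> - x \<in> I"
proof -
  show m: "a \<in> ints F \<Longrightarrow> x \<in> I \<Longrightarrow> a * x \<in> I" for a x
    using assms by (auto simp: idl_def)
  show u: "x \<in> I \<Longrightarrow> - x \<in> I" for x using m[of "- 1" x] F.ints_uminus[OF F.ints_1] by simp
  show a: "x \<in> I \<Longrightarrow> y \<in> I \<Longrightarrow> x + y \<in> I" for x y using assms by (auto simp: idl_def)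
  show "x \<in> I \<Longrightarrow> y \<in> I \<Longrightarrow> x - y \<in> I" using a[of x "- y"] u[of y] by simp
  show "a \<in> ints F \<Longrightarrow> x \<in> I \<Longrightarrow> x * a \<in> I" using m by (simp add: mult.commute)
qed (use assms in \<open>auto simp: idl_def\<close>)

lemma prime_idlD:
  assumes "prime_idl Q"
  shows "idl Q" "Q \<noteq> {0}" "1 \<notin> Q" "a \<in> ints F \<Longrightarrow> b \<in> ints F \<Longrightarrow> a * b \<in> Q \<Longrightarrow> a \<in> Q \<or> b \<in> Q"
  using assms by (auto simp: prime_idl_def)

lemma idl_contains_nat:
  assumes "idl I" "I \<noteq> {0}"
  obtains m where "m > 0" "of_nat m \<in> I"
proof -
  obtain x where x: "x \<in> I" "x \<noteq> 0" using assms idlD(2) by blast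
  then have xF: "x \<in> ints F" using idlD(1) assms by blast
  obtain m y where m: "m > 0" "y \<in> ints M" "of_nat m = x * y"
    using norm_nat_multiple[OF ints_FM[OF xF] x(2)] by metis
  have "y = of_nat m / x" using m x by (simp add: field_simps)
  then have "y \<in> ints F" using m(2) xF F.divide_F[OF F.of_nat_F] by (auto simp: ints_def)
  then show ?thesis using that m idlD(5)[OF assms(1)] x(1) by metis
qed

lemma idl_multiple_nat:
  assumes "idl I" "m > 0" "of_nat m \<in> I" "x \<in> ints F" "y \<in> ints F" "algebraic_int ((x - y) / of_nat m)"
  shows "x - y \<in> I"
proof -
  have "(x - y) / of_nat m \<in> ints F"
    using assms F.diff_F F.divide_F[OF _ F.of_nat_F] by (auto simp: ints_def)
  then have "(x - y) / of_nat m * of_nat m \<in> I" using idlD(4)[OF assms(1)] assms(3) by blast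
  then show ?thesis using assms(2) by simp
qed

text \<open>The residue ring is a finite domain: two powers of \<open>x\<close> agree modulo
  \<open>Q\<close>, and the smaller one cancels. The exponent \<open>k\<close> yields explicit
  inverses modulo \<open>Q\<close>.\<close>

lemma prime_idl_power_eq_1:
  assumes "prime_idl Q" "x \<in> ints F" "x \<notin> Q"
  obtains k where "k > 0" "x ^ k - 1 \<in> Q"
proof -
  note Q = prime_idlD[OF assms(1)]
  obtain m where m: "m > 0" "of_nat m \<in> Q" using idl_contains_nat Q by blast
  obtain i j where ij: "i < j" "algebraic_int ((x ^ j - x ^ i) / of_nat m)"
    using residue_pigeonhole[OF m(1), of "\<lambda>i. x ^ i"] assms(2) ints_FM by blast
  have "x ^ j - x ^ i \<in> Q" using ij m assms(2) Q(1) by (intro idl_multiple_nat) auto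
  moreover have "x ^ j - x ^ i = x ^ i * (x ^ (j - i) - 1)"
    using ij by (simp add: right_diff_distrib flip: power_add)
  moreover have "x ^ n \<notin> Q" for n
    using assms(2,3) Q(3,4) by (induction n) auto
  ultimately have "x ^ (j - i) - 1 \<in> Q"
    using Q(4)[of "x ^ i" "x ^ (j - i) - 1"] assms(2) by (metis F.ints_1 F.ints_diff F.ints_power)
  then show ?thesis using that[of "j - i"] ij by simp
qed

lemma idl_add_principal:
  assumes "idl I" "a \<in> ints F"
  shows "idl {x + b * a |x b. x \<in> I \<and> b \<in> ints F}" "I \<subseteq> {x + b * a |x b. x \<in> I \<and> b \<in> ints F}"
    "a \<in> {x + b * a |x b. x \<in> I \<and> b \<in> ints F}"
proof -
  let ?J = "{x + b * a |x b. x \<in> I \<and> b \<in> ints F}"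
  show sub: "I \<subseteq> ?J" by (force intro: exI[of _ 0])
  show "a \<in> ?J" using idlD(2)[OF assms(1)] by (force intro: exI[of _ 0] exI[of _ 1])
  have "u + v \<in> ?J" if "u \<in> ?J" "v \<in> ?J" for u v
  proof -
    from that obtain x b y c where "u = x + b * a" "v = y + c * a" "x \<in> I" "y \<in> I" "b \<in> ints F" "c \<in> ints F"
      by blast
    then show ?thesis using idlD(3)[OF assms(1)]
      by (intro CollectI exI[of _ "x + y"] exI[of _ "b + c"]) (auto simp: algebra_simps)
  qed
  moreover have "c * u \<in> ?J" if "c \<in> ints F" "u \<in> ?J" for c u
  proof -
    from that obtain x b where "u = x + b * a" "x \<in> I" "b \<in> ints F" by blast
    then show ?thesis using idlD(4)[OF assms(1)] that(1)
      by (intro CollectI exI[of _ "c * x"] exI[of _ "c * b"]) (auto simp: algebra_simps)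
  qed
  moreover have "?J \<subseteq> ints F" using assms idlD(1) by blast
  moreover have "0 \<in> ?J" using sub idlD(2)[OF assms(1)] by blast
  ultimately show "idl ?J" unfolding idl_def by blast
qed

text \<open>
  Ideals containing a positive integer \<open>m\<close> are determined by the representatives of residues modulo
  \<open>m\<close> they contain, which gives a measure for Noetherian induction.
\<close>

lemma idl_measure:
  assumes "m > 0"
  obtains \<mu> :: "complex set \<Rightarrow> nat" and B where
    "\<And>I J. idl I \<Longrightarrow> idl J \<Longrightarrow> of_nat m \<in> I \<Longrightarrow> I \<subset> J \<Longrightarrow> \<mu> I < \<mu> J"
    "\<And>I. \<mu> I \<le> B"
proof -
  obtain S where S: "finite S" "S \<subseteq> ints F" "\<And>x. x \<in> ints F \<Longrightarrow> \<exists>s\<in>S. algebraic_int ((x - s) / of_nat m)"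
    using finite_residues[OF assms ints_mono[OF F_sub]] by metis
  show ?thesis
  proof (rule that[of "\<lambda>I. card (S \<inter> I)" "card S"])
    fix I J assume IJ: "idl I" "idl J" "of_nat m \<in> I" "I \<subset> J"
    then obtain x where x: "x \<in> J" "x \<notin> I" by blast
    then obtain s where s: "s \<in> S" "algebraic_int ((x - s) / of_nat m)"
      using S(3) IJ idlD(1) by blast
    have "x - s \<in> I"
      using idl_multiple_nat[OF IJ(1) assms IJ(3) _ _ s(2)] x s S(2) IJ(2) idlD(1) by blast
    moreover from this have "s \<in> J" using idlD(6)[OF IJ(2), of x "x - s"] x IJ by auto
    moreover have "s \<notin> I" using idlD(3)[OF IJ(1), of "x - s" s] \<open>x - s \<in> I\<close> x by auto
    ultimately have "S \<inter> I \<subset> S \<inter> J" using IJ(4) s(1) by blast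
    then show "card (S \<inter> I) < card (S \<inter> J)" using S(1) by (intro psubset_card_mono) auto
  qed (use S(1) in \<open>auto intro: card_mono\<close>)
qed

text \<open>An ideal of greatest measure among the proper ideals over \<open>I\<close> is maximal
  for inclusion. If it contained \<open>a * b\<close> but neither factor, adjoining \<open>a\<close>
  would give 1, and multiplying by \<open>b\<close> a contradiction.\<close>

lemma exists_prime_above:
  assumes "idl I" "I \<noteq> {0}" "1 \<notin> I"
  obtains Q where "prime_idl Q" "I \<subseteq> Q"
proof -
  obtain m where m: "m > 0" "of_nat m \<in> I" using idl_contains_nat assms by blast
  obtain \<mu> :: "complex set \<Rightarrow> nat" and B where \<mu>: "\<And>I J. idl I \<Longrightarrow> idl J \<Longrightarrow> of_nat m \<in> I \<Longrightarrow> I \<subset> J \<Longrightarrow> \<mu> I < \<mu> J" "\<And>I. \<mu> I \<le> B"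
    using idl_measure[OF m(1)] by metis
  define P where "P J \<longleftrightarrow> idl J \<and> I \<subseteq> J \<and> 1 \<notin> J" for J
  have "P I" using assms by (simp add: P_def)
  then obtain Q where Q: "P Q" "\<And>J. P J \<Longrightarrow> \<mu> J \<le> \<mu> Q"
    using ex_has_greatest_nat[of P I \<mu> "Suc B"] \<mu>(2) by (metis less_Suc_eq_le)
  have "a \<in> Q \<or> b \<in> Q" if ab: "a \<in> ints F" "b \<in> ints F" "a * b \<in> Q" for a b
  proof (rule ccontr)
    assume n: "\<not> ?thesis"
    let ?J = "{x + c * a |x c. x \<in> Q \<and> c \<in> ints F}"
    have iQ: "idl Q" using Q by (simp add: P_def)
    note J = idl_add_principal[OF iQ ab(1)]
    have "Q \<subset> ?J" using J n by blast
    moreover have "of_nat m \<in> Q" using m Q by (auto simp: P_def)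
    ultimately have "\<mu> Q < \<mu> ?J" using \<mu>(1)[OF iQ J(1)] by blast
    then have "\<not> P ?J" using Q(2)[of ?J] by linarith
    then have "1 \<in> ?J" using J(1,2) Q(1) unfolding P_def by blast
    then obtain x c where xc: "1 = x + c * a" "x \<in> Q" "c \<in> ints F" by blast
    have "b = b * x + c * (a * b)" using xc(1) by (metis distrib_left mult.commute mult.left_commute mult.right_neutral)
    moreover have "b * x + c * (a * b) \<in> Q" using xc ab idlD(3,4)[OF iQ] by blast
    ultimately show False using n by metis
  qed
  moreover have "Q \<noteq> {0}" using Q(1) assms idlD(2)[OF assms(1)] by (auto simp: P_def)
  ultimately have "prime_idl Q" using Q(1) by (auto simp: P_def prime_idl_def)
  then show ?thesis using that Q(1) by (auto simp: P_def)
qed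

text \<open>Containment of a product of ideals, tested on products of elements; for an ideal
  \<open>I\<close> this is the same condition.\<close>

definition prods_in :: "complex set list \<Rightarrow> complex set \<Rightarrow> bool"
  where "prods_in Qs I \<longleftrightarrow> (\<forall>xs. list_all2 (\<in>) xs Qs \<longrightarrow> prod_list xs \<in> I)"

text \<open>Noetherian induction: if \<open>a * b\<close> lies in \<open>I\<close> but neither
  factor does, the ideals \<open>I + (a)\<close> and \<open>I + (b)\<close> are larger and their
  product lies in \<open>I\<close>.\<close>

lemma contains_prime_product:
  assumes "idl I" "I \<noteq> {0}"
  obtains Qs where "\<forall>Q\<in>set Qs. prime_idl Q" "prods_in Qs I"
proof -
  obtain m where m: "m > 0" "of_nat m \<in> I" using idl_contains_nat assms by blast
  obtain \<mu> :: "complex set \<Rightarrow> nat" and B where \<mu>: "\<And>I J. idl I \<Longrightarrow> idl J \<Longrightarrow> of_nat m \<in> I \<Longrightarrow> I \<subset> J \<Longrightarrow> \<mu> I < \<mu> J" "\<And>I. \<mu> I \<le> B"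
    using idl_measure[OF m(1)] by metis
  have "\<exists>Qs. (\<forall>Q\<in>set Qs. prime_idl Q) \<and> prods_in Qs I"
    using assms(1) m(2)
  proof (induction "B - \<mu> I" arbitrary: I rule: less_induct)
    case less
    have I0: "I \<noteq> {0}" using less.prems m(1) by auto
    consider "1 \<in> I" | "prime_idl I" | a b where "a \<in> ints F" "b \<in> ints F" "a * b \<in> I" "a \<notin> I" "b \<notin> I"
      using less.prems I0 by (auto simp: prime_idl_def)
    then show ?case
    proof cases
      case 1
      then show ?thesis by (intro exI[of _ "[]"]) (auto simp: prods_in_def)
    next
      case 2
      then show ?thesis by (intro exI[of _ "[I]"]) (auto simp: prods_in_def list_all2_Cons2)
    next
      case 3
      have *: "\<exists>Qs. (\<forall>Q\<in>set Qs. prime_idl Q) \<and> prods_in Qs {x + c * a |x c. x \<in> I \<and> c \<in> ints F}"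
        if "a \<in> ints F" "a \<notin> I" for a
      proof (rule less.hyps)
        note J = idl_add_principal[OF less.prems(1) that(1)]
        show "idl {x + c * a |x c. x \<in> I \<and> c \<in> ints F}" by (rule J)
        show "of_nat m \<in> {x + c * a |x c. x \<in> I \<and> c \<in> ints F}" using J(2) less.prems by blast
        have "\<mu> I < \<mu> {x + c * a |x c. x \<in> I \<and> c \<in> ints F}"
          using J that less.prems by (intro \<mu>(1)) blast+
        then show "B - \<mu> {x + c * a |x c. x \<in> I \<and> c \<in> ints F} < B - \<mu> I"
          using \<mu>(2)[of "{x + c * a |x c. x \<in> I \<and> c \<in> ints F}"] by linarith
      qed
      from *[OF 3(1,4)] *[OF 3(2,5)] obtain As Bs where
        As: "\<forall>Q\<in>set As. prime_idl Q" "prods_in As {x + c * a |x c. x \<in> I \<and> c \<in> ints F}" and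
        Bs: "\<forall>Q\<in>set Bs. prime_idl Q" "prods_in Bs {x + c * b |x c. x \<in> I \<and> c \<in> ints F}" by blast
      have "prods_in (As @ Bs) I"
        unfolding prods_in_def
      proof (intro allI impI)
        fix zs assume "list_all2 (\<in>) zs (As @ Bs)"
        then obtain xs ys where zs: "zs = xs @ ys" "list_all2 (\<in>) xs As" "list_all2 (\<in>) ys Bs"
          by (metis list_all2_append2)
        then have "prod_list xs \<in> {x + c * a |x c. x \<in> I \<and> c \<in> ints F}"
          "prod_list ys \<in> {x + c * b |x c. x \<in> I \<and> c \<in> ints F}"
          using As(2) Bs(2) unfolding prods_in_def by blast+
        then obtain x c y d where x: "prod_list xs = x + c * a" "x \<in> I" "c \<in> ints F"
          and y: "prod_list ys = y + d * b" "y \<in> I" "d \<in> ints F" by blast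
        have "prod_list zs = (y + d * b) * x + (c * a) * y + c * d * (a * b)"
          using zs(1) x(1) y(1) by (simp add: algebra_simps)
        moreover have "y \<in> ints F" using y(2) idlD(1)[OF less.prems(1)] by blast
        then have "(y + d * b) * x \<in> I" "(c * a) * y \<in> I" "c * d * (a * b) \<in> I"
          using x y 3 by (auto intro!: idlD(4)[OF less.prems(1), of "y + d * b"]
            idlD(4)[OF less.prems(1), of "c * a"] idlD(4)[OF less.prems(1), of "c * d"])
        then have "(y + d * b) * x + (c * a) * y + c * d * (a * b) \<in> I"
          by (intro idlD(3)[OF less.prems(1)])
        ultimately show "prod_list zs \<in> I" by simp
      qed
      then show ?thesis using As(1) Bs(1) by (intro exI[of _ "As @ Bs"]) auto
    qed
  qed
  then show ?thesis using that by blast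
qed

text \<open>Nonzero primes are maximal: an element of \<open>Q\<close> outside \<open>P\<close> has
  a power congruent to 1 modulo \<open>P\<close>.\<close>

lemma prime_idl_subset_eq:
  assumes "prime_idl P" "prime_idl Q" "P \<subseteq> Q"
  shows "P = Q"
proof (rule ccontr)
  assume "P \<noteq> Q"
  then obtain x where x: "x \<in> Q" "x \<notin> P" using assms by blast
  have xF: "x \<in> ints F" using x prime_idlD(1)[OF assms(2)] idlD(1) by blast
  obtain k where k: "k > 0" "x ^ k - 1 \<in> P" by (rule prime_idl_power_eq_1[OF assms(1) xF x(2)])
  have "x ^ (k - 1) * x \<in> Q" using x xF prime_idlD(1)[OF assms(2)] by (intro idlD(4)) auto
  then have "x ^ k \<in> Q" using k(1) by (simp flip: power_Suc2)
  then have "1 \<in> Q" using idlD(6)[OF prime_idlD(1)[OF assms(2)], of "x ^ k" "x ^ k - 1"] k(2) assms(3) by auto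
  then show False using prime_idlD(3) assms(2) by blast
qed

text \<open>Dedekind's construction of a nontrivial element of the inverse of \<open>Q\<close>. A
  shortest list of primes with product in \<open>(c)\<close>, for a positive integer
  \<open>c\<close> in \<open>Q\<close>, must contain \<open>Q\<close>; without \<open>Q\<close> some
  product of elements falls outside \<open>(c)\<close>, and dividing it by \<open>c\<close> gives
  \<open>w\<close>.\<close>

lemma prime_idl_colon:
  assumes Q: "prime_idl Q"
  obtains w where "w \<in> F" "w \<notin> ints F" "\<And>q. q \<in> Q \<Longrightarrow> w * q \<in> ints F"
proof -
  note Qd = prime_idlD[OF Q]
  obtain m where m: "m > 0" "of_nat m \<in> Q" using idl_contains_nat Qd by blast
  define c :: complex where "c = of_nat m"
  have c: "c \<noteq> 0" "c \<in> Q" "c \<in> ints F" using m by (auto simp: c_def)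
  define I where "I = {b * c |b. b \<in> ints F}"
  have z0: "idl {0}" by (auto simp: idl_def)
  have "I = {x + b * c |x b. x \<in> {0} \<and> b \<in> ints F}" by (auto simp: I_def)
  then have I: "idl I" "c \<in> I" using idl_add_principal[OF z0 c(3)] by auto
  then have "I \<noteq> {0}" using c by auto
  then have ex: "\<exists>Qs. (\<forall>Q\<in>set Qs. prime_idl Q) \<and> prods_in Qs I"
    using contains_prime_product[OF I(1)] by metis
  define P where "P Qs \<longleftrightarrow> (\<forall>Q\<in>set Qs. prime_idl Q) \<and> prods_in Qs I" for Qs
  obtain Qs where Qs: "P Qs" "\<And>Rs. P Rs \<Longrightarrow> length Qs \<le> length Rs"
    using ex ex_has_least_nat[of P _ length] unfolding P_def[symmetric] by metis
  have IQ: "I \<subseteq> Q" using c Qd idlD by (auto simp: I_def)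
  have "Q \<in> set Qs"
  proof (rule ccontr)
    assume n: "Q \<notin> set Qs"
    have "\<forall>R\<in>set Qs. \<exists>x. x \<in> R \<and> x \<notin> Q"
    proof
      fix R assume R: "R \<in> set Qs"
      then have "prime_idl R" "R \<noteq> Q" using n Qs(1) by (auto simp: P_def)
      then have "\<not> R \<subseteq> Q" using prime_idl_subset_eq[OF _ Q] by blast
      then show "\<exists>x. x \<in> R \<and> x \<notin> Q" by blast
    qed
    then obtain f where f: "\<And>R. R \<in> set Qs \<Longrightarrow> f R \<in> R \<and> f R \<notin> Q" by metis
    have "list_all2 (\<in>) (map f Qs) Qs" using f by (auto simp: list_all2_conv_all_nth)
    then have "prod_list (map f Qs) \<in> Q" using Qs(1) IQ by (auto simp: P_def prods_in_def)
    have "f R \<in> ints F" if "R \<in> set Qs" for R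
      using that f Qs(1) prime_idlD(1) idlD(1) unfolding P_def by blast
    then have "prod_list (map f Rs) \<notin> Q \<and> prod_list (map f Rs) \<in> ints F" if "set Rs \<subseteq> set Qs" for Rs
      using that f Qd(3,4) by (induction Rs) auto
    then show False using \<open>prod_list (map f Qs) \<in> Q\<close> by blast
  qed
  then obtain As Bs where AB: "Qs = As @ Q # Bs" by (meson split_list)
  have "\<not> P (As @ Bs)" using Qs(2)[of "As @ Bs"] AB by auto
  then obtain zs where zs: "list_all2 (\<in>) zs (As @ Bs)" "prod_list zs \<notin> I"
    using Qs(1) AB by (auto simp: P_def prods_in_def)
  then obtain xs ys where xy: "zs = xs @ ys" "list_all2 (\<in>) xs As" "list_all2 (\<in>) ys Bs"
    by (metis list_all2_append2)
  have zF: "prod_list zs \<in> ints F"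
  proof -
    have "set zs \<subseteq> ints F"
    proof
      fix z assume "z \<in> set zs"
      then obtain R where "R \<in> set (As @ Bs)" "z \<in> R"
        using zs(1) by (metis in_set_conv_nth list_all2_conv_all_nth)
      then show "z \<in> ints F" using Qs(1) AB prime_idlD(1) idlD(1) unfolding P_def by fastforce
    qed
    then show ?thesis by (induction zs) auto
  qed
  show ?thesis
  proof (rule that[of "prod_list zs / c"])
    show "prod_list zs / c \<in> F" using zF c F.ints_F by (intro F.divide_F) auto
    show "prod_list zs / c \<notin> ints F"
    proof
      assume "prod_list zs / c \<in> ints F"
      then have "prod_list zs / c * c \<in> I" unfolding I_def by blast
      then show False using zs(2) c by simp
    qed
    fix q assume q: "q \<in> Q"
    have "list_all2 (\<in>) (xs @ q # ys) Qs"
      using xy q AB by (auto intro!: list_all2_appendI)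
    then have "prod_list (xs @ q # ys) \<in> I" using Qs(1) by (auto simp: P_def prods_in_def)
    then obtain b where "b \<in> ints F" "prod_list (xs @ q # ys) = b * c" by (auto simp: I_def)
    moreover have "prod_list (xs @ q # ys) = prod_list zs * q" using xy(1) by simp
    ultimately have "prod_list zs / c * q = b" using c by (simp add: field_simps)
    then show "prod_list zs / c * q \<in> ints F" using \<open>b \<in> ints F\<close> by simp
  qed
qed

text \<open>If \<open>w\<close> mapped \<open>Q\<close> into itself it would be almost integral,
  hence integral. So some \<open>w * r\<close> is a unit modulo \<open>Q\<close>, and a power of it
  congruent to 1 gives the exact equation.\<close>

lemma prime_idl_invertible:
  assumes Q: "prime_idl Q"
  obtains w q r where "w \<in> F" "w \<notin> ints F" "\<And>q. q \<in> Q \<Longrightarrow> w * q \<in> ints F" "q \<in> Q" "r \<in> Q" "q + w * r = 1"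
proof -
  obtain w where w: "w \<in> F" "w \<notin> ints F" "\<And>q. q \<in> Q \<Longrightarrow> w * q \<in> ints F"
    using prime_idl_colon[OF Q] by metis
  note Qd = prime_idlD[OF Q]
  have "\<exists>r\<in>Q. w * r \<notin> Q"
  proof (rule ccontr)
    assume n: "\<not> ?thesis"
    obtain m where m: "m > 0" "of_nat m \<in> Q" using idl_contains_nat Qd by blast
    have "of_nat m * w ^ n \<in> Q" for n
    proof (induction n)
      case (Suc n)
      then have "w * (of_nat m * w ^ n) \<in> Q" using n by blast
      then show ?case by (simp add: algebra_simps)
    qed (use m in simp)
    then have "algebraic_int (of_nat m * w ^ n)" for n
      using idlD(1)[OF Qd(1)] F.ints_F(2) by blast
    then have "algebraic_int w"
      using almost_integral_imp_integral[of w "of_nat m"] w(1) F_sub m(1) by auto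
    then show False using w by (auto simp: ints_def)
  qed
  then obtain r where r: "r \<in> Q" "w * r \<notin> Q" by blast
  obtain k where k: "k > 0" "(w * r) ^ k - 1 \<in> Q"
    using prime_idl_power_eq_1[OF Q w(3)[OF r(1)] r(2)] by metis
  have "(w * r) ^ (k - 1) * r \<in> Q"
    using r w(3) Qd(1) by (intro idlD(4)) auto
  moreover have "- ((w * r) ^ k - 1) + w * ((w * r) ^ (k - 1) * r) = 1"
    using k(1) by (cases k) (auto simp: algebra_simps)
  ultimately show ?thesis
    using that[OF w, of "- ((w * r) ^ k - 1)"] k(2) idlD(7)[OF Qd(1)] by blast
qed

end


subsection \<open>Products of ideals\<close>

text \<open>Products are formed in the complex numbers so that modules over different rings of
  integers can be multiplied: for an ideal \<open>J\<close> of \<open>K\<close>,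
  \<open>iprod J (ints H)\<close> is its extension to \<open>H\<close>.\<close>

abbreviation iprod :: "complex set \<Rightarrow> complex set \<Rightarrow> complex set"
  where "iprod \<equiv> ideal_prod complex_ring"

lemma iprodI: "i \<in> I \<Longrightarrow> j \<in> J \<Longrightarrow> i * j \<in> iprod I J"
  using ideal_prod.prod[of i I j J complex_ring] by simp

lemma iprod_add: "a \<in> iprod I J \<Longrightarrow> b \<in> iprod I J \<Longrightarrow> a + b \<in> iprod I J"
  using ideal_prod.sum[of a complex_ring I J b] by simp

lemma iprod_least:
  assumes "\<And>i j. i \<in> I \<Longrightarrow> j \<in> J \<Longrightarrow> i * j \<in> Z" "\<And>a b. a \<in> Z \<Longrightarrow> b \<in> Z \<Longrightarrow> a + b \<in> Z"
  shows "iprod I J \<subseteq> Z"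
proof
  fix x assume "x \<in> iprod I J"
  then show "x \<in> Z" by (induction rule: ideal_prod.induct) (auto simp: assms)
qed

lemma iprod_comm: "iprod I J = iprod J I"
proof (intro equalityI iprod_least iprod_add)
  show "i * j \<in> iprod J I" if "i \<in> I" "j \<in> J" for i j
    using iprodI[OF that(2,1)] by (simp add: mult.commute)
  show "j * i \<in> iprod I J" if "j \<in> J" "i \<in> I" for i j
    using iprodI[OF that(2,1)] by (simp add: mult.commute)
qed

lemma iprod_mono: "I \<subseteq> I' \<Longrightarrow> J \<subseteq> J' \<Longrightarrow> iprod I J \<subseteq> iprod I' J'"
  by (rule iprod_least) (auto intro: iprodI iprod_add)

lemma iprod_scale:
  assumes "\<And>i. i \<in> I \<Longrightarrow> c * i \<in> I'" "x \<in> iprod I J"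
  shows "c * x \<in> iprod I' J"
  using assms(2) by (induction rule: ideal_prod.induct)
    (auto simp: distrib_left mult.assoc[symmetric] intro!: iprodI iprod_add assms(1))

lemma iprod_assoc: "iprod (iprod I J) K = iprod I (iprod J K)"
proof (rule equalityI)
  show "iprod (iprod I J) K \<subseteq> iprod I (iprod J K)"
  proof (rule iprod_least)
    fix x k assume "x \<in> iprod I J" "k \<in> K"
    then show "x * k \<in> iprod I (iprod J K)"
      by (induction rule: ideal_prod.induct)
        (auto simp: distrib_right mult.assoc intro!: iprod_add iprodI)
  qed (rule iprod_add)
  show "iprod I (iprod J K) \<subseteq> iprod (iprod I J) K"
  proof (rule iprod_least)
    fix i x assume "i \<in> I" "x \<in> iprod J K"
    from this(2,1) show "i * x \<in> iprod (iprod I J) K"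
      by (induction rule: ideal_prod.induct)
        (auto simp: distrib_left mult.assoc[symmetric] intro!: iprod_add iprodI)
  qed (rule iprod_add)
qed

lemma ideal_prod_int_ring: "ideal_prod (int_ring F) I J = iprod I J"
proof (intro equalityI subsetI)
  show "x \<in> iprod I J" if "x \<in> ideal_prod (int_ring F) I J" for x
    using that by (induction rule: ideal_prod.induct) (auto intro: iprodI iprod_add)
  show "x \<in> ideal_prod (int_ring F) I J" if "x \<in> iprod I J" for x
    using that
  proof (induction rule: ideal_prod.induct)
    case (prod i j)
    then show ?case using ideal_prod.prod[of i I j J "int_ring F"] by simp
  next
    case (sum a b)
    then show ?case using ideal_prod.sum[of a "int_ring F" I J b] by simp
  qed
qed

context subfield_of_complex
begin

lemma cring_int_ring: "cring (int_ring F)"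
proof (rule cringI)
  show "abelian_group (int_ring F)"
    by (rule abelian_groupI) (auto simp: algebra_simps intro: bexI[of _ "- _"])
  show "comm_monoid (int_ring F)"
    by (rule comm_monoidI) (auto simp: algebra_simps)
qed (auto simp: algebra_simps)

lemma int_ring_a_inv: "x \<in> ints F \<Longrightarrow> \<ominus>\<^bsub>int_ring F\<^esub> x = - x"
  using abelian_group.minus_equality[OF ring.is_abelian_group[OF cring.axioms(1)[OF cring_int_ring]], of "- x" x]
  by auto

end

context galois_subfield
begin

lemma idl_imp_ideal:
  assumes "idl I" shows "ideal I (int_ring F)"
proof (rule idealI)
  show "ring (int_ring F)" using F.cring_int_ring by (rule cring.axioms(1))
  show "subgroup I (add_monoid (int_ring F))"
  proof (rule group.subgroupI)
    show "group (add_monoid (int_ring F))"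
      using F.cring_int_ring by (intro abelian_group.a_group ring.is_abelian_group cring.axioms(1))
    fix a assume "a \<in> I"
    then have "inv\<^bsub>add_monoid (int_ring F)\<^esub> a = - a"
      using F.int_ring_a_inv[of a] idlD(1)[OF assms] by (auto simp: a_inv_def)
    then show "inv\<^bsub>add_monoid (int_ring F)\<^esub> a \<in> I" using idlD(7)[OF assms \<open>a \<in> I\<close>] by simp
  qed (use idlD[OF assms] in auto)
qed (use idlD[OF assms] in auto)

lemma prime_idl_imp_primeideal:
  assumes "prime_idl Q" shows "primeideal Q (int_ring F)"
proof (rule primeidealI)
  show "ideal Q (int_ring F)" using assms by (intro idl_imp_ideal prime_idlD)
  show "cring (int_ring F)" by (rule F.cring_int_ring)
  show "carrier (int_ring F) \<noteq> Q" using prime_idlD(3)[OF assms] F.ints_1 by auto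
qed (use prime_idlD(4)[OF assms] in auto)

lemma idl_iprod:
  assumes "idl I" "idl J" shows "idl (iprod I J)" "iprod I J \<subseteq> I" "iprod I J \<subseteq> J"
proof -
  show sub: "iprod I J \<subseteq> I" "iprod I J \<subseteq> J"
    using idlD(1,3,4,5)[OF assms(1)] idlD(1,3,4)[OF assms(2)]
    by (intro iprod_least; meson subset_iff)+
  have "0 * 0 \<in> iprod I J" using idlD(2) assms by (intro iprodI)
  moreover have "a * x \<in> iprod I J" if "a \<in> ints F" "x \<in> iprod I J" for a x
    using iprod_scale[of I a I x J] idlD(4)[OF assms(1)] that by blast
  ultimately show "idl (iprod I J)"
    unfolding idl_def using sub idlD(1)[OF assms(1)] iprod_add by auto
qed

lemma idl_ints: "idl (ints F)"
  by (auto simp: idl_def)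

definition pw :: "complex set \<Rightarrow> nat \<Rightarrow> complex set"
  where "pw Q n = ideal_pow (int_ring F) Q n"

lemma pw_0: "pw Q 0 = ints F" and pw_Suc: "pw Q (Suc n) = iprod Q (pw Q n)"
  by (simp_all add: pw_def ideal_pow_def ideal_prod_int_ring)

lemma pw_idl: "idl Q \<Longrightarrow> idl (pw Q n)"
  by (induction n) (simp_all add: pw_0 pw_Suc idl_ints idl_iprod)

lemma pw_mult: "x \<in> Q \<Longrightarrow> y \<in> pw Q n \<Longrightarrow> x * y \<in> pw Q (Suc n)"
  by (simp add: pw_Suc iprodI)

lemma pw_power: "x \<in> Q \<Longrightarrow> x ^ n \<in> pw Q n"
  by (induction n) (auto simp: pw_0 intro: pw_mult)

lemma pw_Suc_subset: "idl Q \<Longrightarrow> pw Q (Suc n) \<subseteq> pw Q n"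
  by (simp add: pw_Suc idl_iprod pw_idl)

lemma pw_1: "idl Q \<Longrightarrow> pw Q 1 = Q"
proof
  assume Q: "idl Q"
  show "pw Q 1 \<subseteq> Q" using Q by (simp add: pw_Suc pw_0 idl_iprod idl_ints)
  show "Q \<subseteq> pw Q 1" using pw_mult[of _ Q 1 0] by (auto simp: pw_0)
qed

text \<open>With \<open>w\<close> in the inverse of \<open>Q\<close> but not integral,
  \<open>w^n\<close> maps the \<open>n\<close>-th power of \<open>Q\<close> into the integers. A
  nonzero \<open>x\<close> in all powers would make \<open>w\<close> almost integral.\<close>

lemma Inter_pw:
  assumes Q: "prime_idl Q" and x: "\<And>n. x \<in> pw Q n"
  shows "x = 0"
proof (rule ccontr)
  assume "x \<noteq> 0"
  obtain w where w: "w \<in> F" "w \<notin> ints F" "\<And>q. q \<in> Q \<Longrightarrow> w * q \<in> ints F"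
    using prime_idl_colon[OF Q] by metis
  have *: "w ^ n * y \<in> ints F" if "y \<in> pw Q n" for n y
    using that
  proof (induction n arbitrary: y)
    case (Suc n)
    from Suc.prems show ?case unfolding pw_Suc
    proof (induction rule: ideal_prod.induct)
      case (prod i j)
      then have "(w * i) * (w ^ n * j) \<in> ints F" using w(3) Suc.IH by blast
      then show ?case by (simp add: algebra_simps)
    qed (auto simp: distrib_left)
  qed (simp add: pw_0)
  have "x \<in> ints F" using x[of 0] by (simp add: pw_0)
  have "algebraic_int w"
  proof (rule almost_integral_imp_integral)
    show "w \<in> M" using w(1) F_sub by blast
    show "x \<in> ints M" "x \<noteq> 0" using \<open>x \<in> ints F\<close> ints_FM \<open>x \<noteq> 0\<close> by auto
    show "algebraic_int (x * w ^ n)" for n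
      using *[OF x, of n] by (simp add: ints_def mult.commute)
  qed
  then show False using w by (auto simp: ints_def)
qed

text \<open>\<open>e = 1 - u^k\<close> lies in \<open>Q\<close> for some \<open>k\<close>, and the
  geometric series writes \<open>1 - e^m\<close> as a multiple of \<open>u\<close>; so
  \<open>u\<close> is invertible modulo the \<open>m\<close>-th power of \<open>Q\<close>.\<close>

lemma pw_cancel:
  assumes Q: "prime_idl Q" and uv: "u \<in> ints F" "v \<in> ints F" "u * v \<in> pw Q m" "u \<notin> Q"
  shows "v \<in> pw Q m"
proof -
  note Qd = prime_idlD[OF Q]
  obtain k where k: "k > 0" "u ^ k - 1 \<in> Q" by (rule prime_idl_power_eq_1[OF Q uv(1,4)])
  define e where "e = 1 - u ^ k"
  have e: "e \<in> Q" using idlD(7)[OF Qd(1) k(2)] by (simp add: e_def)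
  have eF: "e \<in> ints F" using e idlD(1)[OF Qd(1)] by blast
  have "1 - e ^ m = (1 - e) * (\<Sum>i<m. e ^ i)"
    by (simp add: one_diff_power_eq)
  also have "1 - e = u * u ^ (k - 1)" using k(1) by (simp add: e_def flip: power_Suc)
  finally have "1 = u * (u ^ (k - 1) * (\<Sum>i<m. e ^ i)) + e ^ m"
    by (simp add: algebra_simps)
  then have "v = v * (u * (u ^ (k - 1) * (\<Sum>i<m. e ^ i)) + e ^ m)" by simp
  also have "\<dots> = (u ^ (k - 1) * (\<Sum>i<m. e ^ i)) * (u * v) + v * e ^ m"
    by (simp add: algebra_simps)
  finally have v: "v = (u ^ (k - 1) * (\<Sum>i<m. e ^ i)) * (u * v) + v * e ^ m" .
  have "u ^ (k - 1) * (\<Sum>i<m. e ^ i) \<in> ints F" using uv eF by (intro F.ints_mult F.ints_power F.ints_sum)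
  then have "(u ^ (k - 1) * (\<Sum>i<m. e ^ i)) * (u * v) + v * e ^ m \<in> pw Q m"
    using uv pw_power[OF e] idlD(3,4)[OF pw_idl[OF Qd(1)]] by blast
  with v show ?thesis by simp
qed

end


subsection \<open>Inertia\<close>

lemma binomial_prime_expansion:
  assumes "prime q" "x \<in> R" "y \<in> R" "\<And>a b. a \<in> R \<Longrightarrow> b \<in> R \<Longrightarrow> a + b \<in> R"
    "\<And>a b. a \<in> R \<Longrightarrow> b \<in> R \<Longrightarrow> a * b \<in> R" "0 \<in> R" "1 \<in> R"
  obtains r where "r \<in> R" "(x + y) ^ q = x ^ q + y ^ q + of_nat q * (r :: 'a :: comm_ring_1)"
proof
  let ?f = "\<lambda>k. of_nat (q choose k) * x ^ k * y ^ (q - k)"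
  let ?r = "\<Sum>k=1..<q. of_nat ((q choose k) div q) * x ^ k * y ^ (q - k)"
  have R: "of_nat n \<in> R" "a \<in> R \<Longrightarrow> a ^ n \<in> R" for n a
    by (induction n) (auto intro: assms(4-7))
  have sum_R: "sum g A \<in> R" if "\<And>i. i \<in> A \<Longrightarrow> g i \<in> R" for g and A :: "nat set"
    using that by (induction A rule: infinite_finite_induct) (auto intro: assms(4,6))
  show "?r \<in> R" by (intro sum_R assms(5) R assms(2,3))
  have q: "q > 0" using assms(1) prime_gt_0_nat by blast
  have "(x + y) ^ q = (\<Sum>k\<in>insert q (insert 0 {1..<q}). ?f k)"
    unfolding binomial_ring by (intro sum.cong) auto
  also have "\<dots> = x ^ q + y ^ q + (\<Sum>k=1..<q. ?f k)" using q by simp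
  also have "(\<Sum>k=1..<q. ?f k) = of_nat q * ?r"
    unfolding sum_distrib_left
  proof (intro sum.cong refl)
    fix k assume k: "k \<in> {1..<q}"
    then have "q dvd (q choose k)" using assms(1) by (intro dvd_choose_prime) auto
    then have "of_nat (q choose k) = (of_nat q * of_nat ((q choose k) div q) :: 'a)"
      by (metis dvd_mult_div_cancel of_nat_mult)
    then show "?f k = of_nat q * (of_nat ((q choose k) div q) * x ^ k * y ^ (q - k))"
      by (simp add: mult.assoc)
  qed
  finally show "(x + y) ^ q = x ^ q + y ^ q + of_nat q * ?r" .
qed

context galois_subfield
begin

text \<open>Frobenius is injective on the residue field because a \<open>q\<close>-th power in
  \<open>Q\<close> has its base in \<open>Q\<close>. Two iterates of \<open>x\<close> agree by
  finiteness; cancelling the common iterations exhibits \<open>x\<close> as a \<open>q\<close>-th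
  power.\<close>

lemma residue_frobenius_surj:
  assumes Q: "prime_idl Q" and q: "prime q" "of_nat q \<in> Q" and x: "x \<in> ints F"
  obtains z where "z \<in> ints F" "x - z ^ q \<in> Q"
proof -
  note Qd = prime_idlD[OF Q]
  have inj: "a - b \<in> Q" if ab: "a \<in> ints F" "b \<in> ints F" "a ^ q - b ^ q \<in> Q" for a b
  proof -
    obtain r where r: "r \<in> ints F" "(b + (a - b)) ^ q = b ^ q + (a - b) ^ q + of_nat q * r"
      by (rule binomial_prime_expansion[OF q(1), of b "ints F" "a - b"]) (use ab in auto)
    then have "(a - b) ^ q = (a ^ q - b ^ q) - r * of_nat q" by (simp add: algebra_simps)
    then have m: "(a - b) ^ q \<in> Q" using ab(3) idlD(4,6)[OF Qd(1)] r(1) q(2) by metis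
    have "a - b \<in> ints F" using that by auto
    then have "(a - b) ^ n \<in> Q \<Longrightarrow> a - b \<in> Q" for n
      using Qd(3,4) by (induction n) auto
    then show ?thesis using m by blast
  qed
  have inj': "a - b \<in> Q" if "a \<in> ints F" "b \<in> ints F" "a ^ (q ^ n) - b ^ (q ^ n) \<in> Q" for a b n
    using that
  proof (induction n arbitrary: a b)
    case (Suc n)
    then have "(a ^ q) ^ (q ^ n) - (b ^ q) ^ (q ^ n) \<in> Q" by (simp add: power_mult)
    then have "a ^ q - b ^ q \<in> Q" using Suc by blast
    then show ?case using inj Suc.prems by blast
  qed simp
  have q0: "q > 0" using q(1) prime_gt_0_nat by blast
  obtain i j where ij: "i < j" "algebraic_int ((x ^ (q ^ j) - x ^ (q ^ i)) / of_nat q)"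
    using residue_pigeonhole[OF q0, of "\<lambda>i. x ^ (q ^ i)"] x ints_FM by blast
  have "x ^ (q ^ j) - x ^ (q ^ i) \<in> Q" using ij q q0 x by (intro idl_multiple_nat[OF Qd(1)]) auto
  moreover have "x ^ (q ^ j) = ((x ^ (q ^ (j - i - 1))) ^ q) ^ (q ^ i)"
  proof -
    define d where "d = j - i - 1"
    have "j = Suc d + i" using ij by (simp add: d_def)
    then have "q ^ j = q ^ d * q * q ^ i" by (simp add: power_add)
    then show ?thesis unfolding d_def[symmetric] by (simp only: power_mult)
  qed
  ultimately have "(x ^ (q ^ (j - i - 1))) ^ q - x \<in> Q"
    by (intro inj'[of "(x ^ (q ^ (j - i - 1))) ^ q" x i] F.ints_power x) simp
  then show ?thesis
    using that[of "x ^ (q ^ (j - i - 1))"] x idlD(7)[OF Qd(1)] by fastforce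
qed

end

context galois_field
begin

sublocale MM: galois_subfield M M
  by unfold_locales simp

text \<open>The congruence for all integers forces \<open>g\<close> to map \<open>Q\<close> into
  itself, so membership in the decomposition group is implied.\<close>

definition inertia :: "complex set \<Rightarrow> (complex \<Rightarrow> complex) set"
  where "inertia Q = {g \<in> carrier G. \<forall>x\<in>ints M. g x - x \<in> Q}"

lemma funpow_mem: "g \<in> carrier G \<Longrightarrow> x \<in> M \<Longrightarrow> (g ^^ n) x \<in> M"
  by (induction n) auto

lemma funpow_ints: "g \<in> carrier G \<Longrightarrow> x \<in> ints M \<Longrightarrow> (g ^^ n) x \<in> ints M"
  by (induction n) auto

lemma act_pow: "g \<in> carrier G \<Longrightarrow> x \<in> M \<Longrightarrow> (g [^]\<^bsub>G\<^esub> (n :: nat)) x = (g ^^ n) x"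
  by (induction n arbitrary: x) (auto simp: act_one act_mult funpow_swap1)

lemma funpow_hom:
  assumes "g \<in> carrier G" "x \<in> M" "y \<in> M"
  shows "(g ^^ n) (x * y) = (g ^^ n) x * (g ^^ n) y" "(g ^^ n) (x + y) = (g ^^ n) x + (g ^^ n) y"
  using gal_hom[of "g [^]\<^bsub>G\<^esub> n"] act_pow[of g _ n] assms
  by (metis G.nat_pow_closed M.mult_F gal_mult, metis G.nat_pow_closed M.add_F gal_add)

lemma inertia_pow:
  assumes "g \<in> inertia Q" "MM.idl Q"
  shows "g [^]\<^bsub>G\<^esub> (n :: nat) \<in> inertia Q"
proof -
  have g: "g \<in> carrier G" "\<And>x. x \<in> ints M \<Longrightarrow> g x - x \<in> Q" using assms by (auto simp: inertia_def)
  have "(g ^^ n) x - x \<in> Q" if "x \<in> ints M" for x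
  proof (induction n)
    case (Suc n)
    have "g ((g ^^ n) x) - (g ^^ n) x + ((g ^^ n) x - x) \<in> Q"
      using g(2)[OF funpow_ints[OF g(1) that]] Suc MM.idlD(3)[OF assms(2)] by blast
    then show ?case by simp
  qed (use MM.idlD(2)[OF assms(2)] in simp)
  then show ?thesis using g(1) by (auto simp: inertia_def act_pow M.ints_F)
qed

lemma orbit_fixed:
  assumes "g \<in> carrier G" "x \<in> M" "(g ^^ q) x = x"
  shows "g (\<Sum>i<q. (g ^^ i) x) = (\<Sum>i<q. (g ^^ i) x)" "g (\<Prod>i<q. (g ^^ i) x) = (\<Prod>i<q. (g ^^ i) x)"
proof -
  have "g (\<Sum>i<q. (g ^^ i) x) = (\<Sum>i<q. (g ^^ Suc i) x)"
    using assms(1,2) by (simp add: gal_sum funpow_mem)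
  also have "\<dots> + (g ^^ 0) x = (\<Sum>i<Suc q. (g ^^ i) x)" by (simp only: sum.lessThan_Suc_shift add.commute)
  finally show "g (\<Sum>i<q. (g ^^ i) x) = (\<Sum>i<q. (g ^^ i) x)" using assms(3) by simp
  show "g (\<Prod>i<q. (g ^^ i) x) = (\<Prod>i<q. (g ^^ i) x)"
  proof (cases "x = 0")
    case False
    have "g (\<Prod>i<q. (g ^^ i) x) = (\<Prod>i<q. (g ^^ Suc i) x)"
      using assms(1,2) by (simp add: gal_prod funpow_mem)
    also have "\<dots> * (g ^^ 0) x = (\<Prod>i<Suc q. (g ^^ i) x)" by (simp only: prod.lessThan_Suc_shift mult.commute)
    finally show ?thesis using assms(3) False by simp
  next
    case True
    then have "(g ^^ i) x = 0" for i by (induction i) (auto simp: assms gal_zero)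
    then show ?thesis using assms by (cases q) (auto simp: gal_zero gal_one)
  qed
qed

text \<open>
  An automorphism of prime order acting trivially on the residue field of \<open>Q\<close> has fixed representatives
  of all residues: traces if the order is prime to the residue characteristic, norms of \<open>q\<close>-th roots
  otherwise.
\<close>

lemma inertia_fixed_representative:
  assumes Q: "MM.prime_idl Q" and g: "g \<in> inertia Q" and q: "prime (q :: nat)" "g [^]\<^bsub>G\<^esub> q = \<one>\<^bsub>G\<^esub>"
    and x: "x \<in> ints M"
  obtains y where "y \<in> ints M" "g y = y" "x - y \<in> Q"
proof -
  note Qd = MM.prime_idlD[OF Q]
  have gG: "g \<in> carrier G" using g by (simp add: inertia_def)
  have fixq: "(g ^^ q) z = z" if "z \<in> M" for z using act_pow[OF gG that, of q] q(2) act_one[OF that] by simp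
  have gi: "(g ^^ i) z - z \<in> Q" if "z \<in> ints M" for i z
  proof -
    have "(g [^]\<^bsub>G\<^esub> i) z - z \<in> Q" using inertia_pow[OF g Qd(1), of i] that by (simp add: inertia_def)
    then show ?thesis using act_pow[OF gG, of z i] that by (simp add: M.ints_F)
  qed
  have q0: "q > 0" using q(1) prime_gt_0_nat by blast
  show ?thesis
  proof (cases "of_nat q \<in> Q")
    case False
    define t where "t = (\<Sum>i<q. (g ^^ i) x)"
    have t: "t \<in> ints M" unfolding t_def using funpow_ints[OF gG x] by (rule M.ints_sum)
    obtain k where k: "k > 0" "of_nat q ^ k - 1 \<in> Q"
      using MM.prime_idl_power_eq_1[OF Q _ False] by auto
    have "t - of_nat q * x = (\<Sum>i<q. (g ^^ i) x - x)" by (simp add: t_def sum_subtractf)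
    also have "\<dots> \<in> Q" using gi[OF x] MM.idlD(2,3)[OF Qd(1)]
      by (induction q) auto
    finally have tq: "t - of_nat q * x \<in> Q" .
    show ?thesis
    proof (rule that[of "of_nat q ^ (k - 1) * t"])
      show "of_nat q ^ (k - 1) * t \<in> ints M" by (intro M.ints_mult M.ints_power M.ints_of_nat t)
      show "g (of_nat q ^ (k - 1) * t) = of_nat q ^ (k - 1) * t"
        using orbit_fixed(1)[OF gG _ fixq, of x] x t gG
        by (simp add: t_def gal_mult gal_power gal_of_int M.ints_F M.power_F M.sum_F funpow_mem)
      have "x - of_nat q ^ (k - 1) * t = - (x * (of_nat q ^ k - 1)) - of_nat q ^ (k - 1) * (t - of_nat q * x)"
        using k(1) by (cases k) (auto simp: algebra_simps)
      moreover have "- (x * (of_nat q ^ k - 1)) \<in> Q" "of_nat q ^ (k - 1) * (t - of_nat q * x) \<in> Q"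
        using k tq x by (auto intro!: MM.idlD(7)[OF Qd(1)] MM.idlD(4)[OF Qd(1)])
      ultimately show "x - of_nat q ^ (k - 1) * t \<in> Q" using MM.idlD(6)[OF Qd(1)] by metis
    qed
  next
    case True
    obtain z where z: "z \<in> ints M" "x - z ^ q \<in> Q"
      using MM.residue_frobenius_surj[OF Q q(1) True x] .
    define n where "n = (\<Prod>i<q. (g ^^ i) z)"
    have n: "n \<in> ints M" unfolding n_def using funpow_ints[OF gG z(1)] by (rule M.ints_prod)
    have "(\<Prod>i<m. (g ^^ i) z) - z ^ m \<in> Q" for m
    proof (induction m)
      case (Suc m)
      have "(\<Prod>i<Suc m. (g ^^ i) z) - z ^ Suc m
          = (g ^^ m) z * ((\<Prod>i<m. (g ^^ i) z) - z ^ m) + z ^ m * ((g ^^ m) z - z)"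
        by (simp add: algebra_simps)
      moreover have "(g ^^ m) z * ((\<Prod>i<m. (g ^^ i) z) - z ^ m) \<in> Q" "z ^ m * ((g ^^ m) z - z) \<in> Q"
        using Suc gi z funpow_ints[OF gG z(1)] by (auto intro!: MM.idlD(4)[OF Qd(1)])
      ultimately show ?case using MM.idlD(3)[OF Qd(1)] by metis
    qed (use MM.idlD(2)[OF Qd(1)] in simp)
    then have "(x - z ^ q) - (n - z ^ q) \<in> Q" unfolding n_def using z(2) MM.idlD(6)[OF Qd(1)] by blast
    then show ?thesis
      using that[of n] n orbit_fixed(2)[OF gG _ fixq, of z] z(1) by (simp add: n_def M.ints_F)
  qed
qed

text \<open>A bootstrap towards \<open>g x - x\<close> in all powers of \<open>Q\<close>.
  Subtracting a fixed representative \<open>y\<close> from \<open>x\<close> leaves, up to the factor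
  \<open>u\<close> invertible at \<open>Q\<close>, a multiple \<open>\<pi> * z\<close> of the fixed
  uniformiser, and the induction hypothesis for \<open>z\<close> gains one power.\<close>

lemma inertia_prime_order_trivial:
  assumes Q: "MM.prime_idl Q" and g: "g \<in> inertia Q" and q: "prime (q :: nat)" "g [^]\<^bsub>G\<^esub> q = \<one>\<^bsub>G\<^esub>"
    and \<pi>: "\<pi> \<in> Q" "\<pi> \<notin> MM.pw Q 2" "g \<pi> = \<pi>"
  shows "g = \<one>\<^bsub>G\<^esub>"
proof -
  note Qd = MM.prime_idlD[OF Q]
  note pwi = MM.pw_idl[OF Qd(1)]
  have gG: "g \<in> carrier G" using g by (simp add: inertia_def)
  obtain w a r where w: "w \<in> M" "\<And>y. y \<in> Q \<Longrightarrow> w * y \<in> ints M" "a \<in> Q" "r \<in> Q" "a + w * r = 1"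
    using MM.prime_idl_invertible[OF Q] by metis
  \<comment> \<open>\<open>w\<close> lies in the inverse of \<open>Q\<close>. As
    \<open>\<pi>\<close> is not in the square of \<open>Q\<close>, the integer \<open>u\<close> is
    prime to \<open>Q\<close>.\<close>
  define u where "u = w * \<pi>"
  have u: "u \<in> ints M" using w(2) \<pi>(1) by (simp add: u_def)
  have Q1: "MM.pw Q 1 = Q" using MM.pw_1 Qd(1) .
  have uQ: "u \<notin> Q"
  proof
    assume "u \<in> Q"
    then have "u * r \<in> MM.pw Q 2" "\<pi> * a \<in> MM.pw Q 2"
      using MM.pw_mult[of _ Q _ 1] Q1 w \<pi>(1) by (simp_all add: numeral_2_eq_2)
    then have "u * r + \<pi> * a \<in> MM.pw Q 2" using MM.idlD(3)[OF pwi] by blast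
    moreover have "u * r + \<pi> * a = \<pi> * (a + w * r)" by (simp add: u_def algebra_simps)
    ultimately show False using \<pi>(2) w(5) by simp
  qed
  have "g x - x \<in> MM.pw Q (Suc n)" if "x \<in> ints M" for n x
    using that
  proof (induction n arbitrary: x)
    case 0
    then show ?case using g Q1 by (simp add: inertia_def)
  next
    case (Suc n)
    obtain y where y: "y \<in> ints M" "g y = y" "x - y \<in> Q"
      using inertia_fixed_representative[OF Q g q Suc.prems] .
    define z where "z = w * (x - y)"
    have z: "z \<in> ints M" using w(2) y(3) by (simp add: z_def)
    have eq: "u * (x - y) = \<pi> * z" by (simp add: u_def z_def)
    have \<pi>M: "\<pi> \<in> M" using \<pi>(1) MM.idlD(1)[OF Qd(1)] M.ints_F by blast
    have "g u * (g x - y) = \<pi> * g z"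
      using arg_cong[OF eq, of g] gG u y Suc.prems z \<pi>(3) \<pi>M
      by (simp add: gal_mult gal_diff M.ints_F M.diff_F)
    \<comment> \<open>The equation \<open>u * (x - y) = \<pi> * z\<close> is subtracted from its
      image under \<open>g\<close>. In both terms on the right one factor lies in \<open>Q\<close>
      and the other is controlled by the induction hypothesis.\<close>
    then have "u * (g x - x) = \<pi> * (g z - z) - (g u - u) * (g x - y)"
      using eq by (simp add: algebra_simps)
    moreover have "\<pi> * (g z - z) \<in> MM.pw Q (Suc (Suc n))"
      using MM.pw_mult[OF \<pi>(1) Suc.IH[OF z]] .
    moreover have "g x - y \<in> Q"
    proof -
      have "g x - x \<in> Q" using g Suc.prems by (simp add: inertia_def)
      then have "g x - x + (x - y) \<in> Q" by (rule MM.idlD(3)[OF Qd(1) _ y(3)])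
      then show ?thesis by simp
    qed
    then have "(g x - y) * (g u - u) \<in> MM.pw Q (Suc (Suc n))"
      by (rule MM.pw_mult[OF _ Suc.IH[OF u]])
    then have "(g u - u) * (g x - y) \<in> MM.pw Q (Suc (Suc n))"
      by (simp only: mult.commute)
    ultimately have "u * (g x - x) \<in> MM.pw Q (Suc (Suc n))" using MM.idlD(6)[OF pwi] by metis
    then show ?case by (rule MM.pw_cancel[OF Q u _ _ uQ, rotated]) (use Suc.prems gG in auto)
  qed
  then have "g x - x \<in> MM.pw Q n" if "x \<in> ints M" for n x
    using that MM.pw_Suc_subset[OF Qd(1), of n] by blast
  then have eq: "g x = x" if "x \<in> ints M" for x
    using MM.Inter_pw[OF Q, of "g x - x"] that by simp
  show ?thesis
  proof (rule gal_eqI[OF gG G.one_closed])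
    fix x assume x: "x \<in> M"
    then obtain n where n: "n > 0" "algebraic_int (of_nat n * x)"
      by (meson algebraic_M algebraic_int_multiple)
    then have "g (of_nat n * x) = of_nat n * x" using x by (intro eq) (auto simp: ints_def)
    then have "g x = x" using n(1) gG x by (simp add: gal_mult gal_of_int)
    then show "g x = \<one>\<^bsub>G\<^esub> x" using x by (simp add: act_one)
  qed
qed

text \<open>A nontrivial \<open>g\<close> would have a power of prime order, still inertial and
  still fixing \<open>\<pi>\<close>.\<close>

lemma inertia_trivial:
  assumes Q: "MM.prime_idl Q" and g: "g \<in> inertia Q"
    and \<pi>: "\<pi> \<in> Q" "\<pi> \<notin> MM.pw Q 2" "g \<pi> = \<pi>"
  shows "g = \<one>\<^bsub>G\<^esub>"
proof (rule ccontr)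
  assume ne: "g \<noteq> \<one>\<^bsub>G\<^esub>"
  have gG: "g \<in> carrier G" using g by (simp add: inertia_def)
  have o: "G.ord g > 0" using G.ord_ge_1[OF finite_gal gG] by simp
  moreover have "G.ord g \<noteq> 1" using ne gG G.ord_eq_1 by blast
  ultimately obtain q where q: "prime q" "q dvd G.ord g" using prime_factor_nat by metis
  define n where "n = G.ord g div q"
  define h where "h = g [^]\<^bsub>G\<^esub> n"
  have nq: "n * q = G.ord g" using q by (simp add: n_def)
  have h: "h \<in> inertia Q" unfolding h_def using inertia_pow[OF g] MM.prime_idlD(1)[OF Q] .
  have "h [^]\<^bsub>G\<^esub> q = \<one>\<^bsub>G\<^esub>"
    unfolding h_def using gG nq by (simp add: G.nat_pow_pow)
  moreover have "h \<pi> = \<pi>"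
  proof -
    have "\<pi> \<in> M" using \<pi>(1) MM.idlD(1) MM.prime_idlD(1)[OF Q] M.ints_F by blast
    moreover have "(g ^^ m) \<pi> = \<pi>" for m by (induction m) (auto simp: \<pi>(3))
    ultimately show ?thesis unfolding h_def using gG act_pow by simp
  qed
  ultimately have "h = \<one>\<^bsub>G\<^esub>" using inertia_prime_order_trivial[OF Q h q(1) _ \<pi>(1,2)] by blast
  then have "G.ord g dvd n" using gG G.pow_eq_id unfolding h_def by blast
  then have "n * q dvd n * 1" using nq by simp
  moreover have "n > 0" using nq o by (cases n) auto
  ultimately show False using q(1) by (metis dvd_times_left_cancel_iff nat_dvd_1_iff_1 not_prime_1 less_irrefl)
qed

text \<open>Ramification index 1 means that some element of \<open>Q \<inter> L\<close> lies outside
  the square of \<open>Q\<close>: a uniformiser fixed by everything that fixes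
  \<open>L\<close>.\<close>

theorem unramified_imp_inertia_trivial:
  assumes L: "fld L" "L \<subseteq> M" and un: "unramified L M" and Q: "MM.prime_idl Q"
    and g: "g \<in> inertia Q" "\<And>x. x \<in> L \<Longrightarrow> g x = x"
  shows "g = \<one>\<^bsub>G\<^esub>"
proof -
  interpret L: galois_subfield M L by unfold_locales (fact L)+
  note Qd = MM.prime_idlD[OF Q]
  have "ramification_index L M Q = 1"
    using un MM.prime_idl_imp_primeideal[OF Q] Qd(2) by (auto simp: unramified_def)
  then have e1: "(GREATEST n. Idl\<^bsub>int_ring M\<^esub> (Q \<inter> L) \<subseteq> MM.pw Q n) = 1"
    by (simp add: ramification_index_def MM.pw_def)
  have QL: "Q \<inter> L \<subseteq> carrier (int_ring M)" using MM.idlD(1)[OF Qd(1)] by auto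
  have r: "ring (int_ring M)" using M.cring_int_ring by (rule cring.axioms(1))
  have Idl: "Idl\<^bsub>int_ring M\<^esub> (Q \<inter> L) \<subseteq> MM.pw Q n \<longleftrightarrow> Q \<inter> L \<subseteq> MM.pw Q n" for n
    using ring.genideal_minimal[OF r MM.idl_imp_ideal[OF MM.pw_idl[OF Qd(1), of n]], of "Q \<inter> L"]
      ring.genideal_self[OF r QL] by blast
  obtain m where m: "m > 0" "of_nat m \<in> Q" using MM.idl_contains_nat Qd by blast
  have "of_nat m \<in> Q \<inter> L" using m by simp
  \<comment> \<open>\<open>GREATEST\<close> says something only about bounded sets of exponents; the
    bound comes from a positive integer in \<open>Q\<close>, which cannot lie in all powers of
    \<open>Q\<close>.\<close>
  obtain b where b: "of_nat m \<notin> MM.pw Q b" using MM.Inter_pw[OF Q, of "of_nat m"] m(1) by auto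
  have "antimono (MM.pw Q)" by (rule antimonoI) (metis MM.pw_Suc_subset Qd(1) lift_Suc_antimono_le)
  then have bd: "n \<le> b" if "Q \<inter> L \<subseteq> MM.pw Q n" for n
    using that b \<open>of_nat m \<in> Q \<inter> L\<close> by (metis antimonoD nat_le_linear subset_iff)
  have "\<not> Q \<inter> L \<subseteq> MM.pw Q 2"
  proof
    assume "Q \<inter> L \<subseteq> MM.pw Q 2"
    then have "2 \<le> (GREATEST n. Q \<inter> L \<subseteq> MM.pw Q n)"
      using bd by (intro Greatest_le_nat[where b = b]) auto
    then show False using e1 Idl by simp
  qed
  then obtain \<pi> where "\<pi> \<in> Q" "\<pi> \<in> L" "\<pi> \<notin> MM.pw Q 2" by blast
  then show ?thesis using inertia_trivial[OF Q g(1)] g(2) by blast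
qed

end


section \<open>A cyclic extension without inertia\<close>

context galois_field
begin

lemma prime_idl_image:
  assumes g: "g \<in> carrier G" and Q: "MM.prime_idl Q"
  shows "MM.prime_idl (g ` Q)"
proof -
  note Qd = MM.prime_idlD[OF Q]
  note I = MM.idlD[OF Qd(1)]
  let ?h = "inv\<^bsub>G\<^esub> g"
  have h: "?h \<in> carrier G" using g by simp
  have QM: "x \<in> M" if "x \<in> Q" for x using that I(1) M.ints_F by blast
  have mem: "x \<in> g ` Q \<longleftrightarrow> ?h x \<in> Q" if "x \<in> M" for x
  proof
    assume "x \<in> g ` Q"
    then show "?h x \<in> Q" using act_inv(1)[OF g] QM by force
  next
    assume "?h x \<in> Q"
    then have "g (?h x) \<in> g ` Q" by (rule imageI)
    then show "x \<in> g ` Q" using act_inv(2)[OF g that] by simp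
  qed
  have sub: "g ` Q \<subseteq> ints M" using I(1) g by auto
  have "MM.idl (g ` Q)"
    unfolding MM.idl_def
  proof (intro conjI ballI)
    show "0 \<in> g ` Q" using I(2) gal_zero[OF g] by (metis imageI)
    show "x + y \<in> g ` Q" if "x \<in> g ` Q" "y \<in> g ` Q" for x y
      using that I(3) QM g by (auto simp flip: gal_add)
    fix a x assume a: "a \<in> ints M" "x \<in> g ` Q"
    then have xM: "x \<in> M" "a \<in> M" using sub M.ints_F by blast+
    have "?h a * ?h x \<in> Q" using I(4) a h mem xM by blast
    then show "a * x \<in> g ` Q" using mem xM h by (simp add: gal_mult M.mult_F)
  qed (rule sub)
  moreover have "g ` Q \<noteq> {0}"
  proof
    assume z: "g ` Q = {0}"
    have "x = 0" if "x \<in> Q" for x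
      using z that gal_eq_0_iff[OF g QM[OF that]] by blast
    then show False using Qd(2) I(2) by blast
  qed
  moreover have "1 \<notin> g ` Q" using mem[of 1] Qd(3) h by (simp add: gal_one)
  moreover have "a \<in> g ` Q \<or> b \<in> g ` Q" if "a \<in> ints M" "b \<in> ints M" "a * b \<in> g ` Q" for a b
  proof -
    have ab: "a \<in> M" "b \<in> M" using that M.ints_F by auto
    then have "?h a * ?h b \<in> Q" using that(3) mem[of "a * b"] h by (simp add: gal_mult M.mult_F)
    then show ?thesis using Qd(4) h that mem ab by blast
  qed
  ultimately show ?thesis by (simp add: MM.prime_idl_def)
qed

text \<open>A zero ideal also has to be placed under a nonzero prime; a prime over 2 serves, since
  1/2 is not integral.\<close>

lemma prime_idl_above:
  assumes "MM.idl I" "1 \<notin> I"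
  obtains Q where "MM.prime_idl Q" "I \<subseteq> Q"
proof (cases "I = {0}")
  case False
  then show ?thesis using MM.exists_prime_above[OF assms(1) _ assms(2)] that by blast
next
  case True
  let ?J = "{x + b * 2 |x b. x \<in> {0} \<and> b \<in> ints M}"
  have z: "MM.idl {0}" by (auto simp: MM.idl_def)
  have two: "2 \<in> ints M" using M.ints_of_nat[of 2] by simp
  note J = MM.idl_add_principal[OF z two]
  have "1 \<notin> ?J"
  proof
    assume "1 \<in> ?J"
    then obtain b :: complex where b: "1 = b * 2" "b \<in> ints M" by auto
    then have "b = 1 / 2" by simp
    moreover have "(1 / 2 :: complex) \<in> \<rat>" by simp
    ultimately have "(1 / 2 :: complex) \<in> \<int>"
      using b rational_algebraic_int_is_int[of b] by (simp only: ints_def mem_Collect_eq)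
    then obtain n :: int where "(1 / 2 :: complex) = of_int n" by (auto elim: Ints_cases)
    then have "of_int (2 * n) = (of_int 1 :: complex)" by (simp add: field_simps)
    then have "2 * n = 1" using of_int_eq_iff by blast
    then show False by presburger
  qed
  moreover have "?J \<noteq> {0}"
  proof
    assume "?J = {0}"
    with J(3) have "2 \<in> {0 :: complex}" by (simp only:)
    then show False by simp
  qed
  ultimately obtain Q where Q: "MM.prime_idl Q" using MM.exists_prime_above[OF J(1)] by blast
  then show ?thesis using that True MM.idlD(2) MM.prime_idlD(1) by blast
qed

abbreviation polys_over :: "complex set \<Rightarrow> complex poly set"
  where "polys_over A \<equiv> {f. \<forall>i. coeff f i \<in> A}"

text \<open>Gauss's lemma: among the terms of the coefficient of index \<open>i + j\<close>, only
  the product of the two lowest coefficients outside \<open>Q\<close> can lie outside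
  \<open>Q\<close>.\<close>

lemma prime_idl_poly:
  assumes Q: "MM.prime_idl Q" and fg: "f \<in> polys_over (ints M)" "g \<in> polys_over (ints M)" "f * g \<in> polys_over Q"
  shows "f \<in> polys_over Q \<or> g \<in> polys_over Q"
proof (rule ccontr)
  assume n: "\<not> ?thesis"
  note Qd = MM.prime_idlD[OF Q]
  note I = MM.idlD[OF Qd(1)]
  define i where "i = (LEAST i. coeff f i \<notin> Q)"
  define j where "j = (LEAST j. coeff g j \<notin> Q)"
  obtain i' j' where ij': "coeff f i' \<notin> Q" "coeff g j' \<notin> Q" using n by blast
  have i: "coeff f i \<notin> Q" "\<And>k. k < i \<Longrightarrow> coeff f k \<in> Q"
    unfolding i_def using ij'(1) by (rule LeastI) (use not_less_Least in blast)
  have j: "coeff g j \<notin> Q" "\<And>k. k < j \<Longrightarrow> coeff g k \<in> Q"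
    unfolding j_def using ij'(2) by (rule LeastI) (use not_less_Least in blast)
  have sumQ: "sum h A \<in> Q" if "\<And>k. k \<in> A \<Longrightarrow> h k \<in> Q" for h and A :: "nat set"
    using that by (induction A rule: infinite_finite_induct) (auto intro: I(2,3))
  have "coeff (f * g) (i + j) = (\<Sum>k\<le>i + j. coeff f k * coeff g (i + j - k))" by (rule coeff_mult)
  also have "\<dots> = coeff f i * coeff g j + (\<Sum>k\<in>{..i + j} - {i}. coeff f k * coeff g (i + j - k))"
    by (subst sum.remove[of _ i]) auto
  finally have "coeff f i * coeff g j
      = coeff (f * g) (i + j) - (\<Sum>k\<in>{..i + j} - {i}. coeff f k * coeff g (i + j - k))" by simp
  moreover have "(\<Sum>k\<in>{..i + j} - {i}. coeff f k * coeff g (i + j - k)) \<in> Q"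
  proof (rule sumQ)
    fix k assume k: "k \<in> {..i + j} - {i}"
    show "coeff f k * coeff g (i + j - k) \<in> Q"
    proof (cases "k < i")
      case True
      then show ?thesis using i(2) fg(2) I(5) by blast
    next
      case False
      then have "i + j - k < j" using k by auto
      then show ?thesis using j(2) fg(1) I(4) by blast
    qed
  qed
  ultimately have "coeff f i * coeff g j \<in> Q" using fg(3) I(6) by auto
  then show False using Qd(4) i(1) j(1) fg by blast
qed

end

text \<open>
  The map \<open>\<psi>\<close> is a homomorphism to the integers modulo \<open>p\<close>, defined on the stabiliser \<open>W\<close> of the
  root of unity \<open>z\<close>; its kernel \<open>U\<close> contains all inertia groups, so that the fixed field \<open>H\<close> of \<open>U\<close>
  is an unramified cyclic extension of degree \<open>p\<close> of the fixed field \<open>K\<close> of \<open>W\<close>.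
\<close>

locale unramified_cyclic = galois_field +
  fixes p :: nat and z :: complex and \<psi> :: "(complex \<Rightarrow> complex) \<Rightarrow> int" and s :: "complex \<Rightarrow> complex"
  fixes W U :: "(complex \<Rightarrow> complex) set" and H K :: "complex set"
  defines "W \<equiv> {g \<in> carrier G. g z = z}"
    and "U \<equiv> {g \<in> W. int p dvd \<psi> g}"
    and "H \<equiv> {x \<in> M. \<forall>u\<in>U. u x = x}"
    and "K \<equiv> {x \<in> M. \<forall>w\<in>W. w x = x}"
  assumes p: "prime p" "odd p"
    and z: "z \<in> M" "z ^ p = 1" "z \<noteq> 1"
    and \<psi>_mult: "\<And>g h. g \<in> W \<Longrightarrow> h \<in> W \<Longrightarrow> [\<psi> (g \<otimes>\<^bsub>G\<^esub> h) = \<psi> g + \<psi> h] (mod int p)"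
    and s: "s \<in> W" "[\<psi> s = 1] (mod int p)"
    and \<psi>_inertia: "\<And>Q g. MM.prime_idl Q \<Longrightarrow> g \<in> inertia Q \<Longrightarrow> g \<in> W \<Longrightarrow> int p dvd \<psi> g"
begin

lemma W_G: "g \<in> W \<Longrightarrow> g \<in> carrier G" and U_W: "g \<in> U \<Longrightarrow> g \<in> W" and U_G: "g \<in> U \<Longrightarrow> g \<in> carrier G"
  by (auto simp: W_def U_def)

lemma finite_W: "finite W" and finite_U: "finite U"
  using finite_gal by (auto simp: W_def U_def)

lemma one_W [simp]: "\<one>\<^bsub>G\<^esub> \<in> W"
  using z by (simp add: W_def act_one)

lemma mult_W [intro]: "g \<in> W \<Longrightarrow> h \<in> W \<Longrightarrow> g \<otimes>\<^bsub>G\<^esub> h \<in> W"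
  using z by (simp add: W_def act_mult)

lemma inv_W [intro]: "g \<in> W \<Longrightarrow> inv\<^bsub>G\<^esub> g \<in> W"
  using z act_inv(1)[of g z] by (simp add: W_def)

lemma pow_W [intro]: "g \<in> W \<Longrightarrow> g [^]\<^bsub>G\<^esub> (n :: nat) \<in> W"
  by (induction n) auto

lemma \<psi>_one: "int p dvd \<psi> \<one>\<^bsub>G\<^esub>"
  using \<psi>_mult[of "\<one>\<^bsub>G\<^esub>" "\<one>\<^bsub>G\<^esub>"] by (simp add: cong_iff_dvd_diff dvd_minus_iff)

lemma \<psi>_inv:
  assumes "g \<in> W" shows "[\<psi> (inv\<^bsub>G\<^esub> g) = - \<psi> g] (mod int p)"
proof -
  have "[\<psi> (inv\<^bsub>G\<^esub> g \<otimes>\<^bsub>G\<^esub> g) = \<psi> (inv\<^bsub>G\<^esub> g) + \<psi> g] (mod int p)" using assms by (intro \<psi>_mult) auto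
  then have "[\<psi> (inv\<^bsub>G\<^esub> g) + \<psi> g = 0] (mod int p)"
    using \<psi>_one assms by (simp add: W_G G.l_inv) (meson cong_0_iff cong_sym cong_trans)
  then show ?thesis by (simp add: cong_iff_dvd_diff)
qed

lemma \<psi>_pow: "g \<in> W \<Longrightarrow> [\<psi> (g [^]\<^bsub>G\<^esub> (n :: nat)) = int n * \<psi> g] (mod int p)"
proof (induction n)
  case 0
  then show ?case using \<psi>_one by (simp add: cong_0_iff)
next
  case (Suc n)
  have "[\<psi> (g [^]\<^bsub>G\<^esub> n \<otimes>\<^bsub>G\<^esub> g) = \<psi> (g [^]\<^bsub>G\<^esub> n) + \<psi> g] (mod int p)" using Suc by (intro \<psi>_mult) auto
  moreover have "[\<psi> (g [^]\<^bsub>G\<^esub> n) + \<psi> g = int n * \<psi> g + \<psi> g] (mod int p)"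
    using Suc by (intro cong_add) auto
  ultimately show ?case using cong_trans by (simp add: algebra_simps) blast
qed

lemma \<psi>_s_pow: "[\<psi> (s [^]\<^bsub>G\<^esub> (n :: nat)) = int n] (mod int p)"
  using cong_trans[OF \<psi>_pow[OF s(1), of n] cong_scalar_left[OF s(2), of "int n"]] by simp

lemma U_subgroup: "\<one>\<^bsub>G\<^esub> \<in> U" "g \<in> U \<Longrightarrow> h \<in> U \<Longrightarrow> g \<otimes>\<^bsub>G\<^esub> h \<in> U" "g \<in> U \<Longrightarrow> inv\<^bsub>G\<^esub> g \<in> U"
proof -
  show "\<one>\<^bsub>G\<^esub> \<in> U" using \<psi>_one by (simp add: U_def)
  show "g \<otimes>\<^bsub>G\<^esub> h \<in> U" if "g \<in> U" "h \<in> U"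
    using that \<psi>_mult[of g h] cong_dvd_iff[of "\<psi> (g \<otimes>\<^bsub>G\<^esub> h)" "\<psi> g + \<psi> h" "int p"] by (auto simp: U_def)
  show "inv\<^bsub>G\<^esub> g \<in> U" if "g \<in> U"
    using that \<psi>_inv[of g] cong_dvd_iff[of "\<psi> (inv\<^bsub>G\<^esub> g)" "- \<psi> g" "int p"] by (auto simp: U_def)
qed

lemma U_conj:
  assumes "u \<in> U" "g \<in> W"
  shows "inv\<^bsub>G\<^esub> g \<otimes>\<^bsub>G\<^esub> u \<otimes>\<^bsub>G\<^esub> g \<in> U"
proof -
  have W: "inv\<^bsub>G\<^esub> g \<in> W" "u \<in> W" using assms U_W by auto
  have "[\<psi> (inv\<^bsub>G\<^esub> g \<otimes>\<^bsub>G\<^esub> u \<otimes>\<^bsub>G\<^esub> g) = \<psi> (inv\<^bsub>G\<^esub> g) + \<psi> u + \<psi> g] (mod int p)"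
    using \<psi>_mult[of "inv\<^bsub>G\<^esub> g \<otimes>\<^bsub>G\<^esub> u" g] \<psi>_mult[OF W] W assms
    by (meson cong_add cong_refl cong_trans mult_W)
  also have "[\<psi> (inv\<^bsub>G\<^esub> g) + \<psi> u + \<psi> g = - \<psi> g + 0 + \<psi> g] (mod int p)"
    using \<psi>_inv[OF assms(2)] assms(1) by (intro cong_add) (auto simp: U_def cong_0_iff)
  finally show ?thesis using W assms by (auto simp: U_def cong_0_iff)
qed

lemma W_decomp:
  assumes "w \<in> W"
  obtains i u where "i < p" "u \<in> U" "w = s [^]\<^bsub>G\<^esub> i \<otimes>\<^bsub>G\<^esub> u"
proof
  define i where "i = nat (\<psi> w mod int p)"
  have p0: "p > 0" using p(1) prime_gt_0_nat by blast
  then have i: "int i = \<psi> w mod int p" by (simp add: i_def)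
  show "i < p" using p0 i by (metis of_nat_0_less_iff of_nat_less_iff pos_mod_bound)
  let ?u = "inv\<^bsub>G\<^esub> (s [^]\<^bsub>G\<^esub> i) \<otimes>\<^bsub>G\<^esub> w"
  have sW: "s [^]\<^bsub>G\<^esub> i \<in> W" using s(1) by blast
  have "[\<psi> ?u = \<psi> (inv\<^bsub>G\<^esub> (s [^]\<^bsub>G\<^esub> i)) + \<psi> w] (mod int p)" using sW assms by (intro \<psi>_mult) auto
  also have "[\<psi> (inv\<^bsub>G\<^esub> (s [^]\<^bsub>G\<^esub> i)) + \<psi> w = - int i + \<psi> w] (mod int p)"
    using cong_trans[OF \<psi>_inv[OF sW]] \<psi>_s_pow[of i] by (intro cong_add) (auto simp: cong_minus_minus_iff)
  also have "[- int i + \<psi> w = - \<psi> w + \<psi> w] (mod int p)"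
    unfolding i by (intro cong_add) (auto simp: cong_minus_minus_iff)
  finally show "?u \<in> U" using sW assms by (auto simp: U_def cong_0_iff)
  show "w = s [^]\<^bsub>G\<^esub> i \<otimes>\<^bsub>G\<^esub> ?u" using sW assms by (simp add: W_G G.m_assoc[symmetric])
qed

section \<open>The fixed fields \<open>H\<close> and \<open>K\<close> and the action of
  \<open>s\<close>\<close>

lemma fixed_fld:
  assumes "S \<subseteq> carrier G" shows "fld {x \<in> M. \<forall>g\<in>S. g x = x}"
  using assms by (auto simp: fld_def gal_one gal_diff gal_mult gal_inverse subset_iff)

sublocale H: galois_subfield M H
  by unfold_locales (use fixed_fld[of U] U_G in \<open>auto simp: H_def\<close>)

sublocale K: galois_subfield M K
  by unfold_locales (use fixed_fld[of W] W_G in \<open>auto simp: K_def\<close>)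

lemma K_H: "x \<in> K \<Longrightarrow> x \<in> H" and H_M: "x \<in> H \<Longrightarrow> x \<in> M" and K_M: "x \<in> K \<Longrightarrow> x \<in> M"
  using U_W by (auto simp: K_def H_def)

lemma z_K: "z \<in> K"
  using z by (auto simp: K_def W_def)

lemma W_act_H:
  assumes w: "w \<in> W" and x: "x \<in> H"
  shows "w x \<in> H"
proof -
  have "u (w x) = w x" if u: "u \<in> U" for u
  proof -
    have "u (w x) = w ((inv\<^bsub>G\<^esub> w \<otimes>\<^bsub>G\<^esub> u \<otimes>\<^bsub>G\<^esub> w) x)"
      using w u x by (simp add: act_mult W_G U_G H_M act_inv)
    also have "(inv\<^bsub>G\<^esub> w \<otimes>\<^bsub>G\<^esub> u \<otimes>\<^bsub>G\<^esub> w) x = x" using U_conj[OF u w] x unfolding H_def by blast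
    finally show ?thesis .
  qed
  then show ?thesis using w x by (auto simp: H_def W_G)
qed

lemma s_H [intro]: "x \<in> H \<Longrightarrow> s x \<in> H" and s_pow_H [intro]: "x \<in> H \<Longrightarrow> (s ^^ n) x \<in> H"
  using W_act_H[OF s(1)] by (simp, induction n) auto

lemma s_ints_H: "x \<in> ints H \<Longrightarrow> (s ^^ n) x \<in> ints H"
  using funpow_ints[OF W_G[OF s(1)]] by (auto simp: ints_def H_M)

lemma W_on_H:
  assumes "w \<in> W" obtains i where "i < p" "\<And>x. x \<in> H \<Longrightarrow> w x = (s ^^ i) x"
proof -
  obtain i u where iu: "i < p" "u \<in> U" "w = s [^]\<^bsub>G\<^esub> i \<otimes>\<^bsub>G\<^esub> u" using W_decomp[OF assms] .
  have "w x = (s ^^ i) x" if "x \<in> H" for x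
  proof -
    have "w x = (s [^]\<^bsub>G\<^esub> i) (u x)" using iu s(1) that by (simp add: act_mult W_G U_G H_M)
    also have "u x = x" using iu(2) that by (simp add: H_def)
    finally show ?thesis using act_pow[OF W_G[OF s(1)]] that H_M by simp
  qed
  then show ?thesis using that iu(1) by blast
qed

lemma s_pow_p: "x \<in> H \<Longrightarrow> (s ^^ p) x = x"
proof -
  assume x: "x \<in> H"
  have "s [^]\<^bsub>G\<^esub> p \<in> U" using \<psi>_s_pow[of p] s(1) by (auto simp: U_def cong_def)
  then have "(s [^]\<^bsub>G\<^esub> p) x = x" using x by (simp add: H_def)
  then show ?thesis using act_pow[OF W_G[OF s(1)]] x H_M by simp
qed

lemma s_fixed_K: assumes "x \<in> H" "s x = x" shows "x \<in> K"
proof -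
  have "(s ^^ i) x = x" for i by (induction i) (auto simp: assms)
  then have "w x = x" if "w \<in> W" for w using W_on_H[OF that] assms(1) by metis
  then show ?thesis using assms H_M by (auto simp: K_def)
qed

lemma s_K: "x \<in> K \<Longrightarrow> s x = x"
  using s(1) by (simp add: K_def)

text \<open>
  Only automorphisms in \<open>U\<close> act trivially on a residue field of \<open>H\<close>. With one generic element
  \<open>y\<close> of \<open>O[X]\<close> the polynomial \<open>\<Prod>(T - u y)\<close>, \<open>u \<in> U\<close>, is congruent to its image under \<open>w\<close>; hence
  \<open>w y\<close> is congruent to some \<open>u y\<close>, i.e. \<open>u\<inverse> w\<close> is in an inertia group.
\<close>

lemma moved_generate_unit_ideal_M:
  assumes w: "w \<in> W" "w \<notin> U"
  shows "1 \<in> iprod (ints M) {w x - x |x. x \<in> ints H}"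
proof (rule ccontr)
  let ?D = "{w x - x |x. x \<in> ints H}"
  assume n: "1 \<notin> iprod (ints M) ?D"
  have wG: "w \<in> carrier G" using w W_G by blast
  have DM: "?D \<subseteq> ints M" using wG H.ints_FM by auto
  have "0 \<in> ?D" by (intro CollectI exI[of _ 0]) (simp add: gal_zero wG)
  then have "0 * 0 \<in> iprod (ints M) ?D" by (intro iprodI) auto
  moreover have "iprod (ints M) ?D \<subseteq> ints M" using DM by (intro iprod_least) auto
  moreover have "a * x \<in> iprod (ints M) ?D" if "a \<in> ints M" "x \<in> iprod (ints M) ?D" for a x
    using iprod_scale[of "ints M" a "ints M" x ?D] that by blast
  ultimately have "MM.idl (iprod (ints M) ?D)" unfolding MM.idl_def using iprod_add by auto
  then obtain Q where Q: "MM.prime_idl Q" "iprod (ints M) ?D \<subseteq> Q" using prime_idl_above n by blast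
  note Qd = MM.prime_idlD[OF Q(1)]
  note I = MM.idlD[OF Qd(1)]
  have DQ: "w x - x \<in> Q" if "x \<in> ints H" for x
    using Q(2) iprodI[of 1 "ints M" "w x - x" ?D] that by auto
  \<comment> \<open>If \<open>w\<close> and \<open>u\<close> agreed modulo \<open>Q\<close>, then
    \<open>inv u * w\<close> would be inertial at the image of \<open>Q\<close> under
    \<open>inv u\<close>, hence in \<open>U\<close>, and \<open>w\<close> would be in
    \<open>U\<close>.\<close>
  have "\<exists>x\<in>ints M. w x - u x \<notin> Q" if u: "u \<in> U" for u
  proof (rule ccontr)
    assume a: "\<not> ?thesis"
    let ?v = "inv\<^bsub>G\<^esub> u"
    have v: "?v \<in> carrier G" "?v \<in> U" "?v \<in> W" "u \<in> carrier G" using u U_G U_subgroup(3) U_W by auto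
    have "?v \<otimes>\<^bsub>G\<^esub> w \<in> inertia (?v ` Q)"
      unfolding inertia_def
    proof (intro CollectI conjI ballI)
      fix x assume x: "x \<in> ints M"
      then have xM: "x \<in> M" by (rule M.ints_F)
      have "w x - u x \<in> Q" using a x by blast
      moreover have "?v (w x - u x) = (?v \<otimes>\<^bsub>G\<^esub> w) x - x"
        using v wG xM by (simp add: gal_diff act_mult act_inv)
      ultimately show "(?v \<otimes>\<^bsub>G\<^esub> w) x - x \<in> ?v ` Q" by (metis imageI)
    qed (use v wG in simp)
    then have "?v \<otimes>\<^bsub>G\<^esub> w \<in> U"
      using \<psi>_inertia[OF prime_idl_image[OF v(1) Q(1)]] v w by (auto simp: U_def)
    then have "u \<otimes>\<^bsub>G\<^esub> (?v \<otimes>\<^bsub>G\<^esub> w) \<in> U" using u U_subgroup(2) by blast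
    then show False using w(2) v wG by (simp add: G.m_assoc[symmetric])
  qed
  then obtain x where x: "\<And>u. u \<in> U \<Longrightarrow> x u \<in> ints M \<and> w (x u) - u (x u) \<notin> Q" by metis
  obtain idx :: "(complex \<Rightarrow> complex) \<Rightarrow> nat" where idx: "inj_on idx U"
    using finite_U finite_imp_inj_to_nat_seg by blast
  \<comment> \<open>Distinct exponents keep the witnesses \<open>x u\<close> apart, so that one
    polynomial shows \<open>w y\<close> and \<open>u y\<close> to be incongruent for every
    \<open>u\<close> in \<open>U\<close> at once.\<close>
  define y where "y = (\<Sum>u\<in>U. monom (x u) (idx u))"
  have cy: "coeff y i \<in> ints M" for i
    unfolding y_def coeff_sum using x by (intro M.ints_sum) auto
  have cyu: "coeff y (idx u) = x u" if "u \<in> U" for u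
  proof -
    have "coeff y (idx u) = (\<Sum>v\<in>U. if v = u then x v else 0)"
      unfolding y_def coeff_sum using that idx by (intro sum.cong) (auto simp: inj_on_def)
    then show ?thesis using that finite_U by simp
  qed
  have cg: "coeff (map_poly g y) i = g (coeff y i)" if "g \<in> carrier G" for g i
    by (simp add: coeff_map_poly gal_zero that)
  have OX: "map_poly g y \<in> polys_over (ints M)" if "g \<in> carrier G" for g
    using that cy by (simp add: cg)
  interpret OMX: subring_hom "polys_over (ints M)" "map_poly \<one>\<^bsub>G\<^esub>"
    by (rule subring_hom.subring_hom_map_poly, unfold_locales)
       (auto simp: gal_add gal_mult gal_one M.ints_F)
  have fac: "map_poly w y - map_poly u y \<notin> polys_over Q" if "u \<in> U" for u
    using x[OF that] cyu[OF that] cg[OF wG] cg[OF U_G[OF that]] by (auto intro!: exI[of _ "idx u"])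
  have "(\<Prod>u\<in>S. map_poly w y - map_poly u y) \<notin> polys_over Q" if "S \<subseteq> U" "finite S" for S
    using that(2,1)
  proof (induction S rule: finite_induct)
    case empty
    then show ?case using Qd(3) by (auto intro!: exI[of _ 0])
  next
    case (insert u S)
    have "(\<Prod>u\<in>S. map_poly w y - map_poly u y) \<in> polys_over (ints M)"
      using insert.prems OX wG U_G by (intro OMX.prod_mem OMX.diff_mem) blast+
    moreover have "map_poly w y - map_poly u y \<in> polys_over (ints M)"
      using insert.prems OX wG U_G by (intro OMX.diff_mem) blast+
    ultimately show ?case
      using prime_idl_poly[OF Q(1), of "map_poly w y - map_poly u y" "\<Prod>u\<in>S. map_poly w y - map_poly u y"]
        fac[of u] insert by auto
  qed
  then have nQ: "(\<Prod>u\<in>U. map_poly w y - map_poly u y) \<notin> polys_over Q" using finite_U by blast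
  define f where "f = (\<Prod>u\<in>U. [:- map_poly u y, 1:])"
  have lin: "coeff [:- map_poly u y, 1:] i \<in> polys_over (ints M)" if "u \<in> U" for u i
    using OX[OF U_G[OF that]] by (cases i) (auto simp: coeff_pCons M.ints_uminus split: nat.splits)
  interpret OMXT: subring_hom "{f. \<forall>i. coeff f i \<in> polys_over (ints M)}" "map_poly (map_poly \<one>\<^bsub>G\<^esub>)"
    by (rule OMX.subring_hom_map_poly)
  have cf: "coeff f k \<in> polys_over (ints M)" for k
    using OMXT.prod_mem[of U "\<lambda>u. [:- map_poly u y, 1:]"] lin unfolding f_def by blast
  have fixv: "map_poly v (coeff f k) = coeff f k" if v: "v \<in> U" for v k
  proof -
    interpret v: subring_hom M v using gal_hom[OF U_G[OF v]] .
    interpret vX: subring_hom "polys_over M" "map_poly v" by (rule v.subring_hom_map_poly)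
    interpret vXT: subring_hom "{f. \<forall>i. coeff f i \<in> polys_over M}" "map_poly (map_poly v)"
      by (rule vX.subring_hom_map_poly)
    have "map_poly (map_poly v) f = (\<Prod>u\<in>U. map_poly (map_poly v) [:- map_poly u y, 1:])"
      unfolding f_def by (rule vXT.hom_prod) (use lin M.ints_F in blast)
    also have "\<dots> = (\<Prod>u\<in>U. [:- map_poly (v \<otimes>\<^bsub>G\<^esub> u) y, 1:])"
    proof (intro prod.cong refl)
      fix u assume u: "u \<in> U"
      have "map_poly v (map_poly u y) = map_poly (v \<otimes>\<^bsub>G\<^esub> u) y"
        using u v cy by (intro poly_eqI) (simp add: cg U_G coeff_map_poly gal_zero act_mult M.ints_F)
      moreover have "map_poly u y \<in> polys_over M" using OX[OF U_G[OF u]] M.ints_F by blast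
      ultimately show "map_poly (map_poly v) [:- map_poly u y, 1:] = [:- map_poly (v \<otimes>\<^bsub>G\<^esub> u) y, 1:]"
        by (simp add: map_poly_pCons vX.hom_zero vX.hom_one vX.hom_uminus)
    qed
    also have "\<dots> = f"
    proof -
      have "bij_betw (\<lambda>u. v \<otimes>\<^bsub>G\<^esub> u) U U"
        by (rule bij_betwI[of _ _ _ "\<lambda>u. inv\<^bsub>G\<^esub> v \<otimes>\<^bsub>G\<^esub> u"])
           (use v U_subgroup U_G in \<open>auto simp: G.m_assoc[symmetric]\<close>)
      then show ?thesis unfolding f_def by (rule prod.reindex_bij_betw)
    qed
    finally show ?thesis using vX.coeff_map_poly_hom[of f k] by simp
  qed
  \<comment> \<open>The coefficients of \<open>f\<close> are integral and fixed by \<open>U\<close>,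
    so they lie in \<open>ints H\<close>, where \<open>w\<close> acts trivially modulo
    \<open>Q\<close>.\<close>
  have cH: "coeff (coeff f k) i \<in> ints H" for k i
  proof -
    have "v (coeff (coeff f k) i) = coeff (coeff f k) i" if v: "v \<in> U" for v
      using arg_cong[OF fixv[OF v, of k], of "\<lambda>q. coeff q i"] by (simp add: coeff_map_poly gal_zero U_G[OF v])
    then show ?thesis using cf[of k] by (auto simp: ints_def H_def)
  qed
  interpret w: subring_hom M w using gal_hom[OF wG] .
  interpret wX: subring_hom "polys_over M" "map_poly w" by (rule w.subring_hom_map_poly)
  have cfM: "coeff f k \<in> polys_over M" for k using cf[of k] M.ints_F by blast
  have yM: "y \<in> polys_over M" using cy M.ints_F by blast
  have "map_poly \<one>\<^bsub>G\<^esub> y = y"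
    using cy by (intro poly_eqI) (simp add: cg act_one M.ints_F)
  then have "poly f y = 0"
    unfolding f_def poly_prod using finite_U U_subgroup(1)
    by (auto simp: prod_zero_iff intro!: bexI[of _ "\<one>\<^bsub>G\<^esub>"])
  then have "poly (map_poly (map_poly w) f) (map_poly w y) = 0"
    using wX.hom_poly[OF cfM yM] by (simp add: wX.hom_zero)
  then have "poly (f - map_poly (map_poly w) f) (map_poly w y) = poly f (map_poly w y)" by simp
  also have "\<dots> = (\<Prod>u\<in>U. map_poly w y - map_poly u y)"
    unfolding f_def poly_prod by simp
  finally have eq: "(\<Prod>u\<in>U. map_poly w y - map_poly u y) = poly (f - map_poly (map_poly w) f) (map_poly w y)" ..
  have sumQ: "sum h A \<in> Q" if "\<And>k. k \<in> A \<Longrightarrow> h k \<in> Q" for h and A :: "nat set"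
    using that by (induction A rule: infinite_finite_induct) (auto intro: I(2,3))
  have idealX: "c * d \<in> polys_over Q" if "c \<in> polys_over Q" "d \<in> polys_over (ints M)" for c d
    unfolding coeff_mult mem_Collect_eq
  proof (intro allI sumQ)
    show "coeff c i * coeff d (n - i) \<in> Q" for i n using that I(5) by blast
  qed
  have "coeff (f - map_poly (map_poly w) f) k * map_poly w y ^ k \<in> polys_over Q" for k
  proof (rule idealX)
    have "- (w (coeff (coeff f k) i) - coeff (coeff f k) i) \<in> Q" for i
      using DQ[OF cH] I(7) by blast
    then show "coeff (f - map_poly (map_poly w) f) k \<in> polys_over Q"
      by (simp add: wX.coeff_map_poly_hom w.coeff_map_poly_hom)
    show "map_poly w y ^ k \<in> polys_over (ints M)" using OX[OF wG] by (rule OMX.power_mem)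
  qed
  then have "poly (f - map_poly (map_poly w) f) (map_poly w y) \<in> polys_over Q"
    unfolding poly_altdef coeff_sum mem_Collect_eq by (intro allI sumQ) blast
  then show False using nQ eq by simp
qed

end


subsection \<open>The class group\<close>

context galois_subfield
begin

lemma additive_subgroup_complexI:
  assumes "0 \<in> I" "\<And>x y. x \<in> I \<Longrightarrow> y \<in> I \<Longrightarrow> x + y \<in> I" "\<And>x. x \<in> I \<Longrightarrow> - x \<in> I"
  shows "additive_subgroup I complex_ring"
proof (rule additive_subgroup.intro)
  have g: "group (add_monoid complex_ring)"
    by (intro abelian_group.a_group ring.is_abelian_group cring.axioms(1) cring_complex_ring)
  show "subgroup I (add_monoid complex_ring)"
  proof (rule group.subgroupI[OF g])
    show "inv\<^bsub>add_monoid complex_ring\<^esub> a \<in> I" if "a \<in> I" for a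
      using assms(3)[OF that] complex_ring_a_inv[of a] by (simp add: a_inv_def)
  qed (use assms in auto)
qed

lemma additive_subgroup_complexD:
  assumes "additive_subgroup I complex_ring"
  shows "0 \<in> I" "x \<in> I \<Longrightarrow> y \<in> I \<Longrightarrow> x + y \<in> I"
  using additive_subgroup.zero_closed[OF assms] additive_subgroup.a_closed[OF assms, of x y] by auto

definition frac_idl :: "complex set \<Rightarrow> bool"
  where "frac_idl I \<longleftrightarrow> I \<subseteq> F \<and> 0 \<in> I \<and> (\<exists>x\<in>I. x \<noteq> 0) \<and> (\<forall>x\<in>I. \<forall>y\<in>I. x + y \<in> I) \<and>
    (\<forall>a\<in>ints F. \<forall>x\<in>I. a * x \<in> I) \<and> (\<exists>d\<in>ints F. d \<noteq> 0 \<and> (\<forall>x\<in>I. d * x \<in> ints F))"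

lemma fracD:
  assumes "frac_idl I"
  shows "x \<in> I \<Longrightarrow> x \<in> F" "0 \<in> I" "\<exists>x\<in>I. x \<noteq> 0" "x \<in> I \<Longrightarrow> y \<in> I \<Longrightarrow> x + y \<in> I"
    "a \<in> ints F \<Longrightarrow> x \<in> I \<Longrightarrow> a * x \<in> I" "\<exists>d\<in>ints F. d \<noteq> 0 \<and> (\<forall>x\<in>I. d * x \<in> ints F)"
  using assms by (auto simp: frac_idl_def)

lemma fractional_ideals_eq: "fractional_ideals F = {I. frac_idl I}"
proof (intro equalityI subsetI)
  fix I assume "I \<in> fractional_ideals F"
  then have I: "I \<subseteq> F" "I \<noteq> {0}" "additive_subgroup I complex_ring" "\<forall>a\<in>ints F. \<forall>x\<in>I. a * x \<in> I"
    "\<exists>d\<in>ints F. d \<noteq> 0 \<and> (\<forall>x\<in>I. d * x \<in> ints F)" by (auto simp: fractional_ideals_def)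
  note A = additive_subgroup_complexD[OF I(3)]
  have "\<exists>x\<in>I. x \<noteq> 0" using I(2) A(1) by blast
  then show "I \<in> {I. frac_idl I}" using I A unfolding frac_idl_def by blast
next
  fix I assume "I \<in> {I. frac_idl I}"
  then have I: "frac_idl I" by simp
  have "- x \<in> I" if "x \<in> I" for x
    using fracD(5)[OF I, of "- 1" x] that F.ints_uminus[OF F.ints_1] by simp
  then have "additive_subgroup I complex_ring" using fracD[OF I] by (intro additive_subgroup_complexI)
  then show "I \<in> fractional_ideals F" using fracD[OF I] by (auto simp: fractional_ideals_def)
qed

lemma frac_iprod:
  assumes "frac_idl I" "frac_idl J" shows "frac_idl (iprod I J)"
proof -
  note I = fracD[OF assms(1)] and J = fracD[OF assms(2)]
  obtain x y where xy: "x \<in> I" "y \<in> J" "x \<noteq> 0" "y \<noteq> 0" using I(3) J(3) by blast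
  obtain d e where de: "d \<in> ints F" "e \<in> ints F" "d \<noteq> 0" "e \<noteq> 0" "\<And>x. x \<in> I \<Longrightarrow> d * x \<in> ints F" "\<And>x. x \<in> J \<Longrightarrow> e * x \<in> ints F"
    using I(6) J(6) by blast
  have "iprod I J \<subseteq> F" using I(1) J(1) by (intro iprod_least) auto
  moreover have "0 * 0 \<in> iprod I J" using I(2) J(2) by (intro iprodI)
  moreover have "x * y \<in> iprod I J" "x * y \<noteq> 0" using xy by (auto intro: iprodI)
  moreover have "a * x \<in> iprod I J" if "a \<in> ints F" "x \<in> iprod I J" for a x
    using iprod_scale[of I a I x J] I(5) that by blast
  moreover have "iprod I J \<subseteq> {x. (d * e) * x \<in> ints F}"
  proof (rule iprod_least)
    fix i j assume ij: "i \<in> I" "j \<in> J"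
    have "(d * e) * (i * j) = (d * i) * (e * j)" by (simp add: algebra_simps)
    moreover have "(d * i) * (e * j) \<in> ints F" using de(5)[OF ij(1)] de(6)[OF ij(2)] by (rule F.ints_mult)
    ultimately show "i * j \<in> {x. (d * e) * x \<in> ints F}" by (simp only: mem_Collect_eq)
  qed (auto simp: distrib_left)
  moreover have "d * e \<in> ints F" "d * e \<noteq> 0" using de by auto
  ultimately have "0 \<in> iprod I J" "\<exists>x\<in>iprod I J. x \<noteq> 0" "\<exists>d\<in>ints F. d \<noteq> 0 \<and> (\<forall>x\<in>iprod I J. d * x \<in> ints F)"
    "iprod I J \<subseteq> F" "\<forall>a\<in>ints F. \<forall>x\<in>iprod I J. a * x \<in> iprod I J"
    using \<open>x * y \<in> iprod I J\<close> by (simp, blast+)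
  then show ?thesis unfolding frac_idl_def using iprod_add by blast
qed

lemma iprod_ints: "frac_idl I \<Longrightarrow> iprod (ints F) I = I"
proof
  assume I: "frac_idl I"
  show "iprod (ints F) I \<subseteq> I" using fracD(4,5)[OF I] by (intro iprod_least)
  show "I \<subseteq> iprod (ints F) I" using iprodI[of 1 "ints F" _ I] by auto
qed

lemma frac_ints: "frac_idl (ints F)"
  unfolding frac_idl_def using F.ints_F by (auto intro!: bexI[of _ 1])

lemma idl_imp_frac: "idl I \<Longrightarrow> I \<noteq> {0} \<Longrightarrow> frac_idl I"
proof -
  assume I: "idl I" "I \<noteq> {0}"
  then have "\<exists>x\<in>I. x \<noteq> 0" using idlD(2) by blast
  then show ?thesis unfolding frac_idl_def using idlD(1-4)[OF I(1)] F.ints_F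
    by (auto intro!: bexI[of _ 1])
qed

text \<open>Noetherian induction from above. For a prime \<open>Q\<close> over \<open>I\<close> put
  \<open>Q' = O + O w\<close> with \<open>w\<close> in the inverse of \<open>Q\<close>; then
  \<open>I Q'\<close> is an integral ideal, strictly larger than \<open>I\<close> because otherwise
  \<open>w\<close> would be almost integral, and an inverse of it gives one of
  \<open>I\<close>.\<close>

lemma idl_invertible:
  assumes "idl I" "I \<noteq> {0}"
  shows "\<exists>J. frac_idl J \<and> iprod I J = ints F"
proof -
  obtain m where m: "m > 0" "of_nat m \<in> I" using idl_contains_nat assms by blast
  obtain \<mu> :: "complex set \<Rightarrow> nat" and B where \<mu>: "\<And>I J. idl I \<Longrightarrow> idl J \<Longrightarrow> of_nat m \<in> I \<Longrightarrow> I \<subset> J \<Longrightarrow> \<mu> I < \<mu> J" "\<And>I. \<mu> I \<le> B"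
    using idl_measure[OF m(1)] by metis
  show ?thesis
    using assms(1) m(2)
  proof (induction "B - \<mu> I" arbitrary: I rule: less_induct)
    case less
    note I = idlD[OF less.prems(1)]
    have I0: "I \<noteq> {0}" using less.prems m(1) by auto
    show ?case
    proof (cases "1 \<in> I")
      case True
      then have "I = ints F" using I(1) I(4)[of _ 1] by auto
      then show ?thesis using frac_ints iprod_ints by blast
    next
      case False
      obtain Q where Q: "prime_idl Q" "I \<subseteq> Q" using exists_prime_above[OF less.prems(1) I0 False] .
      obtain w q r where w: "w \<in> F" "w \<notin> ints F" "\<And>q. q \<in> Q \<Longrightarrow> w * q \<in> ints F" "q \<in> Q" "r \<in> Q" "q + w * r = 1"
        using prime_idl_invertible[OF Q(1)] by metis
      note Qd = prime_idlD[OF Q(1)]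
      define Q' where "Q' = {a + b * w |a b. a \<in> ints F \<and> b \<in> ints F}"
      have mQ: "of_nat m \<in> Q" using less.prems(2) Q(2) by blast
      have "1 + 0 * w \<in> Q'" "0 + 1 * w \<in> Q'" unfolding Q'_def using F.ints_0 F.ints_1 by blast+
      then have Q'1: "1 \<in> Q'" "w \<in> Q'" by simp_all
      have Q'add: "x + y \<in> Q'" if xy: "x \<in> Q'" "y \<in> Q'" for x y
      proof -
        obtain a b c d where "x = a + b * w" "y = c + d * w" "a \<in> ints F" "b \<in> ints F" "c \<in> ints F" "d \<in> ints F"
          using xy unfolding Q'_def by blast
        then have "x + y = (a + c) + (b + d) * w" "a + c \<in> ints F" "b + d \<in> ints F" by (auto simp: algebra_simps)
        then show ?thesis unfolding Q'_def by blast
      qed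
      have Q'mult: "c * x \<in> Q'" if cx: "c \<in> ints F" "x \<in> Q'" for c x
      proof -
        obtain a b where "x = a + b * w" "a \<in> ints F" "b \<in> ints F"
          using cx(2) unfolding Q'_def by blast
        then have "c * x = c * a + (c * b) * w" "c * a \<in> ints F" "c * b \<in> ints F" using cx(1) by (auto simp: algebra_simps)
        then show ?thesis unfolding Q'_def by blast
      qed
      have QQ': "x * y \<in> ints F" if xy: "x \<in> Q'" "y \<in> Q" for x y
      proof -
        obtain a b where ab: "x = a + b * w" "a \<in> ints F" "b \<in> ints F"
          using xy(1) unfolding Q'_def by blast
        have "y \<in> ints F" using xy(2) idlD(1)[OF Qd(1)] by blast
        then have "a * y + b * (w * y) \<in> ints F" using ab w(3)[OF xy(2)] by auto
        then show ?thesis using ab(1) by (simp add: algebra_simps)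
      qed
      have fQ': "frac_idl Q'"
        unfolding frac_idl_def
      proof (intro conjI)
        show "Q' \<subseteq> F" using w(1) F.ints_F by (auto simp: Q'_def)
        show "0 \<in> Q'" using Q'mult[of 0 1] Q'1 by simp
        show "\<exists>x\<in>Q'. x \<noteq> 0" using Q'1 by (intro bexI[of _ 1]) auto
        show "\<exists>d\<in>ints F. d \<noteq> 0 \<and> (\<forall>x\<in>Q'. d * x \<in> ints F)"
        proof (intro bexI[of _ "of_nat m"] conjI ballI)
          show "of_nat m * x \<in> ints F" if "x \<in> Q'" for x using QQ'[OF that mQ] by (simp only: mult.commute)
        qed (use m(1) in auto)
      qed (use Q'add Q'mult in auto)
      define J where "J = iprod I Q'"
      have fJ: "frac_idl J" unfolding J_def using idl_imp_frac[OF less.prems(1) I0] fQ' by (rule frac_iprod)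
      have "J \<subseteq> ints F"
        unfolding J_def
      proof (rule iprod_least)
        show "i * j \<in> ints F" if "i \<in> I" "j \<in> Q'" for i j
          using QQ'[of j i] that Q(2) by (subst mult.commute) blast
      qed auto
      then have J: "idl J" unfolding idl_def using fracD[OF fJ] by blast
      have IJ: "I \<subseteq> J" unfolding J_def using iprodI[of _ I 1 Q'] Q'1 by auto
      have "I \<noteq> J"
      proof
        assume eq: "I = J"
        have "of_nat m * w ^ n \<in> I" for n
        proof (induction n)
          case (Suc n)
          then have "(of_nat m * w ^ n) * w \<in> I" using eq Q'1(2) unfolding J_def by (metis iprodI)
          then show ?case by (simp add: ac_simps)
        qed (use less.prems in simp)
        then have "algebraic_int (of_nat m * w ^ n)" for n using I(1) F.ints_F(2) by blast
        then have "algebraic_int w"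
          using almost_integral_imp_integral[of w "of_nat m"] w(1) F_sub m(1) by auto
        then show False using w by (auto simp: ints_def)
      qed
      then have "\<mu> I < \<mu> J" using \<mu>(1)[OF less.prems(1) J less.prems(2)] IJ by blast
      then have "B - \<mu> J < B - \<mu> I" using \<mu>(2)[of J] by linarith
      then obtain J' where J': "frac_idl J'" "iprod J J' = ints F"
        using less.hyps[OF _ J] IJ less.prems(2) by blast
      then have "iprod I (iprod Q' J') = ints F" by (simp add: J_def iprod_assoc)
      then show ?thesis using frac_iprod[OF fQ' J'(1)] by blast
    qed
  qed
qed

lemma scale_frac:
  assumes "frac_idl I" "c \<in> F" "c \<noteq> 0"
  shows "frac_idl ((\<lambda>x. c * x) ` I)"
proof -
  note I = fracD[OF assms(1)]
  obtain d where d: "d \<in> ints F" "d \<noteq> 0" "\<And>x. x \<in> I \<Longrightarrow> d * x \<in> ints F" using I(6) by blast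
  have "algebraic c" using assms(2) F_sub algebraic_M by blast
  then obtain n where n: "n > 0" "algebraic_int (of_nat n * c)" using algebraic_int_multiple by blast
  have nc: "of_nat n * c \<in> ints F" using n assms(2) by (auto simp: ints_def)
  show ?thesis
    unfolding frac_idl_def
  proof (intro conjI)
    show "(\<lambda>x. c * x) ` I \<subseteq> F" using assms I(1) by auto
    show "0 \<in> (\<lambda>x. c * x) ` I" using I(2) by force
    show "\<exists>x\<in>(\<lambda>x. c * x) ` I. x \<noteq> 0" using I(3) assms(3) by auto
    show "\<forall>x\<in>(\<lambda>x. c * x) ` I. \<forall>y\<in>(\<lambda>x. c * x) ` I. x + y \<in> (\<lambda>x. c * x) ` I"
      using I(4) by (auto simp flip: distrib_left)
    show "\<forall>a\<in>ints F. \<forall>x\<in>(\<lambda>x. c * x) ` I. a * x \<in> (\<lambda>x. c * x) ` I"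
      using I(5) by (auto simp: mult.left_commute)
    have "(of_nat n * d) * (c * x) \<in> ints F" if "x \<in> I" for x
    proof -
      have "(of_nat n * d) * (c * x) = (of_nat n * c) * (d * x)" by (simp add: algebra_simps)
      moreover have "(of_nat n * c) * (d * x) \<in> ints F" using nc d(3)[OF that] by (rule F.ints_mult)
      ultimately show ?thesis by (simp only:)
    qed
    then show "\<exists>d\<in>ints F. d \<noteq> 0 \<and> (\<forall>x\<in>(\<lambda>x. c * x) ` I. d * x \<in> ints F)"
      using d n(1) by (intro bexI[of _ "of_nat n * d"]) auto
  qed
qed

lemma iprod_image_scale: "iprod ((\<lambda>x. c * x) ` I) J = (\<lambda>x. c * x) ` iprod I J"
proof
  show "iprod ((\<lambda>x. c * x) ` I) J \<subseteq> (\<lambda>x. c * x) ` iprod I J"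
  proof (rule iprod_least)
    show "i * j \<in> (\<lambda>x. c * x) ` iprod I J" if "i \<in> (\<lambda>x. c * x) ` I" "j \<in> J" for i j
      using that iprodI[of _ I j J] by (auto simp: mult.assoc)
    show "a + b \<in> (\<lambda>x. c * x) ` iprod I J" if "a \<in> (\<lambda>x. c * x) ` iprod I J" "b \<in> (\<lambda>x. c * x) ` iprod I J" for a b
      using that iprod_add by (auto simp flip: distrib_left)
  qed
  show "(\<lambda>x. c * x) ` iprod I J \<subseteq> iprod ((\<lambda>x. c * x) ` I) J"
    using iprod_scale[of I c "(\<lambda>x. c * x) ` I" _ J] by blast
qed

lemma frac_invertible:
  assumes "frac_idl I" shows "\<exists>J. frac_idl J \<and> iprod I J = ints F"
proof -
  note I = fracD[OF assms]
  obtain d where d: "d \<in> ints F" "d \<noteq> 0" "\<And>x. x \<in> I \<Longrightarrow> d * x \<in> ints F" using I(6) by blast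
  have dF: "d \<in> F" using d F.ints_F by blast
  have f: "frac_idl ((\<lambda>x. d * x) ` I)" using scale_frac[OF assms dF d(2)] .
  have "idl ((\<lambda>x. d * x) ` I)"
    unfolding idl_def using fracD(2,4,5)[OF f] d(3) by blast
  then obtain J where J: "frac_idl J" "iprod ((\<lambda>x. d * x) ` I) J = ints F"
    using idl_invertible fracD(3)[OF f] by blast
  have "iprod I ((\<lambda>x. d * x) ` J) = iprod ((\<lambda>x. d * x) ` J) I" by (rule iprod_comm)
  also have "\<dots> = (\<lambda>x. d * x) ` iprod I J" by (simp only: iprod_image_scale iprod_comm[of J])
  also have "\<dots> = ints F" using J(2) by (simp only: iprod_image_scale)
  finally show ?thesis using scale_frac[OF J(1) dF d(2)] by blast
qed

abbreviation "FG \<equiv> fractional_ideal_group F"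

lemma FG_simps [simp]: "carrier FG = {I. frac_idl I}" "I \<otimes>\<^bsub>FG\<^esub> J = iprod I J" "\<one>\<^bsub>FG\<^esub> = ints F"
  by (simp_all add: fractional_ideal_group_def fractional_ideals_eq)

lemma comm_group_FG: "comm_group FG"
proof (rule comm_groupI)
  show "\<exists>J\<in>carrier FG. J \<otimes>\<^bsub>FG\<^esub> I = \<one>\<^bsub>FG\<^esub>" if "I \<in> carrier FG" for I
    using frac_invertible[of I] that iprod_comm[of I] by auto
  show "I \<otimes>\<^bsub>FG\<^esub> J = J \<otimes>\<^bsub>FG\<^esub> I" for I J by (simp add: iprod_comm[of I])
qed (auto simp: frac_iprod frac_ints iprod_assoc iprod_ints)

abbreviation principal :: "complex \<Rightarrow> complex set"
  where "principal x \<equiv> (\<lambda>a. x * a) ` ints F"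

lemma principal_iff: "y \<in> principal x \<longleftrightarrow> y / x \<in> ints F" if "x \<noteq> 0"
  using that by (auto simp: image_iff intro!: bexI[of _ "y / x"])

lemma subgroup_principal: "subgroup (principal_fractional_ideals F) FG"
proof (rule group.subgroupI)
  show "group FG" using comm_group_FG by (rule comm_group.axioms(2))
  have fr: "frac_idl (principal x)" if "x \<in> F" "x \<noteq> 0" for x using scale_frac[OF frac_ints that] .
  then show "principal_fractional_ideals F \<subseteq> carrier FG" by (auto simp: principal_fractional_ideals_def)
  have mult: "iprod (principal x) (principal y) = principal (x * y)" if "y \<in> F" "y \<noteq> 0" for x y
    by (simp add: iprod_image_scale iprod_ints[OF fr[OF that]] image_image mult.assoc)
  show "principal_fractional_ideals F \<noteq> {}"
    by (auto simp: principal_fractional_ideals_def intro: exI[of _ 1])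
  show "I \<otimes>\<^bsub>FG\<^esub> J \<in> principal_fractional_ideals F"
    if IJ: "I \<in> principal_fractional_ideals F" "J \<in> principal_fractional_ideals F" for I J
  proof -
    obtain x y where "I = principal x" "J = principal y" "x \<in> F" "y \<in> F" "x \<noteq> 0" "y \<noteq> 0"
      using IJ by (auto simp: principal_fractional_ideals_def)
    then show ?thesis using mult[of y x] by (auto simp: principal_fractional_ideals_def intro!: exI[of _ "x * y"])
  qed
  show "inv\<^bsub>FG\<^esub> I \<in> principal_fractional_ideals F" if I: "I \<in> principal_fractional_ideals F" for I
  proof -
    obtain x where x: "I = principal x" "x \<in> F" "x \<noteq> 0" using I by (auto simp: principal_fractional_ideals_def)
    have "iprod (principal (inverse x)) I = ints F" using mult[OF x(2,3), of "inverse x"] x by simp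
    then have "inv\<^bsub>FG\<^esub> I = principal (inverse x)"
      using x fr F.inverse_F by (intro group.inv_equality[OF \<open>group FG\<close>]) auto
    then show ?thesis using x(2,3) F.inverse_F
      by (auto simp: principal_fractional_ideals_def intro!: exI[of _ "inverse x"])
  qed
qed

text \<open>The order of the class of \<open>J\<close> divides \<open>p\<close> and the order of the
  class group, so it is 1. An infinite group has \<open>Coset.order\<close> 0, which
  \<open>p\<close> divides; the hypothesis therefore includes finiteness.\<close>

lemma principal_of_power_principal:
  assumes p: "prime p" "\<not> p dvd Coset.order (class_group F)"
    and J: "frac_idl J" "J [^]\<^bsub>FG\<^esub> p = principal c" "c \<in> F" "c \<noteq> 0"
  obtains b where "b \<in> F" "b \<noteq> 0" "J = principal b"
proof -
  interpret FG: comm_group FG by (rule comm_group_FG)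
  let ?P = "principal_fractional_ideals F"
  have sub: "subgroup ?P FG" by (rule subgroup_principal)
  have "normal ?P FG" using sub FG.normal_iff_subgroup by blast
  then interpret N: normal ?P FG .
  interpret Cl: group "class_group F" unfolding class_group_def by (rule N.factorgroup_is_group)
  interpret h: group_hom FG "class_group F" "\<lambda>a. ?P #>\<^bsub>FG\<^esub> a"
    unfolding group_hom_def group_hom_axioms_def class_group_def
    using N.r_coset_hom_Mod N.factorgroup_is_group FG.is_group by blast
  have one: "\<one>\<^bsub>class_group F\<^esub> = ?P" by (simp add: class_group_def FactGroup_def)
  let ?x = "?P #>\<^bsub>FG\<^esub> J"
  have JG: "J \<in> carrier FG" using J by simp
  have x: "?x \<in> carrier (class_group F)" using JG by (rule h.hom_closed)
  have "J [^]\<^bsub>FG\<^esub> p \<in> ?P" using J by (auto simp: principal_fractional_ideals_def)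
  then have "?P #>\<^bsub>FG\<^esub> (J [^]\<^bsub>FG\<^esub> p) = ?P" by (intro FG.coset_join2 sub FG.nat_pow_closed JG)
  then have "?x [^]\<^bsub>class_group F\<^esub> p = \<one>\<^bsub>class_group F\<^esub>" using h.hom_nat_pow[OF JG, of p] one by simp
  then have "Cl.ord ?x dvd p" using Cl.pow_eq_id[OF x] by blast
  moreover have "Cl.ord ?x dvd Coset.order (class_group F)"
    using Cl.pow_order_eq_1[OF x] Cl.pow_eq_id[OF x] by blast
  ultimately have "Cl.ord ?x = 1" using p by (metis prime_nat_iff)
  then have "?x = ?P" using Cl.ord_eq_1[OF x] one by simp
  then have "J \<in> ?P" using FG.coset_join1[of ?P J] JG sub by (auto dest: subgroup.subset)
  then show ?thesis using that by (auto simp: principal_fractional_ideals_def)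
qed

end


subsection \<open>Units of relative norm one\<close>

context unramified_cyclic
begin

lemma iprod_difference_list:
  assumes "x \<in> iprod R {w y - y |y. y \<in> R}" "\<And>a. a \<in> R \<Longrightarrow> - a \<in> R"
  shows "\<exists>l. set l \<subseteq> R \<times> R \<and> (\<Sum>(a, b)\<leftarrow>l. a * (b - w b)) = x"
  using assms(1)
proof (induction rule: ideal_prod.induct)
  case (prod i j)
  then obtain y where y: "j = w y - y" "y \<in> R" by blast
  then show ?case using prod(1) assms(2) by (intro exI[of _ "[(- i, y)]"]) (auto simp: y(1) right_diff_distrib)
next
  case (sum a b)
  then obtain k l where "set k \<subseteq> R \<times> R" "set l \<subseteq> R \<times> R"
    "(\<Sum>(a, b)\<leftarrow>k. a * (b - w b)) = a" "(\<Sum>(a, b)\<leftarrow>l. a * (b - w b)) = b" by blast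
  then show ?case by (intro exI[of _ "k @ l"]) auto
qed

text \<open>Descent from \<open>M\<close>: a prime \<open>q\<close> of \<open>H\<close> containing
  all differences has a nonintegral \<open>v\<close> with \<open>v * q\<close> integral. Since the
  differences generate 1 over \<open>ints M\<close>, the element \<open>v\<close> itself would be
  integral.\<close>

lemma moved_generate_unit_ideal_H:
  assumes w: "w \<in> W" "w \<notin> U"
  shows "1 \<in> iprod (ints H) {w x - x |x. x \<in> ints H}"
proof (rule ccontr)
  let ?D = "{w x - x |x. x \<in> ints H}"
  assume n: "1 \<notin> iprod (ints H) ?D"
  have wG: "w \<in> carrier G" using w W_G by blast
  have wH: "w x \<in> ints H" if "x \<in> ints H" for x
    using that W_act_H[OF w(1)] wG gal_algebraic_int by (auto simp: ints_def H_M)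
  have "0 \<in> ?D" by (intro CollectI exI[of _ 0]) (simp add: gal_zero wG)
  then have "0 * 0 \<in> iprod (ints H) ?D" by (intro iprodI) auto
  moreover have "iprod (ints H) ?D \<subseteq> ints H" using wH by (intro iprod_least) auto
  moreover have "a * x \<in> iprod (ints H) ?D" if "a \<in> ints H" "x \<in> iprod (ints H) ?D" for a x
    using iprod_scale[of "ints H" a "ints H" x ?D] that by blast
  ultimately have I: "H.idl (iprod (ints H) ?D)" unfolding H.idl_def using iprod_add by auto
  note one = moved_generate_unit_ideal_M[OF w]
  have DI: "?D \<subseteq> iprod (ints H) ?D" using iprodI[of 1 "ints H" _ ?D] by auto
  have "iprod (ints H) ?D \<noteq> {0}"
  proof
    assume "iprod (ints H) ?D = {0}"
    then have "iprod (ints M) ?D \<subseteq> {0}" using DI by (intro iprod_least) auto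
    then show False using one by auto
  qed
  then obtain q where q: "H.prime_idl q" "iprod (ints H) ?D \<subseteq> q"
    using H.exists_prime_above[OF I _ n] by blast
  obtain v where v: "v \<in> H" "v \<notin> ints H" "\<And>x. x \<in> q \<Longrightarrow> v * x \<in> ints H"
    using H.prime_idl_colon[OF q(1)] by metis
  have "iprod (ints M) ?D \<subseteq> {x. v * x \<in> ints M}"
  proof (rule iprod_least)
    fix i j assume "i \<in> ints M" "j \<in> ?D"
    then have "v * j \<in> ints M" using v(3) q(2) DI H.ints_FM by blast
    then have "i * (v * j) \<in> ints M" using \<open>i \<in> ints M\<close> by blast
    then show "i * j \<in> {x. v * x \<in> ints M}" by (simp add: mult.left_commute)
  qed (auto simp: distrib_left)
  then have "v \<in> ints M" using one by auto
  then show False using v by (auto simp: ints_def)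
qed

text \<open>A dual basis with integral entries says that the trace form of \<open>H/K\<close> is
  unimodular on integers, that is, \<open>H/K\<close> is unramified. The descent arguments below use
  ramification in this form.\<close>

lemma relative_dual_basis:
  obtains l where "set l \<subseteq> ints H \<times> ints H" "(\<Sum>(x, y)\<leftarrow>l. x * y) = 1"
    "\<And>k. k \<in> {1..<p} \<Longrightarrow> (\<Sum>(x, y)\<leftarrow>l. x * (s ^^ k) y) = 0"
proof -
  let ?S = "(\<lambda>k. s ^^ k) ` {1..<p}"
  have sG: "s \<in> carrier G" using s W_G by blast
  have "\<exists>l. set l \<subseteq> ints H \<times> ints H \<and> (\<Sum>(x, y)\<leftarrow>l. x * y) = 1 \<and> (\<forall>g\<in>?S. (\<Sum>(x, y)\<leftarrow>l. x * g y) = 0)"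
  proof (rule dual_basis_exists)
    fix g assume "g \<in> ?S"
    then obtain k where k: "k \<in> {1..<p}" "g = s ^^ k" by blast
    let ?w = "s [^]\<^bsub>G\<^esub> k"
    have wW: "?w \<in> W" using s by blast
    have "\<not> int p dvd int k" using k(1) by (auto dest: dvd_imp_le)
    then have "?w \<notin> U" using \<psi>_s_pow[of k] cong_dvd_iff[of "\<psi> ?w" "int k" "int p"] by (auto simp: U_def)
    then have "1 \<in> iprod (ints H) {?w x - x |x. x \<in> ints H}" using moved_generate_unit_ideal_H wW by blast
    also have "{?w x - x |x. x \<in> ints H} = {g x - x |x. x \<in> ints H}"
      using act_pow[OF sG, of _ k] k(2) H.F.ints_F(1) H_M by metis
    finally show "\<exists>l. set l \<subseteq> ints H \<times> ints H \<and> (\<Sum>(a, b)\<leftarrow>l. a * (b - g b)) = 1"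
      using iprod_difference_list H.F.ints_uminus by blast
  next
    fix g x y assume "g \<in> ?S" "x \<in> ints H" "y \<in> ints H"
    then show "g (x * y) = g x * g y" using funpow_hom(1)[OF sG] H.F.ints_F(1) H_M by auto
  next
    fix g assume "g \<in> ?S"
    moreover have "(s ^^ k) 1 = 1" for k by (induction k) (auto simp: gal_one sG)
    ultimately show "g 1 = 1" by auto
  qed (use s_ints_H in auto)
  then show ?thesis using that by (force simp: image_iff)
qed

section \<open>Units of \<open>H\<close>, conjugates and the relative norm\<close>

definition units :: "complex set \<Rightarrow> complex set"
  where "units F = {x \<in> ints F. x \<noteq> 0 \<and> inverse x \<in> ints F}"

definition rnorm :: "complex \<Rightarrow> complex" where "rnorm x = (\<Prod>i<p. (s ^^ i) x)"

lemma funpow_inverse: "x \<in> M \<Longrightarrow> (s ^^ i) (inverse x) = inverse ((s ^^ i) x)"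
  by (induction i) (auto simp: gal_inverse funpow_mem W_G s(1))

lemma funpow_s_mult: "x \<in> M \<Longrightarrow> y \<in> M \<Longrightarrow> (s ^^ i) (x * y) = (s ^^ i) x * (s ^^ i) y"
  using funpow_hom(1)[OF W_G[OF s(1)]] .

lemma units_mult: "x \<in> units H \<Longrightarrow> y \<in> units H \<Longrightarrow> x * y \<in> units H"
  and units_inverse: "x \<in> units H \<Longrightarrow> inverse x \<in> units H"
  by (auto simp: units_def)

lemma units_H_M: "x \<in> units H \<Longrightarrow> x \<in> M" "x \<in> units H \<Longrightarrow> x \<in> H"
  by (auto simp: units_def ints_def H_M)

lemma funpow_s_one: "(s ^^ i) 1 = 1"
  by (induction i) (auto simp: gal_one W_G s(1))

lemma units_s: assumes "x \<in> units H" shows "(s ^^ i) x \<in> units H"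
proof -
  have x: "x \<in> ints H" "inverse x \<in> ints H" "x \<in> M" "x \<noteq> 0" using assms units_H_M by (auto simp: units_def)
  then have "(s ^^ i) x * (s ^^ i) (inverse x) = 1"
    by (simp add: M.inverse_F funpow_s_one flip: funpow_s_mult)
  then have "(s ^^ i) x \<noteq> 0" by auto
  then show ?thesis using s_ints_H[OF x(1)] s_ints_H[OF x(2)] funpow_inverse[OF x(3)] by (simp add: units_def)
qed

lemma trace_H_K:
  assumes "x \<in> H" shows "(\<Sum>k<p. (s ^^ k) x) \<in> K" "(\<Prod>k<p. (s ^^ k) x) \<in> K"
  using assms orbit_fixed[OF W_G[OF s(1)], of x p] s_pow_p H_M
  by (auto intro!: s_fixed_K H.F.sum_F H.F.prod_F)

end


lemma iprod_interchange: "iprod (iprod A B) (iprod C D) = iprod (iprod A C) (iprod B D)"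
proof -
  have "iprod B (iprod C D) = iprod C (iprod B D)"
    by (simp only: iprod_assoc[symmetric] iprod_comm[of B C])
  then show ?thesis by (simp only: iprod_assoc)
qed

context unramified_cyclic
begin

lemma s_G: "s \<in> carrier G"
  using s W_G by blast

lemma p_gt_0: "p > 0" and p_ge_3: "p \<ge> 3"
proof -
  have "p \<noteq> 2" using p(2) by auto
  then show "p > 0" "p \<ge> 3" using prime_ge_2_nat[OF p(1)] by auto
qed

lemma ints_H_M: "x \<in> ints H \<Longrightarrow> x \<in> H" "x \<in> ints H \<Longrightarrow> x \<in> M" "x \<in> ints H \<Longrightarrow> x \<in> ints M"
  by (auto simp: ints_def H_M)

text \<open>The resolvent \<open>B y\<close> of an integer \<open>y\<close> satisfies the required
  equation, and the integral dual basis shows that it is nonzero for some \<open>y\<close>: the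
  combination of the \<open>B y\<close> with coefficients \<open>x\<close> equals 1.\<close>

lemma hilbert_90:
  assumes \<epsilon>: "\<epsilon> \<in> units H" "rnorm \<epsilon> = 1"
  obtains \<beta> where "\<beta> \<in> ints H" "\<beta> \<noteq> 0" "\<beta> = \<epsilon> * s \<beta>"
proof -
  obtain l where l: "set l \<subseteq> ints H \<times> ints H" "(\<Sum>(x, y)\<leftarrow>l. x * y) = 1"
    "\<And>k. k \<in> {1..<p} \<Longrightarrow> (\<Sum>(x, y)\<leftarrow>l. x * (s ^^ k) y) = 0"
    using relative_dual_basis by blast
  \<comment> \<open>Partial norms of \<open>\<epsilon>\<close>: they satisfy
    \<open>c (Suc k) = \<epsilon> * s (c k)\<close>, and the cycle closes with
    \<open>c p = 1\<close> because the norm is 1.\<close>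
  define c where "c k = (\<Prod>i<k. (s ^^ i) \<epsilon>)" for k
  define B where "B y = (\<Sum>k<p. c k * (s ^^ k) y)" for y
  have \<epsilon>H: "\<epsilon> \<in> ints H" "\<epsilon> \<in> M" using \<epsilon>(1) units_H_M by (auto simp: units_def)
  have cH: "c k \<in> ints H" for k unfolding c_def using s_ints_H[OF \<epsilon>H(1)] by (rule H.F.ints_prod)
  have cM: "c k \<in> M" for k using ints_H_M(2)[OF cH] .
  have c_Suc: "c (Suc k) = \<epsilon> * s (c k)" for k
    unfolding c_def prod.lessThan_Suc_shift using s_G \<epsilon>H by (simp add: gal_prod funpow_mem)
  have cp: "c p = 1" "c 0 = 1" using \<epsilon>(2) by (simp_all add: c_def rnorm_def)
  have BH: "B y \<in> ints H" if "y \<in> ints H" for y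
    unfolding B_def using cH s_ints_H[OF that] by (intro H.F.ints_sum H.F.ints_mult)
  have Beq: "B y = \<epsilon> * s (B y)" if y: "y \<in> ints H" for y
  proof -
    have yM: "(s ^^ k) y \<in> M" for k using ints_H_M(2)[OF s_ints_H[OF y]] .
    have "s (B y) = (\<Sum>k<p. s (c k) * (s ^^ Suc k) y)"
      unfolding B_def using s_G cM yM by (simp add: gal_sum gal_mult M.mult_F)
    then have "\<epsilon> * s (B y) = (\<Sum>k<p. c (Suc k) * (s ^^ Suc k) y)"
      by (simp add: sum_distrib_left c_Suc mult.assoc)
    moreover have "(\<Sum>k<p. c (Suc k) * (s ^^ Suc k) y) + c 0 * (s ^^ 0) y = (\<Sum>k<Suc p. c k * (s ^^ k) y)"
      by (simp only: sum.lessThan_Suc_shift add.commute)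
    moreover have "(\<Sum>k<Suc p. c k * (s ^^ k) y) = B y + y"
      using s_pow_p[OF ints_H_M(1)[OF y]] by (simp add: B_def cp)
    ultimately show ?thesis using cp by simp
  qed
  have "(\<Sum>(x, y)\<leftarrow>l. x * B y) = (\<Sum>a\<leftarrow>l. \<Sum>k<p. c k * (fst a * (s ^^ k) (snd a)))"
    by (rule arg_cong[of _ _ sum_list], rule map_cong) (auto simp: B_def sum_distrib_left mult.left_commute)
  also have "\<dots> = (\<Sum>k<p. c k * (\<Sum>a\<leftarrow>l. fst a * (s ^^ k) (snd a)))"
    by (simp add: sum_list_sum_swap sum_list_const_mult)
  also have "\<dots> = (\<Sum>k<p. if k = 0 then 1 else 0)"
  proof (intro sum.cong refl)
    fix k assume "k \<in> {..<p}"
    then have "(\<Sum>a\<leftarrow>l. fst a * (s ^^ k) (snd a)) = (if k = 0 then 1 else 0)"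
      using l(2) l(3)[of k] by (cases "k = 0") (auto simp: case_prod_unfold)
    then show "c k * (\<Sum>a\<leftarrow>l. fst a * (s ^^ k) (snd a)) = (if k = 0 then 1 else 0)" using cp by simp
  qed
  also have "\<dots> = 1" using p_gt_0 by simp
  finally have sum1: "(\<Sum>(x, y)\<leftarrow>l. x * B y) = 1" .
  have "\<exists>y\<in>ints H. B y \<noteq> 0"
  proof (rule ccontr)
    assume "\<not> ?thesis"
    then have "\<And>a. a \<in> set l \<Longrightarrow> (case a of (x, y) \<Rightarrow> x * B y) = 0" using l(1) by auto
    then have "map (\<lambda>(x, y). x * B y) l = map (\<lambda>_. 0) l" by (rule map_cong[OF refl])
    then have "(\<Sum>(x, y)\<leftarrow>l. x * B y) = (\<Sum>_\<leftarrow>l. 0)" by (simp only:)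
    then show False using sum1 by simp
  qed
  then obtain y where "y \<in> ints H" "B y \<noteq> 0" by blast
  then show ?thesis using that[of "B y"] BH Beq by blast
qed

lemma ints_H_K: "x \<in> ints H \<Longrightarrow> x \<in> K \<Longrightarrow> x \<in> ints K"
  by (auto simp: ints_def)

lemma ints_K_H: "x \<in> ints K \<Longrightarrow> x \<in> ints H"
  using K_H by (auto simp: ints_def)

text \<open>
  The ideal of \<open>H\<close> generated by \<open>\<beta>\<close> is invariant, so it descends to an ideal \<open>J\<close> of \<open>K\<close>, whose
  \<open>p\<close>-th power is generated by the norm of \<open>\<beta>\<close>. As \<open>p\<close> does not divide the class number, \<open>J\<close> is
  principal.
\<close>

lemma norm_one_unit:
  assumes reg: "\<not> p dvd Coset.order (class_group K)" and \<epsilon>: "\<epsilon> \<in> units H" "rnorm \<epsilon> = 1"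
  obtains \<eta> where "\<eta> \<in> units H" "\<epsilon> = \<eta> / s \<eta>"
proof -
  obtain \<beta> where \<beta>: "\<beta> \<in> ints H" "\<beta> \<noteq> 0" "\<beta> = \<epsilon> * s \<beta>" using hilbert_90[OF \<epsilon>] by metis
  have \<beta>H: "\<beta> \<in> H" "\<beta> \<in> M" using \<beta> ints_H_M by auto
  have sp: "\<exists>v\<in>units H. (s ^^ i) \<beta> = \<beta> * v" for i
  proof (induction i)
    case 0
    then show ?case by (intro bexI[of _ 1]) (auto simp: units_def)
  next
    case (Suc i)
    then obtain v where v: "v \<in> units H" "(s ^^ i) \<beta> = \<beta> * v" by blast
    have "(s ^^ Suc i) \<beta> = s \<beta> * s v" using v s_G \<beta>H units_H_M by (simp add: gal_mult)
    also have "s \<beta> = \<beta> * inverse \<epsilon>"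
      using \<beta>(3) \<epsilon>(1) by (simp add: units_def field_simps)
    finally have "(s ^^ Suc i) \<beta> = \<beta> * (inverse \<epsilon> * s v)" by (simp add: mult.assoc)
    moreover have "inverse \<epsilon> * s v \<in> units H"
      using units_mult[OF units_inverse[OF \<epsilon>(1)] units_s[OF v(1), of 1]] by simp
    ultimately show ?case by blast
  qed
  define J where "J = {x \<in> K. x / \<beta> \<in> ints H}"
  have JK: "J \<subseteq> ints K"
  proof
    fix x assume "x \<in> J"
    then have "x \<in> K" "x / \<beta> \<in> ints H" by (auto simp: J_def)
    then have x: "x \<in> K" "x / \<beta> * \<beta> \<in> ints H" using H.F.ints_mult[OF _ \<beta>(1)] by blast+
    then show "x \<in> ints K" using \<beta>(2) ints_H_K by simp
  qed
  have fJ: "K.frac_idl J"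
    unfolding K.frac_idl_def
  proof (intro conjI ballI)
    show "J \<subseteq> K" "0 \<in> J" by (auto simp: J_def)
    obtain m y where m: "m > 0" "y \<in> ints M" "of_nat m = \<beta> * y"
      using norm_nat_multiple[OF ints_H_M(3)[OF \<beta>(1)] \<beta>(2)] by metis
    have "y = of_nat m / \<beta>" using m \<beta>(2) by (simp add: field_simps)
    then have "of_nat m / \<beta> \<in> ints H" using m(2) H.F.divide_F[OF H.F.of_nat_F \<beta>H(1)] by (auto simp: ints_def)
    then have "of_nat m \<in> J" by (simp add: J_def)
    then show "\<exists>x\<in>J. x \<noteq> 0" using m(1) by (intro bexI[of _ "of_nat m"]) auto
    show "x + y \<in> J" if "x \<in> J" "y \<in> J" for x y using that by (auto simp: J_def add_divide_distrib)
    show "a * x \<in> J" if a: "a \<in> ints K" "x \<in> J" for a x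
    proof -
      have "a * (x / \<beta>) \<in> ints H" using a ints_K_H by (intro H.F.ints_mult) (auto simp: J_def)
      moreover have "a * x \<in> K" using a K.F.ints_F(1) by (auto simp: J_def)
      ultimately show ?thesis by (simp add: J_def)
    qed
    show "\<exists>d\<in>ints K. d \<noteq> 0 \<and> (\<forall>x\<in>J. d * x \<in> ints K)" using JK by (intro bexI[of _ 1]) auto
  qed
  \<comment> \<open>Galois descent of the ideal generated by \<open>\<beta>\<close>: the traces of
    \<open>y * \<beta>\<close> lie in \<open>J\<close>, as all conjugates of \<open>\<beta>\<close>
    are associated to it, and the dual basis recombines these traces to
    \<open>\<beta>\<close>.\<close>
  have \<beta>J: "\<beta> \<in> iprod J (ints H)"
  proof -
    obtain l where l: "set l \<subseteq> ints H \<times> ints H" "(\<Sum>(x, y)\<leftarrow>l. x * y) = 1"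
      "\<And>k. k \<in> {1..<p} \<Longrightarrow> (\<Sum>(x, y)\<leftarrow>l. x * (s ^^ k) y) = 0"
      using relative_dual_basis by blast
    define t where "t y = (\<Sum>k<p. (s ^^ k) (y * \<beta>))" for y
    have "(\<Sum>(x, y)\<leftarrow>l. t y * x) = (\<Sum>a\<leftarrow>l. \<Sum>k<p. (s ^^ k) \<beta> * (fst a * (s ^^ k) (snd a)))"
    proof (rule arg_cong[of _ _ sum_list], rule map_cong[OF refl])
      fix a assume "a \<in> set l"
      then have "snd a \<in> ints H" using l(1) by auto
      then have "snd a \<in> M" by (rule ints_H_M)
      then have "t (snd a) = (\<Sum>k<p. (s ^^ k) (snd a) * (s ^^ k) \<beta>)"
        unfolding t_def using \<beta>H(2) by (simp add: funpow_s_mult)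
      then have "t (snd a) * fst a = (\<Sum>k<p. (s ^^ k) (snd a) * (s ^^ k) \<beta> * fst a)"
        by (simp only: sum_distrib_right)
      also have "\<dots> = (\<Sum>k<p. (s ^^ k) \<beta> * (fst a * (s ^^ k) (snd a)))"
        by (intro sum.cong refl) (simp only: ac_simps)
      finally show "(case a of (x, y) \<Rightarrow> t y * x) = (\<Sum>k<p. (s ^^ k) \<beta> * (fst a * (s ^^ k) (snd a)))"
        by (simp only: case_prod_unfold)
    qed
    also have "\<dots> = (\<Sum>k<p. (s ^^ k) \<beta> * (\<Sum>a\<leftarrow>l. fst a * (s ^^ k) (snd a)))"
      by (simp add: sum_list_sum_swap sum_list_const_mult)
    also have "\<dots> = (\<Sum>k<p. if k = 0 then \<beta> else 0)"
    proof (intro sum.cong refl)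
      fix k assume "k \<in> {..<p}"
      then have "(\<Sum>a\<leftarrow>l. fst a * (s ^^ k) (snd a)) = (if k = 0 then 1 else 0)"
        using l(2) l(3)[of k] by (cases "k = 0") (auto simp: case_prod_unfold)
      then show "(s ^^ k) \<beta> * (\<Sum>a\<leftarrow>l. fst a * (s ^^ k) (snd a)) = (if k = 0 then \<beta> else 0)" by simp
    qed
    also have "\<dots> = \<beta>" using p_gt_0 by simp
    finally have eq: "(\<Sum>(x, y)\<leftarrow>l. t y * x) = \<beta>" .
    have tJ: "t y \<in> J" if y: "y \<in> ints H" for y
    proof -
      have "t y \<in> K" unfolding t_def using y \<beta>H ints_H_M(1) by (intro trace_H_K H.F.mult_F)
      moreover have "t y / \<beta> \<in> ints H"
      proof -
        have "(s ^^ k) (y * \<beta>) / \<beta> \<in> ints H" for k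
        proof -
          obtain v where v: "v \<in> units H" "(s ^^ k) \<beta> = \<beta> * v" using sp by blast
          have "(s ^^ k) (y * \<beta>) / \<beta> = (s ^^ k) y * v"
            using v \<beta>(2) \<beta>H ints_H_M(2)[OF y] by (simp add: funpow_s_mult)
          then show ?thesis using s_ints_H[OF y] v by (auto simp: units_def)
        qed
        then show ?thesis unfolding t_def sum_divide_distrib by (rule H.F.ints_sum)
      qed
      ultimately show ?thesis by (simp add: J_def)
    qed
    have "0 * 0 \<in> iprod J (ints H)" by (intro iprodI) (auto simp: J_def)
    then have "(\<Sum>(x, y)\<leftarrow>l. t y * x) \<in> iprod J (ints H)"
      using l(1) tJ by (intro sum_list_mem_closed) (auto intro: iprodI iprod_add)
    then show ?thesis using eq by simp
  qed
  interpret FG: comm_group K.FG by (rule K.comm_group_FG)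
  have J: "J \<in> carrier K.FG" using fJ by simp
  have pow_sub: "x / \<beta> ^ n \<in> ints H" if "x \<in> J [^]\<^bsub>K.FG\<^esub> n" for n x
    using that
  proof (induction n arbitrary: x)
    case (Suc n)
    then have "x \<in> iprod (J [^]\<^bsub>K.FG\<^esub> n) J" by simp
    also have "\<dots> \<subseteq> {x. x / \<beta> ^ Suc n \<in> ints H}"
    proof (rule iprod_least)
      fix i j assume "i \<in> J [^]\<^bsub>K.FG\<^esub> n" "j \<in> J"
      then have "(i / \<beta> ^ n) * (j / \<beta>) \<in> ints H" using Suc.IH by (intro H.F.ints_mult) (auto simp: J_def)
      then show "i * j \<in> {x. x / \<beta> ^ Suc n \<in> ints H}" by (simp add: mult.commute)
    qed (auto simp: add_divide_distrib)
    finally show ?case by simp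
  qed (use ints_K_H in simp)
  have pow_mem: "\<beta> ^ n \<in> iprod (J [^]\<^bsub>K.FG\<^esub> n) (ints H)" for n
  proof (induction n)
    case 0
    show ?case using iprodI[of 1 "ints K" 1 "ints H"] by simp
  next
    case (Suc n)
    have "\<beta> ^ n * \<beta> \<in> iprod (iprod (J [^]\<^bsub>K.FG\<^esub> n) (ints H)) (iprod J (ints H))"
      using Suc \<beta>J by (rule iprodI)
    also have "\<dots> = iprod (iprod (J [^]\<^bsub>K.FG\<^esub> n) J) (iprod (ints H) (ints H))"
      by (rule iprod_interchange)
    also have "\<dots> \<subseteq> iprod (iprod (J [^]\<^bsub>K.FG\<^esub> n) J) (ints H)"
      by (intro iprod_mono order_refl iprod_least) auto
    finally show ?case by (simp add: mult.commute)
  qed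
  define Jp where "Jp = J [^]\<^bsub>K.FG\<^esub> p"
  have fJp: "K.frac_idl Jp" using FG.nat_pow_closed[OF J, of p] by (simp add: Jp_def)
  define N where "N = rnorm \<beta>"
  have NK: "N \<in> K" unfolding N_def rnorm_def using \<beta>H(1) by (rule trace_H_K)
  have "\<exists>v\<in>units H. (\<Prod>i<n. (s ^^ i) \<beta>) = \<beta> ^ n * v" for n
  proof (induction n)
    case 0
    show ?case by (intro bexI[of _ 1]) (auto simp: units_def)
  next
    case (Suc n)
    then obtain v where v: "v \<in> units H" "(\<Prod>i<n. (s ^^ i) \<beta>) = \<beta> ^ n * v" by blast
    obtain w where w: "w \<in> units H" "(s ^^ n) \<beta> = \<beta> * w" using sp by blast
    show ?case using v w units_mult[OF v(1) w(1)] by (intro bexI[of _ "v * w"]) auto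
  qed
  then obtain v where v: "v \<in> units H" "N = \<beta> ^ p * v" unfolding N_def rnorm_def by blast
  have v0: "v \<noteq> 0" "v \<in> ints H" "inverse v \<in> ints H" using v by (auto simp: units_def)
  have N0: "N \<noteq> 0" using v v0 \<beta>(2) by simp
  have Jp_N: "Jp = K.principal N"
  proof
    show "Jp \<subseteq> K.principal N"
    proof
      fix x assume x: "x \<in> Jp"
      have "x / N = x / \<beta> ^ p * inverse v" using v by (simp add: field_simps)
      moreover have "x / \<beta> ^ p * inverse v \<in> ints H" using pow_sub[of x p] x v0 by (intro H.F.ints_mult) (auto simp: Jp_def)
      ultimately have "x / N \<in> ints H" by (simp only:)
      moreover have "x / N \<in> K" using K.fracD(1)[OF fJp x] NK by auto
      ultimately have "x / N \<in> ints K" using ints_H_K by blast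
      then show "x \<in> K.principal N" using K.principal_iff[OF N0] by blast
    qed
    \<comment> \<open>To place \<open>N\<close> in \<open>Jp\<close> it suffices that
      \<open>N\<close> maps the inverse \<open>D\<close> into \<open>ints K\<close>; this holds over
      \<open>ints H\<close>, where \<open>Jp\<close> generates the same ideal as
      \<open>N\<close>.\<close>
    obtain D where D: "K.frac_idl D" "iprod Jp D = ints K" using K.frac_invertible[OF fJp] by blast
    have "N * d \<in> ints K" if d: "d \<in> D" for d
    proof -
      have "d * \<beta> ^ p \<in> iprod (ints K) (ints H)"
      proof (rule iprod_scale[where I = Jp])
        show "d * i \<in> ints K" if "i \<in> Jp" for i
          using iprodI[OF that d] D(2) by (simp add: mult.commute)
      qed (use pow_mem[of p] in \<open>simp add: Jp_def\<close>)
      also have "\<dots> \<subseteq> ints H" using ints_K_H by (intro iprod_least) auto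
      finally have "d * \<beta> ^ p * v \<in> ints H" using v0 by blast
      then have "N * d \<in> ints H" using v(2) by (simp add: ac_simps)
      then show ?thesis using ints_H_K NK K.fracD(1)[OF D(1) d] by auto
    qed
    then have "N * 1 \<in> iprod (ints K) Jp"
      using D(2) by (intro iprod_scale[where I = D]) (auto simp: iprod_comm[of D])
    then have "N \<in> Jp" using K.iprod_ints[OF fJp] by simp
    then show "K.principal N \<subseteq> Jp" using K.fracD(5)[OF fJp] by (auto simp: mult.commute)
  qed
  obtain b where b: "b \<in> K" "b \<noteq> 0" "J = K.principal b"
    using K.principal_of_power_principal[OF p(1) reg fJ _ NK N0] Jp_N unfolding Jp_def by metis
  define \<eta> where "\<eta> = \<beta> / b"
  have "b \<in> J" using b K.principal_iff[of b b] by simp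
  then have "inverse \<eta> \<in> ints H" by (simp add: J_def \<eta>_def)
  moreover have "iprod J (ints H) \<subseteq> {x. x / b \<in> ints H}"
  proof (rule iprod_least)
    fix i j assume ij: "i \<in> J" "j \<in> ints H"
    then have "i / b \<in> ints K" using b K.principal_iff by blast
    then have "i / b * j \<in> ints H" using ij ints_K_H by blast
    then show "i * j \<in> {x. x / b \<in> ints H}" by simp
  qed (auto simp: add_divide_distrib)
  then have "\<eta> \<in> ints H" using \<beta>J by (auto simp: \<eta>_def)
  moreover have "\<eta> \<noteq> 0" using \<beta> b by (simp add: \<eta>_def)
  moreover have "\<epsilon> = \<eta> / s \<eta>"
  proof -
    have "s \<eta> = s \<beta> / b" using s_G \<beta>H K_M[OF b(1)] s_K[OF b(1)] by (simp add: \<eta>_def gal_divide)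
    moreover have "s \<beta> \<noteq> 0" using s_G \<beta>H \<beta>(2) by (simp add: gal_eq_0_iff)
    moreover have "\<epsilon> = \<beta> / s \<beta>" using \<beta>(3) \<open>s \<beta> \<noteq> 0\<close> by (metis nonzero_eq_divide_eq)
    ultimately show ?thesis using b(2) by (simp add: \<eta>_def)
  qed
  ultimately show ?thesis using that by (simp add: units_def)
qed

end


section \<open>The index of the group of \<open>p\<close>-th powers of units\<close>

text \<open>Turns a bound for finite families of inequivalent elements into a system of
  representatives: a family of greatest size meets every class. The bounds come from counting,
  before any quotient is known to be finite.\<close>

lemma maximal_independent:
  fixes N :: nat
  assumes "\<And>x. x \<in> A \<Longrightarrow> R x x" "\<And>x y. x \<in> A \<Longrightarrow> y \<in> A \<Longrightarrow> R x y \<Longrightarrow> R y x"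
    and bound: "\<And>S. finite S \<Longrightarrow> S \<subseteq> A \<Longrightarrow> (\<And>x y. x \<in> S \<Longrightarrow> y \<in> S \<Longrightarrow> R x y \<Longrightarrow> x = y) \<Longrightarrow> card S \<le> N"
  obtains T where "finite T" "T \<subseteq> A" "card T \<le> N" "\<And>x. x \<in> A \<Longrightarrow> \<exists>t\<in>T. R x t"
proof -
  define P where "P S \<longleftrightarrow> finite S \<and> S \<subseteq> A \<and> (\<forall>x\<in>S. \<forall>y\<in>S. R x y \<longrightarrow> x = y)" for S
  have "P {}" by (simp add: P_def)
  moreover have "\<forall>S. P S \<longrightarrow> card S < Suc N" using bound by (auto simp: P_def less_Suc_eq_le)
  ultimately obtain T where T: "P T" "\<And>S. P S \<Longrightarrow> card S \<le> card T"
    using ex_has_greatest_nat[of P "{}" card "Suc N"] by blast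
  have "\<exists>t\<in>T. R x t" if x: "x \<in> A" for x
  proof (rule ccontr)
    assume n: "\<not> ?thesis"
    then have "x \<notin> T" using assms(1) x by blast
    moreover have "P (insert x T)"
      using n T(1) x assms(2) unfolding P_def by blast
    ultimately show False using T(1) T(2)[of "insert x T"] by (simp add: P_def)
  qed
  moreover have "card T \<le> N" using T(1) bound by (auto simp: P_def)
  ultimately show ?thesis using that T(1) by (auto simp: P_def)
qed

lemma prime_bezout:
  assumes "prime p" "0 < d" "d < p"
  obtains a b :: nat where "d * a = p * b + 1"
proof -
  have "\<not> p dvd d" using assms by (auto dest: dvd_imp_le)
  then have "gcd d p = 1" using assms(1) by (metis prime_imp_coprime coprime_iff_gcd_eq_1 gcd.commute)
  then show ?thesis using bezout_nat[of d p] assms(2) that by auto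
qed

lemma root_power_inj:
  fixes z :: complex
  assumes "prime p" "z ^ p = 1" "z \<noteq> 1" "i < p" "j < p" "z ^ i = z ^ j"
  shows "i = j"
proof -
  have p0: "p > 0" using assms(1) prime_gt_0_nat by blast
  have z0: "z \<noteq> 0" using assms(2) p0 by (auto simp: zero_power)
  have main: False if ij: "i < j" "j < p" "z ^ i = z ^ j" for i j
  proof -
    have zd: "z ^ (j - i) = 1" using z0 ij by (simp add: power_diff)
    have d: "0 < j - i" "j - i < p" using ij by auto
    obtain a b where "(j - i) * a = p * b + 1" using prime_bezout[OF assms(1) d] .
    then have "z ^ ((j - i) * a) = z ^ (p * b) * z" by (simp add: power_add)
    then show False using zd assms(2,3) by (simp add: power_mult)
  qed
  show ?thesis using main[of i j] main[of j i] assms(4-6) by (metis linorder_neqE_nat)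
qed

lemma roots_of_unity_power:
  fixes z w :: complex
  assumes "prime p" "z ^ p = 1" "z \<noteq> 1" "w ^ p = 1"
  obtains i where "i < p" "w = z ^ i"
proof -
  have p0: "p > 0" using assms(1) prime_gt_0_nat by blast
  have "inj_on (\<lambda>i. z ^ i) {..<p}"
    using root_power_inj[OF assms(1-3)] by (auto simp: inj_on_def)
  then have "card ((\<lambda>i. z ^ i) ` {..<p}) = p" by (simp add: card_image)
  moreover have "(\<lambda>i. z ^ i) ` {..<p} \<subseteq> {w. w ^ p = 1}"
  proof safe
    fix i :: nat
    have "(z ^ i) ^ p = (z ^ p) ^ i" by (simp only: power_mult[symmetric] mult.commute)
    then show "(z ^ i) ^ p = 1" using assms(2) by simp
  qed
  moreover have "finite {w :: complex. w ^ p = 1}" "card {w :: complex. w ^ p = 1} \<le> p"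
    using card_roots_unity_eq[OF p0] p0 by (auto intro: card_ge_0_finite)
  ultimately have "(\<lambda>i. z ^ i) ` {..<p} = {w. w ^ p = 1}"
    by (metis card_seteq)
  then show ?thesis using assms(4) that by auto
qed

section \<open>The operator \<open>s - 1\<close> on units and the index bound\<close>

context unramified_cyclic
begin

lemma units_closed:
  assumes "fld F"
  shows "1 \<in> units F" "x \<in> units F \<Longrightarrow> y \<in> units F \<Longrightarrow> x * y \<in> units F"
    "x \<in> units F \<Longrightarrow> inverse x \<in> units F" "x \<in> units F \<Longrightarrow> x ^ n \<in> units F"
    "x \<in> units F \<Longrightarrow> y \<in> units F \<Longrightarrow> x / y \<in> units F"
proof -
  interpret F: subfield_of_complex F by unfold_locales (fact assms)
  show 1: "1 \<in> units F" and 2: "\<And>x y. x \<in> units F \<Longrightarrow> y \<in> units F \<Longrightarrow> x * y \<in> units F"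
    and 3: "\<And>x. x \<in> units F \<Longrightarrow> inverse x \<in> units F"
    by (auto simp: units_def)
  show "x \<in> units F \<Longrightarrow> x ^ n \<in> units F" by (induction n) (auto intro: 1 2)
  show "x \<in> units F \<Longrightarrow> y \<in> units F \<Longrightarrow> x / y \<in> units F"
    using 2 3 by (simp add: divide_inverse)
qed

lemmas EH = units_closed[OF H.F.fld]
lemmas EK = units_closed[OF K.F.fld]

lemma units_K_H: "x \<in> units K \<Longrightarrow> x \<in> units H"
  using ints_K_H by (auto simp: units_def)

lemma units_K: "x \<in> units K \<Longrightarrow> x \<in> K" and units_ne_0: "x \<in> units F \<Longrightarrow> x \<noteq> 0"
  by (auto simp: units_def ints_def)

lemma units_H_K: "x \<in> units H \<Longrightarrow> x \<in> K \<Longrightarrow> x \<in> units K"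
  by (auto simp: units_def intro!: ints_H_K K.F.inverse_F)

lemma s_mult: "x \<in> units H \<Longrightarrow> y \<in> units H \<Longrightarrow> s (x * y) = s x * s y"
  and s_inverse: "x \<in> units H \<Longrightarrow> s (inverse x) = inverse (s x)"
  and s_power: "x \<in> units H \<Longrightarrow> s (x ^ n) = s x ^ n"
  and s_units: "x \<in> units H \<Longrightarrow> s x \<in> units H"
  using s_G units_H_M units_s[of x 1] by (auto simp: gal_mult gal_inverse gal_power)

text \<open>Multiplicative form of the operator \<open>s - 1\<close>.\<close>

definition sdiff :: "complex \<Rightarrow> complex" where "sdiff x = s x / x"

lemma sdiff_units: "x \<in> units H \<Longrightarrow> (sdiff ^^ n) x \<in> units H"
  by (induction n) (auto simp: sdiff_def intro: EH s_units)

lemma sdiff_Suc: "(sdiff ^^ Suc n) x = s ((sdiff ^^ n) x) / (sdiff ^^ n) x"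
  by (simp add: sdiff_def[of "(sdiff ^^ n) x"])

lemma sdiff_mult:
  assumes "x \<in> units H" "y \<in> units H"
  shows "(sdiff ^^ n) (x * y) = (sdiff ^^ n) x * (sdiff ^^ n) y"
proof (induction n)
  case (Suc n)
  then show ?case
    unfolding sdiff_Suc using s_mult[OF sdiff_units[OF assms(1)] sdiff_units[OF assms(2)]] by simp
qed simp

lemma sdiff_K: "x \<in> units K \<Longrightarrow> n > 0 \<Longrightarrow> (sdiff ^^ n) x = 1"
proof (induction n)
  case (Suc n)
  have "s 1 = 1" using gal_one s_G by blast
  then show ?case
    using Suc s_K[OF units_K[OF Suc.prems(1)]] units_ne_0[OF Suc.prems(1)]
    by (cases n) (auto simp: sdiff_def)
qed simp

text \<open>The binomial expansion of \<open>(1 + (s - 1))^m\<close>, written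
  multiplicatively.\<close>

lemma s_pow_sdiff:
  assumes "y \<in> units H" shows "(s ^^ m) y = (\<Prod>k\<le>m. (sdiff ^^ k) y ^ (m choose k))"
proof (induction m)
  case (Suc m)
  let ?d = "\<lambda>k. (sdiff ^^ k) y"
  have d: "?d k \<in> units H" for k using sdiff_units[OF assms] .
  have sd: "s (?d k) = ?d k * ?d (Suc k)" for k
    using units_ne_0[OF d[of k]] by (simp add: sdiff_def)
  have "(s ^^ Suc m) y = s (\<Prod>k\<le>m. ?d k ^ (m choose k))" using Suc by simp
  also have "\<dots> = (\<Prod>k\<le>m. s (?d k) ^ (m choose k))"
    using s_G units_H_M(1)[OF d] by (subst gal_prod) (auto simp: gal_power)
  also have "\<dots> = (\<Prod>k\<le>m. ?d k ^ (m choose k)) * (\<Prod>k\<le>m. ?d (Suc k) ^ (m choose k))"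
    by (simp only: sd power_mult_distrib prod.distrib)
  also have "(\<Prod>k\<le>m. ?d k ^ (m choose k)) = ?d 0 * (\<Prod>k\<le>m. ?d (Suc k) ^ (m choose Suc k))"
  proof -
    have "(\<Prod>k\<le>m. ?d k ^ (m choose k)) = (\<Prod>k\<le>Suc m. ?d k ^ (m choose k))" by (simp add: binomial_eq_0)
    also have "\<dots> = ?d 0 ^ (m choose 0) * (\<Prod>k\<le>m. ?d (Suc k) ^ (m choose Suc k))"
      by (rule prod.atMost_Suc_shift)
    finally show ?thesis by simp
  qed
  also have "?d 0 * (\<Prod>k\<le>m. ?d (Suc k) ^ (m choose Suc k)) * (\<Prod>k\<le>m. ?d (Suc k) ^ (m choose k))
      = ?d 0 ^ (Suc m choose 0) * (\<Prod>k\<le>m. ?d (Suc k) ^ (Suc m choose Suc k))"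
    by (simp add: power_add prod.distrib ac_simps)
  also have "\<dots> = (\<Prod>k\<le>Suc m. ?d k ^ (Suc m choose k))"
    by (rule prod.atMost_Suc_shift[symmetric])
  finally show ?case .
qed simp

text \<open>The expansion of \<open>1 + s + ... + s^(m-1) = ((1 + (s - 1))^m - 1) / (s - 1)\<close>
  in powers of \<open>s - 1\<close>; for \<open>m = p\<close> it is the relative norm.\<close>

lemma prod_s_pow_sdiff:
  assumes "y \<in> units H" shows "(\<Prod>i<m. (s ^^ i) y) = (\<Prod>k<m. (sdiff ^^ k) y ^ (m choose Suc k))"
proof (induction m)
  case (Suc m)
  have "(\<Prod>i<Suc m. (s ^^ i) y) = (\<Prod>k<m. (sdiff ^^ k) y ^ (m choose Suc k)) * (\<Prod>k\<le>m. (sdiff ^^ k) y ^ (m choose k))"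
    using Suc s_pow_sdiff[OF assms, of m] by simp
  also have "(\<Prod>k<m. (sdiff ^^ k) y ^ (m choose Suc k)) = (\<Prod>k\<le>m. (sdiff ^^ k) y ^ (m choose Suc k))"
    by (simp add: binomial_eq_0 flip: lessThan_Suc_atMost)
  finally show ?case by (simp add: prod.distrib power_add ac_simps flip: lessThan_Suc_atMost)
qed simp

lemma rnorm_K: "x \<in> units H \<Longrightarrow> rnorm x \<in> units K"
proof -
  assume x: "x \<in> units H"
  have "(\<Prod>i\<in>A. (s ^^ i) x) \<in> units H" for A
    by (induction A rule: infinite_finite_induct) (auto intro: EH units_s[OF x])
  moreover have "rnorm x \<in> K" unfolding rnorm_def using units_H_M[OF x] by (intro trace_H_K)
  ultimately show ?thesis by (auto simp: rnorm_def intro: units_H_K)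
qed

lemma rnorm_of_K: "x \<in> units K \<Longrightarrow> rnorm x = x ^ p"
proof -
  assume "x \<in> units K"
  then have "(s ^^ i) x = x" for i by (induction i) (auto simp: s_K units_K)
  then show ?thesis by (simp add: rnorm_def)
qed

lemma rnorm_mult: "x \<in> units H \<Longrightarrow> y \<in> units H \<Longrightarrow> rnorm (x * y) = rnorm x * rnorm y"
  by (simp add: rnorm_def funpow_s_mult units_H_M prod.distrib)

lemma rnorm_inverse: "x \<in> units H \<Longrightarrow> rnorm (inverse x) = inverse (rnorm x)"
  by (simp add: rnorm_def funpow_inverse units_H_M prod_inversef[unfolded comp_def])

text \<open>Modulo \<open>p\<close>-th powers, \<open>(s - 1)\<^sup>p\<^sup>-\<^sup>1\<close> is the norm, since \<open>p\<close> divides the inner binomial coefficients.\<close>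

lemma sdiff_power_norm:
  assumes y: "y \<in> units H"
  obtains v where "v \<in> units H" "(sdiff ^^ (p - 1)) y = rnorm y * v ^ p"
proof -
  let ?d = "\<lambda>k. (sdiff ^^ k) y"
  have d: "?d k \<in> units H" for k using sdiff_units[OF y] .
  define w where "w = (\<Prod>k<p - 1. ?d k ^ ((p choose Suc k) div p))"
  have w: "w \<in> units H"
  proof -
    have "(\<Prod>k\<in>A. ?d k ^ ((p choose Suc k) div p)) \<in> units H" for A
      by (induction A rule: infinite_finite_induct) (auto intro: EH d)
    then show ?thesis by (simp add: w_def)
  qed
  have "rnorm y = (\<Prod>k<Suc (p - 1). ?d k ^ (p choose Suc k))"
    using prod_s_pow_sdiff[OF y, of p] p_gt_0 by (simp add: rnorm_def)
  also have "\<dots> = (\<Prod>k<p - 1. ?d k ^ (p choose Suc k)) * ?d (p - 1)"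
  proof -
    have "p choose Suc (p - 1) = 1" using p_gt_0 by simp
    then show ?thesis by (simp only: prod.lessThan_Suc power_one_right)
  qed
  also have "(\<Prod>k<p - 1. ?d k ^ (p choose Suc k)) = (\<Prod>k<p - 1. (?d k ^ ((p choose Suc k) div p)) ^ p)"
  proof (intro prod.cong refl)
    fix k assume "k \<in> {..<p - 1}"
    then have "p dvd (p choose Suc k)" using p(1) p_gt_0 by (intro dvd_choose_prime) auto
    then show "?d k ^ (p choose Suc k) = (?d k ^ ((p choose Suc k) div p)) ^ p"
      by (simp flip: power_mult)
  qed
  also have "\<dots> = w ^ p" by (simp add: w_def prod_power_distrib)
  finally have "rnorm y = w ^ p * ?d (p - 1)" .
  then have "?d (p - 1) = rnorm y * inverse w ^ p"
    using units_ne_0[OF w] by (simp add: field_simps)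
  then show ?thesis using that EH(3)[OF w] by blast
qed

definition pth_power_equiv :: "complex \<Rightarrow> complex \<Rightarrow> bool"
  where "pth_power_equiv x y \<longleftrightarrow> (\<exists>k\<in>units K. x = y * k ^ p)"

lemma z_units: "z \<in> units K"
proof -
  have z0: "z \<noteq> 0" using z(2) p_gt_0 by (auto simp: zero_power)
  then have "inverse z ^ p = 1" using z(2) by (simp add: power_inverse)
  then have "algebraic_int z" "algebraic_int (inverse z)"
    using algebraic_int_root_of_unity z(2) p_gt_0 by blast+
  then show ?thesis using z_K z0 by (auto simp: units_def ints_def)
qed

text \<open>
  The unit \<open>\<eta>\<close> with \<open>\<eta> / s \<eta> = z\<close> gives a unit \<open>\<eta>\<^sup>p\<close> of \<open>K\<close> which becomes a \<open>p\<close>-th power only in \<open>H\<close>.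
\<close>

lemma kummer_unit:
  assumes norm_one: "\<And>\<epsilon>. \<epsilon> \<in> units H \<Longrightarrow> rnorm \<epsilon> = 1 \<Longrightarrow> \<exists>\<eta>\<in>units H. \<epsilon> = \<eta> / s \<eta>"
  obtains \<eta> where "\<eta> \<in> units H" "\<eta> ^ p \<in> units K" "\<And>k. k \<in> units K \<Longrightarrow> \<eta> ^ p \<noteq> k ^ p"
proof -
  obtain \<eta> where \<eta>: "\<eta> \<in> units H" "z = \<eta> / s \<eta>"
    using norm_one[OF units_K_H[OF z_units]] rnorm_of_K[OF z_units] z(2) by auto
  have s\<eta>: "z * s \<eta> = \<eta>" using \<eta>(2) units_ne_0[OF s_units[OF \<eta>(1)]] by simp
  have "s (\<eta> ^ p) = (z * s \<eta>) ^ p" using z(2) s_power[OF \<eta>(1)] by (simp add: power_mult_distrib)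
  then have "s (\<eta> ^ p) = \<eta> ^ p" by (simp only: s\<eta>)
  then have u: "\<eta> ^ p \<in> units K"
    using EH(4)[OF \<eta>(1)] units_H_M by (intro units_H_K s_fixed_K) auto
  have "\<eta> ^ p \<noteq> k ^ p" if k: "k \<in> units K" for k
  proof
    assume "\<eta> ^ p = k ^ p"
    then have "(\<eta> / k) ^ p = 1" using units_ne_0[OF k] by (simp add: power_divide)
    then obtain i where "\<eta> / k = z ^ i" using roots_of_unity_power[OF p(1) z(2,3)] by blast
    then have "\<eta> = k * z ^ i" using units_ne_0[OF k] by (simp add: field_simps)
    then have "\<eta> \<in> units K" using EK k z_units by blast
    then have "s \<eta> = \<eta>" using s_K units_K by blast
    then show False using \<eta>(2) z(3) units_ne_0[OF \<eta>(1)] by simp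
  qed
  then show ?thesis using that \<eta>(1) u by blast
qed

text \<open>Dividing a unit by a chosen unit of the same norm class and by a unit of
  \<open>K\<close> leaves norm one, hence a value of \<open>sdiff\<close>. After
  \<open>p - 1\<close> rounds the remaining factor is a norm up to \<open>p\<close>-th powers, so it
  can be merged with the factors from \<open>K\<close>; these are counted modulo \<open>p\<close>-th
  powers and powers of \<open>\<eta>^p\<close>.\<close>

lemma units_index_bound:
  fixes n :: nat
  assumes n: "n > 0"
    and norm_one: "\<And>\<epsilon>. \<epsilon> \<in> units H \<Longrightarrow> rnorm \<epsilon> = 1 \<Longrightarrow> \<exists>\<eta>\<in>units H. \<epsilon> = \<eta> / s \<eta>"
    and bound: "\<And>S. finite S \<Longrightarrow> S \<subseteq> units K \<Longrightarrow>
      (\<And>x y. x \<in> S \<Longrightarrow> y \<in> S \<Longrightarrow> pth_power_equiv x y \<Longrightarrow> x = y) \<Longrightarrow> card S \<le> p ^ n"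
  obtains Fs where "finite Fs" "Fs \<subseteq> units H" "card Fs \<le> p ^ (n * p - 1)"
    "\<And>x. x \<in> units H \<Longrightarrow> \<exists>f\<in>Fs. \<exists>y\<in>units H. x = f * y ^ p"
proof -
  have refl: "pth_power_equiv x x" for x
    unfolding pth_power_equiv_def using EK(1) by (intro bexI[of _ 1]) auto
  have sym: "pth_power_equiv y x" if xy: "pth_power_equiv x y" for x y
  proof -
    obtain k where k: "k \<in> units K" "x = y * k ^ p" using xy by (auto simp: pth_power_equiv_def)
    then have "y = x * inverse k ^ p" using units_ne_0[OF k(1)] by (simp add: field_simps)
    then show ?thesis using EK(3)[OF k(1)] by (auto simp: pth_power_equiv_def)
  qed
  obtain T where T: "finite T" "T \<subseteq> units K" "card T \<le> p ^ n" "\<And>x. x \<in> units K \<Longrightarrow> \<exists>t\<in>T. pth_power_equiv x t"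
  proof (rule maximal_independent[of "units K" pth_power_equiv "p ^ n"])
    show "pth_power_equiv x x" for x by (rule refl)
    show "pth_power_equiv y x" if "pth_power_equiv x y" for x y using that by (rule sym)
    show "card S \<le> p ^ n" if "finite S" "S \<subseteq> units K"
      "\<And>x y. x \<in> S \<Longrightarrow> y \<in> S \<Longrightarrow> pth_power_equiv x y \<Longrightarrow> x = y" for S using that by (rule bound)
  qed (rule that)
  \<comment> \<open>The classes modulo \<open>p\<close>-th powers of \<open>K\<close> that contain
    norms; one unit of \<open>H\<close> is picked for each, giving at most \<open>p^n\<close>
    units.\<close>
  define good where "good t \<longleftrightarrow> (\<exists>b\<in>units H. \<exists>k\<in>units K. rnorm b = t * k ^ p)" for t
  define pick where "pick t = (SOME b. b \<in> units H \<and> (\<exists>k\<in>units K. rnorm b = t * k ^ p))" for t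
  have pick: "pick t \<in> units H \<and> (\<exists>k\<in>units K. rnorm (pick t) = t * k ^ p)" if "good t" for t
    unfolding pick_def by (rule someI_ex) (use that in \<open>auto simp: good_def\<close>)
  define B where "B = pick ` {t \<in> T. good t}"
  have B: "finite B" "B \<subseteq> units H" using T(1) pick by (auto simp: B_def)
  have "card B \<le> card {t \<in> T. good t}" unfolding B_def using T(1) by (intro card_image_le) auto
  also have "\<dots> \<le> card T" using T(1) by (intro card_mono) auto
  finally have cB: "card B \<le> p ^ n" using T(3) by simp
  have step: "\<exists>b\<in>B. \<exists>k\<in>units K. \<exists>y\<in>units H. x = b * k * sdiff y" if x: "x \<in> units H" for x
  proof -
    obtain t where t: "t \<in> T" "pth_power_equiv (rnorm x) t" using T(4)[OF rnorm_K[OF x]] by blast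
    then obtain k where k: "k \<in> units K" "rnorm x = t * k ^ p" by (auto simp: pth_power_equiv_def)
    then have "good t" using x by (auto simp: good_def)
    then obtain k' where k': "k' \<in> units K" "rnorm (pick t) = t * k' ^ p" "pick t \<in> units H" using pick by blast
    have bB: "pick t \<in> B" using t(1) \<open>good t\<close> by (auto simp: B_def)
    define c where "c = k * inverse k'"
    have c: "c \<in> units K" using k k' EK by (auto simp: c_def)
    have t0: "t \<noteq> 0" using t(1) T(2) units_ne_0 by blast
    define \<epsilon> where "\<epsilon> = x * inverse (pick t * c)"
    have pc: "pick t * c \<in> units H" using EH(2) k'(3) units_K_H[OF c] by blast
    have \<epsilon>: "\<epsilon> \<in> units H" unfolding \<epsilon>_def using x pc EH by blast
    have "rnorm \<epsilon> = rnorm x * inverse (rnorm (pick t) * c ^ p)"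
      unfolding \<epsilon>_def using x pc k'(3) c units_K_H[OF c] EH
      by (simp add: rnorm_mult rnorm_inverse rnorm_of_K)
    also have "\<dots> = 1"
      using k k' t0 units_ne_0[OF k(1)] units_ne_0[OF k'(1)] by (simp add: c_def field_simps power_mult_distrib power_inverse)
    finally obtain \<eta> where \<eta>: "\<eta> \<in> units H" "\<epsilon> = \<eta> / s \<eta>" using norm_one[OF \<epsilon>] by blast
    have "sdiff (inverse \<eta>) = \<epsilon>"
      unfolding sdiff_def s_inverse[OF \<eta>(1)] \<eta>(2) by (simp add: divide_inverse)
    moreover have "x = pick t * c * \<epsilon>" using units_ne_0[OF pc] by (simp add: \<epsilon>_def field_simps)
    ultimately show ?thesis using bB c EH(3)[OF \<eta>(1)] by metis
  qed
  \<comment> \<open>Each round multiplies the number of representatives by at most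
    \<open>p^n\<close>, while the factors from \<open>K\<close> collect into a single one.\<close>
  have iter: "\<exists>C. finite C \<and> C \<subseteq> units H \<and> card C \<le> (p ^ n) ^ j \<and>
      (\<forall>x\<in>units H. \<exists>b\<in>C. \<exists>k\<in>units K. \<exists>y\<in>units H. x = b * k * (sdiff ^^ j) y)" for j
  proof (induction j)
    case 0
    have "\<exists>b\<in>{1}. \<exists>k\<in>units K. \<exists>y\<in>units H. x = b * k * (sdiff ^^ 0) y" if "x \<in> units H" for x
      using that EK(1) by (intro bexI[of _ 1] bexI[of _ x]) auto
    then show ?case using EH(1) by (intro exI[of _ "{1}"]) auto
  next
    case (Suc j)
    then obtain C where C: "finite C" "C \<subseteq> units H" "card C \<le> (p ^ n) ^ j"
      "\<And>x. x \<in> units H \<Longrightarrow> \<exists>b\<in>C. \<exists>k\<in>units K. \<exists>y\<in>units H. x = b * k * (sdiff ^^ j) y" by blast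
    let ?C = "(\<lambda>(b, b'). b * (sdiff ^^ j) b') ` (C \<times> B)"
    have "finite ?C" using C(1) B(1) by auto
    moreover have "?C \<subseteq> units H" using C(2) B(2) sdiff_units by (auto intro!: EH(2))
    moreover have "card ?C \<le> (p ^ n) ^ Suc j"
    proof -
      have "card ?C \<le> card C * card B"
        using C(1) B(1) card_image_le[of "C \<times> B" "\<lambda>(b, b'). b * (sdiff ^^ j) b'"] by (simp add: card_cartesian_product)
      also have "\<dots> \<le> (p ^ n) ^ j * p ^ n" using C(3) cB by (rule mult_le_mono)
      finally show ?thesis by (simp add: mult.commute)
    qed
    moreover have "\<exists>b\<in>?C. \<exists>k\<in>units K. \<exists>y\<in>units H. x = b * k * (sdiff ^^ Suc j) y" if x: "x \<in> units H" for x
    proof -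
      obtain b k y where b: "b \<in> C" "k \<in> units K" "y \<in> units H" "x = b * k * (sdiff ^^ j) y"
        using C(4)[OF x] by blast
      obtain b' k' y' where b': "b' \<in> B" "k' \<in> units K" "y' \<in> units H" "y = b' * k' * sdiff y'"
        using step[OF b(3)] by blast
      have u: "b' \<in> units H" "k' \<in> units H" "sdiff y' \<in> units H"
        using b' B(2) units_K_H sdiff_units[of y' 1] by auto
      define k'' where "k'' = (sdiff ^^ j) k'"
      \<comment> \<open>For \<open>j > 0\<close> the factor from \<open>K\<close> is killed by
        \<open>sdiff\<close>; for \<open>j = 0\<close> it is kept unchanged.\<close>
      have k'': "k'' \<in> units K" using b'(2) sdiff_K[OF b'(2), of j] EK(1) by (cases "j = 0") (auto simp: k''_def)
      have "(sdiff ^^ j) y = (sdiff ^^ j) b' * k'' * (sdiff ^^ j) (sdiff y')"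
        using u unfolding b'(4) k''_def by (simp add: sdiff_mult EH(2))
      then have "x = b * (sdiff ^^ j) b' * (k * k'') * (sdiff ^^ Suc j) y'"
        using b(4) by (simp add: funpow_swap1 ac_simps)
      moreover have "b * (sdiff ^^ j) b' \<in> ?C" using b(1) b'(1) by force
      moreover have "k * k'' \<in> units K" using b(2) k'' by (rule EK(2))
      ultimately show ?thesis using b'(3) by blast
    qed
    ultimately show ?case by (intro exI[of _ ?C] conjI ballI)
  qed
  obtain C where C: "finite C" "C \<subseteq> units H" "card C \<le> (p ^ n) ^ (p - 1)"
    "\<And>x. x \<in> units H \<Longrightarrow> \<exists>b\<in>C. \<exists>k\<in>units K. \<exists>y\<in>units H. x = b * k * (sdiff ^^ (p - 1)) y"
    using iter[of "p - 1"] by blast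
  obtain \<eta> where \<eta>: "\<eta> \<in> units H" "\<eta> ^ p \<in> units K" "\<And>k. k \<in> units K \<Longrightarrow> \<eta> ^ p \<noteq> k ^ p"
    using kummer_unit[OF norm_one] by blast
  define u where "u = \<eta> ^ p"
  have u: "u \<in> units K" "u \<noteq> 0" using \<eta> units_ne_0 by (auto simp: u_def)
  \<comment> \<open>Coarser than \<open>pth_power_equiv\<close>: powers of \<open>u\<close>, which
    are \<open>p\<close>-th powers in \<open>H\<close>, are identified as well. This saves one
    factor \<open>p\<close>.\<close>
  define equ where "equ x y \<longleftrightarrow> (\<exists>k\<in>units K. \<exists>i. x = y * k ^ p * u ^ i)" for x y
  have upow: "d = 0" if d: "d < p" "k \<in> units K" "u ^ d = k ^ p" for d k
  proof (rule ccontr)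
    assume d0: "d \<noteq> 0"
    then obtain a b where ab: "d * a = p * b + 1" using prime_bezout[OF p(1) _ d(1)] by auto
    have "u ^ (d * a) = u ^ (p * b) * u" by (simp add: ab power_add)
    moreover have "u ^ (d * a) = (k ^ a) ^ p" using d(3) by (simp add: power_mult) (simp flip: power_mult add: mult.commute)
    moreover have "u ^ (p * b) = (u ^ b) ^ p" by (simp flip: power_mult add: mult.commute)
    ultimately have "(k ^ a) ^ p = (u ^ b) ^ p * u" by simp
    then have "u = (k ^ a / u ^ b) ^ p" using u(2) by (simp add: power_divide field_simps)
    moreover have "k ^ a / u ^ b \<in> units K" using d(2) u(1) by (intro EK)
    ultimately show False using \<eta>(3) by (metis u_def)
  qed
  obtain T' where T': "finite T'" "T' \<subseteq> units K" "card T' \<le> p ^ (n - 1)" "\<And>x. x \<in> units K \<Longrightarrow> \<exists>t\<in>T'. equ x t"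
  proof (rule maximal_independent[of "units K" equ "p ^ (n - 1)"])
    show "equ x x" for x unfolding equ_def using EK(1) by (intro bexI[of _ 1] exI[of _ 0]) auto
    show "equ y x" if xy: "x \<in> units K" "y \<in> units K" "equ x y" for x y
    proof -
      obtain k i where k: "k \<in> units K" "x = y * k ^ p * u ^ i" using xy(3) by (auto simp: equ_def)
      \<comment> \<open>Exponents of \<open>u\<close> are natural numbers, so \<open>u^(-i)\<close>
        is replaced by \<open>u^(p * i - i)\<close> at the cost of a \<open>p\<close>-th
        power.\<close>
      have "i \<le> p * i" using p_gt_0 by simp
      then have "u ^ (p * i) = u ^ (p * i - i) * u ^ i" by (simp flip: power_add)
      then have "y = x * (inverse (k * u ^ i)) ^ p * u ^ (p * i - i)"
        using k(2) u(2) units_ne_0[OF k(1)] by (simp add: field_simps power_mult_distrib power_inverse flip: power_mult)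
      moreover have "inverse (k * u ^ i) \<in> units K" using k(1) u(1) by (intro EK)
      ultimately show ?thesis unfolding equ_def by blast
    qed
    fix S assume S: "finite S" "S \<subseteq> units K" "\<And>x y. x \<in> S \<Longrightarrow> y \<in> S \<Longrightarrow> equ x y \<Longrightarrow> x = y"
    have key: "x = y \<and> i = j" if xy: "x \<in> S" "y \<in> S" "i < p" "j < p" "x * u ^ i = y * u ^ j * k ^ p" "k \<in> units K" "i \<le> j" for x y i j k
    proof -
      have "x * u ^ i = y * k ^ p * u ^ (j - i) * u ^ i"
        using xy(5,7) by (simp add: ac_simps flip: power_add)
      then have x: "x = y * k ^ p * u ^ (j - i)" using u(2) by simp
      then have "equ x y" using xy(6) unfolding equ_def by blast
      then have "x = y" using S(3) xy by blast
      moreover from this x have "u ^ (j - i) = inverse k ^ p"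
        using units_ne_0 xy(2,6) S(2) by (auto simp: field_simps power_inverse)
      then have "j - i = 0" using upow[of "j - i" "inverse k"] xy EK(3) by auto
      ultimately show ?thesis using xy(7) by simp
    qed
    have both: "x = y \<and> i = j" if xy: "x \<in> S" "y \<in> S" "i < p" "j < p" "x * u ^ i = y * u ^ j * k ^ p" "k \<in> units K" for x y i j k
    proof (cases "i \<le> j")
      case True
      then show ?thesis using key xy by blast
    next
      case False
      have "y * u ^ j = x * u ^ i * inverse k ^ p" using xy(5) units_ne_0[OF xy(6)] by (simp add: field_simps power_inverse)
      then show ?thesis using key[of y x j i "inverse k"] xy EK(3) False by auto
    qed
    \<comment> \<open>Multiplying an independent family by \<open>u^0, ..., u^(p-1)\<close> gives
      \<open>p\<close> times as many elements, still inequivalent modulo \<open>p\<close>-th powers;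
      the bound \<open>p^n\<close> then becomes \<open>p^(n-1)\<close>.\<close>
    let ?S = "(\<lambda>(x, i). x * u ^ i) ` (S \<times> {..<p})"
    have "inj_on (\<lambda>(x, i). x * u ^ i) (S \<times> {..<p})"
      using both[of _ _ _ _ 1] EK(1) by (fastforce simp: inj_on_def)
    then have "card ?S = card S * p" by (simp add: card_image card_cartesian_product)
    moreover have "card ?S \<le> p ^ n"
    proof (rule bound)
      show "finite ?S" using S(1) by simp
      show "?S \<subseteq> units K" using S(2) u(1) by (auto intro!: EK)
      fix a b assume ab: "a \<in> ?S" "b \<in> ?S" "pth_power_equiv a b"
      then obtain x i y j where xy: "a = x * u ^ i" "b = y * u ^ j" "x \<in> S" "y \<in> S" "i < p" "j < p" by auto
      obtain k where "k \<in> units K" "a = b * k ^ p" using ab(3) by (auto simp: pth_power_equiv_def)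
      then show "a = b" using both[of x y i j k] xy by simp
    qed
    moreover have "p ^ n = p ^ (n - 1) * p" using n by (simp flip: power_Suc2)
    ultimately show "card S \<le> p ^ (n - 1)" using p_gt_0 by simp
  qed (rule that)
  let ?F = "(\<lambda>(b, t). b * t) ` (C \<times> T')"
  show ?thesis
  proof (rule that[of ?F])
    show "finite ?F" using C(1) T'(1) by simp
    show "?F \<subseteq> units H" using C(2) T'(2) units_K_H by (auto intro!: EH(2))
    have "card ?F \<le> card C * card T'"
      using C(1) T'(1) card_image_le[of "C \<times> T'" "\<lambda>(b, t). b * t"] by (simp add: card_cartesian_product)
    also have "\<dots> \<le> (p ^ n) ^ (p - 1) * p ^ (n - 1)" using C(3) T'(3) by (rule mult_le_mono)
    also have "\<dots> = p ^ (n * (p - 1) + (n - 1))" by (simp add: power_add power_mult)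
    also have "n * (p - 1) + (n - 1) = n * p - 1" using n p_gt_0 by (cases p) auto
    finally show "card ?F \<le> p ^ (n * p - 1)" .
    fix x assume x: "x \<in> units H"
    obtain b k y where b: "b \<in> C" "k \<in> units K" "y \<in> units H" "x = b * k * (sdiff ^^ (p - 1)) y"
      using C(4)[OF x] by blast
    obtain v where v: "v \<in> units H" "(sdiff ^^ (p - 1)) y = rnorm y * v ^ p"
      using sdiff_power_norm[OF b(3)] by blast
    have "k * rnorm y \<in> units K" using b(2) rnorm_K[OF b(3)] by (rule EK(2))
    then obtain t l i where t: "t \<in> T'" "l \<in> units K" "k * rnorm y = t * l ^ p * u ^ i"
      using T'(4) unfolding equ_def by blast
    have "x = (b * t) * (l * \<eta> ^ i * v) ^ p"
      using b(4) v(2) t(3) by (simp add: u_def power_mult_distrib ac_simps flip: power_mult)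
    moreover have "l * \<eta> ^ i * v \<in> units H" using units_K_H[OF t(2)] \<eta>(1) v(1) by (intro EH)
    moreover have "b * t \<in> ?F" using b(1) t(1) by force
    ultimately show "\<exists>f\<in>?F. \<exists>y\<in>units H. x = f * y ^ p" by blast
  qed
qed

end


section \<open>Counting units\<close>

subsection \<open>Archimedean absolute values\<close>

lemma card_le_fibres:
  assumes "finite A" "finite B" "f ` A \<subseteq> B" "\<And>b. b \<in> B \<Longrightarrow> card {a \<in> A. f a = b} \<le> m"
  shows "card A \<le> m * card B"
proof -
  have "A = (\<Union>b\<in>B. {a \<in> A. f a = b})" using assms(3) by auto
  then have "card A \<le> (\<Sum>b\<in>B. card {a \<in> A. f a = b})"
    using card_UN_le[OF assms(2), of "\<lambda>b. {a \<in> A. f a = b}"] by simp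
  also have "\<dots> \<le> (\<Sum>b\<in>B. m)" using assms(4) by (rule sum_mono)
  finally show ?thesis by (simp add: mult.commute)
qed

text \<open>Constants vanish against exponential growth, so counts known up to a constant factor can
  be compared exactly.\<close>

lemma power_growth_le:
  fixes a b A :: real
  assumes "b > 0" "\<And>m :: nat. a ^ m \<le> A * b ^ m"
  shows "a \<le> b"
proof (rule ccontr)
  assume "\<not> a \<le> b"
  then have "a / b > 1" using assms(1) by simp
  then obtain m where m: "A < (a / b) ^ m" using real_arch_pow by blast
  have "(a / b) ^ m \<le> A" using assms(2)[of m] assms(1) by (simp add: power_divide divide_le_eq)
  with m show False by simp
qed

context galois_field
begin

text \<open>Northcott's finiteness: the trace coordinates determine an integer of \<open>M\<close>,
  and they are rational integers bounded in terms of \<open>B\<close>.\<close>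

lemma finite_bounded_ints: "finite {x \<in> ints M. \<forall>g\<in>carrier G. cmod (g x) \<le> B}"
proof -
  obtain l where l: "set l \<subseteq> M \<times> ints M" "\<And>x. x \<in> M \<Longrightarrow> x = (\<Sum>(a, b)\<leftarrow>l. a * trace (b * x))"
    using trace_dual_basis by blast
  define D where "D = (\<Sum>c\<leftarrow>l. \<Sum>g\<in>carrier G. cmod (g (snd c)) * B)"
  let ?A = "{x \<in> ints M. \<forall>g\<in>carrier G. cmod (g x) \<le> B}"
  define f where "f x = map (\<lambda>c. trace (snd c * x)) l" for x
  have "inj_on f ?A"
  proof (rule inj_onI)
    fix x y assume xy: "x \<in> ?A" "y \<in> ?A" "f x = f y"
    then have "trace (snd c * x) = trace (snd c * y)" if "c \<in> set l" for c
      using that by (simp add: f_def)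
    then have "(\<Sum>(a, b)\<leftarrow>l. a * trace (b * x)) = (\<Sum>(a, b)\<leftarrow>l. a * trace (b * y))"
      by (intro arg_cong[of _ _ sum_list] map_cong) auto
    moreover have "x \<in> M" "y \<in> M" using xy M.ints_F by auto
    ultimately show "x = y" using l(2) by metis
  qed
  moreover have "finite (f ` ?A)"
  proof (rule finite_subset)
    let ?I = "of_int ` {- \<lceil>D\<rceil>..\<lceil>D\<rceil>} :: complex set"
    show "f ` ?A \<subseteq> {xs. set xs \<subseteq> ?I \<and> length xs = length l}"
    proof safe
      fix x y assume x: "x \<in> ints M" "\<forall>g\<in>carrier G. cmod (g x) \<le> B" "y \<in> set (f x)"
      then obtain c where c: "c \<in> set l" "y = trace (snd c * x)" by (auto simp: f_def)
      have B0: "B \<ge> 0" using x(2) G.one_closed norm_ge_zero order_trans by blast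
      have sc: "snd c \<in> ints M" using c(1) l(1) by auto
      obtain k where k: "y = of_int k" using trace_Ints[of "snd c * x"] sc x(1) c(2) by (auto elim: Ints_cases)
      have "cmod y \<le> (\<Sum>g\<in>carrier G. cmod (g (snd c * x)))" unfolding c(2) trace_def by (rule norm_sum)
      also have "\<dots> \<le> (\<Sum>g\<in>carrier G. cmod (g (snd c)) * B)"
        using sc x by (intro sum_mono) (auto simp: gal_mult M.ints_F norm_mult intro!: mult_left_mono)
      also have "\<dots> \<le> D"
        unfolding D_def using c(1) B0 by (intro member_le_sum_list) (auto intro!: sum_nonneg)
      finally have "\<bar>real_of_int k\<bar> \<le> D" using k by simp
      then have "k \<in> {- \<lceil>D\<rceil>..\<lceil>D\<rceil>}" by (auto simp: abs_le_iff) linarith+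
      then show "y \<in> ?I" using k by blast
    qed (simp add: f_def)
    show "finite {xs. set xs \<subseteq> ?I \<and> length xs = length l}"
      by (rule finite_lists_length_eq) simp
  qed
  ultimately show ?thesis using finite_imageD by blast
qed

end

context unramified_cyclic
begin

text \<open>
  The complex places of \<open>K\<close> are indexed by the conjugates of \<open>z\<close> in the upper half plane, those of
  \<open>H\<close> by pairs of such a conjugate and a power of \<open>s\<close>.
\<close>

definition places :: "complex set"
  where "places = {g z |g. g \<in> carrier G \<and> Im (g z) > 0}"

definition emb :: "complex \<Rightarrow> complex \<Rightarrow> complex"
  where "emb w = (SOME g. g \<in> carrier G \<and> g z = w)"

lemma emb: "w \<in> places \<Longrightarrow> emb w \<in> carrier G" "w \<in> places \<Longrightarrow> emb w z = w"
  using someI_ex[of "\<lambda>g. g \<in> carrier G \<and> g z = w"] by (auto simp: places_def emb_def)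

lemma finite_places: "finite places"
proof -
  have "places \<subseteq> (\<lambda>g. g z) ` carrier G" by (auto simp: places_def)
  then show ?thesis using finite_gal finite_subset by blast
qed

text \<open>Here \<open>p\<close> odd enters: 1 is the only real \<open>p\<close>-th root of unity,
  so every conjugate of \<open>z\<close> is nonreal and the embeddings of \<open>K\<close> come in
  complex conjugate pairs.\<close>

lemma Im_conjugate_z: "g \<in> carrier G \<Longrightarrow> Im (g z) \<noteq> 0"
proof
  assume g: "g \<in> carrier G" "Im (g z) = 0"
  then obtain r where r: "g z = of_real r" by (metis complex_is_Real_iff Reals_cases)
  have "g z ^ p = 1" using gal_power[OF g(1) z(1), of p] z(2) gal_one[OF g(1)] by simp
  then have "r ^ p = 1" unfolding r by (simp flip: of_real_power)
  then have "r = 1" using p p_gt_0 by (metis odd_real_root_unique real_root_one)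
  then have "g z = g 1" using r gal_one[OF g(1)] by simp
  then show False using z(1,3) gal_bij[OF g(1)] by (auto simp: bij_betw_def inj_on_def)
qed

lemma galois_decomp:
  assumes "g \<in> carrier G"
  obtains w v where "w \<in> places" "v \<in> W" "\<And>x. x \<in> M \<Longrightarrow> cmod (g x) = cmod (emb w (v x))"
proof -
  obtain c where c: "c \<in> carrier G" "\<And>x. x \<in> M \<Longrightarrow> c x = cnj x" using cnj_gal by blast
  have main: "\<exists>v\<in>W. \<forall>x\<in>M. h x = emb (h z) (v x)" if h: "h \<in> carrier G" "Im (h z) > 0" for h
  proof -
    have w: "h z \<in> places" using h by (auto simp: places_def)
    let ?v = "inv\<^bsub>G\<^esub> emb (h z) \<otimes>\<^bsub>G\<^esub> h"
    have "?v z = (inv\<^bsub>G\<^esub> emb (h z)) (emb (h z) z)" using h emb[OF w] z(1) by (simp add: act_mult)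
    then have "?v \<in> W" using h emb(1)[OF w] z(1) by (simp add: W_def act_inv)
    moreover have "h x = emb (h z) (?v x)" if "x \<in> M" for x
      using h emb(1)[OF w] that by (simp add: act_mult act_inv)
    ultimately show ?thesis by blast
  qed
  show ?thesis
  proof (cases "Im (g z) > 0")
    case True
    obtain v where "v \<in> W" "\<forall>x\<in>M. g x = emb (g z) (v x)" using main[OF assms True] by blast
    then show ?thesis using True assms by (intro that[of "g z" v]) (auto simp: places_def)
  next
    case False
    let ?h = "c \<otimes>\<^bsub>G\<^esub> g"
    have h: "?h \<in> carrier G" "Im (?h z) > 0"
      using assms c False Im_conjugate_z[OF assms] z(1) by (auto simp: act_mult)
    have "cmod (?h x) = cmod (g x)" if "x \<in> M" for x
      using assms c that by (simp add: act_mult)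
    moreover obtain v where "v \<in> W" "\<forall>x\<in>M. ?h x = emb (?h z) (v x)" using main[OF h] by blast
    ultimately show ?thesis using h by (intro that[of "?h z" v]) (auto simp: places_def)
  qed
qed

lemma places_nonempty: "places \<noteq> {}"
  using galois_decomp[OF G.one_closed] by blast

text \<open>The group is the disjoint union of the cosets \<open>emb w W\<close> and their
  composites with complex conjugation; a conjugate pair has equal absolute values, whence the
  square.\<close>

lemma prod_galois_places:
  fixes f :: "complex \<Rightarrow> real"
  assumes "x \<in> M"
  shows "cmod (norm_Q x) = (\<Prod>w\<in>places. \<Prod>v\<in>W. cmod (emb w (v x))) ^ 2"
proof -
  obtain c where c: "c \<in> carrier G" "\<And>x. x \<in> M \<Longrightarrow> c x = cnj x" using cnj_gal by blast
  define \<phi> where "\<phi> = (\<lambda>(w, v, e). if e then c \<otimes>\<^bsub>G\<^esub> (emb w \<otimes>\<^bsub>G\<^esub> v) else emb w \<otimes>\<^bsub>G\<^esub> v)"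
  let ?I = "places \<times> W \<times> (UNIV :: bool set)"
  have \<phi>G: "\<phi> (w, v, e) \<in> carrier G" if "w \<in> places" "v \<in> W" for w v e
    using that emb c W_G by (auto simp: \<phi>_def)
  have \<phi>z: "\<phi> (w, v, e) z = (if e then cnj w else w)" if "w \<in> places" "v \<in> W" for w v e
  proof -
    have "w \<in> M" using gal_mem[OF emb(1)[OF that(1)] z(1)] emb(2)[OF that(1)] by simp
    then show ?thesis
      using that emb[OF that(1)] c W_G[OF that(2)] z(1) by (auto simp: \<phi>_def act_mult W_def)
  qed
  have cm: "cmod (\<phi> (w, v, e) y) = cmod (emb w (v y))" if "w \<in> places" "v \<in> W" "y \<in> M" for w v e y
    using that emb[OF that(1)] c W_G[OF that(2)] by (auto simp: \<phi>_def act_mult)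
  have inj: "inj_on \<phi> ?I"
  proof (rule inj_onI)
    fix a b assume ab: "a \<in> ?I" "b \<in> ?I" "\<phi> a = \<phi> b"
    obtain w v e where a: "a = (w, v, e)" "w \<in> places" "v \<in> W" using ab(1) by auto
    obtain w' v' e' where b: "b = (w', v', e')" "w' \<in> places" "v' \<in> W" using ab(2) by auto
    have I: "Im w > 0" "Im w' > 0" using a b by (auto simp: places_def)
    have "(if e then cnj w else w) = (if e' then cnj w' else w')"
      using \<phi>z[OF a(2,3), of e] \<phi>z[OF b(2,3), of e'] ab(3) a(1) b(1) by simp
    then have we: "e = e'" "w = w'"
      using I arg_cong[of "if e then cnj w else w" _ Im] by (auto split: if_splits)
    then have "emb w \<otimes>\<^bsub>G\<^esub> v = emb w \<otimes>\<^bsub>G\<^esub> v'"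
      using ab(3) a b emb(1)[OF a(2)] W_G c(1) by (auto simp: \<phi>_def split: if_splits)
    then show "a = b" using we a b emb(1)[OF a(2)] W_G by simp
  qed
  have surj: "g \<in> \<phi> ` ?I" if g: "g \<in> carrier G" for g
  proof -
    have main: "\<exists>w\<in>places. \<exists>v\<in>W. h = emb w \<otimes>\<^bsub>G\<^esub> v" if h: "h \<in> carrier G" "Im (h z) > 0" for h
    proof -
      have w: "h z \<in> places" using h by (auto simp: places_def)
      let ?v = "inv\<^bsub>G\<^esub> emb (h z) \<otimes>\<^bsub>G\<^esub> h"
      have "?v z = (inv\<^bsub>G\<^esub> emb (h z)) (emb (h z) z)" using h emb[OF w] z(1) by (simp add: act_mult)
      then have "?v \<in> W" using h emb(1)[OF w] z(1) by (simp add: W_def act_inv)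
      moreover have "h = emb (h z) \<otimes>\<^bsub>G\<^esub> ?v" using h emb(1)[OF w] by (simp add: G.m_assoc[symmetric])
      ultimately show ?thesis using w by blast
    qed
    show ?thesis
    proof (cases "Im (g z) > 0")
      case True
      then obtain w v where "w \<in> places" "v \<in> W" "g = emb w \<otimes>\<^bsub>G\<^esub> v" using main[OF g] by blast
      then show ?thesis by (intro image_eqI[of _ _ "(w, v, False)"]) (auto simp: \<phi>_def)
    next
      case False
      let ?h = "c \<otimes>\<^bsub>G\<^esub> g"
      have "?h \<in> carrier G" "Im (?h z) > 0"
        using g c False Im_conjugate_z[OF g] z(1) by (auto simp: act_mult)
      then obtain w v where wv: "w \<in> places" "v \<in> W" "?h = emb w \<otimes>\<^bsub>G\<^esub> v" using main by blast
      have "c \<otimes>\<^bsub>G\<^esub> ?h = g"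
      proof (rule gal_eqI)
        fix x assume "x \<in> M"
        then have "g x \<in> M" "c (g x) \<in> M" using g c(1) by auto
        then show "(c \<otimes>\<^bsub>G\<^esub> ?h) x = g x" using g c \<open>x \<in> M\<close> by (simp add: act_mult)
      qed (use g c in auto)
      then show ?thesis using wv by (intro image_eqI[of _ _ "(w, v, True)"]) (auto simp: \<phi>_def)
    qed
  qed
  have "bij_betw \<phi> ?I (carrier G)"
    unfolding bij_betw_def using inj surj \<phi>G by auto
  then have "(\<Prod>g\<in>carrier G. cmod (g x)) = (\<Prod>i\<in>?I. cmod (\<phi> i x))"
    by (rule prod.reindex_bij_betw[symmetric])
  also have "\<dots> = (\<Prod>w\<in>places. \<Prod>v\<in>W. \<Prod>e\<in>(UNIV :: bool set). cmod (\<phi> (w, v, e) x))"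
    by (simp add: prod.cartesian_product case_prod_unfold)
  also have "\<dots> = (\<Prod>w\<in>places. \<Prod>v\<in>W. cmod (emb w (v x)) ^ 2)"
    using cm[OF _ _ assms] by (intro prod.cong) (auto simp: UNIV_bool power2_eq_square)
  finally show ?thesis by (simp add: norm_Q_def prod_norm[symmetric] prod_power_distrib)
qed

lemma norm_K_places:
  assumes "x \<in> K" shows "cmod (norm_Q x) = (\<Prod>w\<in>places. cmod (emb w x)) ^ (2 * card W)"
proof -
  have "(\<Prod>w\<in>places. \<Prod>v\<in>W. cmod (emb w (v x))) = (\<Prod>w\<in>places. cmod (emb w x)) ^ card W"
  proof -
    have "(\<Prod>v\<in>W. cmod (emb w (v x))) = (\<Prod>v\<in>W. cmod (emb w x))" for w
      using assms by (intro prod.cong) (auto simp: K_def)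
    then show ?thesis by (simp add: prod_power_distrib)
  qed
  then show ?thesis using prod_galois_places[OF K_M[OF assms]] by (simp add: power_mult mult.commute)
qed

definition aH :: "complex \<times> nat \<Rightarrow> complex \<Rightarrow> complex"
  where "aH \<rho> x = emb (fst \<rho>) ((s ^^ snd \<rho>) x)"

definition placesH :: "(complex \<times> nat) set"
  where "placesH = places \<times> {..<p}"

lemma finite_placesH: "finite placesH" and card_placesH: "card placesH = card places * p"
  using finite_places by (auto simp: placesH_def card_cartesian_product)

text \<open>\<open>W\<close> is the disjoint union of the cosets of \<open>s^i\<close>,
  \<open>i < p\<close>, modulo \<open>U\<close>, and \<open>U\<close> acts trivially on
  \<open>x\<close>.\<close>

lemma norm_H_places:
  assumes "x \<in> H" shows "cmod (norm_Q x) = (\<Prod>\<rho>\<in>placesH. cmod (aH \<rho> x)) ^ (2 * card U)"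
proof -
  let ?\<phi> = "\<lambda>(i, u). s [^]\<^bsub>G\<^esub> (i :: nat) \<otimes>\<^bsub>G\<^esub> u"
  have sW: "s [^]\<^bsub>G\<^esub> (i :: nat) \<in> W" for i using s(1) by blast
  have inj: "inj_on ?\<phi> ({..<p} \<times> U)"
  proof (rule inj_onI)
    fix a b assume ab: "a \<in> {..<p} \<times> U" "b \<in> {..<p} \<times> U" "?\<phi> a = ?\<phi> b"
    obtain i u where a: "a = (i, u)" "i < p" "u \<in> U" using ab(1) by auto
    obtain j v where b: "b = (j, v)" "j < p" "v \<in> U" using ab(2) by auto
    have \<psi>eq: "[\<psi> (s [^]\<^bsub>G\<^esub> k \<otimes>\<^bsub>G\<^esub> t) = int k] (mod int p)" if "t \<in> U" for k :: nat and t
    proof -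
      have "[\<psi> (s [^]\<^bsub>G\<^esub> k \<otimes>\<^bsub>G\<^esub> t) = \<psi> (s [^]\<^bsub>G\<^esub> k) + \<psi> t] (mod int p)" using sW U_W[OF that] by (rule \<psi>_mult)
      also have "[\<psi> (s [^]\<^bsub>G\<^esub> k) + \<psi> t = int k + 0] (mod int p)"
        using \<psi>_s_pow[of k] that by (intro cong_add) (auto simp: U_def cong_0_iff)
      finally show ?thesis by simp
    qed
    have "[int i = int j] (mod int p)"
      using \<psi>eq[OF a(3), of i] \<psi>eq[OF b(3), of j] ab(3) a(1) b(1) by (simp add: cong_def)
    then have "i = j" using a(2) b(2) by (simp add: cong_def)
    then have "s [^]\<^bsub>G\<^esub> i \<otimes>\<^bsub>G\<^esub> u = s [^]\<^bsub>G\<^esub> i \<otimes>\<^bsub>G\<^esub> v" using ab(3) a(1) b(1) by simp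
    then show "a = b" using a b \<open>i = j\<close> W_G[OF sW] U_G by simp
  qed
  have "?\<phi> ` ({..<p} \<times> U) = W"
  proof
    show "?\<phi> ` ({..<p} \<times> U) \<subseteq> W" using sW U_W by auto
    show "W \<subseteq> ?\<phi> ` ({..<p} \<times> U)"
    proof
      fix w assume "w \<in> W"
      then obtain i u where "i < p" "u \<in> U" "w = s [^]\<^bsub>G\<^esub> i \<otimes>\<^bsub>G\<^esub> u" by (rule W_decomp)
      then show "w \<in> ?\<phi> ` ({..<p} \<times> U)" by (intro image_eqI[of _ _ "(i, u)"]) auto
    qed
  qed
  then have bij: "bij_betw ?\<phi> ({..<p} \<times> U) W" using inj by (simp add: bij_betw_def)
  have "(\<Prod>v\<in>W. cmod (emb w (v x))) = (\<Prod>i<p. cmod (aH (w, i) x)) ^ card U" for w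
  proof -
    have act: "?\<phi> (i, u) x = (s ^^ i) x" if "u \<in> U" for i u
    proof -
      have "?\<phi> (i, u) x = (s [^]\<^bsub>G\<^esub> i) (u x)" using that assms by (simp add: act_mult W_G[OF sW] U_G H_M)
      also have "u x = x" using that assms by (simp add: H_def)
      finally show ?thesis using act_pow[OF s_G H_M[OF assms]] by simp
    qed
    have "(\<Prod>v\<in>W. cmod (emb w (v x))) = (\<Prod>a\<in>{..<p} \<times> U. cmod (emb w (?\<phi> a x)))"
      by (rule prod.reindex_bij_betw[OF bij, symmetric])
    also have "\<dots> = (\<Prod>i<p. \<Prod>u\<in>U. cmod (aH (w, i) x))"
      unfolding prod.cartesian_product by (intro prod.cong refl) (use act in \<open>auto simp: aH_def\<close>)
    finally show ?thesis by (simp add: prod_power_distrib)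
  qed
  then have "(\<Prod>w\<in>places. \<Prod>v\<in>W. cmod (emb w (v x))) = (\<Prod>\<rho>\<in>placesH. cmod (aH \<rho> x)) ^ card U"
    by (simp add: placesH_def prod_power_distrib prod.cartesian_product case_prod_unfold)
  then show ?thesis using prod_galois_places[OF H_M[OF assms]] by (simp add: power_mult mult.commute)
qed

lemma galois_place_K:
  assumes "g \<in> carrier G" obtains w where "w \<in> places" "\<And>x. x \<in> K \<Longrightarrow> cmod (g x) = cmod (emb w x)"
proof -
  obtain w v where w: "w \<in> places" "v \<in> W" "\<And>x. x \<in> M \<Longrightarrow> cmod (g x) = cmod (emb w (v x))"
    using galois_decomp[OF assms] by blast
  have "cmod (g x) = cmod (emb w x)" if "x \<in> K" for x
  proof -
    have "v x = x" using w(2) that by (auto simp: K_def)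
    then show ?thesis using w(3)[OF K_M[OF that]] by simp
  qed
  then show ?thesis using that w(1) by blast
qed

lemma galois_place_H:
  assumes "g \<in> carrier G" obtains \<rho> where "\<rho> \<in> placesH" "\<And>x. x \<in> H \<Longrightarrow> cmod (g x) = cmod (aH \<rho> x)"
proof -
  obtain w v where w: "w \<in> places" "v \<in> W" "\<And>x. x \<in> M \<Longrightarrow> cmod (g x) = cmod (emb w (v x))"
    using galois_decomp[OF assms] by blast
  obtain i where i: "i < p" "\<And>x. x \<in> H \<Longrightarrow> v x = (s ^^ i) x" using W_on_H[OF w(2)] by blast
  have "cmod (g x) = cmod (aH (w, i) x)" if "x \<in> H" for x
    using w(3)[OF H_M[OF that]] i(2)[OF that] by (simp add: aH_def)
  then show ?thesis using that[of "(w, i)"] w(1) i(1) by (auto simp: placesH_def)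
qed

lemma norm_nonzero_ge_1:
  assumes "x \<in> ints M" "x \<noteq> 0" shows "cmod (norm_Q x) \<ge> 1"
proof -
  obtain k :: int where k: "norm_Q x = of_int k" using norm_Ints[OF assms(1)] by (auto elim: Ints_cases)
  have "k \<noteq> 0" using assms k norm_eq_0_iff[of x] M.ints_F by auto
  then show ?thesis using k by simp
qed

lemma units_M: "x \<in> units H \<Longrightarrow> x \<in> ints M" "x \<in> units H \<Longrightarrow> inverse x \<in> ints M"
  using ints_H_M by (auto simp: units_def)

lemma norm_unit:
  assumes "x \<in> units H" shows "cmod (norm_Q x) = 1"
proof -
  have x: "x \<in> ints M" "inverse x \<in> ints M" "x \<noteq> 0" using assms units_M units_ne_0 by auto
  then have "norm_Q x * norm_Q (inverse x) = norm_Q 1" by (simp add: M.ints_F flip: norm_Q_mult)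
  also have "norm_Q 1 = 1" by (simp add: norm_Q_def gal_one)
  finally have "cmod (norm_Q x) * cmod (norm_Q (inverse x)) = 1"
    by (metis norm_mult norm_one)
  moreover have "cmod (norm_Q x) \<ge> 1" "cmod (norm_Q (inverse x)) \<ge> 1"
    using norm_nonzero_ge_1 x by auto
  ultimately show ?thesis
    by (smt (verit) mult_le_cancel_left1 mult_right_le_one_le)
qed

section \<open>Units of bounded logarithmic height\<close>

definition height_le :: "complex \<Rightarrow> nat \<Rightarrow> bool"
  where "height_le x T \<longleftrightarrow> (\<forall>g\<in>carrier G. \<bar>ln (cmod (g x))\<bar> \<le> real T)"

definition ubox :: "complex set \<Rightarrow> nat \<Rightarrow> complex set"
  where "ubox F T = {x \<in> units F. height_le x T}"

lemma finite_ubox: assumes "F \<subseteq> M" shows "finite (ubox F T)"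
proof (rule finite_subset)
  show "ubox F T \<subseteq> {x \<in> ints M. \<forall>g\<in>carrier G. cmod (g x) \<le> exp (real T)}"
  proof safe
    fix x assume x: "x \<in> ubox F T"
    then show xM: "x \<in> ints M" using assms ints_mono by (auto simp: ubox_def units_def)
    fix g assume g: "g \<in> carrier G"
    then have "cmod (g x) > 0" "ln (cmod (g x)) \<le> real T"
      using x xM gal_eq_0_iff[OF g, of x] M.ints_F units_ne_0 by (auto simp: ubox_def height_le_def)
    then show "cmod (g x) \<le> exp (real T)" by (metis exp_le_cancel_iff exp_ln)
  qed
qed (rule finite_bounded_ints)

lemma ln_cmod:
  assumes "g \<in> carrier G" "x \<in> M" "y \<in> M" "x \<noteq> 0" "y \<noteq> 0"
  shows "ln (cmod (g (x * y))) = ln (cmod (g x)) + ln (cmod (g y))"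
    "ln (cmod (g (x / y))) = ln (cmod (g x)) - ln (cmod (g y))"
    "ln (cmod (g (x ^ k))) = real k * ln (cmod (g x))"
proof -
  have "cmod (g x) > 0" "cmod (g y) > 0" using assms gal_eq_0_iff by auto
  then show "ln (cmod (g (x * y))) = ln (cmod (g x)) + ln (cmod (g y))"
    "ln (cmod (g (x / y))) = ln (cmod (g x)) - ln (cmod (g y))"
    "ln (cmod (g (x ^ k))) = real k * ln (cmod (g x))"
    using assms by (simp_all add: gal_mult gal_divide gal_power norm_mult norm_divide norm_power ln_mult ln_div ln_realpow)
qed

lemma height_bound_finite:
  assumes "finite S" "S \<subseteq> units H" obtains C where "C > 0" "\<And>x. x \<in> S \<Longrightarrow> height_le x C"
proof -
  define B where "B = (\<Sum>x\<in>S. \<Sum>g\<in>carrier G. \<bar>ln (cmod (g x))\<bar>)"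
  have "\<bar>ln (cmod (g x))\<bar> \<le> B" if "x \<in> S" "g \<in> carrier G" for x g
  proof -
    have "\<bar>ln (cmod (g x))\<bar> \<le> (\<Sum>g\<in>carrier G. \<bar>ln (cmod (g x))\<bar>)"
      using that finite_gal by (intro member_le_sum) auto
    also have "\<dots> \<le> B"
      unfolding B_def using that assms(1) by (intro member_le_sum) (auto intro!: sum_nonneg)
    finally show ?thesis .
  qed
  then have "height_le x (Suc (nat \<lceil>B\<rceil>))" if "x \<in> S" for x
    using that unfolding height_le_def by (smt (verit) of_nat_Suc real_nat_ceiling_ge)
  then show ?thesis using that[of "Suc (nat \<lceil>B\<rceil>)"] by simp
qed


subsection \<open>The units of \<open>K\<close>\<close>

lemma sum_ln_places_K:
  assumes "x \<in> units K" shows "(\<Sum>w\<in>places. ln (cmod (emb w x))) = 0"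
proof -
  have x: "x \<in> K" "x \<in> units H" "x \<noteq> 0" using assms units_K units_K_H units_ne_0 by auto
  have pos: "cmod (emb w x) > 0" if "w \<in> places" for w
    using gal_eq_0_iff[OF emb(1)[OF that] K_M[OF x(1)]] x(3) by simp
  have "(\<Prod>w\<in>places. cmod (emb w x)) ^ (2 * card W) = 1"
    using norm_K_places[OF x(1)] norm_unit[OF x(2)] by simp
  moreover have "(\<Prod>w\<in>places. cmod (emb w x)) > 0" using pos by (rule prod_pos)
  moreover have "card W > 0" using finite_W one_W by (metis card_gt_0_iff empty_iff)
  ultimately have "(\<Prod>w\<in>places. cmod (emb w x)) = 1"
    using power_eq_1_iff[of "\<Prod>w\<in>places. cmod (emb w x)" "2 * card W"] by simp
  then have "ln (\<Prod>w\<in>places. cmod (emb w x)) = 0" by simp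
  then show ?thesis using pos by (subst (asm) ln_prod) (auto simp: finite_places)
qed

lemma ubox_K_upper:
  obtains A :: nat where "\<And>T. card (ubox K T) \<le> A * (2 * T + 1) ^ (card places - 1)"
proof -
  obtain w0 where w0: "w0 \<in> places" using places_nonempty by blast
  let ?P = "places - {w0}"
  define n where "n = card places"
  define A where "A = card (ubox K n)"
  have KM: "K \<subseteq> M" using K_M by blast
  have "card (ubox K T) \<le> A * (2 * T + 1) ^ (card places - 1)" for T
  proof -
    \<comment> \<open>Two units with equal \<open>f\<close> differ by at most 1 in each logarithm
      except at \<open>w0\<close>, where the sum relation bounds the difference by \<open>n\<close>;
      hence the constant \<open>A\<close>.\<close>
    define f where "f x = (\<lambda>w\<in>?P. \<lfloor>ln (cmod (emb w x))\<rfloor>)" for x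
    have "card (ubox K T) \<le> A * card (PiE ?P (\<lambda>_. {- int T..int T}))"
    proof (rule card_le_fibres)
      show "finite (ubox K T)" by (rule finite_ubox[OF KM])
      show "finite (PiE ?P (\<lambda>_. {- int T..int T}))" using finite_places by (intro finite_PiE) auto
      show "f ` ubox K T \<subseteq> PiE ?P (\<lambda>_. {- int T..int T})"
      proof (rule image_subsetI)
        fix x assume x: "x \<in> ubox K T"
        have "- int T \<le> \<lfloor>ln (cmod (emb w x))\<rfloor> \<and> \<lfloor>ln (cmod (emb w x))\<rfloor> \<le> int T" if "w \<in> ?P" for w
        proof -
          have "\<bar>ln (cmod (emb w x))\<bar> \<le> real T"
            using x emb(1)[of w] that by (auto simp: ubox_def height_le_def)
          then show ?thesis by (simp add: le_floor_iff floor_le_iff) linarith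
        qed
        then show "f x \<in> PiE ?P (\<lambda>_. {- int T..int T})" by (auto simp: f_def)
      qed
      fix b
      show "card {x \<in> ubox K T. f x = b} \<le> A"
      proof (cases "{x \<in> ubox K T. f x = b} = {}")
        case False
        then obtain x0 where x0: "x0 \<in> ubox K T" "f x0 = b" by blast
        then have x0u: "x0 \<in> units K" "x0 \<noteq> 0" "x0 \<in> M" using units_ne_0 units_K K_M by (auto simp: ubox_def)
        have "(\<lambda>x. x / x0) ` {x \<in> ubox K T. f x = b} \<subseteq> ubox K n"
        proof (rule image_subsetI)
          fix x assume "x \<in> {x \<in> ubox K T. f x = b}"
          then have x: "x \<in> ubox K T" "b = f x" by auto
          have xu: "x \<in> units K" "x \<noteq> 0" "x \<in> M" using x units_ne_0 units_K K_M by (auto simp: ubox_def)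
          have q: "x / x0 \<in> units K" using xu x0u by (intro EK)
          have small: "\<bar>ln (cmod (emb w (x / x0)))\<bar> \<le> 1" if w: "w \<in> ?P" for w
          proof -
            have "\<lfloor>ln (cmod (emb w x))\<rfloor> = \<lfloor>ln (cmod (emb w x0))\<rfloor>"
              using x(2) x0(2) w by (metis f_def restrict_apply')
            then have "\<bar>ln (cmod (emb w x)) - ln (cmod (emb w x0))\<bar> \<le> 1" by linarith
            then show ?thesis using ln_cmod(2)[of "emb w" x x0] emb(1)[of w] w xu x0u by simp
          qed
          have "ln (cmod (emb w0 (x / x0))) = - (\<Sum>w\<in>?P. ln (cmod (emb w (x / x0))))"
            using sum_ln_places_K[OF q] w0 finite_places by (simp add: sum.remove[of places w0])
          also have "\<bar>\<dots>\<bar> \<le> (\<Sum>w\<in>?P. \<bar>ln (cmod (emb w (x / x0)))\<bar>)" unfolding abs_minus_cancel by (rule sum_abs)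
          also have "\<dots> \<le> (\<Sum>w\<in>?P. 1)" using small by (rule sum_mono)
          also have "\<dots> \<le> real n" using finite_places w0 by (simp add: n_def)
          finally have big: "\<bar>ln (cmod (emb w0 (x / x0)))\<bar> \<le> real n" .
          have "n \<ge> 1" using w0 finite_places by (auto simp: n_def Suc_le_eq card_gt_0_iff)
          then have all: "\<bar>ln (cmod (emb w (x / x0)))\<bar> \<le> real n" if "w \<in> places" for w
            using small[of w] big that by (cases "w = w0") auto
          have "height_le (x / x0) n"
            unfolding height_le_def
          proof
            fix g assume "g \<in> carrier G"
            then obtain w where "w \<in> places" "\<And>x. x \<in> K \<Longrightarrow> cmod (g x) = cmod (emb w x)" using galois_place_K by blast
            then show "\<bar>ln (cmod (g (x / x0)))\<bar> \<le> real n" using all units_K[OF q] by simp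
          qed
          then show "x / x0 \<in> ubox K n" using q by (simp add: ubox_def)
        qed
        moreover have "inj_on (\<lambda>x. x / x0) {x \<in> ubox K T. f x = b}" using x0u by (auto simp: inj_on_def)
        ultimately show ?thesis unfolding A_def by (intro card_inj_on_le finite_ubox[OF KM])
      qed (simp only: card.empty le0)
    qed
    also have "card (PiE ?P (\<lambda>_. {- int T..int T})) = (2 * T + 1) ^ (card places - 1)"
      using finite_places w0 by (subst card_PiE) (auto simp: nat_add_distrib nat_mult_distrib)
    finally show ?thesis .
  qed
  then show ?thesis using that by blast
qed

text \<open>The map from \<open>(t, y)\<close> to \<open>t * y^p\<close> is at most \<open>p\<close>
  to one, because independence fixes \<open>t\<close> and then \<open>y\<close> is determined up to
  a power of \<open>z\<close>. It carries height \<open>T\<close> to height \<open>p T + C\<close>,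
  where the count grows by a factor of order \<open>p^(n-1)\<close>; together this allows
  \<open>card S\<close> up to \<open>p^n\<close>.\<close>

lemma independent_units_card:
  assumes S: "finite S" "S \<subseteq> units K" and ind: "\<And>x y. x \<in> S \<Longrightarrow> y \<in> S \<Longrightarrow> pth_power_equiv x y \<Longrightarrow> x = y"
  shows "card S \<le> p ^ card places"
proof -
  define n where "n = card places"
  have n: "n \<ge> 1" using places_nonempty finite_places by (auto simp: n_def Suc_le_eq card_gt_0_iff)
  have KM: "K \<subseteq> M" using K_M by blast
  obtain C where C: "C > 0" "\<And>x. x \<in> S \<Longrightarrow> height_le x C"
    using height_bound_finite[OF S(1)] S(2) units_K_H by blast
  obtain A :: nat where A: "\<And>T. card (ubox K T) \<le> A * (2 * T + 1) ^ (card places - 1)"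
    using ubox_K_upper by blast
  have step: "card S * card (ubox K T) \<le> p * card (ubox K (p * T + C))" for T
  proof -
    have "card (S \<times> ubox K T) \<le> p * card (ubox K (p * T + C))"
    proof (rule card_le_fibres[where f = "\<lambda>(s, y). s * y ^ p"])
      show "finite (S \<times> ubox K T)" using S(1) finite_ubox[OF KM] by blast
      show "finite (ubox K (p * T + C))" by (rule finite_ubox[OF KM])
      show "(\<lambda>(s, y). s * y ^ p) ` (S \<times> ubox K T) \<subseteq> ubox K (p * T + C)"
      proof safe
        fix t y assume t: "t \<in> S" "y \<in> ubox K T"
        have u: "t \<in> units K" "y \<in> units K" "t \<in> M" "y \<in> M" "t \<noteq> 0" "y \<noteq> 0"
          using t S(2) units_ne_0 units_K K_M by (auto simp: ubox_def)
        have "height_le (t * y ^ p) (p * T + C)"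
          unfolding height_le_def
        proof
          fix g assume g: "g \<in> carrier G"
          have "\<bar>ln (cmod (g t))\<bar> \<le> real C" "\<bar>ln (cmod (g y))\<bar> \<le> real T"
            using C(2)[OF t(1)] t(2) g by (auto simp: height_le_def ubox_def)
          then have "\<bar>real p * ln (cmod (g y))\<bar> \<le> real p * real T" by (simp add: abs_mult mult_left_mono)
          then show "\<bar>ln (cmod (g (t * y ^ p)))\<bar> \<le> real (p * T + C)"
            using ln_cmod(1)[OF g u(3) M.power_F[OF u(4)] u(5), of p] ln_cmod(3)[OF g u(4,4,6,6), of p]
              u \<open>\<bar>ln (cmod (g t))\<bar> \<le> real C\<close> by simp
        qed
        moreover have "t * y ^ p \<in> units K" using u by (intro EK)
        ultimately show "t * y ^ p \<in> ubox K (p * T + C)" by (simp add: ubox_def)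
      qed
      fix b
      show "card {a \<in> S \<times> ubox K T. (case a of (s, y) \<Rightarrow> s * y ^ p) = b} \<le> p"
      proof (cases "{a \<in> S \<times> ubox K T. (case a of (s, y) \<Rightarrow> s * y ^ p) = b} = {}")
        case False
        then obtain t0 y0 where t0: "t0 \<in> S" "y0 \<in> ubox K T" "t0 * y0 ^ p = b" by auto
        have u0: "t0 \<in> units K" "y0 \<in> units K" "t0 \<noteq> 0" "y0 \<noteq> 0" using t0 S(2) units_ne_0 by (auto simp: ubox_def)
        have "{a \<in> S \<times> ubox K T. (case a of (s, y) \<Rightarrow> s * y ^ p) = b} \<subseteq> (\<lambda>i. (t0, y0 * z ^ i)) ` {..<p}"
        proof safe
          fix t y assume t: "t \<in> S" "y \<in> ubox K T" "b = t * y ^ p"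
          have u: "t \<in> units K" "y \<in> units K" "t \<noteq> 0" "y \<noteq> 0" using t S(2) units_ne_0 by (auto simp: ubox_def)
          have "t = t0 * (y0 / y) ^ p" using t(3) t0(3) u by (simp add: power_divide field_simps)
          then have "pth_power_equiv t t0" unfolding pth_power_equiv_def using EK(5)[OF u0(2) u(2)] by blast
          then have "t = t0" using ind t t0 by blast
          then have "(y / y0) ^ p = 1" using t(3) t0(3) u0 u by (simp add: power_divide)
          then obtain i where "i < p" "y / y0 = z ^ i" using roots_of_unity_power[OF p(1) z(2,3)] by blast
          then have "y = y0 * z ^ i" "i \<in> {..<p}" using u0 by (auto simp: field_simps)
          then show "(t, y) \<in> (\<lambda>i. (t0, y0 * z ^ i)) ` {..<p}" using \<open>t = t0\<close> by blast
        qed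
        then have "card {a \<in> S \<times> ubox K T. (case a of (s, y) \<Rightarrow> s * y ^ p) = b} \<le> card ((\<lambda>i. (t0, y0 * z ^ i)) ` {..<p})"
          by (intro card_mono) auto
        also have "\<dots> \<le> p" using card_image_le[of "{..<p}"] by simp
        finally show ?thesis .
      qed (simp only: card.empty le0)
    qed
    then show ?thesis by (simp add: card_cartesian_product)
  qed
  \<comment> \<open>The heights reached by iterating \<open>p * t + C\<close> from 0 stay below
    \<open>C * p^m\<close>, so the upper bound has growth rate \<open>p^(n-1)\<close> in
    \<open>m\<close>.\<close>
  define T where "T m = ((\<lambda>t. p * t + C) ^^ m) 0" for m
  have T: "T m + C \<le> C * p ^ m" for m
  proof (induction m)
    case (Suc m)
    have "T (Suc m) + C = p * T m + 2 * C" by (simp add: T_def)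
    also have "\<dots> \<le> p * (T m + C)" using p_ge_3 by (simp add: distrib_left)
    also have "\<dots> \<le> p * (C * p ^ m)" using Suc by (rule mult_le_mono2)
    finally show ?case by (simp add: ac_simps)
  qed (simp add: T_def)
  have grow: "card S ^ m \<le> p ^ m * card (ubox K (T m))" for m
  proof (induction m)
    case 0
    have "1 \<in> ubox K 0" using EK(1) by (auto simp: ubox_def height_le_def gal_one)
    then have "card (ubox K 0) > 0" using finite_ubox[OF KM] by (auto simp: card_gt_0_iff)
    then show ?case by (simp add: T_def)
  next
    case (Suc m)
    have "card S ^ Suc m \<le> p ^ m * (card S * card (ubox K (T m)))" using Suc by simp
    also have "\<dots> \<le> p ^ m * (p * card (ubox K (T (Suc m))))"
      using step[of "T m"] by (intro mult_le_mono2) (simp add: T_def)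
    finally show ?case by (simp add: ac_simps)
  qed
  have "real (card S) \<le> real (p ^ n)"
  proof (rule power_growth_le)
    show "real (p ^ n) > 0" using p_gt_0 by simp
    fix m
    have "2 * T m + 1 \<le> 3 * C * p ^ m"
    proof -
      have "2 * T m + 2 * C \<le> 2 * (C * p ^ m)" using T[of m] by simp
      then show ?thesis using C(1) by linarith
    qed
    then have "(2 * T m + 1) ^ (n - 1) \<le> (3 * C * p ^ m) ^ (n - 1)" by (rule power_mono) simp
    then have "card S ^ m \<le> p ^ m * (A * (3 * C * p ^ m) ^ (n - 1))"
      using grow[of m] A[of "T m"] unfolding n_def[symmetric]
      by (meson mult_le_mono2 order_trans)
    also have "\<dots> = A * (3 * C) ^ (n - 1) * (p ^ n) ^ m"
    proof -
      have "(p ^ n) ^ m = p ^ m * (p ^ m) ^ (n - 1)"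
        using n by (cases n) (simp_all add: power_mult_distrib power_mult[symmetric] power_add[symmetric] algebra_simps)
      then show ?thesis by (simp add: power_mult_distrib)
    qed
    finally have "real (card S ^ m) \<le> real (A * (3 * C) ^ (n - 1) * (p ^ n) ^ m)" by (rule of_nat_mono)
    then show "real (card S) ^ m \<le> real (A * (3 * C) ^ (n - 1)) * real (p ^ n) ^ m" by simp
  qed
  then show ?thesis by (simp add: n_def)
qed

end


subsection \<open>The units of \<open>H\<close>\<close>

context unramified_cyclic
begin

lemma exists_moved_integer: obtains x where "x \<in> ints H" "s x \<noteq> x"
proof -
  have "\<not> int p dvd 1" using p_ge_3 by simp
  then have "s \<notin> U" using s cong_dvd_iff[of "\<psi> s" 1 "int p"] by (auto simp: U_def)
  then have one: "1 \<in> iprod (ints H) {s x - x |x. x \<in> ints H}"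
    using moved_generate_unit_ideal_H s(1) by blast
  have "\<exists>x\<in>ints H. s x \<noteq> x"
  proof (rule ccontr)
    assume "\<not> ?thesis"
    then have "iprod (ints H) {s x - x |x. x \<in> ints H} \<subseteq> {0}" by (intro iprod_least) auto
    then show False using one by auto
  qed
  then show ?thesis using that by blast
qed

lemma s_pow_moved:
  assumes "x \<in> H" "s x \<noteq> x" "i < p" "j < p" "(s ^^ i) x = (s ^^ j) x"
  shows "i = j"
proof -
  have main: False if ij: "i < j" "j < p" "(s ^^ i) x = (s ^^ j) x" for i j
  proof -
    define d where "d = j - i"
    have "inj_on (s ^^ i) H"
    proof (rule inj_onI)
      fix a b assume ab: "a \<in> H" "b \<in> H" "(s ^^ i) a = (s ^^ i) b"
      have "(s [^]\<^bsub>G\<^esub> i) a = (s [^]\<^bsub>G\<^esub> i) b" using ab act_pow[OF s_G] H_M by simp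
      then show "a = b" using ab H_M gal_bij[OF G.nat_pow_closed[OF s_G, of i]] by (auto simp: bij_betw_def inj_on_def)
    qed
    moreover have "(s ^^ j) x = (s ^^ i) ((s ^^ d) x)"
      using ij(1) by (simp add: d_def flip: funpow_add[unfolded comp_def, THEN fun_cong])
    ultimately have d: "(s ^^ d) x = x" using ij(3) assms(1) by (metis inj_onD s_pow_H)
    have dp: "0 < d" "d < p" using ij by (auto simp: d_def)
    obtain a b where ab: "d * a = p * b + 1" using prime_bezout[OF p(1) dp] .
    have "(s ^^ (d * a)) x = x"
      by (induction a) (auto simp: d funpow_add)
    moreover have "(s ^^ (p * b)) x = x"
      using s_pow_p[OF assms(1)] by (induction b) (auto simp: funpow_add)
    ultimately show False using assms(2) ab by simp
  qed
  show ?thesis using main[of i j] main[of j i] assms(3-5) by (metis linorder_neqE_nat)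
qed

definition conj_elt :: "complex \<Rightarrow> complex"
  where "conj_elt = (SOME c. c \<in> carrier G \<and> (\<forall>x\<in>M. c x = cnj x))"

lemma conj_elt: "conj_elt \<in> carrier G" "x \<in> M \<Longrightarrow> conj_elt x = cnj x"
proof -
  have "\<exists>c. c \<in> carrier G \<and> (\<forall>x\<in>M. c x = cnj x)" using cnj_gal by metis
  from someI_ex[OF this] show "conj_elt \<in> carrier G" "x \<in> M \<Longrightarrow> conj_elt x = cnj x"
    by (auto simp: conj_elt_def)
qed

text \<open>All embeddings of \<open>H\<close>, twice as many as its places, realised by elements of
  the Galois group of \<open>M\<close>; the flag selects the complex conjugate.\<close>

definition embH :: "(complex \<times> nat) \<times> bool \<Rightarrow> complex \<Rightarrow> complex"
  where "embH \<epsilon> = (let g = emb (fst (fst \<epsilon>)) \<otimes>\<^bsub>G\<^esub> s [^]\<^bsub>G\<^esub> snd (fst \<epsilon>) in if snd \<epsilon> then conj_elt \<otimes>\<^bsub>G\<^esub> g else g)"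

lemma embH_G: "\<rho> \<in> placesH \<Longrightarrow> embH (\<rho>, e) \<in> carrier G"
  using emb(1) conj_elt s_G by (auto simp: embH_def placesH_def Let_def)

lemma embH_eq:
  assumes "\<rho> \<in> placesH" "x \<in> M"
  shows "embH (\<rho>, e) x = (if e then cnj (aH \<rho> x) else aH \<rho> x)"
proof -
  have w: "emb (fst \<rho>) \<in> carrier G" "s [^]\<^bsub>G\<^esub> snd \<rho> \<in> carrier G" using assms emb(1) s_G by (auto simp: placesH_def)
  have "(emb (fst \<rho>) \<otimes>\<^bsub>G\<^esub> s [^]\<^bsub>G\<^esub> snd \<rho>) x = aH \<rho> x"
    using w assms(2) act_pow[OF s_G assms(2)] by (simp add: act_mult aH_def)
  moreover from this have "aH \<rho> x \<in> M" using w assms(2) by (metis G.m_closed gal_mem)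
  ultimately show ?thesis using w conj_elt assms(2) by (simp add: embH_def act_mult)
qed

lemma aH_eq: "\<rho> \<in> placesH \<Longrightarrow> x \<in> M \<Longrightarrow> aH \<rho> x = embH (\<rho>, False) x"
  by (simp add: embH_eq)

lemma embH_z:
  assumes "\<rho> \<in> placesH" shows "embH (\<rho>, e) z = (if e then cnj (fst \<rho>) else fst \<rho>)"
proof -
  have "(s ^^ i) z = z" for i by (induction i) (auto simp: s_K[OF z_K])
  then show ?thesis using embH_eq[OF assms z(1)] emb(2) assms by (auto simp: aH_def placesH_def)
qed

text \<open>\<open>\<theta> = x + m z\<close>: the value at \<open>z\<close> separates places and
  conjugates, the value at an \<open>x\<close> moved by \<open>s\<close> separates the powers of
  \<open>s\<close>. Only finitely many \<open>m\<close> produce an accidental coincidence between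
  embeddings that differ at \<open>z\<close>.\<close>

lemma primitive_integer:
  obtains \<theta> where "\<theta> \<in> ints H" "inj_on (\<lambda>\<epsilon>. embH \<epsilon> \<theta>) (placesH \<times> UNIV)"
proof -
  obtain x where x: "x \<in> ints H" "s x \<noteq> x" by (rule exists_moved_integer)
  have xH: "x \<in> H" "x \<in> M" using x ints_H_M by auto
  let ?E = "placesH \<times> (UNIV :: bool set)"
  have gE: "embH \<epsilon> \<in> carrier G" if "\<epsilon> \<in> ?E" for \<epsilon> using that embH_G by auto
  define bad where "bad \<epsilon> \<delta> = {m :: nat. embH \<epsilon> z \<noteq> embH \<delta> z \<and> embH \<epsilon> x + of_nat m * embH \<epsilon> z = embH \<delta> x + of_nat m * embH \<delta> z}" for \<epsilon> \<delta>
  have fin: "finite (bad \<epsilon> \<delta>)" for \<epsilon> \<delta>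
  proof -
    have "m = m'" if "m \<in> bad \<epsilon> \<delta>" "m' \<in> bad \<epsilon> \<delta>" for m m'
    proof -
      have "of_nat m * (embH \<epsilon> z - embH \<delta> z) = embH \<delta> x - embH \<epsilon> x"
        "of_nat m' * (embH \<epsilon> z - embH \<delta> z) = embH \<delta> x - embH \<epsilon> x"
        using that by (auto simp: bad_def algebra_simps)
      then have "of_nat m * (embH \<epsilon> z - embH \<delta> z) = of_nat m' * (embH \<epsilon> z - embH \<delta> z)" by simp
      then show "m = m'" using that by (auto simp: bad_def)
    qed
    then have "bad \<epsilon> \<delta> = {} \<or> (\<exists>m. bad \<epsilon> \<delta> = {m})" by blast
    then show ?thesis by auto
  qed
  have "finite (\<Union>\<epsilon>\<in>?E. \<Union>\<delta>\<in>?E. bad \<epsilon> \<delta>)" using finite_placesH fin by auto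
  then obtain m where m: "m \<notin> (\<Union>\<epsilon>\<in>?E. \<Union>\<delta>\<in>?E. bad \<epsilon> \<delta>)" using ex_new_if_finite infinite_UNIV_nat by blast
  define \<theta> where "\<theta> = x + of_nat m * z"
  have zH: "z \<in> ints H" using units_K_H[OF z_units] by (simp add: units_def)
  have val: "embH \<epsilon> \<theta> = embH \<epsilon> x + of_nat m * embH \<epsilon> z" if "\<epsilon> \<in> ?E" for \<epsilon>
    using gE[OF that] xH z(1) by (simp add: \<theta>_def gal_add gal_mult gal_of_int M.mult_F)
  have "inj_on (\<lambda>\<epsilon>. embH \<epsilon> \<theta>) ?E"
  proof (rule inj_onI)
    fix \<epsilon> \<delta> assume E: "\<epsilon> \<in> ?E" "\<delta> \<in> ?E" and eq: "embH \<epsilon> \<theta> = embH \<delta> \<theta>"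
    have zz: "embH \<epsilon> z = embH \<delta> z"
    proof (rule ccontr)
      assume "embH \<epsilon> z \<noteq> embH \<delta> z"
      then have "m \<in> bad \<epsilon> \<delta>" using eq val E by (simp add: bad_def)
      then show False using m E by blast
    qed
    then have xx: "embH \<epsilon> x = embH \<delta> x" using eq val E by simp
    obtain w i e where \<epsilon>: "\<epsilon> = ((w, i), e)" "w \<in> places" "i < p" using E(1) by (auto simp: placesH_def)
    obtain w' j e' where \<delta>: "\<delta> = ((w', j), e')" "w' \<in> places" "j < p" using E(2) by (auto simp: placesH_def)
    have I: "Im w > 0" "Im w' > 0" using \<epsilon> \<delta> by (auto simp: places_def)
    have "(if e then cnj w else w) = (if e' then cnj w' else w')"
    proof -
      have "embH \<epsilon> z = (if e then cnj w else w)" using embH_z[of "(w, i)" e] \<epsilon>(1) E(1) by simp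
      moreover have "embH \<delta> z = (if e' then cnj w' else w')" using embH_z[of "(w', j)" e'] \<delta>(1) E(2) by simp
      ultimately show ?thesis using zz by argo
    qed
    then have we: "e = e'" "w = w'"
      using I arg_cong[of "if e then cnj w else w" _ Im] by (auto split: if_splits)
    have "aH (w, i) x = aH (w, j) x"
      using xx embH_eq[of "(w, i)" x e] embH_eq[of "(w, j)" x e] xH(2) \<epsilon> \<delta> we E by (auto split: if_splits)
    then have "emb w ((s ^^ i) x) = emb w ((s ^^ j) x)" by (simp add: aH_def)
    then have "(s ^^ i) x = (s ^^ j) x"
      using gal_bij[OF emb(1)[OF \<epsilon>(2)]] H_M s_pow_H[OF xH(1)] by (auto simp: bij_betw_def inj_on_def)
    then have "i = j" using s_pow_moved[OF xH(1) x(2) \<epsilon>(3) \<delta>(3)] by blast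
    then show "\<epsilon> = \<delta>" using \<epsilon> \<delta> we by simp
  qed
  moreover have "\<theta> \<in> ints H" unfolding \<theta>_def using x(1) zH by (intro H.F.ints_add H.F.ints_mult H.F.ints_of_nat)
  ultimately show ?thesis using that by blast
qed

text \<open>Minkowski's theorem by the pigeonhole principle, in the lattice spanned by powers of \<open>\<theta>\<close>.\<close>

lemma small_integer:
  obtains D :: real where "D \<ge> 1"
    "\<And>t. (\<Sum>\<rho>\<in>placesH. t \<rho>) = 0 \<Longrightarrow> \<exists>x\<in>ints H. x \<noteq> 0 \<and> (\<forall>\<rho>\<in>placesH. cmod (aH \<rho> x) \<le> D * exp (t \<rho>))"
proof -
  obtain \<theta> where \<theta>: "\<theta> \<in> ints H" "inj_on (\<lambda>\<epsilon>. embH \<epsilon> \<theta>) (placesH \<times> UNIV)" by (rule primitive_integer)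
  have \<theta>M: "\<theta> \<in> M" "\<theta> \<in> ints M" using ints_H_M[OF \<theta>(1)] by auto
  define d where "d = 2 * card placesH"
  define lc where "lc a = (\<Sum>k<d. of_int (a k) * \<theta> ^ k)" for a :: "nat \<Rightarrow> int"
  have lcH: "lc a \<in> ints H" for a unfolding lc_def using \<theta>(1) by (intro H.F.ints_sum) auto
  have lcM: "lc a \<in> M" for a using ints_H_M(2)[OF lcH] .
  have val: "g (lc a) = (\<Sum>k<d. of_int (a k) * g \<theta> ^ k)" if "g \<in> carrier G" for g a
    unfolding lc_def using that \<theta>M by (subst gal_sum) (auto simp: gal_mult gal_of_int gal_power M.power_F)
  \<comment> \<open>The number \<open>d\<close> of embeddings is the degree of \<open>H\<close>: a
    nonzero polynomial of degree below \<open>d\<close> cannot vanish at \<open>d\<close> distinct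
    conjugates of \<open>\<theta>\<close>.\<close>
  have indep: "\<forall>k<d. a k = 0" if "lc a = 0" for a
  proof -
    define q :: "complex poly" where "q = (\<Sum>k<d. monom (of_int (a k)) k)"
    have cq: "coeff q k = (if k < d then of_int (a k) else 0)" for k
      by (simp add: q_def coeff_sum)
    have "q = 0"
    proof (rule ccontr)
      assume q0: "q \<noteq> 0"
      have "poly q (embH \<epsilon> \<theta>) = 0" if "\<epsilon> \<in> placesH \<times> UNIV" for \<epsilon>
      proof -
        have g: "embH \<epsilon> \<in> carrier G" using that embH_G by auto
        then show ?thesis using val[OF g, of a] \<open>lc a = 0\<close> by (simp add: q_def poly_sum poly_monom gal_zero)
      qed
      then have "(\<lambda>\<epsilon>. embH \<epsilon> \<theta>) ` (placesH \<times> UNIV) \<subseteq> {y. poly q y = 0}" by auto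
      then have "card ((\<lambda>\<epsilon>. embH \<epsilon> \<theta>) ` (placesH \<times> (UNIV :: bool set))) \<le> card {y. poly q y = 0}"
        using poly_roots_finite[OF q0] by (intro card_mono) auto
      then have "d \<le> degree q"
        using card_poly_roots_bound[OF q0] \<theta>(2) by (simp add: card_image card_cartesian_product d_def)
      then show False using cq[of "degree q"] q0 by (auto simp: leading_coeff_0_iff)
    qed
    then show ?thesis using cq by (metis coeff_0 of_int_eq_0_iff)
  qed
  define E :: real where "E = 1 + (\<Sum>\<rho>\<in>placesH. \<Sum>k<d. cmod (aH \<rho> \<theta>) ^ k)"
  have E1: "E \<ge> 1" by (auto simp: E_def intro!: sum_nonneg)
  have bnd: "cmod (aH \<rho> (lc a)) \<le> A * E" if \<rho>: "\<rho> \<in> placesH" "\<And>k. k < d \<Longrightarrow> \<bar>a k\<bar> \<le> A" for \<rho> a and A :: int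
  proof -
    have g: "embH (\<rho>, False) \<in> carrier G" using embH_G[OF \<rho>(1)] .
    have "aH \<rho> (lc a) = (\<Sum>k<d. of_int (a k) * aH \<rho> \<theta> ^ k)"
      using val[OF g] aH_eq[OF \<rho>(1)] lcM \<theta>M by simp
    then have "cmod (aH \<rho> (lc a)) \<le> (\<Sum>k<d. real_of_int \<bar>a k\<bar> * cmod (aH \<rho> \<theta>) ^ k)"
      using norm_sum[of "\<lambda>k. of_int (a k) * aH \<rho> \<theta> ^ k" "{..<d}"] by (simp add: norm_mult norm_power)
    also have "\<dots> \<le> (\<Sum>k<d. real_of_int A * cmod (aH \<rho> \<theta>) ^ k)"
      using \<rho>(2) by (intro sum_mono mult_right_mono) (simp_all del: of_int_abs)
    also have "\<dots> = real_of_int A * (\<Sum>k<d. cmod (aH \<rho> \<theta>) ^ k)" by (simp add: sum_distrib_left)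
    also have "\<dots> \<le> real_of_int A * E"
    proof (rule mult_left_mono)
      have "(\<Sum>k<d. cmod (aH \<rho> \<theta>) ^ k) \<le> (\<Sum>\<rho>\<in>placesH. \<Sum>k<d. cmod (aH \<rho> \<theta>) ^ k)"
        using finite_placesH \<rho>(1) by (intro member_le_sum) (auto intro!: sum_nonneg)
      then show "(\<Sum>k<d. cmod (aH \<rho> \<theta>) ^ k) \<le> E" by (simp add: E_def)
      have "d > 0" using \<rho>(1) finite_placesH by (auto simp: d_def card_gt_0_iff)
      then show "0 \<le> real_of_int A" using \<rho>(2)[of 0] by simp
    qed
    finally show ?thesis .
  qed
  have "\<exists>x\<in>ints H. x \<noteq> 0 \<and> (\<forall>\<rho>\<in>placesH. cmod (aH \<rho> x) \<le> 8 * E * exp (t \<rho>))" if t: "(\<Sum>\<rho>\<in>placesH. t \<rho>) = 0" for t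
  proof -
    \<comment> \<open>The coefficient range \<open>A\<close> is large enough to make every
      \<open>q \<rho>\<close> at least 1; rounding then costs at most a factor 2 in the number of
      cells.\<close>
    define A :: nat where "A = nat \<lceil>\<Sum>\<rho>\<in>placesH. 4 * exp (t \<rho>)\<rceil>"
    have A: "4 * exp (t \<rho>) \<le> real A" if "\<rho> \<in> placesH" for \<rho>
    proof -
      have "4 * exp (t \<rho>) \<le> (\<Sum>\<rho>\<in>placesH. 4 * exp (t \<rho>))"
        using that finite_placesH by (intro member_le_sum) auto
      then show ?thesis unfolding A_def by linarith
    qed
    define q where "q \<rho> = real A * exp (- t \<rho>) / 4" for \<rho>
    have q1: "q \<rho> \<ge> 1" if "\<rho> \<in> placesH" for \<rho>
      using A[OF that] by (simp add: q_def exp_minus field_simps)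
    \<comment> \<open>Side length of the cells. Each real coordinate meets at most
      \<open>4 * q \<rho> = A exp (- t \<rho>)\<close> cells; as the \<open>t \<rho>\<close> sum to
      0, there are at most \<open>A^d\<close> cells for \<open>(A + 1)^d\<close> coefficient
      vectors.\<close>
    define \<delta> where "\<delta> \<rho> = 4 * E * exp (t \<rho>)" for \<rho>
    have \<delta>: "\<delta> \<rho> > 0" for \<rho> using E1 by (simp add: \<delta>_def)
    have \<delta>q: "\<delta> \<rho> * q \<rho> = real A * E" for \<rho> by (simp add: \<delta>_def q_def exp_minus field_simps)
    define cell where "cell a = (\<lambda>\<rho>\<in>placesH. (\<lfloor>Re (aH \<rho> (lc a)) / \<delta> \<rho>\<rfloor>, \<lfloor>Im (aH \<rho> (lc a)) / \<delta> \<rho>\<rfloor>))" for a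
    let ?Vs = "PiE {..<d} (\<lambda>_. {0..int A})"
    define I where "I \<rho> = {\<lfloor>- q \<rho>\<rfloor>..\<lfloor>q \<rho>\<rfloor>}" for \<rho>
    let ?Cs = "PiE placesH (\<lambda>\<rho>. I \<rho> \<times> I \<rho>)"
    have finC: "finite ?Cs" using finite_placesH by (intro finite_PiE) (auto simp: I_def)
    have "cell ` ?Vs \<subseteq> ?Cs"
    proof (rule image_subsetI)
      fix a assume a: "a \<in> ?Vs"
      have "\<lfloor>Re (aH \<rho> (lc a)) / \<delta> \<rho>\<rfloor> \<in> I \<rho> \<and> \<lfloor>Im (aH \<rho> (lc a)) / \<delta> \<rho>\<rfloor> \<in> I \<rho>" if \<rho>: "\<rho> \<in> placesH" for \<rho>
      proof -
        have "cmod (aH \<rho> (lc a)) \<le> real_of_int (int A) * E"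
          using a by (intro bnd[OF \<rho>]) (auto simp: PiE_iff)
        then have c: "cmod (aH \<rho> (lc a)) \<le> \<delta> \<rho> * q \<rho>" using \<delta>q by simp
        have "\<lfloor>r / \<delta> \<rho>\<rfloor> \<in> I \<rho>" if "\<bar>r\<bar> \<le> \<delta> \<rho> * q \<rho>" for r
        proof -
          have "r / \<delta> \<rho> \<le> q \<rho>" "- q \<rho> \<le> r / \<delta> \<rho>" using that \<delta>[of \<rho>] by (auto simp: field_simps abs_le_iff)
          then show ?thesis by (auto simp: I_def intro: floor_mono)
        qed
        then show ?thesis using c abs_Re_le_cmod abs_Im_le_cmod order_trans by blast
      qed
      then show "cell a \<in> ?Cs" by (auto simp: cell_def)
    qed
    moreover have "card ?Cs < card ?Vs"
    proof -
      have cI: "real (card (I \<rho>)) \<le> real A * exp (- t \<rho>)" if "\<rho> \<in> placesH" for \<rho>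
      proof -
        have "real (card (I \<rho>)) \<le> 2 * q \<rho> + 2" using q1[OF that] by (simp add: I_def) linarith
        also have "\<dots> \<le> 4 * q \<rho>" using q1[OF that] by simp
        finally show ?thesis by (simp add: q_def)
      qed
      have "real (card ?Cs) = (\<Prod>\<rho>\<in>placesH. real (card (I \<rho>)) ^ 2)"
        using finite_placesH by (simp add: card_PiE card_cartesian_product power2_eq_square)
      also have "\<dots> \<le> (\<Prod>\<rho>\<in>placesH. (real A * exp (- t \<rho>)) ^ 2)"
        using cI by (intro prod_mono) (auto intro!: power_mono)
      also have "\<dots> = (\<Prod>\<rho>\<in>placesH. real A * exp (- t \<rho>)) ^ 2" by (rule prod_power_distrib[symmetric])
      also have "(\<Prod>\<rho>\<in>placesH. real A * exp (- t \<rho>)) = real A ^ card placesH * exp (- (\<Sum>\<rho>\<in>placesH. t \<rho>))"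
        using finite_placesH by (simp add: prod.distrib exp_sum sum_negf[symmetric])
      also have "\<dots> ^ 2 = real A ^ d" using t by (simp add: d_def power_mult mult.commute[of 2])
      finally have "card ?Cs \<le> A ^ d" by (metis of_nat_le_iff of_nat_power)
      also have "\<dots> < Suc A ^ d"
      proof (rule power_strict_mono)
        show "0 < d" using places_nonempty finite_placesH finite_places p_gt_0 by (auto simp: d_def card_placesH card_gt_0_iff)
      qed auto
      also have "Suc A ^ d = card ?Vs" by (simp add: card_PiE nat_add_distrib)
      finally show ?thesis .
    qed
    ultimately have "card (cell ` ?Vs) < card ?Vs" using card_mono[OF finC] by (meson le_less_trans)
    then have "\<not> inj_on cell ?Vs" by (rule pigeonhole)
    then obtain a b where ab: "a \<in> ?Vs" "b \<in> ?Vs" "a \<noteq> b" "cell a = cell b" by (auto simp: inj_on_def)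
    define x where "x = lc a - lc b"
    have xd: "x = lc (\<lambda>k. a k - b k)" by (simp add: x_def lc_def sum_subtractf left_diff_distrib)
    have "x \<noteq> 0"
    proof
      assume "x = 0"
      then have "lc (\<lambda>k. a k - b k) = 0" using xd by simp
      then have "\<forall>k<d. a k = b k" using indep[of "\<lambda>k. a k - b k"] by simp
      then have "a = b" using ab(1,2) by (intro PiE_ext) auto
      then show False using ab(3) by blast
    qed
    moreover have "x \<in> ints H" unfolding x_def using lcH by auto
    moreover have "cmod (aH \<rho> x) \<le> 8 * E * exp (t \<rho>)" if \<rho>: "\<rho> \<in> placesH" for \<rho>
    proof -
      have g: "embH (\<rho>, False) \<in> carrier G" using embH_G[OF \<rho>] .
      have ax: "aH \<rho> x = aH \<rho> (lc a) - aH \<rho> (lc b)"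
        using gal_diff[OF g lcM lcM] aH_eq[OF \<rho>] lcM by (simp add: x_def M.diff_F)
      have close: "\<bar>r - r'\<bar> \<le> \<delta> \<rho>" if "\<lfloor>r / \<delta> \<rho>\<rfloor> = \<lfloor>r' / \<delta> \<rho>\<rfloor>" for r r'
      proof -
        have "\<bar>r / \<delta> \<rho> - r' / \<delta> \<rho>\<bar> \<le> 1" using that by linarith
        then show ?thesis using \<delta>[of \<rho>] by (simp add: diff_divide_distrib[symmetric] abs_divide)
      qed
      have "cell a \<rho> = cell b \<rho>" using ab(4) by simp
      then have "\<bar>Re (aH \<rho> x)\<bar> \<le> \<delta> \<rho>" "\<bar>Im (aH \<rho> x)\<bar> \<le> \<delta> \<rho>"
        using \<rho> by (auto simp: cell_def ax intro: close)
      then have "cmod (aH \<rho> x) \<le> \<delta> \<rho> + \<delta> \<rho>" using cmod_le[of "aH \<rho> x"] by linarith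
      then show ?thesis by (simp add: \<delta>_def)
    qed
    ultimately show ?thesis by blast
  qed
  moreover have "8 * E \<ge> 1" using E1 by simp
  ultimately show ?thesis using that by blast
qed

text \<open>The norm of a nonzero integer has absolute value at least 1, so upper bounds at all
  other places force a lower bound at \<open>\<rho>\<close>.\<close>

lemma abs_ln_placesH:
  assumes x: "x \<in> ints H" "x \<noteq> 0" and D: "D \<ge> 1" and t: "(\<Sum>\<rho>\<in>placesH. t \<rho>) = 0"
    and le: "\<And>\<rho>. \<rho> \<in> placesH \<Longrightarrow> cmod (aH \<rho> x) \<le> D * exp (t \<rho>)" and \<rho>: "\<rho> \<in> placesH"
  shows "\<bar>ln (cmod (aH \<rho> x)) - t \<rho>\<bar> \<le> real (card placesH) * ln D"
    and "cmod (norm_Q x) \<le> (D ^ card placesH) ^ (2 * card U)"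
proof -
  have xM: "x \<in> M" "x \<in> ints M" "x \<in> H" using ints_H_M[OF x(1)] by auto
  have pos: "cmod (aH \<rho> x) > 0" if "\<rho> \<in> placesH" for \<rho>
    using gal_eq_0_iff[OF embH_G[OF that] xM(1)] aH_eq[OF that xM(1)] x(2) by simp
  have l: "ln (cmod (aH \<rho> x)) - t \<rho> \<le> ln D" if "\<rho> \<in> placesH" for \<rho>
  proof -
    have "ln (cmod (aH \<rho> x)) \<le> ln (D * exp (t \<rho>))" using le[OF that] pos[OF that] D by (subst ln_le_cancel_iff) auto
    also have "\<dots> = ln D + t \<rho>" using D by (simp add: ln_mult)
    finally show ?thesis by simp
  qed
  have N: "cmod (norm_Q x) = (\<Prod>\<rho>\<in>placesH. cmod (aH \<rho> x)) ^ (2 * card U)" by (rule norm_H_places[OF xM(3)])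
  have U0: "2 * card U > 0" using finite_U U_subgroup(1) by (auto simp: card_gt_0_iff)
  have "(\<Prod>\<rho>\<in>placesH. cmod (aH \<rho> x)) \<ge> 1"
  proof (rule ccontr)
    assume "\<not> ?thesis"
    moreover have "(\<Prod>\<rho>\<in>placesH. cmod (aH \<rho> x)) \<ge> 0" by (rule prod_nonneg) simp
    ultimately have "cmod (norm_Q x) < 1" unfolding N using U0 power_strict_mono[of "\<Prod>\<rho>\<in>placesH. cmod (aH \<rho> x)" 1 "2 * card U"] by simp
    then show False using norm_nonzero_ge_1[OF xM(2) x(2)] by simp
  qed
  then have "0 \<le> ln (\<Prod>\<rho>\<in>placesH. cmod (aH \<rho> x))" by simp
  also have "\<dots> = (\<Sum>\<rho>\<in>placesH. ln (cmod (aH \<rho> x)))" using pos finite_placesH by (intro ln_prod) auto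
  also have "\<dots> = (\<Sum>\<rho>\<in>placesH. ln (cmod (aH \<rho> x)) - t \<rho>)" using t by (simp add: sum_subtractf)
  also have "\<dots> = (ln (cmod (aH \<rho> x)) - t \<rho>) + (\<Sum>\<sigma>\<in>placesH - {\<rho>}. ln (cmod (aH \<sigma> x)) - t \<sigma>)"
    using \<rho> finite_placesH by (simp add: sum.remove)
  also have "\<dots> \<le> (ln (cmod (aH \<rho> x)) - t \<rho>) + (\<Sum>\<sigma>\<in>placesH - {\<rho>}. ln D)"
    using l by (intro add_left_mono sum_mono) auto
  also have "(\<Sum>\<sigma>\<in>placesH - {\<rho>}. ln D) \<le> real (card placesH) * ln D"
    using D finite_placesH by (auto intro!: mult_right_mono card_mono)
  finally have "- (real (card placesH) * ln D) \<le> ln (cmod (aH \<rho> x)) - t \<rho>" by linarith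
  moreover have "ln D \<le> real (card placesH) * ln D"
  proof -
    have "card placesH \<ge> 1" using \<rho> finite_placesH by (auto simp: Suc_le_eq card_gt_0_iff)
    then show ?thesis using D mult_right_mono[of 1 "real (card placesH)" "ln D"] by simp
  qed
  ultimately show "\<bar>ln (cmod (aH \<rho> x)) - t \<rho>\<bar> \<le> real (card placesH) * ln D" using l[OF \<rho>] by linarith
  have "(\<Prod>\<rho>\<in>placesH. cmod (aH \<rho> x)) \<le> (\<Prod>\<rho>\<in>placesH. D * exp (t \<rho>))"
    using le by (intro prod_mono) auto
  also have "\<dots> = D ^ card placesH" using finite_placesH t by (simp add: prod.distrib exp_sum[symmetric])
  finally have "(\<Prod>\<rho>\<in>placesH. cmod (aH \<rho> x)) \<le> D ^ card placesH" .
  then show "cmod (norm_Q x) \<le> (D ^ card placesH) ^ (2 * card U)"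
    unfolding N by (intro power_mono prod_nonneg) auto
qed

text \<open>
  Small integers with prescribed sizes on a grid of logarithmic vectors have bounded norm, hence fall
  into finitely many classes of associates; quotients within a class are units.
\<close>

lemma ubox_H_lower:
  obtains B C :: nat where "C > 0" "\<And>k. (k + 1) ^ (card placesH - 1) \<le> card (ubox H (C * (k + 1))) * B"
proof -
  obtain D :: real where D: "D \<ge> 1" "\<And>t. (\<Sum>\<rho>\<in>placesH. t \<rho>) = 0 \<Longrightarrow> \<exists>x\<in>ints H. x \<noteq> 0 \<and> (\<forall>\<rho>\<in>placesH. cmod (aH \<rho> x) \<le> D * exp (t \<rho>))"
    using small_integer by blast
  define N where "N = card placesH"
  have HM: "H \<subseteq> M" using H_M by blast
  obtain \<rho>0 where \<rho>0: "\<rho>0 \<in> placesH" using places_nonempty p_gt_0 by (auto simp: placesH_def)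
  let ?P = "placesH - {\<rho>0}"
  define c where "c = real N * ln D"
  have c0: "c \<ge> 0" using D(1) by (simp add: c_def)
  \<comment> \<open>Grid spacing larger than twice the error \<open>c\<close>, so different grid
    points give different integers \<open>xf f\<close>.\<close>
  define q where "q = 2 * c + 1"
  define tv where "tv f \<rho> = (if \<rho> = \<rho>0 then - (\<Sum>\<sigma>\<in>?P. q * real (f \<sigma>)) else q * real (f \<rho>))" for f :: "complex \<times> nat \<Rightarrow> nat" and \<rho>
  have tv0: "(\<Sum>\<rho>\<in>placesH. tv f \<rho>) = 0" for f
    using \<rho>0 finite_placesH by (simp add: sum.remove[of placesH \<rho>0] tv_def)
  define xf where "xf f = (SOME x. x \<in> ints H \<and> x \<noteq> 0 \<and> (\<forall>\<rho>\<in>placesH. cmod (aH \<rho> x) \<le> D * exp (tv f \<rho>)))" for f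
  have xf: "xf f \<in> ints H" "xf f \<noteq> 0" "\<And>\<rho>. \<rho> \<in> placesH \<Longrightarrow> cmod (aH \<rho> (xf f)) \<le> D * exp (tv f \<rho>)" for f
    using someI_ex[of "\<lambda>x. x \<in> ints H \<and> x \<noteq> 0 \<and> (\<forall>\<rho>\<in>placesH. cmod (aH \<rho> x) \<le> D * exp (tv f \<rho>))"] D(2)[OF tv0[of f]]
    unfolding xf_def by blast+
  have xfM: "xf f \<in> ints M" "xf f \<in> M" "xf f \<in> H" for f using ints_H_M[OF xf(1)] by auto
  have ln_xf: "\<bar>ln (cmod (aH \<rho> (xf f))) - tv f \<rho>\<bar> \<le> c" if "\<rho> \<in> placesH" for f \<rho>
    using abs_ln_placesH(1)[OF xf(1,2) D(1) tv0 xf(3) that] by (simp add: c_def N_def)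
  \<comment> \<open>All norms are nonzero integers of absolute value at most \<open>Bn\<close>, so
    they divide the factorial \<open>m\<close>, and each \<open>xf f\<close> divides
    \<open>m\<close>.\<close>
  define Bn where "Bn = nat \<lceil>(D ^ N) ^ (2 * card U)\<rceil>"
  define m where "m = (fact Bn :: nat)"
  have m0: "m > 0" by (simp add: m_def)
  have div_m: "\<exists>y\<in>ints M. of_nat m = xf f * y" for f
  proof -
    obtain y where y: "y \<in> ints M" "norm_Q (xf f) = xf f * y" using norm_multiple[OF xfM(1)] by blast
    obtain k :: int where k: "norm_Q (xf f) = of_int k" using norm_Ints[OF xfM(1)] by (auto elim: Ints_cases)
    have "k \<noteq> 0" using k norm_eq_0_iff[OF xfM(2), of f] xf(2)[of f] by auto
    have "cmod (norm_Q (xf f)) \<le> (D ^ N) ^ (2 * card U)"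
      using abs_ln_placesH(2)[OF xf(1,2) D(1) tv0 xf(3) \<rho>0] by (simp add: N_def)
    then have "real_of_int \<bar>k\<bar> \<le> (D ^ N) ^ (2 * card U)" using k by simp
    then have "nat \<bar>k\<bar> \<le> Bn" unfolding Bn_def by linarith
    then have "nat \<bar>k\<bar> dvd m" using \<open>k \<noteq> 0\<close> unfolding m_def by (intro dvd_fact) auto
    then have "k dvd int m" by (metis abs_dvd_iff int_nat_eq abs_ge_zero int_dvd_int_iff nat_0_le)
    then obtain l where "int m = k * l" by blast
    then have "(of_nat m :: complex) = of_int k * of_int l" by (metis of_int_mult of_int_of_nat_eq)
    then have "of_nat m = xf f * (y * of_int l)" using k y by simp
    moreover have "y * of_int l \<in> ints M" using y(1) by (intro M.ints_mult M.ints_of_int)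
    ultimately show ?thesis by blast
  qed
  obtain S where S: "finite S" "S \<subseteq> ints H" "\<And>x. x \<in> ints H \<Longrightarrow> \<exists>s\<in>S. algebraic_int ((x - s) / of_nat m)"
    using finite_residues[OF m0 ints_mono[OF HM]] by metis
  define res where "res f = (SOME s. s \<in> S \<and> algebraic_int ((xf f - s) / of_nat m))" for f
  have res: "res f \<in> S" "algebraic_int ((xf f - res f) / of_nat m)" for f
    using someI_ex[of "\<lambda>s. s \<in> S \<and> algebraic_int ((xf f - s) / of_nat m)"] S(3)[OF xf(1)] unfolding res_def by blast+
  \<comment> \<open>\<open>xf f / xf h = 1 + (xf f - xf h) / m * (m / xf h)\<close>, where both
    factors of the product are integral. By symmetry, equal residues modulo \<open>m\<close> give
    associated elements.\<close>
  have assoc: "xf f / xf h \<in> ints H" if "res f = res h" for f h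
  proof -
    obtain y where y: "y \<in> ints M" "of_nat m = xf h * y" using div_m by blast
    have "algebraic_int ((xf f - res f) / of_nat m - (xf h - res h) / of_nat m)"
      using res(2) by (intro algebraic_int_diff)
    then have "algebraic_int ((xf f - xf h) / of_nat m)" using that by (simp add: diff_divide_distrib)
    then have "algebraic_int (1 + (xf f - xf h) / of_nat m * y)"
      using y(1) M.ints_F(2) by (intro algebraic_int_add_mult) auto
    moreover have "1 + (xf f - xf h) / of_nat m * y = xf f / xf h"
    proof -
      have "y \<noteq> 0" using y(2) m0 by auto
      then show ?thesis using xf(2)[of h] unfolding y(2) by (simp add: field_simps)
    qed
    ultimately show ?thesis using H.F.divide_F[OF xfM(3) xfM(3)] by (simp add: ints_def)
  qed
  define C where "C = nat \<lceil>2 * (real N * q + c)\<rceil> + 1"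
  have C: "2 * (real N * q + c) \<le> real C" unfolding C_def by linarith
  have "(k + 1) ^ (N - 1) \<le> card (ubox H (C * (k + 1))) * card S" for k
  proof -
    let ?F = "PiE ?P (\<lambda>_. {0..k})"
    have tv_le: "\<bar>tv f \<rho>\<bar> \<le> real N * q * real k" if "f \<in> ?F" "\<rho> \<in> placesH" for f \<rho>
    proof -
      have f: "q * real (f \<sigma>) \<le> q * real k" "q * real (f \<sigma>) \<ge> 0" if "\<sigma> \<in> ?P" for \<sigma>
        using that \<open>f \<in> ?F\<close> c0 by (auto simp: q_def PiE_iff intro!: mult_left_mono)
      have N1: "real N \<ge> 1" using \<rho>0 finite_placesH by (auto simp: N_def Suc_le_eq card_gt_0_iff)
      have qk: "q * real k \<ge> 0" using c0 by (simp add: q_def)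
      show ?thesis
      proof (cases "\<rho> = \<rho>0")
        case True
        have "(\<Sum>\<sigma>\<in>?P. q * real (f \<sigma>)) \<le> (\<Sum>\<sigma>\<in>?P. q * real k)" using f by (intro sum_mono)
        also have "\<dots> \<le> real N * (q * real k)"
          using finite_placesH qk by (simp add: N_def mult_right_mono card_mono del: card_Diff_insert)
        finally have "(\<Sum>\<sigma>\<in>?P. q * real (f \<sigma>)) \<le> real N * q * real k" by (simp add: mult.assoc)
        moreover have "(\<Sum>\<sigma>\<in>?P. q * real (f \<sigma>)) \<ge> 0" using f by (intro sum_nonneg)
        ultimately show ?thesis using True by (simp add: tv_def)
      next
        case False
        then have "\<bar>tv f \<rho>\<bar> \<le> q * real k" using f[of \<rho>] that by (simp add: tv_def)
        also have "\<dots> \<le> real N * (q * real k)" using N1 qk mult_right_mono[of 1 "real N" "q * real k"] by simp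
        finally show ?thesis by (simp add: mult.assoc)
      qed
    qed
    have inj: "inj_on xf ?F"
    proof (rule inj_onI)
      fix f h assume fh: "f \<in> ?F" "h \<in> ?F" "xf f = xf h"
      show "f = h"
      proof (rule PiE_ext[OF fh(1,2)])
        fix \<sigma> assume \<sigma>: "\<sigma> \<in> ?P"
        have "\<bar>tv f \<sigma> - tv h \<sigma>\<bar> \<le> 2 * c" using ln_xf[of \<sigma> f] ln_xf[of \<sigma> h] fh(3) \<sigma> by auto
        then have "\<bar>q * (real (f \<sigma>) - real (h \<sigma>))\<bar> \<le> 2 * c" using \<sigma> by (simp add: tv_def right_diff_distrib)
        moreover have q0: "q > 0" using c0 by (simp add: q_def)
        ultimately have "q * \<bar>real (f \<sigma>) - real (h \<sigma>)\<bar> \<le> 2 * c" by (simp only: abs_mult abs_of_pos)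
        also have "2 * c < q * 1" by (simp add: q_def)
        finally have "q * \<bar>real (f \<sigma>) - real (h \<sigma>)\<bar> < q * 1" .
        then have "\<bar>real (f \<sigma>) - real (h \<sigma>)\<bar> < 1" using mult_less_cancel_left_pos[OF q0] by blast
        then show "f \<sigma> = h \<sigma>" by linarith
      qed
    qed
    have "card ?F \<le> card (ubox H (C * (k + 1))) * card S"
    proof (rule card_le_fibres[where f = res])
      show "finite ?F" using finite_placesH by (intro finite_PiE) auto
      show "res ` ?F \<subseteq> S" using res(1) by blast
      fix b
      show "card {f \<in> ?F. res f = b} \<le> card (ubox H (C * (k + 1)))"
      proof (cases "{f \<in> ?F. res f = b} = {}")
        case False
        then obtain h where h: "h \<in> ?F" "res h = b" by blast
        have "(\<lambda>f. xf f / xf h) ` {f \<in> ?F. res f = b} \<subseteq> ubox H (C * (k + 1))"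
        proof (rule image_subsetI)
          fix f assume "f \<in> {f \<in> ?F. res f = b}"
          then have f: "f \<in> ?F" "res f = res h" using h by auto
          have u: "xf f / xf h \<in> units H"
            using assoc[OF f(2)] assoc[OF f(2)[symmetric]] xf(2) by (simp add: units_def)
          have "height_le (xf f / xf h) (C * (k + 1))"
            unfolding height_le_def
          proof
            fix g assume g: "g \<in> carrier G"
            obtain \<rho> where \<rho>: "\<rho> \<in> placesH" "\<And>x. x \<in> H \<Longrightarrow> cmod (g x) = cmod (aH \<rho> x)" using galois_place_H[OF g] by blast
            have b: "\<bar>ln (cmod (g (xf f')))\<bar> \<le> real N * q * real k + c" if "f' \<in> ?F" for f'
              using ln_xf[OF \<rho>(1), of f'] tv_le[OF that \<rho>(1)] \<rho>(2)[OF xfM(3)] by simp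
            have "\<bar>a - a'\<bar> \<le> 2 * r" if "\<bar>a\<bar> \<le> r" "\<bar>a'\<bar> \<le> r" for a a' r :: real using that by linarith
            from this[OF b[OF f(1)] b[OF h(1)]]
            have "\<bar>ln (cmod (g (xf f / xf h)))\<bar> \<le> 2 * (real N * q * real k + c)"
              using ln_cmod(2)[OF g xfM(2) xfM(2) xf(2) xf(2), of f h] by (simp only:)
            also have "\<dots> \<le> 2 * (real N * q + c) * (real k + 1)"
            proof -
              have "2 * (real N * q + c) * (real k + 1) = 2 * (real N * q * real k + c) + 2 * (real N * q + c * real k)"
                by (simp add: algebra_simps)
              moreover have "2 * (real N * q + c * real k) \<ge> 0" using c0 by (simp add: q_def)
              ultimately show ?thesis by (simp only: le_add_same_cancel1)
            qed
            also have "\<dots> \<le> real C * (real k + 1)" using C by (intro mult_right_mono) auto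
            finally show "\<bar>ln (cmod (g (xf f / xf h)))\<bar> \<le> real (C * (k + 1))" by (simp only: of_nat_mult of_nat_add of_nat_1)
          qed
          then show "xf f / xf h \<in> ubox H (C * (k + 1))" using u by (simp add: ubox_def)
        qed
        moreover have "inj_on (\<lambda>f. xf f / xf h) {f \<in> ?F. res f = b}"
          using inj xf(2)[of h] by (auto simp: inj_on_def)
        ultimately show ?thesis by (intro card_inj_on_le finite_ubox[OF HM])
      qed (simp only: card.empty le0)
    qed (rule S(1))
    moreover have "card ?F = (k + 1) ^ (N - 1)"
      using finite_placesH \<rho>0 by (simp add: card_PiE N_def)
    ultimately show ?thesis by simp
  qed
  moreover have "C > 0" by (simp add: C_def)
  ultimately show ?thesis using that unfolding N_def by blast
qed

text \<open>The number of units in a box of size \<open>T\<close> grows at least like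
  \<open>T^(N-1)\<close>. Under the opposite assumption, extracting \<open>p\<close>-th roots with
  at most \<open>p^(N-1)\<close> representatives, and using the \<open>p\<close> roots of unity,
  gives growth at most like \<open>T^(N-2)\<close>.\<close>

theorem class_number_divisible: "p dvd Coset.order (class_group K)"
proof (rule ccontr)
  assume reg: "\<not> ?thesis"
  have HM: "H \<subseteq> M" using H_M by blast
  define n where "n = card places"
  define N where "N = card placesH"
  have n: "n > 0" using places_nonempty finite_places by (auto simp: n_def card_gt_0_iff)
  have N: "N = n * p" by (simp add: N_def n_def card_placesH)
  have "1 * 3 \<le> n * p" using n p_ge_3 by (intro mult_le_mono) auto
  then have N3: "N \<ge> 3" by (simp add: N)
  obtain Fs where Fs: "finite Fs" "Fs \<subseteq> units H" "card Fs \<le> p ^ (n * p - 1)"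
    "\<And>x. x \<in> units H \<Longrightarrow> \<exists>f\<in>Fs. \<exists>y\<in>units H. x = f * y ^ p"
  proof (rule units_index_bound[of n])
    show "n > 0" by (rule n)
    show "\<exists>\<eta>\<in>units H. \<epsilon> = \<eta> / s \<eta>" if "\<epsilon> \<in> units H" "rnorm \<epsilon> = 1" for \<epsilon>
      using norm_one_unit[OF reg that] by metis
    show "card S \<le> p ^ n" if "finite S" "S \<subseteq> units K"
      "\<And>x y. x \<in> S \<Longrightarrow> y \<in> S \<Longrightarrow> pth_power_equiv x y \<Longrightarrow> x = y" for S
      using independent_units_card[OF that] by (simp add: n_def)
  qed (rule that)
  obtain C0 where C0: "C0 > 0" "\<And>x. x \<in> Fs \<Longrightarrow> height_le x C0" using height_bound_finite[OF Fs(1,2)] by blast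
  obtain B C :: nat where BC: "C > 0" "\<And>k. (k + 1) ^ (card placesH - 1) \<le> card (ubox H (C * (k + 1))) * B"
    using ubox_H_lower by blast
  have zH: "z \<in> units H" using units_K_H[OF z_units] .
  have z_h: "ln (cmod (g (z ^ i))) = 0" if g: "g \<in> carrier G" for g i
  proof -
    have "g z ^ p = 1" using gal_power[OF g z(1), of p] z(2) gal_one[OF g] by simp
    then have "cmod (g z) ^ p = 1" by (metis norm_one norm_power)
    then have "cmod (g z) = 1" using p_gt_0 power_eq_1_iff[of "cmod (g z)" p] by simp
    then show ?thesis using gal_power[OF g z(1)] by (simp add: norm_power)
  qed
  \<comment> \<open>Each unit \<open>x = f * y^p\<close> yields \<open>p\<close> pairs
    \<open>(f, y * z^i)\<close>, all of which recover \<open>x\<close>. Taking the root divides the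
    logarithmic height by \<open>p\<close>, up to the bounded height of \<open>f\<close>.\<close>
  have step: "p * card (ubox H T) \<le> p ^ (N - 1) * card (ubox H T')" if T: "T + C0 \<le> p * T'" for T T'
  proof -
    have ex: "\<exists>a. fst a \<in> Fs \<and> snd a \<in> units H \<and> x = fst a * snd a ^ p" if "x \<in> ubox H T" for x
      using Fs(4)[of x] that by (auto simp: ubox_def)
    define h where "h x = (SOME a. fst a \<in> Fs \<and> snd a \<in> units H \<and> x = fst a * snd a ^ p)" for x
    have h: "fst (h x) \<in> Fs" "snd (h x) \<in> units H" "x = fst (h x) * snd (h x) ^ p" if "x \<in> ubox H T" for x
      using someI_ex[OF ex[OF that]] unfolding h_def by blast+
    let ?f = "\<lambda>(x, i). (fst (h x), snd (h x) * z ^ i)"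
    have "card (ubox H T \<times> {..<p}) \<le> card (Fs \<times> ubox H T')"
    proof (rule card_inj_on_le[where f = ?f])
      show "finite (Fs \<times> ubox H T')" using Fs(1) finite_ubox[OF HM] by blast
      show "?f ` (ubox H T \<times> {..<p}) \<subseteq> Fs \<times> ubox H T'"
      proof safe
        fix x i assume x: "x \<in> ubox H T"
        show "fst (h x) \<in> Fs" by (rule h[OF x])
        define y where "y = snd (h x)"
        have y: "y \<in> units H" "x = fst (h x) * y ^ p" "fst (h x) \<in> units H"
          using h[OF x] Fs(2) by (auto simp: y_def)
        have yM: "y \<in> M" "y \<noteq> 0" "fst (h x) \<in> M" "fst (h x) \<noteq> 0" "z ^ i \<in> M"
          using y units_H_M units_ne_0 z(1) by auto
        have z0: "z ^ i \<noteq> 0" using units_ne_0[OF zH] by simp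
        have "height_le (y * z ^ i) T'"
          unfolding height_le_def
        proof
          fix g assume g: "g \<in> carrier G"
          have "ln (cmod (g x)) = ln (cmod (g (fst (h x)))) + real p * ln (cmod (g y))"
            using ln_cmod(1)[OF g yM(3) M.power_F[OF yM(1)] yM(4), of p] ln_cmod(3)[OF g yM(1,1,2,2), of p] y(2) yM(2) by simp
          moreover have "\<bar>ln (cmod (g x))\<bar> \<le> real T" using x g by (simp add: ubox_def height_le_def)
          moreover have "\<bar>ln (cmod (g (fst (h x))))\<bar> \<le> real C0" using C0(2)[OF h(1)[OF x]] g by (simp add: height_le_def)
          moreover have "real T + real C0 \<le> real p * real T'" using T by (metis of_nat_add of_nat_le_iff of_nat_mult)
          ultimately have "\<bar>real p * ln (cmod (g y))\<bar> \<le> real p * real T'" by linarith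
          then have "\<bar>ln (cmod (g y))\<bar> \<le> real T'" using p_gt_0 by (simp add: abs_mult)
          then show "\<bar>ln (cmod (g (y * z ^ i)))\<bar> \<le> real T'"
            using ln_cmod(1)[OF g yM(1) yM(5) yM(2) z0] z_h[OF g] by simp
        qed
        moreover have "y * z ^ i \<in> units H" using y(1) zH by (intro EH)
        ultimately show "snd (h x) * z ^ i \<in> ubox H T'" by (simp add: ubox_def y_def)
      qed
      show "inj_on ?f (ubox H T \<times> {..<p})"
      proof (rule inj_onI)
        fix a b assume ab: "a \<in> ubox H T \<times> {..<p}" "b \<in> ubox H T \<times> {..<p}" "?f a = ?f b"
        obtain x i where a: "a = (x, i)" "x \<in> ubox H T" "i < p" using ab(1) by auto
        obtain y j where b: "b = (y, j)" "y \<in> ubox H T" "j < p" using ab(2) by auto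
        have e: "fst (h x) = fst (h y)" "snd (h x) * z ^ i = snd (h y) * z ^ j" using ab(3) a(1) b(1) by auto
        have zp: "(z ^ k) ^ p = 1" for k
        proof -
          have "(z ^ k) ^ p = (z ^ p) ^ k" by (simp only: power_mult[symmetric] mult.commute)
          then show ?thesis using z(2) by simp
        qed
        have "(snd (h x) * z ^ i) ^ p = (snd (h y) * z ^ j) ^ p" using e(2) by simp
        then have "snd (h x) ^ p = snd (h y) ^ p" by (simp add: power_mult_distrib zp)
        then have xy: "x = y" using h(3)[OF a(2)] h(3)[OF b(2)] e(1) by simp
        then have "z ^ i = z ^ j" using e(2) units_ne_0[OF h(2)[OF b(2)]] by simp
        then have "i = j" using root_power_inj[OF p(1) z(2,3) a(3) b(3)] by blast
        then show "a = b" using xy a b by simp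
      qed
    qed
    then have "p * card (ubox H T) \<le> card Fs * card (ubox H T')" by (simp add: card_cartesian_product mult.commute)
    also have "\<dots> \<le> p ^ (N - 1) * card (ubox H T')" using Fs(3) N by (intro mult_le_mono1) simp
    finally show ?thesis .
  qed
  \<comment> \<open>The summand \<open>C0\<close> absorbs the height of the representatives:
    \<open>T (Suc m) + C0\<close> is at most \<open>p * T m\<close> because \<open>2 * C0\<close> is
    at most \<open>p * C0\<close>.\<close>
  define T where "T m = p ^ m + C0" for m
  have pN: "p ^ (N - 1) = p * p ^ (N - 2)" using N3 by (simp flip: power_Suc add: Suc_diff_Suc numeral_2_eq_2)
  have shrink: "card (ubox H (T (Suc m))) \<le> p ^ (N - 2) * card (ubox H (T m))" for m
  proof -
    have "2 * C0 \<le> p * C0" using p_ge_3 by (intro mult_le_mono1) simp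
    have "T (Suc m) + C0 = p * p ^ m + 2 * C0" by (simp add: T_def)
    also have "\<dots> \<le> p * p ^ m + p * C0" using \<open>2 * C0 \<le> p * C0\<close> by (rule add_left_mono)
    also have "\<dots> = p * T m" by (simp add: T_def distrib_left)
    finally have "T (Suc m) + C0 \<le> p * T m" .
    then have "p * card (ubox H (T (Suc m))) \<le> p * (p ^ (N - 2) * card (ubox H (T m)))"
      using step[of "T (Suc m)" "T m"] unfolding pN by (simp only: mult.assoc)
    then show ?thesis using p_gt_0 by simp
  qed
  have up: "card (ubox H (T m)) \<le> (p ^ (N - 2)) ^ m * card (ubox H (T 0))" for m
  proof (induction m)
    case (Suc m)
    have "card (ubox H (T (Suc m))) \<le> p ^ (N - 2) * ((p ^ (N - 2)) ^ m * card (ubox H (T 0)))"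
      using shrink[of m] Suc by (meson mult_le_mono2 order_trans)
    then show ?case by (simp add: mult.assoc)
  qed simp
  have Cp: "C \<le> p ^ C"
  proof -
    have "C < 2 ^ C" by (rule less_exp)
    also have "\<dots> \<le> p ^ C" using p_ge_3 by (intro power_mono) auto
    finally show ?thesis by simp
  qed
  have mono: "card (ubox H a) \<le> card (ubox H b)" if "a \<le> b" for a b
    using that by (intro card_mono finite_ubox[OF HM]) (auto simp: ubox_def height_le_def intro: order_trans)
  have "real (p ^ (N - 1)) \<le> real (p ^ (N - 2))"
  proof (rule power_growth_le)
    show "real (p ^ (N - 2)) > 0" using p_gt_0 by simp
    fix j
    have pj: "p ^ j - 1 + 1 = p ^ j" using p_gt_0 by simp
    have "(p ^ (N - 1)) ^ j = (p ^ j) ^ (N - 1)" by (simp only: power_mult[symmetric] mult.commute)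
    also have "\<dots> \<le> card (ubox H (C * p ^ j)) * B" using BC(2)[of "p ^ j - 1"] unfolding pj N_def .
    also have "card (ubox H (C * p ^ j)) \<le> card (ubox H (T (j + C)))"
      using Cp by (intro mono) (simp add: T_def power_add mult.commute trans_le_add1)
    also have "\<dots> \<le> (p ^ (N - 2)) ^ (j + C) * card (ubox H (T 0))" by (rule up)
    finally have "(p ^ (N - 1)) ^ j \<le> ((p ^ (N - 2)) ^ C * card (ubox H (T 0)) * B) * (p ^ (N - 2)) ^ j"
      by (simp add: power_add mult_right_mono ac_simps)
    then have "real ((p ^ (N - 1)) ^ j) \<le> real (((p ^ (N - 2)) ^ C * card (ubox H (T 0)) * B) * (p ^ (N - 2)) ^ j)"
      by (rule of_nat_mono)
    then show "real (p ^ (N - 1)) ^ j \<le> real ((p ^ (N - 2)) ^ C * card (ubox H (T 0)) * B) * real (p ^ (N - 2)) ^ j" by simp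
  qed
  then have "p ^ (N - 1) \<le> p ^ (N - 2)" by (simp only: of_nat_le_iff)
  then have "N - 1 \<le> N - 2" using p_ge_3 by (simp add: power_le_imp_le_exp)
  then show False using N3 by simp
qed

end


section \<open>Evaluations on symmetric powers\<close>

lemma free_module_simps [simp]:
  "carrier (free_module R S) = {c \<in> S \<rightarrow>\<^sub>E carrier R. finite {s \<in> S. c s \<noteq> \<zero>\<^bsub>R\<^esub>}}"
  "\<zero>\<^bsub>free_module R S\<^esub> = (\<lambda>s\<in>S. \<zero>\<^bsub>R\<^esub>)"
  "c \<oplus>\<^bsub>free_module R S\<^esub> d = (\<lambda>s\<in>S. c s \<oplus>\<^bsub>R\<^esub> d s)"
  "a \<odot>\<^bsub>free_module R S\<^esub> c = (\<lambda>s\<in>S. a \<otimes>\<^bsub>R\<^esub> c s)"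
  by (simp_all add: free_module_def)

text \<open>Telescoping \<open>(c + 1)^(j+1) - c^(j+1)\<close> expresses \<open>(j + 1)\<close>
  times the \<open>j\<close>-th power sum through lower ones and \<open>p^(j+1)\<close>; for
  \<open>j < p - 1\<close> the factor \<open>j + 1\<close> is prime to \<open>p\<close>.\<close>

lemma power_sum_cong_0:
  fixes p :: nat
  assumes "prime p" "j < p - 1"
  shows "int p dvd (\<Sum>c<p. int c ^ j)"
  using assms(2)
proof (induction j rule: less_induct)
  case (less j)
  let ?S = "\<lambda>i. \<Sum>c<p. int c ^ i"
  have "(\<Sum>c<p. int (Suc c) ^ Suc j - int c ^ Suc j) = int p ^ Suc j"
    by (subst sum_lessThan_telescope) simp
  moreover have "(\<Sum>c<p. int (Suc c) ^ Suc j - int c ^ Suc j) = (\<Sum>c<p. \<Sum>i\<le>j. int (Suc j choose i) * int c ^ i)"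
  proof (intro sum.cong refl)
    fix c
    have "int (Suc c) ^ Suc j = (\<Sum>i\<le>Suc j. int (Suc j choose i) * int c ^ i)"
      using binomial_ring[of "int c" 1 "Suc j"] by (simp add: add.commute)
    also have "\<dots> = (\<Sum>i\<le>j. int (Suc j choose i) * int c ^ i) + int c ^ Suc j" by simp
    finally show "int (Suc c) ^ Suc j - int c ^ Suc j = (\<Sum>i\<le>j. int (Suc j choose i) * int c ^ i)" by simp
  qed
  moreover have "(\<Sum>c<p. \<Sum>i\<le>j. int (Suc j choose i) * int c ^ i) = (\<Sum>i\<le>j. int (Suc j choose i) * ?S i)"
    by (subst sum.swap) (simp add: sum_distrib_left)
  moreover have "(\<Sum>i\<le>j. int (Suc j choose i) * ?S i) = (\<Sum>i<j. int (Suc j choose i) * ?S i) + int (Suc j) * ?S j"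
    by (simp flip: lessThan_Suc_atMost)
  ultimately have "int (Suc j) * ?S j = int p ^ Suc j - (\<Sum>i<j. int (Suc j choose i) * ?S i)" by linarith
  moreover have "int p dvd (\<Sum>i<j. int (Suc j choose i) * ?S i)"
    using less by (intro dvd_sum dvd_mult less.IH) auto
  ultimately have "int p dvd int (Suc j) * ?S j" by (auto intro: dvd_diff)
  moreover have "\<not> int p dvd int (Suc j)"
  proof
    assume "int p dvd int (Suc j)"
    then have "p dvd Suc j" by (simp only: int_dvd_int_iff)
    then show False using less.prems by (auto dest: dvd_imp_le)
  qed
  ultimately show ?case using assms(1) prime_dvd_mult_iff[of "int p"] by auto
qed

lemma fermat_int:
  assumes "prime p" "\<not> int p dvd b" shows "[b ^ (p - 1) = 1] (mod int p)"
proof -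
  have "residues (int p)" using prime_gt_1_nat[OF assms(1)] by (simp add: residues_def)
  moreover have "coprime b (int p)"
    using prime_imp_coprime[of "int p" b] assms by (simp add: coprime_commute)
  ultimately have "[b ^ totient (nat (int p)) = 1] (mod int p)" by (rule residues.euler_theorem)
  then show ?thesis using totient_prime[OF assms(1)] by simp
qed

lemma power_sum_cong_last:
  assumes "prime (p :: nat)" shows "[(\<Sum>c<p. int c ^ (p - 1)) = - 1] (mod int p)"
proof -
  have p1: "p > 1" using assms prime_gt_1_nat by blast
  have "(\<Sum>c<p. int c ^ (p - 1)) = (\<Sum>c\<in>{1..<p}. int c ^ (p - 1))"
    using p1 by (intro sum.mono_neutral_right) (auto simp: not_le zero_power)
  also have "[\<dots> = (\<Sum>c\<in>{1..<p}. 1)] (mod int p)"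
    using assms by (intro cong_sum fermat_int) (auto dest: zdvd_imp_le)
  also have "(\<Sum>c\<in>{1..<p}. 1 :: int) = int p - 1" using p1 by (simp add: of_nat_diff)
  also have "[int p - 1 = - 1] (mod int p)" by (simp add: cong_iff_dvd_diff)
  finally show ?thesis .
qed

definition lform :: "int \<times> int \<Rightarrow> int \<times> int \<Rightarrow> int"
  where "lform v x = fst x * fst v + snd x * snd v"

text \<open>The symmetric product of \<open>xs\<close> evaluated at \<open>v\<close>, each vector
  being read as a linear form in the coordinates of \<open>v\<close>.\<close>

definition tform :: "int \<times> int \<Rightarrow> (int \<times> int) list \<Rightarrow> int"
  where "tform v xs = prod_list (map (lform v) xs)"

lemma tform_simps [simp]: "tform v [] = 1" "tform v (x # xs) = lform v x * tform v xs"
  "tform v (xs @ ys) = tform v xs * tform v ys"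
  by (simp_all add: tform_def)

text \<open>
  Along the line \<open>(1, k b)\<close> the value is a polynomial in \<open>k\<close> whose leading coefficient is the value
  at \<open>(0, 1)\<close>; summing over all residues \<open>k\<close> leaves only the leading term.
\<close>

lemma sum_tform:
  assumes p: "prime p" and b: "\<not> int p dvd b" and len: "length xs = p - 1"
  shows "[(\<Sum>k<p. tform (1, int k * b) xs) = - tform (0, 1) xs] (mod int p)"
proof -
  define P where "P xs = prod_list (map (\<lambda>x. [:fst x, snd x:]) xs)" for xs :: "(int \<times> int) list"
  have val: "tform (1, c) xs = poly (P xs) c" for c xs
    by (induction xs) (auto simp: P_def lform_def algebra_simps)
  have deg: "degree (P xs) \<le> length xs" for xs
  proof (induction xs)
    case (Cons x xs)
    have "degree (P (x # xs)) \<le> degree [:fst x, snd x:] + degree (P xs)"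
      unfolding P_def list.map prod_list.Cons by (rule degree_mult_le)
    also have "\<dots> \<le> 1 + length xs" using Cons by (intro add_mono) auto
    finally show ?case by simp
  qed (simp add: P_def)
  have lead: "coeff (P xs) (length xs) = tform (0, 1) xs" for xs
  proof (induction xs)
    case (Cons x xs)
    have "P (x # xs) = smult (fst x) (P xs) + pCons 0 (smult (snd x) (P xs))" by (simp add: P_def)
    moreover have "coeff (P xs) (Suc (length xs)) = 0" using deg[of xs] by (intro coeff_eq_0) simp
    ultimately show ?case using Cons by (simp add: lform_def)
  qed (simp add: P_def)
  let ?a = "coeff (P xs)"
  have p1: "p > 1" using p prime_gt_1_nat by blast
  have "poly (P xs) c = (\<Sum>j\<le>p - 1. ?a j * c ^ j)" for c
    unfolding poly_altdef using deg[of xs] len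
    by (intro sum.mono_neutral_left) (auto simp: coeff_eq_0)
  then have "(\<Sum>k<p. tform (1, int k * b) xs) = (\<Sum>k<p. \<Sum>j\<le>p - 1. ?a j * b ^ j * int k ^ j)"
    by (simp add: val power_mult_distrib ac_simps)
  also have "\<dots> = (\<Sum>j\<le>p - 1. ?a j * b ^ j * (\<Sum>k<p. int k ^ j))"
    by (subst sum.swap) (simp add: sum_distrib_left)
  also have "\<dots> = (\<Sum>j<p - 1. ?a j * b ^ j * (\<Sum>k<p. int k ^ j)) + ?a (p - 1) * b ^ (p - 1) * (\<Sum>k<p. int k ^ (p - 1))"
    by (simp flip: lessThan_Suc_atMost)
  also have "[\<dots> = 0 + ?a (p - 1) * 1 * (- 1)] (mod int p)"
  proof (intro cong_add cong_mult cong_refl)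
    have "int p dvd (\<Sum>j<p - 1. ?a j * b ^ j * (\<Sum>k<p. int k ^ j))"
      by (rule dvd_sum, rule dvd_mult, rule power_sum_cong_0[OF p]) auto
    then show "[(\<Sum>j<p - 1. ?a j * b ^ j * (\<Sum>k<p. int k ^ j)) = 0] (mod int p)" by (simp add: cong_0_iff)
  qed (use fermat_int[OF p b] power_sum_cong_last[OF p] in \<open>simp_all del: One_nat_def\<close>)
  also have "0 + ?a (p - 1) * 1 * (- 1) = - tform (0, 1) xs" using lead[of xs] len by simp
  finally show ?thesis .
qed

lemma tform_cong:
  assumes "\<And>x. x \<in> set xs \<Longrightarrow> [lform v x = lform v' (f x)] (mod m)"
  shows "[tform v xs = tform v' (map f xs)] (mod m)"
  using assms by (induction xs) (auto intro: cong_mult)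

section \<open>Evaluations modulo \<open>p\<close> on the free module and on its quotient\<close>

locale sym_power_eval =
  fixes p i :: nat
  assumes p: "prime p" "odd p"
begin

abbreviation "R \<equiv> prime_field p"
abbreviation "V \<equiv> V_module p"
abbreviation "T \<equiv> tuples V i"
abbreviation "FM \<equiv> free_on_tuples R V i"
abbreviation "SK \<equiv> sym_kernel R V i"

sublocale residues "int p" R
  using p(1) prime_gt_1_nat[of p] by unfold_locales auto

lemma p_gt_1: "p > 1"
  using p(1) prime_gt_1_nat by blast

lemma R_simps: "carrier R = {0..int p - 1}" "x \<oplus>\<^bsub>R\<^esub> y = (x + y) mod int p" "x \<otimes>\<^bsub>R\<^esub> y = (x * y) mod int p"
  "\<zero>\<^bsub>R\<^esub> = 0" "\<one>\<^bsub>R\<^esub> = 1"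
  by (rule res_carrier_eq res_add_eq res_mult_eq res_zero_eq res_one_eq)+

lemma mod_R: "x mod int p \<in> carrier R"
  using p_gt_1 by (simp add: R_simps)

lemma V_simps: "carrier V = carrier R \<times> carrier R" "x \<oplus>\<^bsub>V\<^esub> y = (fst x \<oplus>\<^bsub>R\<^esub> fst y, snd x \<oplus>\<^bsub>R\<^esub> snd y)"
  "a \<odot>\<^bsub>V\<^esub> x = (a \<otimes>\<^bsub>R\<^esub> fst x, a \<otimes>\<^bsub>R\<^esub> snd x)"
  by (simp_all add: V_module_def Let_def case_prod_unfold)

lemma finite_T: "finite T"
proof -
  have "finite (carrier V)" by (simp add: V_simps R_simps)
  then show ?thesis by (rule finite_lists_length_eq)
qed

lemma carrier_FM: "carrier FM = T \<rightarrow>\<^sub>E carrier R"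
proof -
  have "finite {s \<in> T. c s \<noteq> \<zero>\<^bsub>R\<^esub>}" for c :: "(int \<times> int) list \<Rightarrow> int"
    by (rule finite_subset[OF _ finite_T]) blast
  then show ?thesis by simp
qed

lemma finite_FM: "finite (carrier FM)"
  unfolding carrier_FM using finite_T by (intro finite_PiE) (auto simp: R_simps)

lemma abelian_group_FM: "abelian_group FM"
proof (rule abelian_groupI)
  show "\<exists>d\<in>carrier FM. d \<oplus>\<^bsub>FM\<^esub> c = \<zero>\<^bsub>FM\<^esub>" if "c \<in> carrier FM" for c
    using that mod_R unfolding carrier_FM
    by (intro bexI[of _ "\<lambda>s\<in>T. (- c s) mod int p"]) (auto simp: R_simps mod_simps)
next
  fix c d e assume c: "c \<in> carrier FM" "d \<in> carrier FM" "e \<in> carrier FM"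
  show "c \<oplus>\<^bsub>FM\<^esub> d \<in> carrier FM" unfolding carrier_FM using mod_R by (auto simp: R_simps(2))
  show "(c \<oplus>\<^bsub>FM\<^esub> d) \<oplus>\<^bsub>FM\<^esub> e = c \<oplus>\<^bsub>FM\<^esub> (d \<oplus>\<^bsub>FM\<^esub> e)"
    by (auto simp: R_simps mod_simps add.assoc intro!: restrict_ext)
  show "c \<oplus>\<^bsub>FM\<^esub> d = d \<oplus>\<^bsub>FM\<^esub> c" by (auto simp: R_simps add.commute)
  show "\<zero>\<^bsub>FM\<^esub> \<oplus>\<^bsub>FM\<^esub> c = c"
  proof
    fix s show "(\<zero>\<^bsub>FM\<^esub> \<oplus>\<^bsub>FM\<^esub> c) s = c s"
    proof (cases "s \<in> T")
      case True
      then have "c s \<in> carrier R" using c(1) unfolding carrier_FM by (rule PiE_mem[rotated])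
      then show ?thesis using True by (simp add: R_simps)
    next
      case False
      then have "c s = undefined" using c(1) unfolding carrier_FM by (rule PiE_arb[rotated])
      then show ?thesis by (simp only: free_module_simps restrict_apply False if_False)
    qed
  qed
next
  show "\<zero>\<^bsub>FM\<^esub> \<in> carrier FM" unfolding carrier_FM using mod_R[of 0] by (auto simp: R_simps(4))
qed

definition ev :: "int \<times> int \<Rightarrow> ((int \<times> int) list \<Rightarrow> int) \<Rightarrow> int"
  where "ev v c = (\<Sum>s\<in>T. c s * tform v s)"

lemma ev_add: "[ev v (c \<oplus>\<^bsub>FM\<^esub> d) = ev v c + ev v d] (mod int p)"
proof -
  have "[ev v (c \<oplus>\<^bsub>FM\<^esub> d) = (\<Sum>s\<in>T. (c s + d s) * tform v s)] (mod int p)"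
    unfolding ev_def by (intro cong_sum cong_mult cong_refl) (auto simp: R_simps cong_def)
  then show ?thesis by (simp add: ev_def sum.distrib distrib_right)
qed

lemma ev_smult: "[ev v (a \<odot>\<^bsub>FM\<^esub> c) = a * ev v c] (mod int p)"
proof -
  have "[ev v (a \<odot>\<^bsub>FM\<^esub> c) = (\<Sum>s\<in>T. (a * c s) * tform v s)] (mod int p)"
    unfolding ev_def by (intro cong_sum cong_mult cong_refl) (auto simp: R_simps cong_def)
  then show ?thesis by (simp add: ev_def sum_distrib_left mult.assoc)
qed

lemma ev_zero: "ev v \<zero>\<^bsub>FM\<^esub> = 0"
  by (simp add: ev_def R_simps)

lemma ev_basis: "xs \<in> T \<Longrightarrow> ev v (free_basis R T xs) = tform v xs"
proof -
  assume xs: "xs \<in> T"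
  have "ev v (free_basis R T xs) = (\<Sum>s\<in>T. if s = xs then tform v s else 0)"
    unfolding ev_def by (intro sum.cong) (auto simp: free_basis_def R_simps)
  then show ?thesis using xs finite_T by simp
qed

lemma basis_FM: "free_basis R T xs \<in> carrier FM"
  unfolding carrier_FM free_basis_def using p_gt_1 by (auto simp: R_simps)

lemma ev_minus:
  assumes "c \<in> carrier FM" "d \<in> carrier FM"
  shows "[ev v (c \<ominus>\<^bsub>FM\<^esub> d) = ev v c - ev v d] (mod int p)"
proof -
  interpret FM: abelian_group FM by (rule abelian_group_FM)
  have "(c \<ominus>\<^bsub>FM\<^esub> d) \<oplus>\<^bsub>FM\<^esub> d = c" using assms by (simp only: a_minus_def FM.a_assoc FM.a_inv_closed FM.l_neg FM.r_zero)
  then have "[ev v c = ev v (c \<ominus>\<^bsub>FM\<^esub> d) + ev v d] (mod int p)" using ev_add[of v "c \<ominus>\<^bsub>FM\<^esub> d" d] by simp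
  then have "[ev v c - ev v d = ev v (c \<ominus>\<^bsub>FM\<^esub> d) + ev v d - ev v d] (mod int p)" by (rule cong_diff[OF _ cong_refl])
  then show ?thesis by (simp add: cong_sym_eq)
qed

lemma ev_sym_relations:
  assumes "c \<in> sym_relations R V i" shows "int p dvd ev v c" "c \<in> carrier FM"
proof -
  interpret FM: abelian_group FM by (rule abelian_group_FM)
  let ?e = "free_basis R T"
  have l_add: "[lform v (x \<oplus>\<^bsub>V\<^esub> y) = lform v x + lform v y] (mod int p)" for x y
  proof -
    have "[lform v (x \<oplus>\<^bsub>V\<^esub> y) = (fst x + fst y) * fst v + (snd x + snd y) * snd v] (mod int p)"
      unfolding lform_def by (intro cong_add cong_mult cong_refl) (auto simp: V_simps R_simps cong_def)
    then show ?thesis by (simp add: lform_def algebra_simps)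
  qed
  have l_smult: "[lform v (a \<odot>\<^bsub>V\<^esub> x) = a * lform v x] (mod int p)" for a x
  proof -
    have "[lform v (a \<odot>\<^bsub>V\<^esub> x) = (a * fst x) * fst v + (a * snd x) * snd v] (mod int p)"
      unfolding lform_def by (intro cong_add cong_mult cong_refl) (auto simp: V_simps R_simps cong_def)
    then show ?thesis by (simp add: lform_def algebra_simps)
  qed
  have V_closed: "x \<oplus>\<^bsub>V\<^esub> y \<in> carrier V" "a \<odot>\<^bsub>V\<^esub> x \<in> carrier V" for a x y
    using mod_R by (auto simp: V_simps R_simps(2,3))
  have smult_closed: "a \<odot>\<^bsub>FM\<^esub> d \<in> carrier FM" for a d
    unfolding carrier_FM using mod_R by (auto simp: R_simps(3))
  consider
    (add) xs ys x y where "c = ?e (xs @ [x \<oplus>\<^bsub>V\<^esub> y] @ ys) \<ominus>\<^bsub>FM\<^esub> (?e (xs @ [x] @ ys) \<oplus>\<^bsub>FM\<^esub> ?e (xs @ [y] @ ys))"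
      "xs @ [x] @ ys \<in> T" "y \<in> carrier V"
  | (smult) xs ys a x where "c = ?e (xs @ [a \<odot>\<^bsub>V\<^esub> x] @ ys) \<ominus>\<^bsub>FM\<^esub> (a \<odot>\<^bsub>FM\<^esub> ?e (xs @ [x] @ ys))"
      "xs @ [x] @ ys \<in> T" "a \<in> carrier R"
  | (perm) xs ys where "c = ?e xs \<ominus>\<^bsub>FM\<^esub> ?e ys" "xs \<in> T" "ys \<in> T" "mset xs = mset ys"
    using assms unfolding sym_relations_def Let_def by blast
  then have "int p dvd ev v c \<and> c \<in> carrier FM"
  proof cases
    case add
    have T: "xs @ [x \<oplus>\<^bsub>V\<^esub> y] @ ys \<in> T" "xs @ [y] @ ys \<in> T" using add V_closed by auto
    let ?d = "?e (xs @ [x] @ ys) \<oplus>\<^bsub>FM\<^esub> ?e (xs @ [y] @ ys)"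
    have d: "?d \<in> carrier FM" by (intro FM.a_closed basis_FM)
    have "[ev v c = ev v (?e (xs @ [x \<oplus>\<^bsub>V\<^esub> y] @ ys)) - ev v ?d] (mod int p)" (is "[_ = ?x1] (mod _)")
      unfolding add(1) using basis_FM d by (rule ev_minus)
    also have "[?x1 = tform v (xs @ [x \<oplus>\<^bsub>V\<^esub> y] @ ys) - (tform v (xs @ [x] @ ys) + tform v (xs @ [y] @ ys))] (mod int p)" (is "[_ = ?x2] (mod _)")
      using ev_add[of v "?e (xs @ [x] @ ys)" "?e (xs @ [y] @ ys)"] ev_basis[OF T(1)] ev_basis[OF T(2)] ev_basis[OF add(2)]
      by (intro cong_diff) simp_all
    also have "[?x2 = tform v xs * (lform v x + lform v y) * tform v ys - (tform v (xs @ [x] @ ys) + tform v (xs @ [y] @ ys))] (mod int p)" (is "[_ = ?x3] (mod _)")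
      using cong_mult[OF cong_mult[OF cong_refl[of "tform v xs"] l_add[of x y]] cong_refl[of "tform v ys"]]
      by (intro cong_diff cong_refl) (simp add: mult.assoc)
    also have "?x3 = 0" by (simp add: algebra_simps)
    finally show ?thesis unfolding add(1) using FM.minus_closed[OF basis_FM d] by (simp add: cong_0_iff)
  next
    case smult
    have T: "xs @ [a \<odot>\<^bsub>V\<^esub> x] @ ys \<in> T" using smult V_closed by auto
    let ?d = "a \<odot>\<^bsub>FM\<^esub> ?e (xs @ [x] @ ys)"
    have d: "?d \<in> carrier FM" by (rule smult_closed)
    have "[ev v c = ev v (?e (xs @ [a \<odot>\<^bsub>V\<^esub> x] @ ys)) - ev v ?d] (mod int p)" (is "[_ = ?x1] (mod _)")
      unfolding smult(1) using basis_FM d by (rule ev_minus)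
    also have "[?x1 = tform v (xs @ [a \<odot>\<^bsub>V\<^esub> x] @ ys) - a * tform v (xs @ [x] @ ys)] (mod int p)" (is "[_ = ?x2] (mod _)")
      using ev_smult[of v a "?e (xs @ [x] @ ys)"] ev_basis[OF T] ev_basis[OF smult(2)]
      by (intro cong_diff) simp_all
    also have "[?x2 = tform v xs * (a * lform v x) * tform v ys - a * tform v (xs @ [x] @ ys)] (mod int p)" (is "[_ = ?x3] (mod _)")
      using cong_mult[OF cong_mult[OF cong_refl[of "tform v xs"] l_smult[of a x]] cong_refl[of "tform v ys"]]
      by (intro cong_diff cong_refl) (simp add: mult.assoc)
    also have "?x3 = 0" by (simp add: algebra_simps)
    finally show ?thesis unfolding smult(1) using FM.minus_closed[OF basis_FM d] by (simp add: cong_0_iff)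
  next
    case perm
    have "tform v xs = tform v ys"
      unfolding tform_def by (metis perm(4) mset_map prod_mset_prod_list)
    moreover have "[ev v c = ev v (?e xs) - ev v (?e ys)] (mod int p)"
      unfolding perm(1) using basis_FM basis_FM by (rule ev_minus)
    ultimately have "[ev v c = 0] (mod int p)" using ev_basis[OF perm(2)] ev_basis[OF perm(3)] by simp
    then show ?thesis unfolding perm(1) using FM.minus_closed[OF basis_FM basis_FM] by (simp add: cong_0_iff)
  qed
  then show "int p dvd ev v c" "c \<in> carrier FM" by auto
qed

lemmas [simp del] = free_module_simps

lemma submodule_ev_kernel: "submodule {c \<in> carrier FM. int p dvd ev v c} R FM"
proof -
  interpret FM: abelian_group FM by (rule abelian_group_FM)
  show ?thesis
  proof (intro submodule.intro submodule_axioms.intro)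
    show "subgroup {c \<in> carrier FM. int p dvd ev v c} (add_monoid FM)"
    proof (rule group.subgroupI[OF FM.a_group])
      have "\<zero>\<^bsub>FM\<^esub> \<in> {c \<in> carrier FM. int p dvd ev v c}" using FM.zero_closed ev_zero by simp
      then show "{c \<in> carrier FM. int p dvd ev v c} \<noteq> {}" by blast
      fix c assume c: "c \<in> {c \<in> carrier FM. int p dvd ev v c}"
      have "inv\<^bsub>add_monoid FM\<^esub> c = \<zero>\<^bsub>FM\<^esub> \<ominus>\<^bsub>FM\<^esub> c" using c by (simp add: a_minus_def a_inv_def[symmetric])
      moreover have "[ev v (\<zero>\<^bsub>FM\<^esub> \<ominus>\<^bsub>FM\<^esub> c) = 0 - ev v c] (mod int p)"
        using ev_minus[OF FM.zero_closed, of c v] c ev_zero by simp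
      moreover have "int p dvd ev v (\<zero>\<^bsub>FM\<^esub> \<ominus>\<^bsub>FM\<^esub> c)"
        using cong_dvd_iff[OF calculation(2)] c by simp
      ultimately show "inv\<^bsub>add_monoid FM\<^esub> c \<in> {c \<in> carrier FM. int p dvd ev v c}"
        using c FM.minus_closed[OF FM.zero_closed, of c] by (simp)
    next
      fix c d assume cd: "c \<in> {c \<in> carrier FM. int p dvd ev v c}" "d \<in> {c \<in> carrier FM. int p dvd ev v c}"
      then have "int p dvd ev v (c \<oplus>\<^bsub>FM\<^esub> d)" using cong_dvd_iff[OF ev_add] by auto
      then show "c \<otimes>\<^bsub>add_monoid FM\<^esub> d \<in> {c \<in> carrier FM. int p dvd ev v c}"
        using cd FM.a_closed[of c d] by (simp)
    qed auto
    fix a c assume "a \<in> carrier R" "c \<in> {c \<in> carrier FM. int p dvd ev v c}"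
    then have "int p dvd ev v (a \<odot>\<^bsub>FM\<^esub> c)" using cong_dvd_iff[OF ev_smult] by auto
    moreover have "a \<odot>\<^bsub>FM\<^esub> c \<in> carrier FM" unfolding carrier_FM free_module_simps(4) using mod_R by (auto simp: R_simps(3))
    ultimately show "a \<odot>\<^bsub>FM\<^esub> c \<in> {c \<in> carrier FM. int p dvd ev v c}" by blast
  qed
qed

text \<open>\<open>sym_kernel\<close> is a hull, that is, the smallest submodule containing the
  relations; the kernel of an evaluation is one such submodule.\<close>

lemma SK_ev: "c \<in> SK \<Longrightarrow> int p dvd ev v c" and SK_FM: "c \<in> SK \<Longrightarrow> c \<in> carrier FM" and SK_zero: "\<zero>\<^bsub>FM\<^esub> \<in> SK"
proof -
  have "{c \<in> carrier FM. int p dvd ev v c} \<in> {t. submodule t R FM \<and> sym_relations R V i \<subseteq> t}"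
    using submodule_ev_kernel ev_sym_relations by blast
  then show "c \<in> SK \<Longrightarrow> int p dvd ev v c" "c \<in> SK \<Longrightarrow> c \<in> carrier FM"
    unfolding sym_kernel_def hull_def by blast+
  have "\<zero>\<^bsub>FM\<^esub> \<in> t" if "submodule t R FM" for t
    using subgroup.one_closed[OF submodule.axioms(1)[OF that]] by simp
  then show "\<zero>\<^bsub>FM\<^esub> \<in> SK" unfolding sym_kernel_def hull_def by blast
qed

abbreviation "A \<equiv> A_module p i"

lemma A_simps: "carrier A = a_rcosets\<^bsub>FM\<^esub> SK" "C \<oplus>\<^bsub>A\<^esub> D = set_add FM C D"
  "a \<odot>\<^bsub>A\<^esub> C = set_add FM SK ((\<lambda>x. a \<odot>\<^bsub>FM\<^esub> x) ` C)"
  by (simp_all add: A_module_def sym_power_def quot_module_def)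

lemma set_addE: assumes "x \<in> set_add FM C D" obtains c d where "c \<in> C" "d \<in> D" "x = c \<oplus>\<^bsub>FM\<^esub> d"
  using assms by (auto simp: set_add_def set_mult_def)

lemma set_addI: "c \<in> C \<Longrightarrow> d \<in> D \<Longrightarrow> c \<oplus>\<^bsub>FM\<^esub> d \<in> set_add FM C D"
  by (auto simp: set_add_def set_mult_def)

text \<open>Only the residue modulo \<open>p\<close> is meaningful: it does not depend on the representative of a coset \<open>C\<close>.\<close>

definition EV :: "int \<times> int \<Rightarrow> ((int \<times> int) list \<Rightarrow> int) set \<Rightarrow> int"
  where "EV v C = ev v (SOME c. c \<in> C)"

text \<open>A property shared by cosets and preserved by the set operations that make up the action,
  so evaluations can be followed through intermediate sets not yet identified as cosets.\<close>

definition const_on :: "((int \<times> int) list \<Rightarrow> int) set \<Rightarrow> bool"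
  where "const_on C \<longleftrightarrow> C \<noteq> {} \<and> (\<forall>v. \<forall>c\<in>C. \<forall>d\<in>C. [ev v c = ev v d] (mod int p))"

lemma EV_eq: assumes "const_on C" "c \<in> C" shows "[EV v C = ev v c] (mod int p)"
proof -
  have "(SOME c. c \<in> C) \<in> C" using someI[of "\<lambda>c. c \<in> C"] assms(2) by blast
  then show ?thesis using assms unfolding const_on_def EV_def by blast
qed

lemma const_on_set_add:
  assumes "const_on C" "const_on D"
  shows "const_on (set_add FM C D)" "[EV v (set_add FM C D) = EV v C + EV v D] (mod int p)"
proof -
  have key: "[ev v x = EV v C + EV v D] (mod int p)" if x: "x \<in> set_add FM C D" for x v
  proof -
    obtain c d where cd: "c \<in> C" "d \<in> D" "x = c \<oplus>\<^bsub>FM\<^esub> d" using x by (rule set_addE)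
    have "[ev v x = ev v c + ev v d] (mod int p)" unfolding cd(3) by (rule ev_add)
    also have "[ev v c + ev v d = EV v C + EV v D] (mod int p)"
      using EV_eq[OF assms(1) cd(1)] EV_eq[OF assms(2) cd(2)] by (intro cong_add) (auto simp: cong_sym_eq)
    finally show ?thesis .
  qed
  obtain c d where "c \<in> C" "d \<in> D" using assms by (auto simp: const_on_def)
  then have ne: "c \<oplus>\<^bsub>FM\<^esub> d \<in> set_add FM C D" by (rule set_addI)
  show co: "const_on (set_add FM C D)"
    unfolding const_on_def
  proof (intro conjI allI ballI)
    show "[ev v x = ev v y] (mod int p)" if "x \<in> set_add FM C D" "y \<in> set_add FM C D" for v x y
      using cong_trans[OF key[OF that(1)] cong_sym[OF key[OF that(2)]]] .
  qed (use ne in blast)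
  show "[EV v (set_add FM C D) = EV v C + EV v D] (mod int p)"
    using cong_trans[OF EV_eq[OF co ne] key[OF ne]] .
qed

lemma const_on_SK: "const_on SK" "[EV v SK = 0] (mod int p)"
proof -
  have z: "[ev v c = 0] (mod int p)" if "c \<in> SK" for c v using SK_ev[OF that] by (simp add: cong_0_iff)
  show co: "const_on SK"
    unfolding const_on_def
  proof (intro conjI allI ballI)
    show "[ev v c = ev v d] (mod int p)" if "c \<in> SK" "d \<in> SK" for v c d
      using cong_trans[OF z[OF that(1)] cong_sym[OF z[OF that(2)]]] .
  qed (use SK_zero in blast)
  show "[EV v SK = 0] (mod int p)" using EV_eq[OF co SK_zero, of v] ev_zero by simp
qed

lemma const_on_A: "C \<in> carrier A \<Longrightarrow> const_on C"
proof -
  assume "C \<in> carrier A"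
  then obtain c where c: "C = SK +>\<^bsub>FM\<^esub> c" by (auto simp: A_simps A_RCOSETS_def')
  have "C = set_add FM SK {c}" unfolding c by (auto simp: a_r_coset_def' set_add_def set_mult_def)
  moreover have "const_on {c}" by (simp add: const_on_def)
  ultimately show ?thesis using const_on_set_add(1)[OF const_on_SK(1)] by simp
qed

lemma EV_add:
  assumes "C \<in> carrier A" "D \<in> carrier A" shows "[EV v (C \<oplus>\<^bsub>A\<^esub> D) = EV v C + EV v D] (mod int p)"
  unfolding A_simps using assms by (intro const_on_set_add const_on_A)

lemma const_on_image:
  assumes C: "const_on C" and f: "\<And>v c. c \<in> C \<Longrightarrow> [ev v (f c) = a * ev (g v) c] (mod int p)"
  shows "const_on (f ` C)" "[EV v (f ` C) = a * EV (g v) C] (mod int p)"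
proof -
  have key: "[ev v (f c) = a * EV (g v) C] (mod int p)" if "c \<in> C" for c v
    using cong_trans[OF f[OF that] cong_scalar_left[OF cong_sym[OF EV_eq[OF C that]]]] .
  obtain c where c: "c \<in> C" using C by (auto simp: const_on_def)
  show co: "const_on (f ` C)"
    unfolding const_on_def using c cong_trans[OF key cong_sym[OF key]] by auto
  show "[EV v (f ` C) = a * EV (g v) C] (mod int p)"
    using cong_trans[OF EV_eq[OF co imageI[OF c]] key[OF c]] .
qed

lemma EV_shift:
  assumes "const_on C" shows "const_on (set_add FM SK C)" "[EV v (set_add FM SK C) = EV v C] (mod int p)"
  using const_on_set_add[OF const_on_SK(1) assms] cong_trans[OF const_on_set_add(2)[OF const_on_SK(1) assms] cong_add[OF const_on_SK(2) cong_refl]]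
  by auto

lemma EV_smult:
  assumes "const_on C" shows "const_on (a \<odot>\<^bsub>A\<^esub> C)" "[EV v (a \<odot>\<^bsub>A\<^esub> C) = a * EV v C] (mod int p)"
  unfolding A_simps
  using EV_shift[OF const_on_image(1)[OF assms, of "\<lambda>x. a \<odot>\<^bsub>FM\<^esub> x" a "\<lambda>v. v"]] ev_smult
    cong_trans[OF EV_shift(2)[OF const_on_image(1)[OF assms, of "\<lambda>x. a \<odot>\<^bsub>FM\<^esub> x" a "\<lambda>v. v"]] const_on_image(2)[OF assms, of "\<lambda>x. a \<odot>\<^bsub>FM\<^esub> x" a "\<lambda>v. v"]]
  by blast+

lemma finsum_R:
  assumes "finite S" "\<And>s. s \<in> S \<Longrightarrow> c s \<in> carrier R"
  shows "[(\<Oplus>\<^bsub>R\<^esub>s\<in>S. c s) = (\<Sum>s\<in>S. c s)] (mod int p)"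
  using assms
proof (induction S rule: finite_induct)
  case empty
  then show ?case by (simp add: R_simps)
next
  case (insert s S)
  have "(\<Oplus>\<^bsub>R\<^esub>s\<in>insert s S. c s) = c s \<oplus>\<^bsub>R\<^esub> (\<Oplus>\<^bsub>R\<^esub>s\<in>S. c s)"
    using insert by (intro finsum_insert) auto
  also have "[\<dots> = c s + (\<Oplus>\<^bsub>R\<^esub>s\<in>S. c s)] (mod int p)" by (simp add: R_simps cong_def)
  also have "[c s + (\<Oplus>\<^bsub>R\<^esub>s\<in>S. c s) = c s + (\<Sum>s\<in>S. c s)] (mod int p)"
    using insert by (intro cong_add cong_refl) auto
  also have "c s + (\<Sum>s\<in>S. c s) = (\<Sum>s\<in>insert s S. c s)" using insert by simp
  finally show ?case .
qed

lemma A_subset: "C \<in> carrier A \<Longrightarrow> C \<subseteq> carrier FM"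
proof -
  interpret FM: abelian_group FM by (rule abelian_group_FM)
  assume "C \<in> carrier A"
  then show ?thesis
    using FM.a_closed SK_FM by (auto simp: A_simps A_RCOSETS_def' a_r_coset_def')
qed

text \<open>\<open>g\<close> is the transpose of \<open>f\<close>: evaluating after \<open>f\<close>
  is evaluating at the transposed point. Grouping tuples by their image under \<open>map f\<close>
  transfers this from single tuples to coefficient functions.\<close>

lemma EV_sym_power_map:
  assumes C: "const_on C" "C \<subseteq> carrier FM" and fV: "\<And>x. x \<in> carrier V \<Longrightarrow> f x \<in> carrier V"
    and g: "\<And>v x. x \<in> carrier V \<Longrightarrow> [lform (g v) x = lform v (f x)] (mod int p)"
  shows "const_on (sym_power_map R V i f C)" "[EV v (sym_power_map R V i f C) = EV (g v) C] (mod int p)"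
proof -
  let ?h = "free_module_map R T (map f)"
  have mapT: "map f s \<in> T" if "s \<in> T" for s using that fV by auto
  have key: "[ev v (?h c) = 1 * ev (g v) c] (mod int p)" if c: "c \<in> C" for v c
  proof -
    have cR: "c s \<in> carrier R" if "s \<in> T" for s
      using c C(2) that unfolding carrier_FM by blast
    let ?N = "\<lambda>t. {s \<in> T. map f s = t \<and> c s \<noteq> \<zero>\<^bsub>R\<^esub>}"
    have N: "(\<Sum>s\<in>?N t. c s) = (\<Sum>s\<in>{s \<in> T. map f s = t}. c s)" for t
    proof (rule sum.mono_neutral_left)
      show "finite {s \<in> T. map f s = t}" by (rule finite_subset[OF _ finite_T]) blast
      show "\<forall>s\<in>{s \<in> T. map f s = t} - ?N t. c s = 0" unfolding R_simps(4) by blast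
    qed blast
    have "ev v (?h c) = (\<Sum>t\<in>T. (\<Oplus>\<^bsub>R\<^esub>s\<in>?N t. c s) * tform v t)"
      unfolding ev_def free_module_map_def by (intro sum.cong) auto
    also have "[\<dots> = (\<Sum>t\<in>T. (\<Sum>s\<in>?N t. c s) * tform v t)] (mod int p)"
      by (intro cong_sum cong_mult cong_refl finsum_R cR finite_subset[OF _ finite_T]) blast+
    also have "(\<Sum>t\<in>T. (\<Sum>s\<in>?N t. c s) * tform v t) = (\<Sum>t\<in>T. (\<Sum>s\<in>{s \<in> T. map f s = t}. c s) * tform v t)"
      unfolding N ..
    also have "\<dots> = (\<Sum>t\<in>T. \<Sum>s\<in>{s \<in> T. map f s = t}. c s * tform v (map f s))"
      by (simp add: sum_distrib_right)
    also have "\<dots> = (\<Sum>s\<in>T. c s * tform v (map f s))"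
      by (intro sum.group finite_T image_subsetI mapT)
    also have "[\<dots> = (\<Sum>s\<in>T. c s * tform (g v) s)] (mod int p)"
      by (intro cong_sum cong_mult cong_refl cong_sym[OF tform_cong] g) auto
    finally show ?thesis by (simp add: ev_def)
  qed
  have co: "const_on (?h ` C)" and E: "[EV v (?h ` C) = EV (g v) C] (mod int p)"
    using const_on_image[OF C(1) key] by auto
  show "const_on (sym_power_map R V i f C)" "[EV v (sym_power_map R V i f C) = EV (g v) C] (mod int p)"
    unfolding sym_power_map_def using EV_shift(1)[OF co] cong_trans[OF EV_shift(2)[OF co] E] by auto
qed

text \<open>On the stabiliser of the root of unity the cyclotomic character is 1, so the twist by
  \<open>j\<close> disappears and the action is by unipotent matrices. Their transposes fix
  \<open>(0, 1)\<close> and translate along the line of points \<open>(1, k)\<close>.\<close>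

lemma EV_A_act:
  assumes C: "C \<in> carrier A" and chi: "cyclo_char p t = 1"
  shows "[EV v (A_act p N i j t C) = EV (fst v, fst v * kummer_cocycle p N t + snd v) C] (mod int p)"
proof -
  let ?g = "\<lambda>v. (fst v, fst v * kummer_cocycle p N t + snd v)"
  let ?D = "sym_power_map R V i (V_act p N t) C"
  have "V_act p N t x \<in> carrier V" if "x \<in> carrier V" for x
    using that mod_R by (auto simp: V_act_def V_simps R_simps(2,3) chi)
  moreover have "[lform (?g v) x = lform v (V_act p N t x)] (mod int p)" for v x
  proof -
    obtain x1 x2 where x: "x = (x1, x2)" by (cases x)
    have "[lform v (V_act p N t x) = (x1 + kummer_cocycle p N t * x2) * fst v + x2 * snd v] (mod int p)"
      unfolding lform_def by (intro cong_add cong_mult cong_refl) (auto simp: x V_act_def R_simps chi cong_def mod_simps)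
    then show ?thesis by (simp add: lform_def x algebra_simps cong_sym_eq)
  qed
  ultimately have D: "const_on ?D" "[EV v ?D = EV (?g v) C] (mod int p)"
    using EV_sym_power_map[OF const_on_A[OF C] A_subset[OF C], of "V_act p N t" ?g] by blast+
  have "(1 :: int) [^]\<^bsub>R\<^esub> j = 1"
    using inv_one by (simp add: int_pow_def2 R_simps(5)[symmetric] del: res_one_eq)
  then have "[EV v (A_act p N i j t C) = 1 * EV v ?D] (mod int p)"
    unfolding A_act_def chi using EV_smult(2)[OF D(1), of v 1] by simp
  then show ?thesis using cong_trans[OF _ D(2)] by simp
qed

lemma EV_cong:
  assumes "[fst v = fst w] (mod int p)" "[snd v = snd w] (mod int p)"
  shows "[EV v C = EV w C] (mod int p)"
proof -
  have "[lform v x = lform w x] (mod int p)" for x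
    using assms unfolding lform_def by (intro cong_add cong_mult cong_refl)
  then have "[tform v s = tform w s] (mod int p)" for s
    using tform_cong[of s v w "\<lambda>x. x" "int p"] by simp
  then show ?thesis unfolding EV_def ev_def by (intro cong_sum cong_mult cong_refl)
qed

lemma sum_EV:
  assumes "\<not> int p dvd b" "i = p - 1" "C \<in> carrier A"
  shows "[(\<Sum>k<p. EV (1, int k * b) C) = - EV (0, 1) C] (mod int p)"
proof -
  let ?c = "SOME c. c \<in> C"
  have "(\<Sum>k<p. EV (1, int k * b) C) = (\<Sum>s\<in>T. ?c s * (\<Sum>k<p. tform (1, int k * b) s))"
    unfolding EV_def ev_def by (subst sum.swap) (simp add: sum_distrib_left)
  also have "[\<dots> = (\<Sum>s\<in>T. ?c s * (- tform (0, 1) s))] (mod int p)"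
    using assms by (intro cong_sum cong_mult cong_refl sum_tform p) auto
  also have "(\<Sum>s\<in>T. ?c s * (- tform (0, 1) s)) = - EV (0, 1) C"
    by (simp add: EV_def ev_def sum_negf)
  finally show ?thesis .
qed

text \<open>The witness is the \<open>i\<close>-th power of the second basis vector of
  \<open>V\<close>.\<close>

lemma EV_nontrivial:
  obtains C where "C \<in> carrier A" "[EV (0, 1) C = 1] (mod int p)"
proof -
  interpret FM: abelian_group FM by (rule abelian_group_FM)
  let ?xs = "replicate i (0 :: int, 1 :: int)"
  have xs: "?xs \<in> T" using p_gt_1 by (auto simp: V_simps R_simps)
  let ?C = "SK +>\<^bsub>FM\<^esub> free_basis R T ?xs"
  have C: "?C \<in> carrier A" using basis_FM by (auto simp: A_simps A_RCOSETS_def')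
  have "\<zero>\<^bsub>FM\<^esub> \<oplus>\<^bsub>FM\<^esub> free_basis R T ?xs \<in> ?C"
    using SK_zero by (auto simp: a_r_coset_def')
  then have "free_basis R T ?xs \<in> ?C" using FM.l_zero[OF basis_FM] by simp
  then have "[EV (0, 1) ?C = ev (0, 1) (free_basis R T ?xs)] (mod int p)"
    by (rule EV_eq[OF const_on_A[OF C]])
  moreover have "tform (0, 1) ?xs = 1" by (induction i) (auto simp: lform_def)
  ultimately show ?thesis using that[OF C] ev_basis[OF xs] by simp
qed

lemma finite_A: "finite (carrier A)"
proof -
  have "carrier A = (\<lambda>c. SK +>\<^bsub>FM\<^esub> c) ` carrier FM" by (auto simp: A_simps A_RCOSETS_def')
  then show ?thesis using finite_FM by simp
qed

end


section \<open>A character trivial on inertia\<close>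

context group
begin

lemma cong_hom_pow:
  fixes f :: "'a \<Rightarrow> int"
  assumes f: "\<And>g h. g \<in> carrier G \<Longrightarrow> h \<in> carrier G \<Longrightarrow> [f (g \<otimes> h) = f g + f h] (mod m)" and g: "g \<in> carrier G"
  shows "[f (g [^] (n :: nat)) = int n * f g] (mod m)"
proof (induction n)
  case 0
  show ?case using f[of \<one> \<one>] by (simp add: cong_iff_dvd_diff)
next
  case (Suc n)
  have "[f (g [^] Suc n) = f (g [^] n) + f g] (mod m)" using f[of "g [^] n" g] g by simp
  also have "[f (g [^] n) + f g = int n * f g + f g] (mod m)" by (intro cong_add Suc cong_refl)
  finally show ?case by (simp add: algebra_simps)
qed

text \<open>
  The group \<open>A\<close> plays the role of \<open>Sym\<^sup>p\<^sup>-\<^sup>1(V)\<close>, and \<open>ev v\<close> of the evaluation at \<open>v\<close>. If some inertial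
  \<open>\<tau>\<close> lies outside \<open>A\<close>, it splits the group as \<open>A \<rtimes> \<langle>\<tau>\<rangle>\<close>, and \<open>ev (0, 1)\<close> extends to a character
  trivial on \<open>\<tau>\<close>. For a further inertial element \<open>g \<tau>\<close>, the relation \<open>(g \<tau>)\<^sup>p = 1\<close> reads
  \<open>\<Prod> \<tau>\<^sup>k g \<tau>\<^sup>-\<^sup>k = 1\<close>, and applying \<open>ev (1, 0)\<close> to it yields \<open>ev (0, 1) g = 0\<close>.
\<close>

lemma exists_character:
  fixes p :: nat and b :: "'a \<Rightarrow> int" and ev :: "int \<times> int \<Rightarrow> 'a \<Rightarrow> int"
  assumes p: "prime p"
    and A: "A = {g \<in> carrier G. int p dvd b g}"
    and b_mult: "\<And>g h. g \<in> carrier G \<Longrightarrow> h \<in> carrier G \<Longrightarrow> [b (g \<otimes> h) = b g + b h] (mod int p)"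
    and ev_mult: "\<And>v g h. g \<in> A \<Longrightarrow> h \<in> A \<Longrightarrow> [ev v (g \<otimes> h) = ev v g + ev v h] (mod int p)"
    and conj: "\<And>v t g h. t \<in> carrier G \<Longrightarrow> g \<in> A \<Longrightarrow> h \<in> A \<Longrightarrow> h \<otimes> t = t \<otimes> g \<Longrightarrow>
      [ev v h = ev (fst v, fst v * b t + snd v) g] (mod int p)"
    and ev_cong: "\<And>x y g. [x = y] (mod int p) \<Longrightarrow> [ev (1, x) g = ev (1, y) g] (mod int p)"
    and ev_sum: "\<And>c g. \<not> int p dvd c \<Longrightarrow> g \<in> A \<Longrightarrow> [(\<Sum>k<p. ev (1, int k * c) g) = - ev (0, 1) g] (mod int p)"
    and g0: "g0 \<in> A" "[ev (0, 1) g0 = 1] (mod int p)"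
    and J: "J \<subseteq> carrier G" "\<And>g n. g \<in> J \<Longrightarrow> g [^] (n :: nat) \<in> J" "\<And>g. g \<in> J \<Longrightarrow> g \<in> A \<Longrightarrow> g = \<one>"
  obtains \<psi> s where "\<And>g h. g \<in> carrier G \<Longrightarrow> h \<in> carrier G \<Longrightarrow> [\<psi> (g \<otimes> h) = \<psi> g + \<psi> h] (mod int p)"
    "s \<in> carrier G" "[\<psi> s = 1] (mod int p)" "\<And>g. g \<in> J \<Longrightarrow> int p dvd \<psi> g"
proof -
  have b_pow: "[b (g [^] n) = int n * b g] (mod int p)" if "g \<in> carrier G" for g and n :: nat
    using b_mult that by (rule cong_hom_pow)
  have b_one: "int p dvd b \<one>" using b_pow[of \<one> 0] by (simp add: cong_0_iff)
  have b_inv: "[b (inv g) = - b g] (mod int p)" if "g \<in> carrier G" for g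
  proof -
    have "[b \<one> = b g + b (inv g)] (mod int p)" using b_mult[of g "inv g"] that by simp
    then have "int p dvd b g + b (inv g)" using b_one cong_dvd_iff by blast
    then show ?thesis by (simp add: cong_iff_dvd_diff add.commute)
  qed
  have A_G: "g \<in> carrier G" if "g \<in> A" for g using that A by blast
  have A_one: "\<one> \<in> A" using b_one A by simp
  have A_mult: "g \<otimes> h \<in> A" if "g \<in> A" "h \<in> A" for g h
    using that cong_dvd_iff[OF b_mult[of g h]] unfolding A by auto
  have A_inv: "inv g \<in> A" if "g \<in> A" for g
    using that cong_dvd_iff[OF b_inv[of g]] unfolding A by auto
  have ev_one: "int p dvd ev v \<one>" for v
    using ev_mult[OF A_one A_one, of v] by (simp add: cong_iff_dvd_diff)
  have unit_power: "\<exists>m :: nat. [b (g [^] m) = 1] (mod int p) \<and> \<not> int p dvd int m" if g: "g \<in> carrier G" "g \<notin> A" for g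
  proof -
    have "coprime (b g) (int p)" using g prime_imp_coprime[of "int p" "b g"] p A by (simp add: coprime_commute)
    then obtain x where x: "[b g * x = 1] (mod int p)" using cong_solve_coprime_int by blast
    define m where "m = nat (x mod int p)"
    have "int m = x mod int p" using prime_gt_0_nat[OF p] by (simp add: m_def)
    then have m: "[int m = x] (mod int p)" by (simp add: cong_def)
    have "[int m * b g = x * b g] (mod int p)" using m by (rule cong_scalar_right)
    from cong_trans[OF cong_trans[OF b_pow[OF g(1), of m] this]] x
    have 1: "[b (g [^] m) = 1] (mod int p)" by (simp add: mult.commute)
    moreover have "\<not> int p dvd int m"
    proof
      assume "int p dvd int m"
      then have "int p dvd int m * b g" by simp
      then have "int p dvd b (g [^] m)" using cong_dvd_iff[OF b_pow[OF g(1), of m]] by blast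
      then have "int p dvd 1" using cong_dvd_iff[OF 1] by blast
      then show False using prime_gt_1_nat[OF p] by simp
    qed
    ultimately show ?thesis by blast
  qed
  show ?thesis
  proof (cases "J \<subseteq> A")
    case True
    \<comment> \<open>All inertia is trivial in this case, so any nonzero character serves: the
      evaluation at \<open>(0, 1)\<close> if \<open>A\<close> is the whole group, and
      \<open>b\<close> otherwise.\<close>
    then have J1: "g = \<one>" if "g \<in> J" for g using that J(3) by blast
    show ?thesis
    proof (cases "A = carrier G")
      case True
      then show ?thesis using ev_mult g0 J1 ev_one by (intro that[of "ev (0, 1)" g0]) auto
    next
      case False
      then obtain t where t: "t \<in> carrier G" "t \<notin> A" using A by blast
      obtain m :: nat where "[b (t [^] m) = 1] (mod int p)" using unit_power[OF t] by blast
      then show ?thesis using b_mult t J1 b_one by (intro that[of b "t [^] m"]) auto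
    qed
  next
    case False
    then obtain \<tau>0 where \<tau>0: "\<tau>0 \<in> J" "\<tau>0 \<notin> A" by blast
    then obtain m0 :: nat where m0: "[b (\<tau>0 [^] m0) = 1] (mod int p)" using unit_power J(1) by blast
    define \<tau> where "\<tau> = \<tau>0 [^] m0"
    have \<tau>: "\<tau> \<in> J" "\<tau> \<in> carrier G" "[b \<tau> = 1] (mod int p)" using J m0 \<tau>0 by (auto simp: \<tau>_def)
    \<comment> \<open>The \<open>p\<close>-th power lies in \<open>A\<close>, as \<open>b\<close> is
      additive modulo \<open>p\<close>, and is again inertial; inertia meets \<open>A\<close>
      trivially.\<close>
    have pow_p: "g [^] p = \<one>" if "g \<in> J" for g
    proof (rule J(3)[OF J(2)[OF that]])
      have "g \<in> carrier G" using that J(1) by blast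
      then show "g [^] p \<in> A" using cong_dvd_iff[OF b_pow[of g p]] by (simp add: A)
    qed
    have \<tau>_mod: "\<tau> [^] (n mod p) = \<tau> [^] n" for n :: nat
    proof -
      have "\<tau> [^] n = \<tau> [^] (p * (n div p) + n mod p)" by simp
      also have "\<dots> = (\<tau> [^] p) [^] (n div p) \<otimes> \<tau> [^] (n mod p)"
        using \<tau>(2) by (simp only: nat_pow_mult nat_pow_pow nat_pow_closed)
      finally show ?thesis using pow_p[OF \<tau>(1)] \<tau>(2) by simp
    qed
    have b_\<tau>: "[b (\<tau> [^] n) = int n] (mod int p)" for n :: nat
      using cong_trans[OF b_pow[OF \<tau>(2)] cong_mult[OF cong_refl \<tau>(3)]] by simp
    \<comment> \<open>Semidirect decomposition: \<open>w = r w \<otimes> \<tau> [^] k w\<close> with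
      \<open>r w\<close> in \<open>A\<close>. The character is the evaluation at
      \<open>(0, 1)\<close> of the \<open>A\<close>-part, which kills \<open>\<tau>\<close>.\<close>
    define k where "k w = nat (b w mod int p)" for w
    define r where "r w = w \<otimes> inv (\<tau> [^] k w)" for w
    define \<psi> where "\<psi> w = ev (0, 1) (r w)" for w
    have k: "int (k w) = b w mod int p" for w using prime_gt_0_nat[OF p] by (simp add: k_def)
    have r: "w = r w \<otimes> \<tau> [^] k w" if "w \<in> carrier G" for w
      using that \<tau>(2) by (simp add: r_def m_assoc)
    have r_A: "r w \<in> A" if w: "w \<in> carrier G" for w
    proof -
      have "[b (r w) = b w + b (inv (\<tau> [^] k w))] (mod int p)"
        unfolding r_def using w \<tau>(2) by (intro b_mult) auto
      also have "[b w + b (inv (\<tau> [^] k w)) = b w + - b (\<tau> [^] k w)] (mod int p)"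
        using \<tau>(2) by (intro cong_add cong_refl b_inv) auto
      also have "[b w + - b (\<tau> [^] k w) = b w - int (k w)] (mod int p)"
        using b_\<tau>[of "k w"] cong_diff[OF cong_refl[of "b w"]] by force
      also have "[b w - int (k w) = 0] (mod int p)" by (simp add: k cong_iff_dvd_diff minus_mod_eq_mult_div)
      finally show ?thesis using w \<tau>(2) by (simp add: A cong_0_iff) (simp add: r_def)
    qed
    have r_eq: "r (g \<otimes> \<tau> [^] n) = g" if g: "g \<in> A" for g and n :: nat
    proof -
      note gG = A_G[OF g]
      have "[b (g \<otimes> \<tau> [^] n) = b g + b (\<tau> [^] n)] (mod int p)" using gG \<tau>(2) by (intro b_mult) auto
      also have "[b g + b (\<tau> [^] n) = 0 + int n] (mod int p)"
        using g b_\<tau>[of n] by (intro cong_add) (auto simp: A cong_0_iff)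
      finally have "b (g \<otimes> \<tau> [^] n) mod int p = int (n mod p)" by (simp add: cong_def zmod_int)
      then have "k (g \<otimes> \<tau> [^] n) = n mod p" by (simp add: k_def)
      then show ?thesis using gG \<tau>(2) by (simp add: r_def \<tau>_mod m_assoc)
    qed
    have h_A: "\<tau> [^] n \<otimes> g \<otimes> inv (\<tau> [^] n) \<in> A" if g: "g \<in> A" for g and n :: nat
    proof -
      note gG = A_G[OF g]
      have "[b (\<tau> [^] n \<otimes> g \<otimes> inv (\<tau> [^] n)) = b (\<tau> [^] n \<otimes> g) + b (inv (\<tau> [^] n))] (mod int p)"
        using gG \<tau>(2) by (intro b_mult) auto
      also have "[b (\<tau> [^] n \<otimes> g) + b (inv (\<tau> [^] n)) = (b (\<tau> [^] n) + b g) + - b (\<tau> [^] n)] (mod int p)"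
        using gG \<tau>(2) by (intro cong_add b_mult b_inv) auto
      also have "[(b (\<tau> [^] n) + b g) + - b (\<tau> [^] n) = 0] (mod int p)" using g by (simp add: A cong_0_iff)
      finally show ?thesis using gG \<tau>(2) by (simp add: A cong_0_iff)
    qed
    have h_comm: "(\<tau> [^] n \<otimes> g \<otimes> inv (\<tau> [^] n)) \<otimes> \<tau> [^] n = \<tau> [^] n \<otimes> g" if "g \<in> A" for g and n :: nat
      using A_G[OF that] \<tau>(2) by (simp add: m_assoc)
    have \<psi>_mult: "[\<psi> (w \<otimes> w') = \<psi> w + \<psi> w'] (mod int p)" if w: "w \<in> carrier G" "w' \<in> carrier G" for w w'
    proof -
      let ?h = "\<tau> [^] k w \<otimes> r w' \<otimes> inv (\<tau> [^] k w)"
      note c = A_G[OF r_A[OF w(1)]] A_G[OF r_A[OF w(2)]] A_G[OF h_A[OF r_A[OF w(2)], of "k w"]]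
      have "w \<otimes> w' = (r w \<otimes> \<tau> [^] k w) \<otimes> (r w' \<otimes> \<tau> [^] k w')" using r w by simp
      also have "\<dots> = r w \<otimes> (\<tau> [^] k w \<otimes> r w') \<otimes> \<tau> [^] k w'" using c \<tau>(2) by (simp add: m_assoc)
      also have "\<dots> = r w \<otimes> (?h \<otimes> \<tau> [^] k w) \<otimes> \<tau> [^] k w'" using h_comm[OF r_A[OF w(2)]] by simp
      also have "\<dots> = (r w \<otimes> ?h) \<otimes> (\<tau> [^] k w \<otimes> \<tau> [^] k w')"
        using c(1,3) \<tau>(2) by (simp only: m_assoc m_closed nat_pow_closed)
      also have "\<dots> = (r w \<otimes> ?h) \<otimes> \<tau> [^] (k w + k w')" using \<tau>(2) by (simp add: nat_pow_mult)
      finally have "\<psi> (w \<otimes> w') = ev (0, 1) (r w \<otimes> ?h)"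
        using r_eq[OF A_mult[OF r_A[OF w(1)] h_A[OF r_A[OF w(2)]]]] by (simp add: \<psi>_def)
      also have "[ev (0, 1) (r w \<otimes> ?h) = ev (0, 1) (r w) + ev (0, 1) ?h] (mod int p)"
        by (rule ev_mult[OF r_A[OF w(1)] h_A[OF r_A[OF w(2)]]])
      \<comment> \<open>The first coordinate of \<open>(0, 1)\<close> is zero, so conjugation leaves
        this evaluation unchanged.\<close>
      also have "[ev (0, 1) (r w) + ev (0, 1) ?h = \<psi> w + \<psi> w'] (mod int p)"
        using conj[OF _ r_A[OF w(2)] h_A[OF r_A[OF w(2)]] h_comm[OF r_A[OF w(2)]], of "k w" "(0, 1)"] \<tau>(2)
        unfolding \<psi>_def by (intro cong_add cong_refl) auto
      finally show ?thesis .
    qed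
    have \<psi>_pow: "[\<psi> (w [^] n) = int n * \<psi> w] (mod int p)" if "w \<in> carrier G" for w and n :: nat
      using \<psi>_mult that by (rule cong_hom_pow)
    have \<psi>_A: "\<psi> g = ev (0, 1) g" if "g \<in> A" for g
      using r_eq[OF that, of 0] A_G[OF that] by (simp add: \<psi>_def)
    have "int p dvd \<psi> \<sigma>" if \<sigma>: "\<sigma> \<in> J" for \<sigma>
    proof (cases "\<sigma> \<in> A")
      case True
      then show ?thesis using J(3)[OF \<sigma>] \<psi>_A ev_one by simp
    next
      case False
      have \<sigma>G: "\<sigma> \<in> carrier G" using \<sigma> J(1) by blast
      then obtain m :: nat where m: "[b (\<sigma> [^] m) = 1] (mod int p)" "\<not> int p dvd int m"
        using unit_power False by blast
      define \<rho> where "\<rho> = \<sigma> [^] m"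
      have \<rho>: "\<rho> \<in> carrier G" "\<rho> \<in> J" using \<sigma> \<sigma>G J(2) by (auto simp: \<rho>_def)
      define g where "g = r \<rho>"
      have "b \<rho> mod int p = 1 mod int p" using m(1) by (simp add: \<rho>_def cong_def)
      then have "k \<rho> = 1" using prime_gt_1_nat[OF p] by (simp add: k_def)
      then have \<rho>_eq: "\<rho> = g \<otimes> \<tau>" using r[OF \<rho>(1)] \<tau>(2) by (simp add: g_def)
      have g: "g \<in> A" unfolding g_def by (rule r_A[OF \<rho>(1)])
      note gG = A_G[OF g]
      \<comment> \<open>\<open>P\<close> is the product of the conjugates of \<open>g\<close> by the
        first \<open>n\<close> powers of \<open>\<tau>\<close>. Conjugation by the
        \<open>k\<close>-th power moves the point \<open>(1, 0)\<close> to
        \<open>(1, k b \<tau>)\<close>, so for \<open>n = p\<close> the sum runs over the whole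
        line.\<close>
      have "\<exists>P. P \<in> A \<and> \<rho> [^] n = P \<otimes> \<tau> [^] n \<and> [ev (1, 0) P = (\<Sum>k<n. ev (1, int k * b \<tau>) g)] (mod int p)" for n :: nat
      proof (induction n)
        case 0
        show ?case using A_one ev_one[of "(1, 0)"] by (intro exI[of _ \<one>]) (simp add: cong_0_iff)
      next
        case (Suc n)
        then obtain P where P: "P \<in> A" "\<rho> [^] n = P \<otimes> \<tau> [^] n"
          "[ev (1, 0) P = (\<Sum>k<n. ev (1, int k * b \<tau>) g)] (mod int p)" by blast
        let ?h = "\<tau> [^] n \<otimes> g \<otimes> inv (\<tau> [^] n)"
        note PG = A_G[OF P(1)] and hG = A_G[OF h_A[OF g, of n]]
        have "\<rho> [^] Suc n = (P \<otimes> \<tau> [^] n) \<otimes> (g \<otimes> \<tau>)" using P(2) \<rho>_eq by simp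
        also have "\<dots> = P \<otimes> (\<tau> [^] n \<otimes> g) \<otimes> \<tau>" using PG gG \<tau>(2) by (simp add: m_assoc)
        also have "\<dots> = P \<otimes> (?h \<otimes> \<tau> [^] n) \<otimes> \<tau>" using h_comm[OF g] by simp
        also have "\<dots> = (P \<otimes> ?h) \<otimes> (\<tau> [^] n \<otimes> \<tau>)" using PG hG \<tau>(2) by (simp only: m_assoc m_closed nat_pow_closed)
        finally have eq: "\<rho> [^] Suc n = (P \<otimes> ?h) \<otimes> \<tau> [^] Suc n" by simp
        have "[ev (1, 0) (P \<otimes> ?h) = ev (1, 0) P + ev (1, 0) ?h] (mod int p)" by (rule ev_mult[OF P(1) h_A[OF g]])
        also have "[ev (1, 0) P + ev (1, 0) ?h = (\<Sum>k<n. ev (1, int k * b \<tau>) g) + ev (1, b (\<tau> [^] n)) g] (mod int p)"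
          using conj[OF _ g h_A[OF g] h_comm[OF g], of n "(1, 0)"] \<tau>(2) by (intro cong_add P(3)) auto
        also have "[(\<Sum>k<n. ev (1, int k * b \<tau>) g) + ev (1, b (\<tau> [^] n)) g = (\<Sum>k<n. ev (1, int k * b \<tau>) g) + ev (1, int n * b \<tau>) g] (mod int p)"
          by (intro cong_add cong_refl ev_cong b_pow \<tau>(2))
        finally show ?case using eq A_mult[OF P(1) h_A[OF g]] by (intro exI[of _ "P \<otimes> ?h"]) simp
      qed
      then obtain P where P: "P \<in> A" "\<rho> [^] p = P \<otimes> \<tau> [^] p"
        "[ev (1, 0) P = (\<Sum>k<p. ev (1, int k * b \<tau>) g)] (mod int p)" by blast
      have "P = \<one>" using P(2) pow_p[OF \<rho>(2)] pow_p[OF \<tau>(1)] A_G[OF P(1)] by simp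
      moreover have "\<not> int p dvd b \<tau>" using cong_dvd_iff[OF \<tau>(3)] prime_gt_1_nat[OF p] by simp
      ultimately have "[ev (1, 0) \<one> = - ev (0, 1) g] (mod int p)" using cong_trans[OF P(3) ev_sum[OF _ g]] by blast
      from cong_dvd_iff[OF this] have "int p dvd ev (0, 1) g" using ev_one[of "(1, 0)"] by simp
      moreover have "\<psi> \<rho> = ev (0, 1) g" using r_eq[OF g, of 1] \<tau>(2) by (simp add: \<psi>_def \<rho>_eq)
      ultimately have "int p dvd int m * \<psi> \<sigma>"
        using cong_dvd_iff[OF \<psi>_pow[OF \<sigma>G, of m]] by (simp add: \<rho>_def)
      then show ?thesis using m(2) p prime_dvd_mult_iff[of "int p"] by auto
    qed
    then show ?thesis using \<psi>_mult A_G[OF g0(1)] g0 \<psi>_A by (intro that[of \<psi> g0]) auto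
  qed
qed

end


section \<open>Unramified extensions with group a symmetric power\<close>

lemma fld_generate_field: "fld (generate_field complex_ring S)"
  using field.generate_field_is_subfield[OF field_complex_ring] by (intro fldI_subfield) simp

lemma generate_field_subset:
  assumes "fld F" "S \<subseteq> F" shows "generate_field complex_ring S \<subseteq> F"
proof
  interpret F: subfield_of_complex F by unfold_locales (fact assms(1))
  fix x assume "x \<in> generate_field complex_ring S"
  then show "x \<in> F"
    by induction (use assms(2) in \<open>auto simp: complex_ring_m_inv intro: F.uminus_F F.inverse_F F.add_F F.mult_F\<close>)
qed

context galois_over_rats
begin

lemma fld_vimage:
  assumes "g \<in> carrier G" "fld F" shows "fld {x \<in> M. g x \<in> F}"
proof -
  interpret F: subfield_of_complex F by unfold_locales (fact assms(2))
  show ?thesis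
    using assms(1) by (auto simp: fld_def gal_one gal_diff gal_mult gal_inverse intro: M.diff_F M.mult_F M.inverse_F F.diff_F F.mult_F F.inverse_F)
qed

lemma fld_fixed: "g \<in> carrier G \<Longrightarrow> fld {x \<in> M. g x = x}"
  by (auto simp: fld_def gal_one gal_diff gal_mult gal_inverse intro: M.diff_F M.mult_F M.inverse_F)

lemma carrier_gal_over: "\<rat> \<subseteq> K \<Longrightarrow> carrier (gal_group K M) = {g \<in> carrier G. \<forall>x\<in>K. g x = x}"
  unfolding gal_carrier by auto

lemma gal_group_over: "x \<otimes>\<^bsub>gal_group K M\<^esub> y = x \<otimes>\<^bsub>G\<^esub> y" "\<one>\<^bsub>gal_group K M\<^esub> = \<one>\<^bsub>G\<^esub>"
  "g [^]\<^bsub>gal_group K M\<^esub> (n :: nat) = g [^]\<^bsub>G\<^esub> n"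
proof -
  show *: "x \<otimes>\<^bsub>gal_group K M\<^esub> y = x \<otimes>\<^bsub>G\<^esub> y" "\<one>\<^bsub>gal_group K M\<^esub> = \<one>\<^bsub>G\<^esub>" for x y by (simp_all add: gal_group_def)
  show "g [^]\<^bsub>gal_group K M\<^esub> (n :: nat) = g [^]\<^bsub>G\<^esub> n" by (simp add: nat_pow_def gal_group_def)
qed

end

context galois_field
begin

text \<open>
  A dual basis over \<open>\<rat>(z)\<close> that separates the identity from the automorphisms moving \<open>z\<close> turns the
  full trace into the trace over the stabiliser of \<open>z\<close>.
\<close>

lemma fixed_field_eq:
  assumes z: "z \<in> M" and F: "F = generate_field complex_ring {z}"
    and stable: "\<And>g. g \<in> carrier G \<Longrightarrow> g z \<in> F"
  shows "{x \<in> M. \<forall>g\<in>{g \<in> carrier G. g z = z}. g x = x} = F"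
proof (intro equalityI subsetI)
  interpret F: subfield_of_complex F unfolding F by unfold_locales (rule fld_generate_field)
  let ?W = "{g \<in> carrier G. g z = z}"
  let ?S = "carrier G - ?W"
  have FM: "F \<subseteq> M" unfolding F using M.fld z by (intro generate_field_subset) auto
  have zF: "z \<in> F" unfolding F by (rule generate_field.incl) simp
  have gF: "g x \<in> F" if "g \<in> carrier G" "x \<in> F" for g x
    using generate_field_subset[OF fld_vimage[OF that(1) F.fld], of "{z}"] z stable[OF that(1)] that(2) F by blast
  show "x \<in> {x \<in> M. \<forall>g\<in>?W. g x = x}" if "x \<in> F" for x
  proof -
    have "g x = x" if "g \<in> ?W" for g
      using generate_field_subset[OF fld_fixed, of g "{z}"] z \<open>x \<in> F\<close> that unfolding F by blast
    then show ?thesis using that FM by blast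
  qed
  fix u assume "u \<in> {x \<in> M. \<forall>g\<in>?W. g x = x}"
  then have u: "u \<in> M" "\<And>g. g \<in> ?W \<Longrightarrow> g u = u" by blast+
  have "\<exists>l. set l \<subseteq> F \<times> F \<and> (\<Sum>(x, y)\<leftarrow>l. x * y) = 1 \<and> (\<forall>g\<in>?S. (\<Sum>(x, y)\<leftarrow>l. x * g y) = 0)"
  proof (rule dual_basis_exists)
    show "finite ?S" using finite_gal by simp
    show "g (x * y) = g x * g y" if "g \<in> ?S" "x \<in> F" "y \<in> F" for g x y using that FM by (auto intro: gal_mult)
    show "g 1 = 1" if "g \<in> ?S" for g using that by (simp add: gal_one)
    show "\<exists>l. set l \<subseteq> F \<times> F \<and> (\<Sum>(a, b)\<leftarrow>l. a * (b - g b)) = 1" if g: "g \<in> ?S" for g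
    proof (intro exI conjI)
      have "z - g z \<noteq> 0" using g by auto
      then show "(\<Sum>(a, b)\<leftarrow>[(inverse (z - g z), z)]. a * (b - g b)) = 1" by simp
      show "set [(inverse (z - g z), z)] \<subseteq> F \<times> F" using g stable zF by auto
    qed
    show "g x \<in> F" if "g \<in> ?S" "x \<in> F" for g x using that gF by blast
  qed auto
  then obtain l where l: "set l \<subseteq> F \<times> F" "(\<Sum>(x, y)\<leftarrow>l. x * y) = 1" "\<And>g. g \<in> ?S \<Longrightarrow> (\<Sum>(x, y)\<leftarrow>l. x * g y) = 0"
    by blast
  define t where "t = (\<Sum>(x, y)\<leftarrow>l. x * trace (y * u))"
  have "t \<in> F" unfolding t_def using l(1)
  proof (induction l)
    case (Cons a l)
    then have "snd a * u \<in> M" using FM u(1) by (auto intro!: M.mult_F)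
    then have "trace (snd a * u) \<in> F" using trace_Rats F.Rats_F by blast
    then show ?case using Cons by (auto simp: case_prod_unfold intro!: F.add_F F.mult_F)
  qed simp
  have "(\<Sum>(x, y)\<leftarrow>l'. x * trace (y * u)) = (\<Sum>g\<in>carrier G. (\<Sum>(x, y)\<leftarrow>l'. x * g y) * g u)" if "set l' \<subseteq> F \<times> F" for l'
    using that
  proof (induction l')
    case (Cons a l')
    then have "snd a \<in> M" using FM by auto
    then have "trace (snd a * u) = (\<Sum>g\<in>carrier G. g (snd a) * g u)" using u(1) by (simp add: trace_def gal_mult)
    then show ?case using Cons by (simp add: case_prod_unfold sum.distrib distrib_right sum_distrib_left mult.assoc)
  qed simp
  then have "t = (\<Sum>g\<in>carrier G. (\<Sum>(x, y)\<leftarrow>l. x * g y) * g u)" using l(1) by (simp add: t_def)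
  also have "\<dots> = (\<Sum>g\<in>?W. (\<Sum>(x, y)\<leftarrow>l. x * g y) * g u)"
    using finite_gal l(3) by (intro sum.mono_neutral_right) auto
  also have "\<dots> = (\<Sum>g\<in>?W. u)"
  proof (rule sum.cong[OF refl])
    fix g assume g: "g \<in> ?W"
    have "g y = y" if "y \<in> F" for y
      using generate_field_subset[OF fld_fixed, of g "{z}"] z g that unfolding F by blast
    then have "(\<Sum>(x, y)\<leftarrow>l. x * g y) = (\<Sum>(x, y)\<leftarrow>l. x * y)"
      using l(1) by (intro arg_cong[of _ _ sum_list] map_cong) auto
    then show "(\<Sum>(x, y)\<leftarrow>l. x * g y) * g u = u" using l(2) u(2)[OF g] by simp
  qed
  finally have "t = of_nat (card ?W) * u" by simp
  moreover have "card ?W \<noteq> 0" using finite_gal G.one_closed z by (auto simp: card_eq_0_iff act_one)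
  ultimately have "u = t / of_nat (card ?W)" by simp
  then show "u \<in> F" using \<open>t \<in> F\<close> by auto
qed

end


lemma zeta_root: assumes "p > 1" shows "zeta p ^ p = 1" "zeta p \<noteq> 1"
proof -
  have b: "bij_betw (\<lambda>k. cis (2 * pi * real k / real p)) {..<p} {z. z ^ p = 1}"
    using assms by (intro bij_betw_roots_unity) simp
  have "cis (2 * pi * real 1 / real p) \<in> {z. z ^ p = 1}"
    using bij_betwE[OF b] assms by blast
  then show "zeta p ^ p = 1" by (simp add: zeta_def)
  have "cis (2 * pi * real 1 / real p) \<noteq> cis (2 * pi * real 0 / real p)"
    using inj_on_eq_iff[OF bij_betw_imp_inj_on[OF b], of 1 0] assms by simp
  then show "zeta p \<noteq> 1" by (simp add: zeta_def)
qed

lemma nth_root_power: assumes "p > 0" "N > 0" shows "nth_root p N ^ p = of_nat N" "nth_root p N \<noteq> 0"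
  using assms by (auto simp: nth_root_def simp flip: of_real_power)

lemma root_power_cong:
  fixes z :: complex
  assumes "prime p" "z ^ p = 1" "z \<noteq> 1" "z ^ m = z ^ n"
  shows "[m = n] (mod p)"
proof -
  have mod: "z ^ (m mod p) = z ^ m" for m
  proof -
    have "z ^ m = z ^ (p * (m div p) + m mod p)" by simp
    also have "\<dots> = z ^ (m mod p)" unfolding power_add power_mult assms(2) by simp
    finally show ?thesis by simp
  qed
  show ?thesis unfolding cong_def
    using assms prime_gt_0_nat by (intro root_power_inj[OF assms(1-3)]) (auto simp: mod)
qed

section \<open>The given extension: its groups over \<open>L\<close> and over the cyclotomic
  field\<close>

locale sym_extension = galois_over_rats M + S: sym_power_eval p "p - 1" for M p +
  fixes N :: nat and j :: int and \<phi> :: "(complex \<Rightarrow> complex) \<Rightarrow> ((int \<times> int) list \<Rightarrow> int) set"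
  assumes N: "N > 0"
    and gal_L: "galois_extension (kummer_field p N) M"
    and \<phi>: "\<phi> \<in> iso (gal_group (kummer_field p N) M) (add_monoid (A_module p (p - 1)))"
    and \<phi>_conj: "\<And>t g. t \<in> carrier G \<Longrightarrow> restrict t (kummer_field p N) \<in> carrier (gal_group \<rat> (kummer_field p N)) \<Longrightarrow>
      g \<in> carrier (gal_group (kummer_field p N) M) \<Longrightarrow>
      \<phi> (t \<otimes>\<^bsub>G\<^esub> g \<otimes>\<^bsub>G\<^esub> inv\<^bsub>G\<^esub> t) = A_act p N (p - 1) j (restrict t (kummer_field p N)) (\<phi> g)"
    and unram: "unramified (kummer_field p N) M"
begin

abbreviation "L \<equiv> kummer_field p N"
abbreviation "z \<equiv> zeta p"
abbreviation "\<nu> \<equiv> nth_root p N"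
abbreviation "W \<equiv> {g \<in> carrier G. g z = z}"
abbreviation "B \<equiv> {g \<in> carrier G. \<forall>x\<in>L. g x = x}"

lemma fld_L: "fld L" and L_M: "L \<subseteq> M"
  using gal_L by (auto simp: galois_extension_def intro: fldI_subfield)

sublocale L: subfield_of_complex L
  by unfold_locales (rule fld_L)

lemma z_L: "z \<in> L" and \<nu>_L: "\<nu> \<in> L"
  unfolding kummer_field_def by (rule generate_field.incl; simp)+

lemma z_M: "z \<in> M" and \<nu>_M: "\<nu> \<in> M"
  using z_L \<nu>_L L_M by blast+

lemma z_pow: "z ^ p = 1" "z \<noteq> 1" "z \<noteq> 0"
  using zeta_root[OF S.p_gt_1] S.p_gt_1 by (auto simp: zero_power)

lemma \<nu>_pow: "\<nu> ^ p = of_nat N" "\<nu> \<noteq> 0"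
  using nth_root_power[of p N] N S.p_gt_1 by auto

lemma L_subset: "fld F \<Longrightarrow> z \<in> F \<Longrightarrow> \<nu> \<in> F \<Longrightarrow> L \<subseteq> F"
  unfolding kummer_field_def by (rule generate_field_subset) auto

lemma fixes_L: "g \<in> carrier G \<Longrightarrow> g z = z \<Longrightarrow> g \<nu> = \<nu> \<Longrightarrow> x \<in> L \<Longrightarrow> g x = x"
  using L_subset[OF fld_fixed, of g] z_M \<nu>_M by blast

lemma carrier_gal_L: "carrier (gal_group L M) = B"
  by (rule carrier_gal_over[OF L.Rats_F])

lemma \<phi>_mult: "g \<in> B \<Longrightarrow> h \<in> B \<Longrightarrow> \<phi> (g \<otimes>\<^bsub>G\<^esub> h) = \<phi> g \<oplus>\<^bsub>S.A\<^esub> \<phi> h"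
proof -
  assume gh: "g \<in> B" "h \<in> B"
  have hom: "\<phi> \<in> hom (gal_group L M) (add_monoid S.A)" using \<phi> unfolding iso_def by blast
  have "\<phi> (g \<otimes>\<^bsub>gal_group L M\<^esub> h) = \<phi> g \<otimes>\<^bsub>add_monoid S.A\<^esub> \<phi> h"
    using gh unfolding carrier_gal_L[symmetric] by (rule hom_mult[OF hom])
  then show ?thesis unfolding gal_group_over[where K = L] by (simp only: monoid.simps)
qed

lemma \<phi>_bij: "bij_betw \<phi> B (carrier S.A)"
  using \<phi> unfolding iso_def carrier_gal_L by simp

lemma \<phi>_A: "g \<in> B \<Longrightarrow> \<phi> g \<in> carrier S.A"
  using \<phi>_bij bij_betwE by blast

lemma root_image: "g \<in> carrier G \<Longrightarrow> x \<in> M \<Longrightarrow> x ^ n = of_nat k \<Longrightarrow> g x ^ n = of_nat k"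
  using gal_power[of g x n] gal_of_int(2)[of g k] by simp

text \<open>
  An automorphism of \<open>M\<close> is determined up to \<open>Gal(M/L)\<close> by the images of \<open>\<zeta>\<close> and \<open>N\<^sup>1\<^sup>/\<^sup>p\<close>.
\<close>

lemma finite_gal: "finite (carrier G)"
proof (rule ccontr)
  assume inf: "infinite (carrier G)"
  let ?f = "\<lambda>g. (g z, g \<nu>)"
  have "?f ` carrier G \<subseteq> {x. x ^ p = of_nat 1} \<times> {x. x ^ p = of_nat N}"
    using root_image[OF _ z_M, of _ p 1] root_image[OF _ \<nu>_M, of _ p N] z_pow \<nu>_pow by auto
  then have "finite (?f ` carrier G)"
    using S.p_gt_1 by (rule_tac finite_subset) (auto intro!: finite_nth_roots)
  then obtain g where g: "g \<in> carrier G" "infinite {h \<in> carrier G. ?f h = ?f g}"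
    using pigeonhole_infinite[OF inf] by blast
  have "{h \<in> carrier G. ?f h = ?f g} \<subseteq> (\<lambda>h. g \<otimes>\<^bsub>G\<^esub> h) ` B"
  proof
    fix h assume "h \<in> {h \<in> carrier G. ?f h = ?f g}"
    then have h: "h \<in> carrier G" "h z = g z" "h \<nu> = g \<nu>" by auto
    let ?k = "inv\<^bsub>G\<^esub> g \<otimes>\<^bsub>G\<^esub> h"
    have k: "?k \<in> carrier G" "?k z = z" "?k \<nu> = \<nu>"
      using g(1) h z_M \<nu>_M by (simp_all add: act_mult act_inv)
    then have "?k \<in> B" using fixes_L by blast
    moreover have "h = g \<otimes>\<^bsub>G\<^esub> ?k" using g(1) h(1) by (simp add: G.m_assoc[symmetric])
    ultimately show "h \<in> (\<lambda>h. g \<otimes>\<^bsub>G\<^esub> h) ` B" by blast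
  qed
  moreover have "finite B" using \<phi>_bij S.finite_A bij_betw_finite by blast
  ultimately show False using g(2) finite_subset by blast
qed

sublocale galois_field M
  by unfold_locales (rule finite_gal)

lemma W_\<nu>: assumes "g \<in> W" obtains i where "i < p" "g \<nu> = \<nu> * z ^ i"
proof -
  have "(g \<nu> / \<nu>) ^ p = 1"
    using root_image[OF _ \<nu>_M \<nu>_pow(1), of g] assms \<nu>_pow N by (simp add: power_divide)
  then obtain i where "i < p" "g \<nu> / \<nu> = z ^ i" by (rule roots_of_unity_power[OF S.p(1) z_pow(1,2)])
  then show ?thesis using that \<nu>_pow(2) by (simp add: field_simps)
qed

lemma W_L: assumes "g \<in> W" "x \<in> L" shows "g x \<in> L"
proof -
  obtain i where "g \<nu> = \<nu> * z ^ i" using W_\<nu>[OF assms(1)] by blast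
  then have "L \<subseteq> {x \<in> M. g x \<in> L}"
    using assms(1) z_L \<nu>_L z_M \<nu>_M by (intro L_subset fld_vimage fld_L) (auto intro!: L.mult_F L.power_F)
  then show ?thesis using assms(2) by blast
qed

lemma W_inv: "g \<in> W \<Longrightarrow> inv\<^bsub>G\<^esub> g \<in> W"
  using act_inv(1)[of g z] z_M by auto

lemma restrict_gal: assumes g: "g \<in> W" shows "restrict g L \<in> carrier (gal_group \<rat> L)"
proof -
  have "bij_betw (restrict g L) L L"
    using W_L[OF g] W_L[OF W_inv[OF g]] act_inv g L_M
    by (intro bij_betwI[of _ _ _ "inv\<^bsub>G\<^esub> g"]) auto
  moreover have "restrict g L \<in> ring_hom (subfield_ring L) (subfield_ring L)"
    using W_L[OF g] g L_M by (auto simp: ring_hom_def gal_add gal_mult gal_one subset_iff L.add_F L.mult_F)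
  moreover have "\<forall>x\<in>\<rat>. restrict g L x = x" using g L.Rats_F by (auto simp: gal_Rats)
  ultimately show ?thesis by (simp add: gal_group_def Bij_def)
qed

lemma cyclo_char_W: assumes "g \<in> W" shows "cyclo_char p (restrict g L) = 1"
  unfolding cyclo_char_def
proof (rule the_equality)
  show "1 \<in> carrier (prime_field p) \<and> restrict g L z = z powi 1"
    using assms z_L S.p_gt_1 by (simp add: S.R_simps)
  fix a assume a: "a \<in> carrier (prime_field p) \<and> restrict g L z = z powi a"
  then have "z ^ nat a = z ^ 1" "nat a < p" "a \<ge> 0"
    using assms z_L by (auto simp: S.R_simps power_int_def)
  then have "nat a = 1" using root_power_inj[OF S.p(1) z_pow(1,2)] S.p_gt_1 by blast
  then show "a = 1" using \<open>a \<ge> 0\<close> by simp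
qed

definition b :: "(complex \<Rightarrow> complex) \<Rightarrow> int"
  where "b g = kummer_cocycle p N (restrict g L)"

lemma b_eq: assumes "g \<in> W" "i < p" "g \<nu> = \<nu> * z ^ i" shows "b g = int i"
  unfolding b_def kummer_cocycle_def
proof (rule the_equality)
  have v: "restrict g L \<nu> / \<nu> = z ^ i" using assms \<nu>_L \<nu>_pow(2) by simp
  then show "int i \<in> carrier (prime_field p) \<and> restrict g L \<nu> / \<nu> = z powi int i"
    using assms(2) by (simp add: S.R_simps)
  fix a assume a: "a \<in> carrier (prime_field p) \<and> restrict g L \<nu> / \<nu> = z powi a"
  then have "z ^ nat a = z ^ i" "nat a < p" "a \<ge> 0"
    using v by (auto simp: S.R_simps power_int_def)
  then have "nat a = i" using root_power_inj[OF S.p(1) z_pow(1,2)] assms(2) by blast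
  then show "a = int i" using \<open>a \<ge> 0\<close> by simp
qed

lemma b_W: assumes "g \<in> W" obtains i where "i < p" "g \<nu> = \<nu> * z ^ i" "b g = int i"
  using W_\<nu>[OF assms] b_eq[OF assms] by metis

lemma W_mult: "g \<in> W \<Longrightarrow> h \<in> W \<Longrightarrow> g \<otimes>\<^bsub>G\<^esub> h \<in> W"
  using z_M by (auto simp: act_mult)

text \<open>In general \<open>b\<close> is a cocycle twisted by the cyclotomic character; elements
  of \<open>W\<close> fix the root of unity, so the twist is trivial and \<open>b\<close> is
  additive.\<close>

lemma b_mult: assumes g: "g \<in> W" and h: "h \<in> W" shows "[b (g \<otimes>\<^bsub>G\<^esub> h) = b g + b h] (mod int p)"
proof -
  obtain i where i: "g \<nu> = \<nu> * z ^ i" "b g = int i" using b_W[OF g] by blast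
  obtain k where k: "h \<nu> = \<nu> * z ^ k" "b h = int k" using b_W[OF h] by blast
  obtain l where l: "(g \<otimes>\<^bsub>G\<^esub> h) \<nu> = \<nu> * z ^ l" "b (g \<otimes>\<^bsub>G\<^esub> h) = int l" using b_W[OF W_mult[OF g h]] by blast
  have "(g \<otimes>\<^bsub>G\<^esub> h) \<nu> = g (\<nu> * z ^ k)" using g h \<nu>_M k by (simp add: act_mult)
  also have "\<dots> = \<nu> * z ^ i * z ^ k" using g \<nu>_M z_M i by (simp add: gal_mult gal_power M.power_F)
  finally have "z ^ l = z ^ (i + k)" using l(1) \<nu>_pow(2) by (simp add: power_add)
  then have "[l = i + k] (mod p)" by (rule root_power_cong[OF S.p(1) z_pow(1,2)])
  then show ?thesis by (metis i(2) k(2) l(2) cong_int_iff of_nat_add)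
qed

lemma B_eq: "B = {g \<in> W. int p dvd b g}"
proof (intro equalityI subsetI)
  fix g assume g: "g \<in> B"
  then have gW: "g \<in> W" and "g \<nu> = \<nu> * z ^ 0" using z_L \<nu>_L by auto
  then have "b g = int 0" using S.p_gt_1 by (intro b_eq) auto
  then show "g \<in> {g \<in> W. int p dvd b g}" using gW by simp
next
  fix g assume g: "g \<in> {g \<in> W. int p dvd b g}"
  then obtain i where i: "i < p" "g \<nu> = \<nu> * z ^ i" "b g = int i" using b_W by blast
  then have "p dvd i" using g by simp
  then have "i = 0" using i(1) by (auto dest: dvd_imp_le)
  then show "g \<in> B" using g i(2) fixes_L by auto
qed

definition ev :: "int \<times> int \<Rightarrow> (complex \<Rightarrow> complex) \<Rightarrow> int"
  where "ev v g = S.EV v (\<phi> g)"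

lemma ev_conj:
  assumes t: "t \<in> W" and g: "g \<in> B" and h: "h \<in> B" "h \<otimes>\<^bsub>G\<^esub> t = t \<otimes>\<^bsub>G\<^esub> g"
  shows "[ev v h = ev (fst v, fst v * b t + snd v) g] (mod int p)"
proof -
  have c: "t \<in> carrier G" "g \<in> carrier G" "h \<in> carrier G" using assms by auto
  have h_eq: "t \<otimes>\<^bsub>G\<^esub> g \<otimes>\<^bsub>G\<^esub> inv\<^bsub>G\<^esub> t = h" using c by (simp add: h(2)[symmetric] G.m_assoc)
  have "g \<in> carrier (gal_group L M)" using g unfolding carrier_gal_L .
  from \<phi>_conj[OF c(1) restrict_gal[OF t] this]
  have "\<phi> h = A_act p N (p - 1) j (restrict t L) (\<phi> g)" unfolding h_eq .
  then show ?thesis unfolding ev_def b_def using S.EV_A_act[OF \<phi>_A[OF g] cyclo_char_W[OF t]] by simp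
qed

text \<open>Union of the inertia groups of \<open>M\<close> over the cyclotomic field. It is closed
  under powers, though in general not under products, and this is all that the construction of the
  character asks of it.\<close>

definition "J = {g \<in> W. \<exists>Q. MM.prime_idl Q \<and> g \<in> inertia Q}"

lemma J_pow: "g \<in> J \<Longrightarrow> g [^]\<^bsub>G\<^esub> (n :: nat) \<in> J"
proof -
  assume g: "g \<in> J"
  then obtain Q where Q: "MM.prime_idl Q" "g \<in> inertia Q" by (auto simp: J_def)
  have gW: "g \<in> W" using g by (simp add: J_def)
  have "g [^]\<^bsub>G\<^esub> n \<in> W"
  proof (induction n)
    case 0
    show ?case using z_M by (simp add: act_one)
  next
    case (Suc n)
    then show ?case using W_mult gW by simp
  qed
  then show ?thesis using Q inertia_pow[OF Q(2) MM.prime_idlD(1)[OF Q(1)]] by (auto simp: J_def)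
qed

lemma J_B: "g \<in> J \<Longrightarrow> g \<in> B \<Longrightarrow> g = \<one>\<^bsub>G\<^esub>"
  using unramified_imp_inertia_trivial[OF fld_L L_M unram] by (auto simp: J_def)

lemma fixed_field_W: "{x \<in> M. \<forall>g\<in>W. g x = x} = cyclotomic_field p"
proof (rule fixed_field_eq[OF z_M])
  show K: "cyclotomic_field p = generate_field complex_ring {z}" by (simp add: cyclotomic_field_def)
  interpret K: subfield_of_complex "cyclotomic_field p" unfolding K by unfold_locales (rule fld_generate_field)
  fix g assume "g \<in> carrier G"
  then have "g z ^ p = 1" using root_image[OF _ z_M, of g p 1] z_pow by simp
  then obtain i where "g z = z ^ i" by (rule roots_of_unity_power[OF S.p(1) z_pow(1,2)])
  moreover have "z \<in> cyclotomic_field p" unfolding K by (rule generate_field.incl) simp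
  ultimately show "g z \<in> cyclotomic_field p" by auto
qed

text \<open>The groups \<open>W\<close> and \<open>B\<close> become the ambient group and the
  subgroup \<open>A\<close> of \<open>exists_character\<close>. The resulting character vanishes on
  inertia, and its kernel defines the unramified cyclic extension of the cyclotomic field to which
  the unit argument applies.\<close>

theorem p_dvd_class_number: "p dvd Coset.order (class_group (cyclotomic_field p))"
proof -
  let ?K = "cyclotomic_field p"
  let ?GK = "gal_group ?K M"
  have KM: "?K \<subseteq> M" and RK: "\<rat> \<subseteq> ?K" unfolding fixed_field_W[symmetric] using M.Rats_F by (auto simp: gal_Rats)
  interpret GK: group ?GK by (rule group_gal[OF KM])
  have "z \<in> ?K" unfolding cyclotomic_field_def by (rule generate_field.incl) simp
  then have W: "carrier ?GK = W"
    unfolding carrier_gal_over[OF RK] unfolding fixed_field_W[symmetric] by blast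
  obtain C where C: "C \<in> carrier S.A" "[S.EV (0, 1) C = 1] (mod int p)" by (rule S.EV_nontrivial)
  have "C \<in> \<phi> ` B" unfolding bij_betw_imp_surj_on[OF \<phi>_bij] by (rule C(1))
  then obtain g0 where g0: "C = \<phi> g0" "g0 \<in> B" by (rule imageE)
  obtain \<psi> s where \<psi>: "\<And>g h. g \<in> W \<Longrightarrow> h \<in> W \<Longrightarrow> [\<psi> (g \<otimes>\<^bsub>G\<^esub> h) = \<psi> g + \<psi> h] (mod int p)"
    "s \<in> W" "[\<psi> s = 1] (mod int p)" "\<And>g. g \<in> J \<Longrightarrow> int p dvd \<psi> g"
  proof -
    note obt = that
    show thesis
    proof (rule GK.exists_character[of p B b ev g0 J, unfolded W gal_group_over[where K = "cyclotomic_field p"]])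
      show "[ev v (g \<otimes>\<^bsub>G\<^esub> h) = ev v g + ev v h] (mod int p)" if "g \<in> B" "h \<in> B" for v g h
        unfolding ev_def \<phi>_mult[OF that] using that by (intro S.EV_add \<phi>_A)
      show "[ev (1, x) g = ev (1, y) g] (mod int p)" if "[x = y] (mod int p)" for x y g
        unfolding ev_def using that by (intro S.EV_cong) auto
      show "[(\<Sum>k<p. ev (1, int k * c) g) = - ev (0, 1) g] (mod int p)" if "\<not> int p dvd c" "g \<in> B" for c g
        unfolding ev_def using that by (intro S.sum_EV \<phi>_A) auto
      show "[ev (0, 1) g0 = 1] (mod int p)" using C(2) g0(1) by (simp add: ev_def)
      show "J \<subseteq> W" by (auto simp: J_def)
      show "[b (g \<otimes>\<^bsub>G\<^esub> h) = b g + b h] (mod int p)" if "g \<in> W" "h \<in> W" for g h using that by (rule b_mult)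
      show "[ev v h = ev (fst v, fst v * b t + snd v) g] (mod int p)"
        if "t \<in> W" "g \<in> B" "h \<in> B" "h \<otimes>\<^bsub>G\<^esub> t = t \<otimes>\<^bsub>G\<^esub> g" for v t g h using that by (rule ev_conj)
      show "g [^]\<^bsub>G\<^esub> n \<in> J" if "g \<in> J" for g and n :: nat using that by (rule J_pow)
      show "g = \<one>\<^bsub>G\<^esub>" if "g \<in> J" "g \<in> B" for g using that by (rule J_B)
      show thesis if "\<And>g h. g \<in> W \<Longrightarrow> h \<in> W \<Longrightarrow> [\<psi> (g \<otimes>\<^bsub>G\<^esub> h) = \<psi> g + \<psi> h] (mod int p)"
        "s \<in> W" "[\<psi> s = 1] (mod int p)" "\<And>g. g \<in> J \<Longrightarrow> int p dvd \<psi> g" for \<psi> s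
        using that by (rule obt)
    qed (rule S.p(1) B_eq g0(2))+
  qed
  have \<psi>_inertia: "int p dvd \<psi> g" if "MM.prime_idl Q" "g \<in> inertia Q" "g \<in> W" for Q g
    using that by (intro \<psi>(4)) (auto simp: J_def)
  \<comment> \<open>The sets are given literally so that \<open>K\<close> becomes the fixed field of
    \<open>W\<close>, which \<open>fixed_field_W\<close> identifies with the cyclotomic
    field.\<close>
  interpret unramified_cyclic M p z \<psi> s W "{g \<in> W. int p dvd \<psi> g}"
    "{x \<in> M. \<forall>u\<in>{g \<in> W. int p dvd \<psi> g}. u x = x}" "{x \<in> M. \<forall>w\<in>W. w x = x}"
    by (unfold_locales; (rule S.p z_M z_pow \<psi>(2,3))?; (erule (1) \<psi>(1) | erule (2) \<psi>_inertia)?)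
  show ?thesis using class_number_divisible unfolding fixed_field_W .
qed

end

theorem theorem4p13:
  fixes p N :: nat and j :: int
  assumes "regular_prime p"
    and "Factorial_Ring.prime N"
    and "[N = 1] (mod p)"
  shows "\<not> (\<exists>M. A_extension p N (p - 1) j M \<and> unramified (kummer_field p N) M)"
proof
  assume "\<exists>M. A_extension p N (p - 1) j M \<and> unramified (kummer_field p N) M"
  then obtain M \<phi> where M: "galois_extension (kummer_field p N) M" "galois_extension \<rat> M" "unramified (kummer_field p N) M"
    and \<phi>: "\<phi> \<in> iso (gal_group (kummer_field p N) M) (add_monoid (A_module p (p - 1)))"
    "\<And>\<sigma> \<tau> g. \<sigma> \<in> carrier (gal_group \<rat> (kummer_field p N)) \<Longrightarrow> \<tau> \<in> carrier (gal_group \<rat> M) \<Longrightarrow>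
      restrict \<tau> (kummer_field p N) = \<sigma> \<Longrightarrow> g \<in> carrier (gal_group (kummer_field p N) M) \<Longrightarrow>
      \<phi> (\<tau> \<otimes>\<^bsub>gal_group \<rat> M\<^esub> g \<otimes>\<^bsub>gal_group \<rat> M\<^esub> inv\<^bsub>gal_group \<rat> M\<^esub> \<tau>) = A_act p N (p - 1) j \<sigma> (\<phi> g)"
    unfolding A_extension_def Let_def by blast
  interpret sym_extension M p N j \<phi>
    by unfold_locales (use assms M \<phi> prime_gt_0_nat in \<open>auto simp: regular_prime_def\<close>)
  show False using p_dvd_class_number assms(1) by (simp add: regular_prime_def)
qed


end
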